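(* Let $(A_n,\varphi_n)_{n\in\mathbb N}$ be a diagonal AH-system and let $A$ be the resulting AH-algebra, with canonical C$^*$-diagonal $C$, Bratteli diagram $\mathcal B$ of the AF-subsystem and associated labelled Bratteli diagram $\mathcal B_\lambda$. The function $\Phi\colon\mathcal G_{\mathcal B_\lambda}\to\mathcal G_{\mathcal B}\ltimes\widehat C$ defined by $$\Phi(x^\lambda,y^\lambda)=((x,y),h^{-1}(y^\lambda))$$ is an isomorphism of topological groupoids, where $x,y\in\mathcal P^\infty_{\mathcal B}$ are the unlabelled paths underlying $x^\lambda,y^\lambda$ and $h\colon\widehat C\to\mathcal P^\infty_{\mathcal B_\lambda}$ is the canonical homeomorphism. In particular $\mathcal G_{\mathcal B_\lambda}$ is a groupoid model for $A$, i.e. $A\cong C^*_{\mathrm r}(\mathcal G_{\mathcal B_\lambda})$.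
   Context: Diagonal AH-systems. $\mathbb N=\{1,2,\dots\}$. For $n\in\mathbb N$ let $A_n=\bigoplus_{i=1}^{N_n}C(X_{n,i})\otimes M_{k_{n,i}}$ with $X_{n,i}$ compact Hausdorff. A diagonal AH-system is an inductive system of such algebras whose connecting maps $\varphi_n\colon A_n\to A_{n+1}$ are unital injective diagonal maps: for all $i\le N_n$, $j\le N_{n+1}$ there are a finite (possibly empty) set $E_n(i,j)$ and continuous maps (eigenfunctions) $\lambda_e\colon X_{n+1,j}\to X_{n,i}$, $e\in E_n(i,j)$, such that the $j$-th component of $\varphi_n(f_1,\dots,f_{N_n})$ is block diagonal with blocks $f_i\circ\lambda_e$ ($1\le i\le N_n$, $e\in E_n(i,j)$), in some fixed order. The limit $A=\varinjlim_n(A_n,\varphi_n)$ is a diagonal AH-algebra; $A_n$ is identified with its image in $A$. Subalgebras. $C_n=\bigoplus_i C(X_{n,i})\otimes D_{k_{n,i}}$ with $D_k\subseteq M_k$ the diagonal matrices, and $C=\varinjlim_n C_n\subseteq A$ with Gelfand spectrum $\widehat C$. $B_n=\bigoplus_i 1\otimes M_{k_{n,i}}\subseteq A_n$ and $B=\varinjlim_n B_n\subseteq A$ (the AF-subalgebra). Bratteli diagram $\mathcal B$ of the AF-subsystem. $V_0=\{v_0\}$ (root), $V_n=\{(n,1),\dots,(n,N_n)\}$ for $n\ge1$; $E_0$ consists of $k_{1,j}$ edges from $v_0$ to $(1,j)$ for each $j$; for $n\ge 1$ the edges from $(n,i)$ to $(n+1,j)$ are the elements of $E_n(i,j)$, and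 $E_n=\bigsqcup_{i,j}E_n(i,j)$. The index set $\{1,\dots,k_{n,i}\}$ of $M_{k_{n,i}}$ is identified with the set of paths of length $n$ from $v_0$ to $(n,i)$: for $n=1$ via $E_0$, and inductively the diagonal position of index $p$ inside the block $f_i\circ\lambda_e$ of $\varphi_n(f)$ is labelled $pe$. $\mathcal P^\infty_{\mathcal B}$ is the set of infinite paths $x=x_1x_2\cdots$ starting at $v_0$ ($x_k\in E_{k-1}$), with base of open sets $Z_p=\{x: x_{[1,n]}=p\}$. $\mathcal G_{\mathcal B}$ is the groupoid of pairs $(x,y)$ of tail-equivalent paths ($x_{[m,\infty)}=y_{[m,\infty)}$ for some $m$), with $(x,y)(y,z)=(x,z)$, $r(x,y)=x$, $s(x,y)=y$, and base of open sets $Z_{p,q}=\{(x,y): x_{[1,n]}=p,\ y_{[1,n]}=q,\ x_{[n+1,\infty)}=y_{[n+1,\infty)}\}$ for paths $p,q$ from $v_0$ of equal length $n$ with the same terminal vertex. $C^*_{\mathrm r}(\mathcal G_{\mathcal B})$ is identified with $B$ so that $1_{Z_{p,q}}$ is the matrix unit $e_{p,q}\in B_n$; then $C(\mathcal P^\infty_{\mathcal B})=C\cap B$. Action. The anchor map $\rho\colon\widehat C\to\mathcal P^\infty_{\mathcal B}$ is the Gelfand dual of $C\cap B\subseteq C$, and $((x,y)\cdot\chi)(c)=\chi(1_{Z_{p,q}}^*c\,1_{Z_{p,q}})$ for $\rho(\chi)=y$, $c\in C$ and any $p,q$ with $(x,y)\in Z_{p,q}$. The transformation groupoid $\mathcal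 G_{\mathcal B}\ltimes\widehat C$ is $\{(\gamma,\chi):s(\gamma)=\rho(\chi)\}$ with the subspace topology of the product topology on $\mathcal G_{\mathcal B}\times\widehat C$, $r(\gamma,\chi)=(r(\gamma),\gamma\cdot\chi)$, $s(\gamma,\chi)=(s(\gamma),\chi)$, $(\eta,\gamma\cdot\chi)(\gamma,\chi)=(\eta\gamma,\chi)$. Labelled Bratteli diagram $\mathcal B_\lambda$. It has the same vertices and edges as $\mathcal B$, with vertex $(n,i)$ regarded as the space $X_{n,i}$ and the root as the one-point space $\{0\}$; each edge $e\in E_n$ ($n\ge1$) is labelled by its eigenfunction $\lambda(e)=\lambda_e\colon r(e)\to s(e)$, and each edge of $E_0$ by the constant map to $\{0\}$. A labelled infinite path starting at the root is $x^\lambda=(e_k,t_k)_{k\ge1}$ with $x=e_1e_2\cdots\in\mathcal P^\infty_{\mathcal B}$ (its underlying unlabelled path), $t_k\in s(e_k)$, $\lambda(e_k)(t_{k+1})=t_k$; the set of these is $\mathcal P^\infty_{\mathcal B_\lambda}$. For a finite path $p=e_1\cdots e_n$ in $\mathcal B$ from $v_0$ and $U\subseteq s(e_n)$ open, the cylinder set $Z(p,U)$ is the set of labelled infinite paths whose first $n$ edges are $e_1,\dots,e_n$ and with $t_n\in U$; these form a base of the topology on $\mathcal P^\infty_{\mathcal B_\lambda}$. Two labelled infinite paths $x^\lambda,y^\lambda\in\mathcal P^\infty_{\mathcal B_\lambda}$ are tail-equivalent if $x^\lambda_{[n,\infty)}=y^\lambda_{[n,\infty)}$ for some $n\in\mathbb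 N$. $\mathcal G_{\mathcal B_\lambda}$ is the groupoid of pairs $(x^\lambda,y^\lambda)$ of tail-equivalent labelled infinite paths, with $(x^\lambda,y^\lambda)(y^\lambda,z^\lambda)=(x^\lambda,z^\lambda)$, equipped with the subspace topology inherited from the product topology on $\mathcal P^\infty_{\mathcal B_\lambda}\times\mathcal P^\infty_{\mathcal B_\lambda}$. The homeomorphism $h$. For $\chi\in\widehat C$ and $n\ge1$, $\chi|_{C_n}$ has the form $(f_1,\dots,f_{N_n})\mapsto (f_{i_n}(\chi_n))_{p_n,p_n}$ for a unique vertex $(n,i_n)$, point $\chi_n\in X_{n,i_n}$ and path $p_n$ of length $n$ from $v_0$ to $(n,i_n)$; the $p_n$ are the initial segments of one path $e_1e_2\cdots\in\mathcal P^\infty_{\mathcal B}$ and $\lambda(e_{n+1})(\chi_{n+1})=\chi_n$. Then $h(\chi)=(e_k,t_k)_{k\ge1}$ with $t_1=0$ and $t_{k+1}=\chi_k$ for $k\ge1$.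
   Formalization: The groupoid of tail-equivalent labelled paths carries the inductive limit topology of the relations "equal from n on" (each with the subspace topology of the product), not the subspace topology of the product, for which Φ is not continuous already for the 2^∞ UHF algebra. *)

theory Defs
  imports "HOL-Analysis.Analysis" "Jordan_Normal_Form.Schur_Decomposition"
begin

section \<open>Normed *-algebras on a carrier, completions and direct limits\<close>

record 'x star_alg =
  sa_carrier :: "'x set"
  sa_add :: "'x \<Rightarrow> 'x \<Rightarrow> 'x"
  sa_mult :: "'x \<Rightarrow> 'x \<Rightarrow> 'x"
  sa_scale :: "complex \<Rightarrow> 'x \<Rightarrow> 'x"
  sa_star :: "'x \<Rightarrow> 'x"
  sa_norm :: "'x \<Rightarrow> real"

definition sa_dist :: "'x star_alg \<Rightarrow> 'x \<Rightarrow> 'x \<Rightarrow> real" where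
  "sa_dist S a b = sa_norm S (sa_add S a (sa_scale S (-1) b))"

definition star_isomorphic :: "'x star_alg \<Rightarrow> 'y star_alg \<Rightarrow> bool" where
  "star_isomorphic S T \<longleftrightarrow> (\<exists>f. bij_betw f (sa_carrier S) (sa_carrier T) \<and>
     (\<forall>a\<in>sa_carrier S. \<forall>b\<in>sa_carrier S.
        f (sa_add S a b) = sa_add T (f a) (f b) \<and> f (sa_mult S a b) = sa_mult T (f a) (f b)) \<and>
     (\<forall>a\<in>sa_carrier S. (\<forall>z. f (sa_scale S z a) = sa_scale T z (f a)) \<and>
        f (sa_star S a) = sa_star T (f a) \<and> sa_norm T (f a) = sa_norm S a))"

text \<open>The completion of a normed *-algebra: Cauchy sequences modulo null sequences.\<close>

definition cauchy_seqs :: "'x star_alg \<Rightarrow> (nat \<Rightarrow> 'x) set" where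
  "cauchy_seqs S = {u. (\<forall>n. u n \<in> sa_carrier S) \<and>
     (\<forall>\<epsilon>>0. \<exists>M. \<forall>m\<ge>M. \<forall>n\<ge>M. sa_dist S (u m) (u n) < \<epsilon>)}"

definition cauchy_class :: "'x star_alg \<Rightarrow> (nat \<Rightarrow> 'x) \<Rightarrow> (nat \<Rightarrow> 'x) set" where
  "cauchy_class S u = {v \<in> cauchy_seqs S. (\<lambda>n. sa_dist S (u n) (v n)) \<longlonglongrightarrow> 0}"

definition completion :: "'x star_alg \<Rightarrow> (nat \<Rightarrow> 'x) set star_alg" where
  "completion S = \<lparr>
     sa_carrier = cauchy_class S ` cauchy_seqs S,
     sa_add = (\<lambda>U V. \<Union>u\<in>U. \<Union>v\<in>V. cauchy_class S (\<lambda>n. sa_add S (u n) (v n))),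
     sa_mult = (\<lambda>U V. \<Union>u\<in>U. \<Union>v\<in>V. cauchy_class S (\<lambda>n. sa_mult S (u n) (v n))),
     sa_scale = (\<lambda>z U. \<Union>u\<in>U. cauchy_class S (\<lambda>n. sa_scale S z (u n))),
     sa_star = (\<lambda>U. \<Union>u\<in>U. cauchy_class S (\<lambda>n. sa_star S (u n))),
     sa_norm = (\<lambda>U. THE r. \<forall>u\<in>U. (\<lambda>n. sa_norm S (u n)) \<longlonglongrightarrow> r) \<rparr>"

text \<open>
  The algebraic direct limit of \<open>A 1 \<rightarrow> A 2 \<rightarrow> \<dots>\<close>: pairs \<open>(n, a)\<close> with \<open>n \<ge> 1\<close> and \<open>a \<in> A n\<close>,
  two pairs being identified when they eventually have the same image.  Here \<open>transit \<phi> n k\<close> is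
  the composite \<open>\<phi> (k - 1) \<circ> \<dots> \<circ> \<phi> n\<close>, and the norm of the class of \<open>(n, a)\<close> is the limit of
  the norms of the images of \<open>a\<close> in \<open>A k\<close>.
\<close>

definition transit :: "(nat \<Rightarrow> 'x \<Rightarrow> 'x) \<Rightarrow> nat \<Rightarrow> nat \<Rightarrow> 'x \<Rightarrow> 'x" where
  "transit \<phi> n k = fold \<phi> [n..<k]"

definition dl_class :: "(nat \<Rightarrow> 'x star_alg) \<Rightarrow> (nat \<Rightarrow> 'x \<Rightarrow> 'x) \<Rightarrow> nat \<Rightarrow> 'x \<Rightarrow> (nat \<times> 'x) set" where
  "dl_class A \<phi> n a = {(m, b). m \<ge> 1 \<and> b \<in> sa_carrier (A m) \<and>
     (\<exists>k. k \<ge> n \<and> k \<ge> m \<and> transit \<phi> n k a = transit \<phi> m k b)}"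

definition direct_limit ::
  "(nat \<Rightarrow> 'x star_alg) \<Rightarrow> (nat \<Rightarrow> 'x \<Rightarrow> 'x) \<Rightarrow> (nat \<times> 'x) set star_alg" where
  "direct_limit A \<phi> = \<lparr>
     sa_carrier = {dl_class A \<phi> n a | n a. n \<ge> 1 \<and> a \<in> sa_carrier (A n)},
     sa_add = (\<lambda>S T. \<Union>{dl_class A \<phi> n (sa_add (A n) a b) | n a b. (n, a) \<in> S \<and> (n, b) \<in> T}),
     sa_mult = (\<lambda>S T. \<Union>{dl_class A \<phi> n (sa_mult (A n) a b) | n a b. (n, a) \<in> S \<and> (n, b) \<in> T}),
     sa_scale = (\<lambda>z S. \<Union>{dl_class A \<phi> n (sa_scale (A n) z a) | n a. (n, a) \<in> S}),
     sa_star = (\<lambda>S. \<Union>{dl_class A \<phi> n (sa_star (A n) a) | n a. (n, a) \<in> S}),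
     sa_norm = (\<lambda>S. THE r. \<forall>(n, a)\<in>S. (\<lambda>k. sa_norm (A k) (transit \<phi> n k a)) \<longlonglongrightarrow> r) \<rparr>"

definition cstar_limit ::
  "(nat \<Rightarrow> 'x star_alg) \<Rightarrow> (nat \<Rightarrow> 'x \<Rightarrow> 'x) \<Rightarrow> (nat \<Rightarrow> (nat \<times> 'x) set) set star_alg" where
  "cstar_limit A \<phi> = completion (direct_limit A \<phi>)"

definition to_limit ::
  "(nat \<Rightarrow> 'x star_alg) \<Rightarrow> (nat \<Rightarrow> 'x \<Rightarrow> 'x) \<Rightarrow> nat \<Rightarrow> 'x \<Rightarrow> (nat \<Rightarrow> (nat \<times> 'x) set) set" where
  "to_limit A \<phi> n a = cauchy_class (direct_limit A \<phi>) (\<lambda>_. dl_class A \<phi> n a)"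

text \<open>The closure in the limit of the union of the images of subalgebras \<open>S n \<subseteq> A n\<close>.\<close>

definition limit_subalg ::
  "(nat \<Rightarrow> 'x star_alg) \<Rightarrow> (nat \<Rightarrow> 'x \<Rightarrow> 'x) \<Rightarrow> (nat \<Rightarrow> 'x set) \<Rightarrow> (nat \<Rightarrow> (nat \<times> 'x) set) set set" where
  "limit_subalg A \<phi> S = {c \<in> sa_carrier (cstar_limit A \<phi>).
     \<forall>\<epsilon>>0. \<exists>n\<ge>1. \<exists>a\<in>S n. sa_dist (cstar_limit A \<phi>) c (to_limit A \<phi> n a) < \<epsilon>}"

text \<open>
  The Gelfand spectrum: nonzero multiplicative linear functionals with the weak-* topology, i.e.
  the topology of pointwise convergence on the algebra.
\<close>

definition characters :: "'x star_alg \<Rightarrow> ('x \<Rightarrow> complex) set" where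
  "characters S = {\<omega> \<in> extensional (sa_carrier S).
     (\<forall>a\<in>sa_carrier S. \<forall>b\<in>sa_carrier S.
        \<omega> (sa_add S a b) = \<omega> a + \<omega> b \<and> \<omega> (sa_mult S a b) = \<omega> a * \<omega> b) \<and>
     (\<forall>a\<in>sa_carrier S. \<forall>z. \<omega> (sa_scale S z a) = z * \<omega> a) \<and>
     (\<exists>a\<in>sa_carrier S. \<omega> a \<noteq> 0)}"

definition gelfand_spectrum :: "'x star_alg \<Rightarrow> ('x \<Rightarrow> complex) topology" where
  "gelfand_spectrum S =
     subtopology (product_topology (\<lambda>_. euclidean) (sa_carrier S)) (characters S)"


section \<open>Topological groupoids and their reduced C*-algebras\<close>

text \<open>The unit space is identified with the set of identity arrows; \<open>gp_rng\<close>, \<open>gp_src\<close> are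
  arrow-valued and \<open>gp_comp G g h\<close> is meaningful when \<open>gp_src G g = gp_rng G h\<close>.\<close>

record 'g groupoid =
  gp_top :: "'g topology"
  gp_comp :: "'g \<Rightarrow> 'g \<Rightarrow> 'g"
  gp_inv :: "'g \<Rightarrow> 'g"
  gp_rng :: "'g \<Rightarrow> 'g"
  gp_src :: "'g \<Rightarrow> 'g"

abbreviation gp_arrows :: "'g groupoid \<Rightarrow> 'g set" where
  "gp_arrows G \<equiv> topspace (gp_top G)"

definition gp_units :: "'g groupoid \<Rightarrow> 'g set" where
  "gp_units G = {u \<in> gp_arrows G. gp_src G u = u}"

definition gp_composable :: "'g groupoid \<Rightarrow> ('g \<times> 'g) set" where
  "gp_composable G = {(g, h). g \<in> gp_arrows G \<and> h \<in> gp_arrows G \<and> gp_src G g = gp_rng G h}"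

definition topological_groupoid :: "'g groupoid \<Rightarrow> bool" where
  "topological_groupoid G \<longleftrightarrow>
     (\<forall>g\<in>gp_arrows G.
        gp_src G g \<in> gp_arrows G \<and> gp_rng G g \<in> gp_arrows G \<and> gp_inv G g \<in> gp_arrows G \<and>
        gp_src G (gp_src G g) = gp_src G g \<and> gp_rng G (gp_src G g) = gp_src G g \<and>
        gp_src G (gp_rng G g) = gp_rng G g \<and> gp_rng G (gp_rng G g) = gp_rng G g \<and>
        gp_src G (gp_inv G g) = gp_rng G g \<and> gp_rng G (gp_inv G g) = gp_src G g \<and>
        gp_comp G (gp_rng G g) g = g \<and> gp_comp G g (gp_src G g) = g \<and>
        gp_comp G g (gp_inv G g) = gp_rng G g \<and> gp_comp G (gp_inv G g) g = gp_src G g) \<and>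
     (\<forall>(g, h)\<in>gp_composable G. gp_comp G g h \<in> gp_arrows G \<and>
        gp_src G (gp_comp G g h) = gp_src G h \<and> gp_rng G (gp_comp G g h) = gp_rng G g) \<and>
     (\<forall>g h k. (g, h) \<in> gp_composable G \<and> (h, k) \<in> gp_composable G \<longrightarrow>
        gp_comp G (gp_comp G g h) k = gp_comp G g (gp_comp G h k)) \<and>
     continuous_map (subtopology (prod_topology (gp_top G) (gp_top G)) (gp_composable G)) (gp_top G)
       (\<lambda>(g, h). gp_comp G g h) \<and>
     continuous_map (gp_top G) (gp_top G) (gp_inv G)"

definition topological_groupoid_iso :: "'g groupoid \<Rightarrow> 'h groupoid \<Rightarrow> ('g \<Rightarrow> 'h) \<Rightarrow> bool" where
  "topological_groupoid_iso G H \<Phi> \<longleftrightarrow>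
     topological_groupoid G \<and> topological_groupoid H \<and>
     homeomorphic_map (gp_top G) (gp_top H) \<Phi> \<and>
     (\<forall>(g, h)\<in>gp_composable G. (\<Phi> g, \<Phi> h) \<in> gp_composable H \<and>
        \<Phi> (gp_comp G g h) = gp_comp H (\<Phi> g) (\<Phi> h))"

text \<open>
  The convolution algebra of continuous compactly supported functions (extended by 0 off the
  groupoid).  The reduced norm of \<open>f\<close> is the supremum over the units \<open>u\<close> of the operator norm of
  the regular representation \<open>(\<pi>\<^sub>u(f)\<xi>)(g) = \<Sum>h. f (g h\<^sup>-\<^sup>1) \<xi>(h)\<close> on \<open>\<ell>\<^sup>2\<close> of the source fibre
  of \<open>u\<close>.  In the etale case the convolution sums have finitely many nonzero terms.
\<close>

definition Cc :: "'g groupoid \<Rightarrow> ('g \<Rightarrow> complex) set" where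
  "Cc G = {f. continuous_map (gp_top G) euclidean f \<and> (\<forall>g. g \<notin> gp_arrows G \<longrightarrow> f g = 0) \<and>
     compactin (gp_top G) (gp_top G closure_of {g \<in> gp_arrows G. f g \<noteq> 0})}"

definition src_fibre :: "'g groupoid \<Rightarrow> 'g \<Rightarrow> 'g set" where
  "src_fibre G u = {g \<in> gp_arrows G. gp_src G g = u}"

definition convolve :: "'g groupoid \<Rightarrow> ('g \<Rightarrow> complex) \<Rightarrow> ('g \<Rightarrow> complex) \<Rightarrow> 'g \<Rightarrow> complex" where
  "convolve G f \<xi> g = (if g \<in> gp_arrows G
     then \<Sum>\<^sub>\<infinity>h\<in>src_fibre G (gp_src G g). f (gp_comp G g (gp_inv G h)) * \<xi> h else 0)"

definition ell2 :: "'g set \<Rightarrow> ('g \<Rightarrow> complex) set" where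
  "ell2 I = {\<xi>. (\<lambda>g. (cmod (\<xi> g))\<^sup>2) summable_on I}"

definition ell2_norm :: "'g set \<Rightarrow> ('g \<Rightarrow> complex) \<Rightarrow> real" where
  "ell2_norm I \<xi> = sqrt (\<Sum>\<^sub>\<infinity>g\<in>I. (cmod (\<xi> g))\<^sup>2)"

definition reduced_norm :: "'g groupoid \<Rightarrow> ('g \<Rightarrow> complex) \<Rightarrow> real" where
  "reduced_norm G f = Sup {ell2_norm (src_fibre G u) (convolve G f \<xi>) | u \<xi>.
     u \<in> gp_units G \<and> \<xi> \<in> ell2 (src_fibre G u) \<and> ell2_norm (src_fibre G u) \<xi> \<le> 1}"

definition Cc_alg :: "'g groupoid \<Rightarrow> ('g \<Rightarrow> complex) star_alg" where
  "Cc_alg G = \<lparr>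
     sa_carrier = Cc G,
     sa_add = (\<lambda>f g x. f x + g x),
     sa_mult = convolve G,
     sa_scale = (\<lambda>z f x. z * f x),
     sa_star = (\<lambda>f x. if x \<in> gp_arrows G then cnj (f (gp_inv G x)) else 0),
     sa_norm = reduced_norm G \<rparr>"

definition reduced_cstar :: "'g groupoid \<Rightarrow> (nat \<Rightarrow> 'g \<Rightarrow> complex) set star_alg" where
  "reduced_cstar G = completion (Cc_alg G)"

text \<open>The groupoid structure of an equivalence relation carrying a given topology.\<close>

definition relation_groupoid :: "('p \<times> 'p) topology \<Rightarrow> ('p \<times> 'p) groupoid" where
  "relation_groupoid T = \<lparr>
     gp_top = T,
     gp_comp = (\<lambda>(x, y) (y', z). (x, z)),
     gp_inv = (\<lambda>(x, y). (y, x)),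
     gp_rng = (\<lambda>(x, y). (x, x)),
     gp_src = (\<lambda>(x, y). (y, y)) \<rparr>"

definition transformation_groupoid ::
  "'g groupoid \<Rightarrow> 'c topology \<Rightarrow> ('c \<Rightarrow> 'g) \<Rightarrow> ('g \<Rightarrow> 'c \<Rightarrow> 'c) \<Rightarrow> ('g \<times> 'c) groupoid" where
  "transformation_groupoid G Y anchor act = \<lparr>
     gp_top = subtopology (prod_topology (gp_top G) Y) {(g, \<omega>). gp_src G g = anchor \<omega>},
     gp_comp = (\<lambda>(h, \<omega>') (g, \<omega>). (gp_comp G h g, \<omega>)),
     gp_inv = (\<lambda>(g, \<omega>). (gp_inv G g, act g \<omega>)),
     gp_rng = (\<lambda>(g, \<omega>). (gp_rng G g, act g \<omega>)),
     gp_src = (\<lambda>(g, \<omega>). (gp_src G g, \<omega>)) \<rparr>"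


section \<open>Diagonal AH-systems\<close>

text \<open>
  Summands are numbered \<open>0, \<dots>, num D n - 1\<close>; only levels \<open>n \<ge> 1\<close> are used.  The spaces \<open>X\<^sub>n\<^sub>,\<^sub>i\<close>
  are \<open>spc D n i\<close>, all with points in one type, which is no restriction for countably many spaces.
  \<open>egn D n i j e\<close> is the eigenfunction of \<open>e \<in> edg D n i j\<close>, and \<open>ord D n j\<close> lists the
  pairs \<open>(i, e)\<close> in the order in which the blocks appear on the diagonal of summand \<open>j\<close> at level
  \<open>n + 1\<close>.
\<close>

record ('a, 'e) ah_data =
  num :: "nat \<Rightarrow> nat"
  spc :: "nat \<Rightarrow> nat \<Rightarrow> 'a topology"
  siz :: "nat \<Rightarrow> nat \<Rightarrow> nat"
  edg :: "nat \<Rightarrow> nat \<Rightarrow> nat \<Rightarrow> 'e set"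
  egn :: "nat \<Rightarrow> nat \<Rightarrow> nat \<Rightarrow> 'e \<Rightarrow> 'a \<Rightarrow> 'a"
  ord :: "nat \<Rightarrow> nat \<Rightarrow> (nat \<times> 'e) list"

type_synonym 'a elt = "nat \<Rightarrow> 'a \<Rightarrow> complex mat"

definition mat_opnorm :: "complex mat \<Rightarrow> real" where
  "mat_opnorm M = Sup {L2_set (\<lambda>a. cmod (vec_index (M *\<^sub>v v) a)) {..<dim_row M} | v.
     v \<in> carrier_vec (dim_col M) \<and> L2_set (\<lambda>a. cmod (vec_index v a)) {..<dim_col M} \<le> 1}"

definition fibrewise :: "('a, 'e) ah_data \<Rightarrow> nat \<Rightarrow> 'a elt \<Rightarrow> 'a elt" where
  "fibrewise D n F = (\<lambda>i\<in>{..<num D n}. \<lambda>x\<in>topspace (spc D n i). F i x)"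

definition A_carrier :: "('a, 'e) ah_data \<Rightarrow> nat \<Rightarrow> 'a elt set" where
  "A_carrier D n = (\<Pi>\<^sub>E i\<in>{..<num D n}.
     {f \<in> topspace (spc D n i) \<rightarrow>\<^sub>E carrier_mat (siz D n i) (siz D n i).
        \<forall>a<siz D n i. \<forall>b<siz D n i. continuous_map (spc D n i) euclidean (\<lambda>x. f x $$ (a, b))})"

definition A_alg :: "('a, 'e) ah_data \<Rightarrow> nat \<Rightarrow> 'a elt star_alg" where
  "A_alg D n = \<lparr>
     sa_carrier = A_carrier D n,
     sa_add = (\<lambda>f g. fibrewise D n (\<lambda>i x. f i x + g i x)),
     sa_mult = (\<lambda>f g. fibrewise D n (\<lambda>i x. f i x * g i x)),
     sa_scale = (\<lambda>z f. fibrewise D n (\<lambda>i x. z \<cdot>\<^sub>m f i x)),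
     sa_star = (\<lambda>f. fibrewise D n (\<lambda>i x. mat_adjoint (f i x))),
     sa_norm = (\<lambda>f. Sup {mat_opnorm (f i x) | i x. i < num D n \<and> x \<in> topspace (spc D n i)}) \<rparr>"

definition A_one :: "('a, 'e) ah_data \<Rightarrow> nat \<Rightarrow> 'a elt" where
  "A_one D n = fibrewise D n (\<lambda>i x. 1\<^sub>m (siz D n i))"

definition conn :: "('a, 'e) ah_data \<Rightarrow> nat \<Rightarrow> 'a elt \<Rightarrow> 'a elt" where
  "conn D n f = fibrewise D (Suc n)
     (\<lambda>j x. diag_block_mat (map (\<lambda>(i, e). f i (egn D n i j e x)) (ord D n j)))"

definition diagonal_AH_system :: "('a, 'e) ah_data \<Rightarrow> bool" where
  "diagonal_AH_system D \<longleftrightarrow> (\<forall>n\<ge>1.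
     num D n \<ge> 1 \<and>
     (\<forall>i<num D n. siz D n i \<ge> 1 \<and> topspace (spc D n i) \<noteq> {} \<and>
        compact_space (spc D n i) \<and> Hausdorff_space (spc D n i)) \<and>
     (\<forall>j<num D (Suc n).
        (\<forall>i<num D n. finite (edg D n i j) \<and>
           (\<forall>e\<in>edg D n i j. continuous_map (spc D (Suc n) j) (spc D n i) (egn D n i j e))) \<and>
        distinct (ord D n j) \<and>
        set (ord D n j) = {(i, e). i < num D n \<and> e \<in> edg D n i j}) \<and>
     conn D n \<in> A_carrier D n \<rightarrow> A_carrier D (Suc n) \<and>
     conn D n (A_one D n) = A_one D (Suc n) \<and>
     inj_on (conn D n) (A_carrier D n))"

definition AH_limit where
  "AH_limit D = cstar_limit (A_alg D) (conn D)"

abbreviation emb where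
  "emb D \<equiv> to_limit (A_alg D) (conn D)"

definition C_level :: "('a, 'e) ah_data \<Rightarrow> nat \<Rightarrow> 'a elt set" where
  "C_level D n = {f \<in> A_carrier D n. \<forall>i<num D n. \<forall>x\<in>topspace (spc D n i). diagonal_mat (f i x)}"

definition B_level :: "('a, 'e) ah_data \<Rightarrow> nat \<Rightarrow> 'a elt set" where
  "B_level D n = {f \<in> A_carrier D n. \<forall>i<num D n. \<exists>M. \<forall>x\<in>topspace (spc D n i). f i x = M}"

definition C_alg where
  "C_alg D = (AH_limit D)\<lparr>sa_carrier := limit_subalg (A_alg D) (conn D) (C_level D)\<rparr>"

definition B_alg where
  "B_alg D = (AH_limit D)\<lparr>sa_carrier := limit_subalg (A_alg D) (conn D) (B_level D)\<rparr>"

definition CB_alg where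
  "CB_alg D = (AH_limit D)\<lparr>sa_carrier := sa_carrier (C_alg D) \<inter> sa_carrier (B_alg D)\<rparr>"

abbreviation C_hat where
  "C_hat D \<equiv> gelfand_spectrum (C_alg D)"


section \<open>The Bratteli diagram and its path groupoid\<close>

text \<open>\<open>Root a j\<close> is the \<open>a\<close>-th edge from the root to \<open>(1, j)\<close>, and \<open>Edge i e j\<close> at level \<open>n \<ge> 1\<close>
  is \<open>e \<in> edg D n i j\<close>, from \<open>(n, i)\<close> to \<open>(n + 1, j)\<close>.  Paths are indexed from 0: the edge \<open>x m\<close>
  of a path \<open>x\<close> goes from level \<open>m\<close> to level \<open>m + 1\<close>.\<close>

datatype 'e bedge = Root nat nat | Edge nat 'e nat

fun bsrc :: "'e bedge \<Rightarrow> nat" where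
  "bsrc (Root a j) = 0"
| "bsrc (Edge i e j) = i"

fun btgt :: "'e bedge \<Rightarrow> nat" where
  "btgt (Root a j) = j"
| "btgt (Edge i e j) = j"

definition bedges :: "('a, 'e) ah_data \<Rightarrow> nat \<Rightarrow> 'e bedge set" where
  "bedges D n = (if n = 0 then {Root a j | a j. j < num D 1 \<and> a < siz D 1 j}
     else {Edge i e j | i e j. i < num D n \<and> j < num D (Suc n) \<and> e \<in> edg D n i j})"

definition fin_paths :: "('a, 'e) ah_data \<Rightarrow> 'e bedge list set" where
  "fin_paths D = {p. p \<noteq> [] \<and> (\<forall>m<length p. p ! m \<in> bedges D m) \<and>
     (\<forall>m. Suc m < length p \<longrightarrow> bsrc (p ! Suc m) = btgt (p ! m))}"

definition inf_paths :: "('a, 'e) ah_data \<Rightarrow> (nat \<Rightarrow> 'e bedge) set" where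
  "inf_paths D = {x. \<forall>m. x m \<in> bedges D m \<and> bsrc (x (Suc m)) = btgt (x m)}"

definition init_seg :: "nat \<Rightarrow> (nat \<Rightarrow> 'b) \<Rightarrow> 'b list" where
  "init_seg n x = map x [0..<n]"

definition Zset :: "('a, 'e) ah_data \<Rightarrow> 'e bedge list \<Rightarrow> (nat \<Rightarrow> 'e bedge) set" where
  "Zset D p = {x \<in> inf_paths D. init_seg (length p) x = p}"

text \<open>Pairs of paths of equal length with the same terminal vertex label the matrix units.\<close>

definition path_pairs :: "('a, 'e) ah_data \<Rightarrow> ('e bedge list \<times> 'e bedge list) set" where
  "path_pairs D = {(p, q). p \<in> fin_paths D \<and> q \<in> fin_paths D \<and>
     length p = length q \<and> btgt (last p) = btgt (last q)}"

definition Zset2 :: "('a, 'e) ah_data \<Rightarrow> 'e bedge list \<Rightarrow> 'e bedge list \<Rightarrow>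
    ((nat \<Rightarrow> 'e bedge) \<times> (nat \<Rightarrow> 'e bedge)) set" where
  "Zset2 D p q = {(x, y). x \<in> Zset D p \<and> y \<in> Zset D q \<and> (\<forall>m\<ge>length p. x m = y m)}"

definition path_groupoid where
  "path_groupoid D =
     relation_groupoid (topology_generated_by {Zset2 D p q | p q. (p, q) \<in> path_pairs D})"

text \<open>
  The identification of finite paths with matrix positions: an edge of \<open>E\<^sub>0\<close> is its own number,
  and the position of \<open>pe\<close> is the position of \<open>p\<close> shifted to the block belonging to \<open>e\<close>.
\<close>

definition block_offset :: "('a, 'e) ah_data \<Rightarrow> nat \<Rightarrow> nat \<Rightarrow> nat \<times> 'e \<Rightarrow> nat" where
  "block_offset D n j b = sum_list (map (\<lambda>(i, e). siz D n i) (takeWhile (\<lambda>b'. b' \<noteq> b) (ord D n j)))"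

primrec pos_upto :: "('a, 'e) ah_data \<Rightarrow> 'e bedge list \<Rightarrow> nat \<Rightarrow> nat" where
  "pos_upto D p 0 = 0"
| "pos_upto D p (Suc n) = (case p ! n of
     Root a j \<Rightarrow> a
   | Edge i e j \<Rightarrow> block_offset D n j (i, e) + pos_upto D p n)"

definition pos :: "('a, 'e) ah_data \<Rightarrow> 'e bedge list \<Rightarrow> nat" where
  "pos D p = pos_upto D p (length p)"

definition mat_unit :: "('a, 'e) ah_data \<Rightarrow> 'e bedge list \<Rightarrow> 'e bedge list \<Rightarrow> 'a elt" where
  "mat_unit D p q = fibrewise D (length p) (\<lambda>i x.
     Matrix.mat (siz D (length p) i) (siz D (length p) i)
       (\<lambda>(a, b). if i = btgt (last p) \<and> a = pos D p \<and> b = pos D q then 1 else 0))"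

abbreviation unit_in_A where
  "unit_in_A D p q \<equiv> emb D (length p) (mat_unit D p q)"


section \<open>The action of the path groupoid on the spectrum of C\<close>

text \<open>
  Under \<open>C(P) = C \<inter> B\<close>, where \<open>1\<^sub>Z\<^sub>(\<^sub>p\<^sub>) = e\<^sub>p\<^sub>,\<^sub>p\<close>, evaluation at the path \<open>y\<close> is the character of
  \<open>C \<inter> B\<close> taking these values on the matrix units (which generate \<open>C \<inter> B\<close>); the Gelfand dual of
  the inclusion \<open>C \<inter> B \<subseteq> C\<close> is restriction of characters.
\<close>

definition evaluation_at where
  "evaluation_at D y \<psi> \<longleftrightarrow> \<psi> \<in> characters (CB_alg D) \<and>
     (\<forall>p\<in>fin_paths D. \<psi> (unit_in_A D p p) = (if y \<in> Zset D p then 1 else 0))"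

definition anchor_map where
  "anchor_map D \<omega> =
     (THE y. y \<in> inf_paths D \<and> evaluation_at D y (restrict \<omega> (sa_carrier (CB_alg D))))"

definition path_action where
  "path_action D \<gamma> \<omega> = (THE \<omega>'. \<omega>' \<in> characters (C_alg D) \<and>
     (\<forall>(p, q)\<in>path_pairs D. \<gamma> \<in> Zset2 D p q \<longrightarrow>
        (\<forall>c\<in>sa_carrier (C_alg D). \<omega>' c =
           \<omega> (sa_mult (AH_limit D) (sa_star (AH_limit D) (unit_in_A D p q))
                (sa_mult (AH_limit D) c (unit_in_A D p q))))))"

definition action_groupoid where
  "action_groupoid D = transformation_groupoid (path_groupoid D) (C_hat D)
     (\<lambda>\<omega>. (anchor_map D \<omega>, anchor_map D \<omega>)) (path_action D)"


section \<open>The labelled Bratteli diagram\<close>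

text \<open>The root is the one-point space \<open>{None}\<close> (\<open>None\<close> playing the role of the point 0), and
  \<open>(n, i)\<close> for \<open>n \<ge> 1\<close> is the copy of \<open>spc D n i\<close> under \<open>Some\<close>.\<close>

definition vertex_space :: "('a, 'e) ah_data \<Rightarrow> nat \<Rightarrow> nat \<Rightarrow> 'a option topology" where
  "vertex_space D n i = (if n = 0 then discrete_topology {None}
     else pullback_topology (Some ` topspace (spc D n i)) the (spc D n i))"

definition edge_label :: "('a, 'e) ah_data \<Rightarrow> nat \<Rightarrow> 'e bedge \<Rightarrow> 'a option \<Rightarrow> 'a option" where
  "edge_label D n b = (case b of
     Root a j \<Rightarrow> (\<lambda>_. None)
   | Edge i e j \<Rightarrow> map_option (egn D n i j e))"

definition labelled_paths :: "('a, 'e) ah_data \<Rightarrow> (nat \<Rightarrow> 'e bedge \<times> 'a option) set" where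
  "labelled_paths D = {x. fst \<circ> x \<in> inf_paths D \<and>
     (\<forall>m. snd (x m) \<in> topspace (vertex_space D m (bsrc (fst (x m))))) \<and>
     (\<forall>m. edge_label D m (fst (x m)) (snd (x (Suc m))) = snd (x m))}"

definition cylinder :: "('a, 'e) ah_data \<Rightarrow> 'e bedge list \<Rightarrow> 'a option set \<Rightarrow>
    (nat \<Rightarrow> 'e bedge \<times> 'a option) set" where
  "cylinder D p U = {x \<in> labelled_paths D.
     init_seg (length p) (fst \<circ> x) = p \<and> snd (x (length p - 1)) \<in> U}"

definition labelled_path_space :: "('a, 'e) ah_data \<Rightarrow> (nat \<Rightarrow> 'e bedge \<times> 'a option) topology" where
  "labelled_path_space D = topology_generated_by {cylinder D p U | p U.
     p \<in> fin_paths D \<and> openin (vertex_space D (length p - 1) (bsrc (last p))) U}"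

definition tail_equal_from :: "('a, 'e) ah_data \<Rightarrow> nat \<Rightarrow>
    ((nat \<Rightarrow> 'e bedge \<times> 'a option) \<times> (nat \<Rightarrow> 'e bedge \<times> 'a option)) set" where
  "tail_equal_from D n = {(x, y). x \<in> labelled_paths D \<and> y \<in> labelled_paths D \<and>
     (\<forall>m\<ge>n. x m = y m)}"

text \<open>
  Tail equivalence is the increasing union of the relations \<open>tail_equal_from D n\<close>.  Each of these
  carries the subspace topology inherited from the product of two copies of the path space, and
  the union carries the resulting inductive limit topology.  (The subspace topology on the whole
  union would be too coarse: already when all spaces are points and all \<open>N\<^sub>n = 1\<close>, as for the
  \<open>2\<^sup>\<infinity>\<close> UHF-algebra, the diagonal would not be open, whereas it is open in the path groupoid, so
  the groupoid would not be etale.)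
\<close>

definition labelled_groupoid_top :: "('a, 'e) ah_data \<Rightarrow>
    ((nat \<Rightarrow> 'e bedge \<times> 'a option) \<times> (nat \<Rightarrow> 'e bedge \<times> 'a option)) topology" where
  "labelled_groupoid_top D = topology (\<lambda>W. W \<subseteq> (\<Union>n. tail_equal_from D n) \<and>
     (\<forall>n. openin (subtopology (prod_topology (labelled_path_space D) (labelled_path_space D))
                    (tail_equal_from D n)) (W \<inter> tail_equal_from D n)))"

definition labelled_groupoid where
  "labelled_groupoid D = relation_groupoid (labelled_groupoid_top D)"


section \<open>The maps h and Phi\<close>

text \<open>\<open>coord D \<omega> n\<close> is the pair of \<open>p\<^sub>n\<close> and \<open>\<omega>\<^sub>n\<close>; the vertex is the end point of \<open>p\<^sub>n\<close>.\<close>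

definition coord where
  "coord D \<omega> n = (THE (p, x). p \<in> fin_paths D \<and> length p = n \<and>
     x \<in> topspace (spc D n (btgt (last p))) \<and>
     (\<forall>f\<in>C_level D n. \<omega> (emb D n f) = f (btgt (last p)) x $$ (pos D p, pos D p)))"

definition h_map where
  "h_map D \<omega> = (\<lambda>m. (last (fst (coord D \<omega> (Suc m))),
     if m = 0 then None else Some (snd (coord D \<omega> m))))"

definition Phi where
  "Phi D = (\<lambda>(x, y). ((fst \<circ> x, fst \<circ> y), inv_into (characters (C_alg D)) (h_map D) y))"

end

theory Submission
  imports Defs
begin

text \<open>Every element of \<open>A\<^sub>n\<close> is a function on the groupoid of labelled paths: at a pair of paths
  agreeing from level \<open>n\<close> on, take the matrix entry whose row and column are the initial segments
  of the two paths, at the point of \<open>X\<^sub>n\<^sub>,\<^sub>i\<close> through which both paths run.  This is compatible with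
  the connecting maps, and it is isometric because the matrices at the points of \<open>X\<^sub>n\<^sub>,\<^sub>i\<close> are exactly
  the diagonal blocks of the resulting kernel; here injectivity of the connecting maps enters, as it makes
  the eigenfunctions jointly surjective, so that every point lies on a path.  The image is dense by a
  partition of unity, so the completions agree.  Under this isomorphism \<open>C\<close> becomes the algebra
  of continuous functions on the compact path space: its characters are the point evaluations, and
  conjugation by matrix units permutes them by changing initial segments.  Thus \<open>h\<^sup>-\<^sup>1\<close> is the
  evaluation map, and \<open>Phi\<close> identifies the two groupoids because a labelled path is
  determined by its tail and its edges.\<close>

subsection \<open>Normed *-algebras and their completions\<close>

text \<open>Tail equivalence is a union of relations \<open>R n\<close>, and the obstacle is that
  its topology is not induced from the product of two path spaces but is the limit of the topologies
  of the pieces. The remedy is that each \<open>R n\<close> turns out compact, open and closed: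
  agreement of edges is locally constant, and labels above determine labels below. So every compact
  set lies in one \<open>R n\<close>, continuity is tested inside one \<open>R n\<close>, and the
  elements of \<open>Cc\<close> are the continuous functions on some \<open>R n\<close>, extended by
  zero.

  Operator norms are handled through inequalities for finite kernels instead of suprema, and the
  norm estimates in the direct limit are pulled back from the convolution algebra. The axioms of the
  transformation groupoid are obtained by transport along \<open>Phi\<close>: its range and inverse
  involve \<open>path_action\<close>, a definite description whose value is known on the characters
  \<open>chi y\<close> and on pairs underlying tail-equivalent labelled paths, and
  \<open>Phi\<close> reaches exactly these.\<close>

lemma UN_eq_const: "a \<in> A \<Longrightarrow> (\<And>x. x \<in> A \<Longrightarrow> f x = c) \<Longrightarrow> (\<Union>x\<in>A. f x) = c"
  by auto

text \<open>The axioms are the estimates that make operations on Cauchy sequences well defined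
  modulo null sequences. They are phrased through \<open>sa_dist\<close>, so they transfer along
  isometric maps that respect the operations, which is how the direct limit obtains them.\<close>

locale normed_star =
  fixes T :: "'y star_alg"
  assumes add_closed: "a \<in> sa_carrier T \<Longrightarrow> b \<in> sa_carrier T \<Longrightarrow> sa_add T a b \<in> sa_carrier T"
    and mult_closed: "a \<in> sa_carrier T \<Longrightarrow> b \<in> sa_carrier T \<Longrightarrow> sa_mult T a b \<in> sa_carrier T"
    and scale_closed: "a \<in> sa_carrier T \<Longrightarrow> sa_scale T z a \<in> sa_carrier T"
    and star_closed: "a \<in> sa_carrier T \<Longrightarrow> sa_star T a \<in> sa_carrier T"
    and norm_nonneg: "a \<in> sa_carrier T \<Longrightarrow> 0 \<le> sa_norm T a"
    and norm_diff: "a \<in> sa_carrier T \<Longrightarrow> b \<in> sa_carrier T \<Longrightarrow>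
      \<bar>sa_norm T a - sa_norm T b\<bar> \<le> sa_dist T a b"
    and dist_self: "a \<in> sa_carrier T \<Longrightarrow> sa_dist T a a = 0"
    and dist_commute: "a \<in> sa_carrier T \<Longrightarrow> b \<in> sa_carrier T \<Longrightarrow> sa_dist T a b = sa_dist T b a"
    and dist_triangle: "a \<in> sa_carrier T \<Longrightarrow> b \<in> sa_carrier T \<Longrightarrow> c \<in> sa_carrier T \<Longrightarrow>
      sa_dist T a c \<le> sa_dist T a b + sa_dist T b c"
    and dist_add: "a \<in> sa_carrier T \<Longrightarrow> b \<in> sa_carrier T \<Longrightarrow> a' \<in> sa_carrier T \<Longrightarrow> b' \<in> sa_carrier T \<Longrightarrow>
      sa_dist T (sa_add T a b) (sa_add T a' b') \<le> sa_dist T a a' + sa_dist T b b'"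
    and dist_mult: "a \<in> sa_carrier T \<Longrightarrow> b \<in> sa_carrier T \<Longrightarrow> a' \<in> sa_carrier T \<Longrightarrow> b' \<in> sa_carrier T \<Longrightarrow>
      sa_dist T (sa_mult T a b) (sa_mult T a' b') \<le> sa_norm T a * sa_dist T b b' + sa_dist T a a' * sa_norm T b'"
    and dist_scale: "a \<in> sa_carrier T \<Longrightarrow> b \<in> sa_carrier T \<Longrightarrow>
      sa_dist T (sa_scale T z a) (sa_scale T z b) \<le> cmod z * sa_dist T a b"
    and dist_star: "a \<in> sa_carrier T \<Longrightarrow> b \<in> sa_carrier T \<Longrightarrow>
      sa_dist T (sa_star T a) (sa_star T b) \<le> sa_dist T a b"
begin

lemma dist_nonneg: "a \<in> sa_carrier T \<Longrightarrow> b \<in> sa_carrier T \<Longrightarrow> 0 \<le> sa_dist T a b"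
  using norm_diff[of a b] by linarith

lemma cauchy_seqsI:
  assumes "\<And>n. u n \<in> sa_carrier T" "\<And>\<epsilon>. \<epsilon> > 0 \<Longrightarrow> \<exists>M. \<forall>m\<ge>M. \<forall>n\<ge>M. sa_dist T (u m) (u n) < \<epsilon>"
  shows "u \<in> cauchy_seqs T"
  using assms unfolding cauchy_seqs_def by auto

lemma cauchy_carrier: "u \<in> cauchy_seqs T \<Longrightarrow> u n \<in> sa_carrier T"
  by (auto simp: cauchy_seqs_def)

lemma cauchyD: "u \<in> cauchy_seqs T \<Longrightarrow> \<epsilon> > 0 \<Longrightarrow> \<exists>M. \<forall>m\<ge>M. \<forall>n\<ge>M. sa_dist T (u m) (u n) < \<epsilon>"
  by (auto simp: cauchy_seqs_def)

lemma const_cauchy: "a \<in> sa_carrier T \<Longrightarrow> (\<lambda>_. a) \<in> cauchy_seqs T"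
  by (rule cauchy_seqsI) (auto simp: dist_self)

lemma cauchy_of_bound:
  assumes u: "u \<in> cauchy_seqs T" and w: "\<And>n. w n \<in> sa_carrier T"
    and b: "\<And>m n. sa_dist T (w m) (w n) \<le> K * sa_dist T (u m) (u n)"
  shows "w \<in> cauchy_seqs T"
proof (rule cauchy_seqsI[OF w])
  fix \<epsilon> :: real assume e: "\<epsilon> > 0"
  \<comment> \<open>Dividing by \<open>\<bar>K\<bar> + 1\<close> rather than by \<open>K\<close>
    covers every sign of \<open>K\<close> at once.\<close>
  obtain M where M: "\<forall>m\<ge>M. \<forall>n\<ge>M. sa_dist T (u m) (u n) < \<epsilon> / (\<bar>K\<bar> + 1)"
    using cauchyD[OF u, of "\<epsilon> / (\<bar>K\<bar> + 1)"] e by auto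
  have "sa_dist T (w m) (w n) < \<epsilon>" if "m \<ge> M" "n \<ge> M" for m n
  proof -
    have d: "sa_dist T (u m) (u n) < \<epsilon> / (\<bar>K\<bar> + 1)" "0 \<le> sa_dist T (u m) (u n)"
      using M that dist_nonneg cauchy_carrier[OF u] by auto
    have "sa_dist T (w m) (w n) \<le> (\<bar>K\<bar> + 1) * sa_dist T (u m) (u n)"
      using b[of m n] mult_right_mono[OF _ d(2), of K "\<bar>K\<bar> + 1"] by linarith
    also have "\<dots> < \<epsilon>" using d(1) by (simp add: field_simps)
    finally show ?thesis .
  qed
  then show "\<exists>M. \<forall>m\<ge>M. \<forall>n\<ge>M. sa_dist T (w m) (w n) < \<epsilon>" by blast
qed

lemma norm_convergent:
  assumes u: "u \<in> cauchy_seqs T" shows "convergent (\<lambda>n. sa_norm T (u n))"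
proof -
  have "Cauchy (\<lambda>n. sa_norm T (u n))"
  proof (rule metric_CauchyI)
    fix e :: real assume "e > 0"
    then obtain M where M: "\<forall>m\<ge>M. \<forall>n\<ge>M. sa_dist T (u m) (u n) < e" using cauchyD[OF u] by blast
    then show "\<exists>M. \<forall>m\<ge>M. \<forall>n\<ge>M. dist (sa_norm T (u m)) (sa_norm T (u n)) < e"
      using norm_diff[OF cauchy_carrier[OF u] cauchy_carrier[OF u]]
      by (metis dist_real_def le_less_trans)
  qed
  then show ?thesis by (simp add: Cauchy_convergent_iff)
qed

lemma norm_bounded:
  assumes u: "u \<in> cauchy_seqs T" obtains K where "K \<ge> 0" "\<And>n. sa_norm T (u n) \<le> K"
proof -
  have "Bseq (\<lambda>n. sa_norm T (u n))" using norm_convergent[OF u] convergent_imp_Bseq by blast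
  then obtain K where "\<And>n. norm (sa_norm T (u n)) \<le> K" "K > 0" by (auto simp: Bseq_def)
  then show ?thesis using that[of K] by (metis abs_le_D1 less_eq_real_def real_norm_def)
qed

lemma cauchy_add:
  assumes u: "u \<in> cauchy_seqs T" and v: "v \<in> cauchy_seqs T"
  shows "(\<lambda>n. sa_add T (u n) (v n)) \<in> cauchy_seqs T"
proof (rule cauchy_seqsI)
  note c = cauchy_carrier[OF u] cauchy_carrier[OF v]
  show "sa_add T (u n) (v n) \<in> sa_carrier T" for n using c add_closed by auto
  fix \<epsilon> :: real assume e: "\<epsilon> > 0"
  obtain M N where M: "\<forall>m\<ge>M. \<forall>n\<ge>M. sa_dist T (u m) (u n) < \<epsilon> / 2"
    and N: "\<forall>m\<ge>N. \<forall>n\<ge>N. sa_dist T (v m) (v n) < \<epsilon> / 2"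
    using cauchyD[OF u, of "\<epsilon>/2"] cauchyD[OF v, of "\<epsilon>/2"] e by auto
  have "sa_dist T (sa_add T (u m) (v m)) (sa_add T (u n) (v n)) < \<epsilon>" if "m \<ge> max M N" "n \<ge> max M N" for m n
    using dist_add[of "u m" "v m" "u n" "v n"] c M N that by (smt (verit) field_sum_of_halves max.bounded_iff)
  then show "\<exists>M. \<forall>m\<ge>M. \<forall>n\<ge>M. sa_dist T (sa_add T (u m) (v m)) (sa_add T (u n) (v n)) < \<epsilon>" by blast
qed

lemma cauchy_mult:
  assumes u: "u \<in> cauchy_seqs T" and v: "v \<in> cauchy_seqs T"
  shows "(\<lambda>n. sa_mult T (u n) (v n)) \<in> cauchy_seqs T"
proof (rule cauchy_seqsI)
  note c = cauchy_carrier[OF u] cauchy_carrier[OF v]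
  show "sa_mult T (u n) (v n) \<in> sa_carrier T" for n using c mult_closed by auto
  fix \<epsilon> :: real assume e: "\<epsilon> > 0"
  obtain K L where K: "K \<ge> 0" "\<And>n. sa_norm T (u n) \<le> K" and L: "L \<ge> 0" "\<And>n. sa_norm T (v n) \<le> L"
    using norm_bounded[OF u] norm_bounded[OF v] by metis
  \<comment> \<open>\<open>K\<close> and \<open>L\<close> bound the norms of the two sequences, so
    \<open>dist_mult\<close> leaves at most \<open>\<epsilon> * (K + L) / (2 * (K + L + 1))\<close>;
    the summand 1 keeps the denominator positive when both bounds vanish.\<close>
  have pos: "\<epsilon> / (2 * (K + L + 1)) > 0" using e K L by simp
  obtain M N where M: "\<forall>m\<ge>M. \<forall>n\<ge>M. sa_dist T (u m) (u n) < \<epsilon> / (2 * (K + L + 1))"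
    and N: "\<forall>m\<ge>N. \<forall>n\<ge>N. sa_dist T (v m) (v n) < \<epsilon> / (2 * (K + L + 1))"
    using cauchyD[OF u pos] cauchyD[OF v pos] by auto
  have "sa_dist T (sa_mult T (u m) (v m)) (sa_mult T (u n) (v n)) < \<epsilon>" if mn: "m \<ge> max M N" "n \<ge> max M N" for m n
  proof -
    let ?d = "\<epsilon> / (2 * (K + L + 1))"
    have "sa_dist T (sa_mult T (u m) (v m)) (sa_mult T (u n) (v n))
        \<le> sa_norm T (u m) * sa_dist T (v m) (v n) + sa_dist T (u m) (u n) * sa_norm T (v n)"
      using dist_mult c by blast
    also have "\<dots> \<le> K * ?d + ?d * L"
      using K L M N mn c dist_nonneg norm_nonneg less_imp_le[OF pos] by (intro add_mono mult_mono) (auto intro: less_imp_le)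
    also have "\<dots> = \<epsilon> * ((K + L) / (2 * (K + L + 1)))" by (simp add: algebra_simps add_divide_distrib)
    also have "\<dots> < \<epsilon> * 1" using K(1) L(1) e by (intro mult_strict_left_mono) (auto simp: field_simps)
    also have "\<dots> = \<epsilon>" by simp
    finally show ?thesis .
  qed
  then show "\<exists>M. \<forall>m\<ge>M. \<forall>n\<ge>M. sa_dist T (sa_mult T (u m) (v m)) (sa_mult T (u n) (v n)) < \<epsilon>" by blast
qed

lemma cauchy_scale: "u \<in> cauchy_seqs T \<Longrightarrow> (\<lambda>n. sa_scale T z (u n)) \<in> cauchy_seqs T"
  by (rule cauchy_of_bound) (auto simp: cauchy_carrier intro: scale_closed dist_scale)

lemma cauchy_star: "u \<in> cauchy_seqs T \<Longrightarrow> (\<lambda>n. sa_star T (u n)) \<in> cauchy_seqs T"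
  by (rule cauchy_of_bound[where K=1]) (auto simp: cauchy_carrier intro: star_closed dist_star)

lemma in_class_iff:
  "v \<in> cauchy_class T u \<longleftrightarrow> v \<in> cauchy_seqs T \<and> (\<lambda>n. sa_dist T (u n) (v n)) \<longlonglongrightarrow> 0"
  by (simp add: cauchy_class_def)

lemma class_self: "u \<in> cauchy_seqs T \<Longrightarrow> u \<in> cauchy_class T u"
  by (simp add: in_class_iff dist_self cauchy_carrier)

lemma null_trans:
  assumes "u \<in> cauchy_seqs T" "v \<in> cauchy_seqs T" "w \<in> cauchy_seqs T"
    "(\<lambda>n. sa_dist T (u n) (v n)) \<longlonglongrightarrow> 0" "(\<lambda>n. sa_dist T (v n) (w n)) \<longlonglongrightarrow> 0"
  shows "(\<lambda>n. sa_dist T (u n) (w n)) \<longlonglongrightarrow> 0"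
  by (rule tendsto_sandwich[OF _ _ tendsto_const tendsto_add_zero[OF assms(4,5)]])
     (use assms in \<open>auto intro!: always_eventually dist_nonneg dist_triangle simp: cauchy_carrier\<close>)

lemma null_sym:
  assumes "u \<in> cauchy_seqs T" "v \<in> cauchy_seqs T" "(\<lambda>n. sa_dist T (u n) (v n)) \<longlonglongrightarrow> 0"
  shows "(\<lambda>n. sa_dist T (v n) (u n)) \<longlonglongrightarrow> 0"
  using assms dist_commute[OF cauchy_carrier cauchy_carrier] by auto

lemma class_eq_iff:
  assumes "u \<in> cauchy_seqs T" "v \<in> cauchy_seqs T"
  shows "cauchy_class T u = cauchy_class T v \<longleftrightarrow> (\<lambda>n. sa_dist T (u n) (v n)) \<longlonglongrightarrow> 0"
proof
  assume "cauchy_class T u = cauchy_class T v"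
  then show "(\<lambda>n. sa_dist T (u n) (v n)) \<longlonglongrightarrow> 0" using class_self[OF assms(2)] in_class_iff by blast
next
  assume a: "(\<lambda>n. sa_dist T (u n) (v n)) \<longlonglongrightarrow> 0"
  show "cauchy_class T u = cauchy_class T v"
  proof (rule subset_antisym; rule subsetI)
    fix w assume "w \<in> cauchy_class T u"
    then show "w \<in> cauchy_class T v"
      unfolding in_class_iff using null_trans[OF assms(2,1) _ null_sym[OF assms a]] by blast
  next
    fix w assume "w \<in> cauchy_class T v"
    then show "w \<in> cauchy_class T u"
      unfolding in_class_iff using null_trans[OF assms(1,2) _ a] by blast
  qed
qed

lemma class_in_iff:
  assumes "u \<in> cauchy_seqs T" shows "v \<in> cauchy_class T u \<longleftrightarrow> v \<in> cauchy_seqs T \<and> cauchy_class T v = cauchy_class T u"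
  using class_eq_iff in_class_iff assms null_sym by metis

lemma compl_carrier: "sa_carrier (completion T) = cauchy_class T ` cauchy_seqs T"
  by (simp add: completion_def)

text \<open>The operations of \<open>completion\<close> are unions over all choices of
  representatives; such a union is a single class because equivalent representatives give equivalent
  results. The same scheme serves product, scaling and star.\<close>

lemma compl_add:
  assumes u: "u \<in> cauchy_seqs T" and v: "v \<in> cauchy_seqs T"
  shows "sa_add (completion T) (cauchy_class T u) (cauchy_class T v) = cauchy_class T (\<lambda>n. sa_add T (u n) (v n))"
proof -
  have "cauchy_class T (\<lambda>n. sa_add T (u' n) (v' n)) = cauchy_class T (\<lambda>n. sa_add T (u n) (v n))"
    if "u' \<in> cauchy_class T u" "v' \<in> cauchy_class T v" for u' v'
  proof -
    have u': "u' \<in> cauchy_seqs T" "(\<lambda>n. sa_dist T (u' n) (u n)) \<longlonglongrightarrow> 0"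
     and v': "v' \<in> cauchy_seqs T" "(\<lambda>n. sa_dist T (v' n) (v n)) \<longlonglongrightarrow> 0"
      using that class_in_iff[OF u] class_in_iff[OF v] class_eq_iff u v by auto
    have "(\<lambda>n. sa_dist T (sa_add T (u' n) (v' n)) (sa_add T (u n) (v n))) \<longlonglongrightarrow> 0"
      by (rule tendsto_sandwich[OF _ _ tendsto_const tendsto_add_zero[OF u'(2) v'(2)]])
         (use u' v' u v in \<open>auto intro!: always_eventually dist_nonneg dist_add add_closed simp: cauchy_carrier\<close>)
    then show ?thesis using class_eq_iff cauchy_add u v u' v' by blast
  qed
  then have "(\<Union>u'\<in>cauchy_class T u. \<Union>v'\<in>cauchy_class T v. cauchy_class T (\<lambda>n. sa_add T (u' n) (v' n))) =
    cauchy_class T (\<lambda>n. sa_add T (u n) (v n))"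
    by (intro UN_eq_const[OF class_self[OF u]] UN_eq_const[OF class_self[OF v]])
  then show ?thesis by (simp add: completion_def)
qed

lemma compl_mult:
  assumes u: "u \<in> cauchy_seqs T" and v: "v \<in> cauchy_seqs T"
  shows "sa_mult (completion T) (cauchy_class T u) (cauchy_class T v) = cauchy_class T (\<lambda>n. sa_mult T (u n) (v n))"
proof -
  have "cauchy_class T (\<lambda>n. sa_mult T (u' n) (v' n)) = cauchy_class T (\<lambda>n. sa_mult T (u n) (v n))"
    if "u' \<in> cauchy_class T u" "v' \<in> cauchy_class T v" for u' v'
  proof -
    have u': "u' \<in> cauchy_seqs T" "(\<lambda>n. sa_dist T (u' n) (u n)) \<longlonglongrightarrow> 0"
     and v': "v' \<in> cauchy_seqs T" "(\<lambda>n. sa_dist T (v' n) (v n)) \<longlonglongrightarrow> 0"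
      using that class_in_iff[OF u] class_in_iff[OF v] class_eq_iff u v by auto
    \<comment> \<open>\<open>dist_mult\<close> is asymmetric: it asks for a bound on the new first
      factor \<open>u'\<close> and on the old second factor \<open>v\<close>.\<close>
    obtain K L where K: "K \<ge> 0" "\<And>n. sa_norm T (u' n) \<le> K" and L: "L \<ge> 0" "\<And>n. sa_norm T (v n) \<le> L"
      using norm_bounded[OF u'(1)] norm_bounded[OF v] by metis
    have lim: "(\<lambda>n. K * sa_dist T (v' n) (v n) + sa_dist T (u' n) (u n) * L) \<longlonglongrightarrow> 0"
      using tendsto_add[OF tendsto_mult_left[OF v'(2), of K] tendsto_mult_right[OF u'(2), of L]] by simp
    have b: "sa_dist T (sa_mult T (u' n) (v' n)) (sa_mult T (u n) (v n)) \<le> K * sa_dist T (v' n) (v n) + sa_dist T (u' n) (u n) * L" for n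
    proof -
      have "sa_dist T (sa_mult T (u' n) (v' n)) (sa_mult T (u n) (v n))
        \<le> sa_norm T (u' n) * sa_dist T (v' n) (v n) + sa_dist T (u' n) (u n) * sa_norm T (v n)"
        using dist_mult u' v' u v cauchy_carrier by blast
      also have "\<dots> \<le> K * sa_dist T (v' n) (v n) + sa_dist T (u' n) (u n) * L"
        using K L u' v' u v by (intro add_mono mult_mono) (auto intro!: dist_nonneg norm_nonneg simp: cauchy_carrier)
      finally show ?thesis .
    qed
    have "(\<lambda>n. sa_dist T (sa_mult T (u' n) (v' n)) (sa_mult T (u n) (v n))) \<longlonglongrightarrow> 0"
      by (rule tendsto_sandwich[OF _ _ tendsto_const lim])
         (use u' v' u v b in \<open>auto intro!: always_eventually dist_nonneg mult_closed simp: cauchy_carrier\<close>)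
    then show ?thesis using class_eq_iff cauchy_mult u v u' v' by blast
  qed
  then have "(\<Union>u'\<in>cauchy_class T u. \<Union>v'\<in>cauchy_class T v. cauchy_class T (\<lambda>n. sa_mult T (u' n) (v' n))) =
    cauchy_class T (\<lambda>n. sa_mult T (u n) (v n))"
    by (intro UN_eq_const[OF class_self[OF u]] UN_eq_const[OF class_self[OF v]])
  then show ?thesis by (simp add: completion_def)
qed

lemma compl_scale:
  assumes u: "u \<in> cauchy_seqs T"
  shows "sa_scale (completion T) z (cauchy_class T u) = cauchy_class T (\<lambda>n. sa_scale T z (u n))"
proof -
  have "cauchy_class T (\<lambda>n. sa_scale T z (u' n)) = cauchy_class T (\<lambda>n. sa_scale T z (u n))"
    if "u' \<in> cauchy_class T u" for u'
  proof -
    have u': "u' \<in> cauchy_seqs T" "(\<lambda>n. sa_dist T (u' n) (u n)) \<longlonglongrightarrow> 0"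
      using that class_in_iff[OF u] class_eq_iff u by auto
    have "(\<lambda>n. sa_dist T (sa_scale T z (u' n)) (sa_scale T z (u n))) \<longlonglongrightarrow> 0"
      by (rule tendsto_sandwich[OF _ _ tendsto_const tendsto_mult_right_zero[OF u'(2), of "cmod z"]])
         (use u' u in \<open>auto intro!: always_eventually dist_nonneg dist_scale scale_closed simp: cauchy_carrier\<close>)
    then show ?thesis using class_eq_iff cauchy_scale u u' by blast
  qed
  then have "(\<Union>u'\<in>cauchy_class T u. cauchy_class T (\<lambda>n. sa_scale T z (u' n))) =
    cauchy_class T (\<lambda>n. sa_scale T z (u n))"
    by (intro UN_eq_const[OF class_self[OF u]])
  then show ?thesis by (simp add: completion_def)
qed

lemma compl_star:
  assumes u: "u \<in> cauchy_seqs T"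
  shows "sa_star (completion T) (cauchy_class T u) = cauchy_class T (\<lambda>n. sa_star T (u n))"
proof -
  have "cauchy_class T (\<lambda>n. sa_star T (u' n)) = cauchy_class T (\<lambda>n. sa_star T (u n))"
    if "u' \<in> cauchy_class T u" for u'
  proof -
    have u': "u' \<in> cauchy_seqs T" "(\<lambda>n. sa_dist T (u' n) (u n)) \<longlonglongrightarrow> 0"
      using that class_in_iff[OF u] class_eq_iff u by auto
    have "(\<lambda>n. sa_dist T (sa_star T (u' n)) (sa_star T (u n))) \<longlonglongrightarrow> 0"
      by (rule tendsto_sandwich[OF _ _ tendsto_const u'(2)])
         (use u' u in \<open>auto intro!: always_eventually dist_nonneg dist_star star_closed simp: cauchy_carrier\<close>)
    then show ?thesis using class_eq_iff cauchy_star u u' by blast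
  qed
  then have "(\<Union>u'\<in>cauchy_class T u. cauchy_class T (\<lambda>n. sa_star T (u' n))) =
    cauchy_class T (\<lambda>n. sa_star T (u n))"
    by (intro UN_eq_const[OF class_self[OF u]])
  then show ?thesis by (simp add: completion_def)
qed

text \<open>The definite description is meaningful because norms converge along a Cauchy sequence
  and equivalent sequences have the same limit of norms.\<close>

lemma compl_norm:
  assumes u: "u \<in> cauchy_seqs T"
  shows "(\<lambda>n. sa_norm T (u n)) \<longlonglongrightarrow> sa_norm (completion T) (cauchy_class T u)"
proof -
  obtain r where r: "(\<lambda>n. sa_norm T (u n)) \<longlonglongrightarrow> r" using norm_convergent[OF u] convergent_def by blast
  have all: "(\<lambda>n. sa_norm T (v n)) \<longlonglongrightarrow> r" if "v \<in> cauchy_class T u" for v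
  proof -
    have v: "v \<in> cauchy_seqs T" "(\<lambda>n. sa_dist T (u n) (v n)) \<longlonglongrightarrow> 0" using that in_class_iff by auto
    have "(\<lambda>n. sa_norm T (u n) - sa_norm T (v n)) \<longlonglongrightarrow> 0"
      by (rule Lim_null_comparison[OF _ v(2)])
         (use u v in \<open>auto intro!: always_eventually norm_diff simp: cauchy_carrier\<close>)
    then show ?thesis using Lim_transform[OF r] by (simp add: tendsto_minus_cancel_left[symmetric] Lim_transform2[OF r])
  qed
  have "sa_norm (completion T) (cauchy_class T u) = (THE r. \<forall>v\<in>cauchy_class T u. (\<lambda>n. sa_norm T (v n)) \<longlonglongrightarrow> r)"
    by (simp add: completion_def)
  also have "\<dots> = r"
    by (rule the_equality) (use all class_self[OF u] r in \<open>auto intro: LIMSEQ_unique\<close>)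
  finally show ?thesis using r by simp
qed

lemma compl_dist:
  assumes u: "u \<in> cauchy_seqs T" and v: "v \<in> cauchy_seqs T"
  shows "(\<lambda>n. sa_dist T (u n) (v n)) \<longlonglongrightarrow> sa_dist (completion T) (cauchy_class T u) (cauchy_class T v)"
  using compl_norm[OF cauchy_add[OF u cauchy_scale[OF v, of "-1"]]] compl_add[OF u cauchy_scale[OF v]] compl_scale[OF v]
  by (simp add: sa_dist_def)

text \<open>Approximability within every \<epsilon> is turned into a representing Cauchy sequence
  with all its terms in \<open>S\<close>. Elements of a closure can then be handled termwise, inside
  the subalgebra.\<close>

lemma closure_seq:
  assumes S: "S \<subseteq> sa_carrier T" and c: "c \<in> sa_carrier (completion T)"
  shows "(\<forall>\<epsilon>>0. \<exists>s\<in>S. sa_dist (completion T) c (cauchy_class T (\<lambda>_. s)) < \<epsilon>) \<longleftrightarrow>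
    (\<exists>u\<in>cauchy_seqs T. range u \<subseteq> S \<and> c = cauchy_class T u)"
proof
  assume "\<exists>u\<in>cauchy_seqs T. range u \<subseteq> S \<and> c = cauchy_class T u"
  then obtain u where u: "u \<in> cauchy_seqs T" "range u \<subseteq> S" "c = cauchy_class T u" by blast
  show "\<forall>\<epsilon>>0. \<exists>s\<in>S. sa_dist (completion T) c (cauchy_class T (\<lambda>_. s)) < \<epsilon>"
  proof (intro allI impI)
    fix \<epsilon> :: real assume e: "\<epsilon> > 0"
    obtain M where M: "\<forall>m\<ge>M. \<forall>n\<ge>M. sa_dist T (u m) (u n) < \<epsilon>/2" using cauchyD[OF u(1), of "\<epsilon>/2"] e by auto
    have "sa_dist (completion T) c (cauchy_class T (\<lambda>_. u M)) \<le> \<epsilon>/2"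
      by (rule LIMSEQ_le_const2[OF compl_dist[OF u(1) const_cauchy[OF cauchy_carrier[OF u(1)]], of M, folded u(3)]])
         (use M in \<open>auto intro!: exI[of _ M] less_imp_le\<close>)
    then show "\<exists>s\<in>S. sa_dist (completion T) c (cauchy_class T (\<lambda>_. s)) < \<epsilon>"
      using u(2) e by (intro bexI[of _ "u M"]) auto
  qed
next
  assume a: "\<forall>\<epsilon>>0. \<exists>s\<in>S. sa_dist (completion T) c (cauchy_class T (\<lambda>_. s)) < \<epsilon>"
  obtain v where v: "v \<in> cauchy_seqs T" "c = cauchy_class T v" using c by (auto simp: compl_carrier)
  have "\<exists>u. \<forall>k. u k \<in> S \<and> sa_dist (completion T) c (cauchy_class T (\<lambda>_. u k)) < inverse (real (Suc k))"
    using a by (intro choice) (auto simp: Bex_def)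
  then obtain u where u: "\<And>k. u k \<in> S" "\<And>k. sa_dist (completion T) c (cauchy_class T (\<lambda>_. u k)) < inverse (real (Suc k))"
    by blast
  have uc: "u k \<in> sa_carrier T" for k using u S by auto
  \<comment> \<open>The distance to the constant class of \<open>u k\<close> is a limit of distances
    to \<open>u k\<close>; so \<open>v\<close> stays close to \<open>u k\<close> from some index on,
    which depends on \<open>k\<close>.\<close>
  have ev: "\<exists>N. \<forall>n\<ge>N. sa_dist T (v n) (u k) < inverse (real (Suc k))" for k
    using order_tendstoD(2)[OF compl_dist[OF v(1) const_cauchy[OF uc[of k]]], of "inverse (real (Suc k))"] u(2)[of k] v(2)
    by (auto simp: eventually_sequentially)
  have vc: "v k \<in> sa_carrier T" for k using v(1) by (rule cauchy_carrier)
  have small: "\<exists>M. \<forall>k\<ge>M. \<forall>n\<ge>M. sa_dist T (u k) (v n) < \<epsilon>" if e: "\<epsilon> > 0" for \<epsilon>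
  proof -
    obtain M1 where M1: "inverse (real (Suc M1)) < \<epsilon>/2" using reals_Archimedean[of "\<epsilon>/2"] e by auto
    obtain M2 where M2: "\<forall>m\<ge>M2. \<forall>n\<ge>M2. sa_dist T (v m) (v n) < \<epsilon>/2" using cauchyD[OF v(1), of "\<epsilon>/2"] e by auto
    have "sa_dist T (u k) (v n) < \<epsilon>" if kn: "k \<ge> max M1 M2" "n \<ge> max M1 M2" for k n
    proof -
      obtain N where N: "\<forall>n\<ge>N. sa_dist T (v n) (u k) < inverse (real (Suc k))" using ev by blast
      \<comment> \<open>An auxiliary index beyond the threshold belonging to \<open>k\<close>. It
        does not occur in the resulting bound, which is therefore uniform in \<open>k\<close> and
        \<open>n\<close>.\<close>
      let ?m = "max N M2"
      have "sa_dist T (u k) (v n) \<le> sa_dist T (v ?m) (u k) + sa_dist T (v ?m) (v n)"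
        using dist_triangle[of "u k" "v ?m" "v n"] dist_commute[of "u k" "v ?m"] uc vc by auto
      moreover have "sa_dist T (v ?m) (u k) < inverse (real (Suc k))" using N by auto
      moreover have "inverse (real (Suc k)) \<le> inverse (real (Suc M1))" using kn by (intro le_imp_inverse_le) auto
      moreover have "sa_dist T (v ?m) (v n) < \<epsilon>/2" using M2 kn by auto
      ultimately show ?thesis using M1 by linarith
    qed
    then show ?thesis by blast
  qed
  have ucs: "u \<in> cauchy_seqs T"
  proof (rule cauchy_seqsI[OF uc])
    fix \<epsilon> :: real assume e: "\<epsilon> > 0"
    obtain M where M: "\<forall>k\<ge>M. \<forall>n\<ge>M. sa_dist T (u k) (v n) < \<epsilon>/2" using small[of "\<epsilon>/2"] e by auto
    have "sa_dist T (u k) (u n) < \<epsilon>" if "k \<ge> M" "n \<ge> M" for k n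
      using dist_triangle[of "u k" "v M" "u n"] dist_commute[of "v M" "u n"] uc vc M that
      by (smt (verit) field_sum_of_halves order_refl)
    then show "\<exists>M. \<forall>m\<ge>M. \<forall>n\<ge>M. sa_dist T (u m) (u n) < \<epsilon>" by blast
  qed
  have "(\<lambda>n. sa_dist T (v n) (u n)) \<longlonglongrightarrow> 0"
  proof (rule LIMSEQ_I)
    fix r :: real assume "r > 0"
    then obtain M where M: "\<forall>k\<ge>M. \<forall>n\<ge>M. sa_dist T (u k) (v n) < r" using small by blast
    then show "\<exists>no. \<forall>n\<ge>no. norm (sa_dist T (v n) (u n) - 0) < r"
      using dist_commute[OF vc uc] dist_nonneg[OF vc uc] by auto
  qed
  then have "c = cauchy_class T u" using class_eq_iff[OF v(1) ucs] v(2) by simp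
  then show "\<exists>u\<in>cauchy_seqs T. range u \<subseteq> S \<and> c = cauchy_class T u"
    using ucs u(1) by (intro bexI[of _ u]) auto
qed

end

section \<open>Isometric embeddings and the completions they identify\<close>

locale star_embedding = normed_star T for T :: "'y star_alg" +
  fixes S :: "'x star_alg" and F :: "'x \<Rightarrow> 'y"
  assumes S_add: "a \<in> sa_carrier S \<Longrightarrow> b \<in> sa_carrier S \<Longrightarrow> sa_add S a b \<in> sa_carrier S"
    and S_mult: "a \<in> sa_carrier S \<Longrightarrow> b \<in> sa_carrier S \<Longrightarrow> sa_mult S a b \<in> sa_carrier S"
    and S_scale: "a \<in> sa_carrier S \<Longrightarrow> sa_scale S z a \<in> sa_carrier S"
    and S_star: "a \<in> sa_carrier S \<Longrightarrow> sa_star S a \<in> sa_carrier S"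
    and F_in: "a \<in> sa_carrier S \<Longrightarrow> F a \<in> sa_carrier T"
    and F_add: "a \<in> sa_carrier S \<Longrightarrow> b \<in> sa_carrier S \<Longrightarrow> F (sa_add S a b) = sa_add T (F a) (F b)"
    and F_mult: "a \<in> sa_carrier S \<Longrightarrow> b \<in> sa_carrier S \<Longrightarrow> F (sa_mult S a b) = sa_mult T (F a) (F b)"
    and F_scale: "a \<in> sa_carrier S \<Longrightarrow> F (sa_scale S z a) = sa_scale T z (F a)"
    and F_star: "a \<in> sa_carrier S \<Longrightarrow> F (sa_star S a) = sa_star T (F a)"
    and F_norm: "a \<in> sa_carrier S \<Longrightarrow> sa_norm S a = sa_norm T (F a)"
begin

lemma F_dist: "a \<in> sa_carrier S \<Longrightarrow> b \<in> sa_carrier S \<Longrightarrow> sa_dist S a b = sa_dist T (F a) (F b)"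
  by (simp add: sa_dist_def F_norm F_add F_scale S_add S_scale)

text \<open>Each estimate for \<open>S\<close> is the estimate for \<open>T\<close> at the images
  under \<open>F\<close>, since \<open>F\<close> respects operations and norms.\<close>

sublocale dom: normed_star S
proof
  show "\<And>a b. a \<in> sa_carrier S \<Longrightarrow> b \<in> sa_carrier S \<Longrightarrow> sa_dist S a b = sa_dist S b a"
    using F_dist dist_commute F_in by metis
qed (simp_all add: F_dist F_norm F_in F_add F_mult F_scale F_star S_add S_mult S_scale S_star
  norm_nonneg norm_diff dist_self dist_triangle dist_add dist_mult dist_scale dist_star)

lemma F_cauchy: "u \<in> cauchy_seqs S \<Longrightarrow> (\<lambda>n. F (u n)) \<in> cauchy_seqs T"
  unfolding cauchy_seqs_def using F_dist[of "u m" "u n" for m n] F_in by auto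

lemma F_class_eq:
  assumes "u \<in> cauchy_seqs S" "v \<in> cauchy_seqs S"
  shows "cauchy_class S u = cauchy_class S v \<longleftrightarrow> cauchy_class T (\<lambda>n. F (u n)) = cauchy_class T (\<lambda>n. F (v n))"
  using assms by (simp add: dom.class_eq_iff class_eq_iff F_cauchy F_dist dom.cauchy_carrier)

text \<open>An isometry is injective on Cauchy classes. By density each Cauchy sequence of
  \<open>T\<close> is shadowed by images of elements of \<open>S\<close> up to a null sequence, and
  these elements form a Cauchy sequence because \<open>F\<close> preserves distances.\<close>

lemma completion_iso:
  assumes dense: "\<And>t \<epsilon>. t \<in> sa_carrier T \<Longrightarrow> \<epsilon> > 0 \<Longrightarrow> \<exists>s\<in>sa_carrier S. sa_dist T (F s) t < \<epsilon>"
  shows "star_isomorphic (completion S) (completion T)"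
proof -
  \<comment> \<open>A union over representatives, all of which contribute the same class by
    \<open>F_class_eq\<close>.\<close>
  define J where "J U = (\<Union>u\<in>U. cauchy_class T (\<lambda>n. F (u n)))" for U
  have J: "J (cauchy_class S u) = cauchy_class T (\<lambda>n. F (u n))" if "u \<in> cauchy_seqs S" for u
    unfolding J_def using dom.class_self[OF that] dom.class_in_iff[OF that] F_class_eq that by blast
  have inj: "inj_on J (sa_carrier (completion S))"
    by (auto simp: inj_on_def dom.compl_carrier J F_class_eq)
  have surj: "\<exists>U\<in>sa_carrier (completion S). J U = cauchy_class T v" if v: "v \<in> cauchy_seqs T" for v
  proof -
    have "\<exists>u. \<forall>n. u n \<in> sa_carrier S \<and> sa_dist T (F (u n)) (v n) < inverse (real (Suc n))"
      using dense[OF cauchy_carrier[OF v]] by (intro choice) (auto simp: Bex_def)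
    then obtain u where u: "\<And>n. u n \<in> sa_carrier S" "\<And>n. sa_dist T (F (u n)) (v n) < inverse (real (Suc n))" by blast
    have vc: "v n \<in> sa_carrier T" for n using cauchy_carrier[OF v] .
    have uc: "F (u n) \<in> sa_carrier T" for n using u F_in by auto
    have lim: "(\<lambda>n. sa_dist T (F (u n)) (v n)) \<longlonglongrightarrow> 0"
      by (rule tendsto_sandwich[OF _ _ tendsto_const LIMSEQ_inverse_real_of_nat])
         (use u(2) dist_nonneg[OF uc vc] in \<open>auto intro!: always_eventually less_imp_le simp del: of_nat_Suc\<close>)
    have "u \<in> cauchy_seqs S"
    proof (rule dom.cauchy_seqsI[OF u(1)])
      fix \<epsilon> :: real assume e: "\<epsilon> > 0"
      obtain M where M: "\<forall>m\<ge>M. \<forall>n\<ge>M. sa_dist T (v m) (v n) < \<epsilon>/3" using cauchyD[OF v, of "\<epsilon>/3"] e by auto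
      obtain N where N: "\<forall>n\<ge>N. sa_dist T (F (u n)) (v n) < \<epsilon>/3"
        using order_tendstoD(2)[OF lim, of "\<epsilon>/3"] e by (auto simp: eventually_sequentially)
      have "sa_dist S (u m) (u n) < \<epsilon>" if mn: "m \<ge> max M N" "n \<ge> max M N" for m n
      proof -
        have "sa_dist T (F (u m)) (F (u n)) \<le> sa_dist T (F (u m)) (v m) + sa_dist T (v m) (v n) + sa_dist T (F (u n)) (v n)"
          using dist_triangle[of "F (u m)" "v m" "F (u n)"] dist_triangle[of "v m" "v n" "F (u n)"] uc vc
            dist_commute[of "v n" "F (u n)"] by force
        moreover have "sa_dist T (F (u m)) (v m) < \<epsilon>/3" "sa_dist T (v m) (v n) < \<epsilon>/3" "sa_dist T (F (u n)) (v n) < \<epsilon>/3"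
          using M N mn by auto
        ultimately show ?thesis unfolding F_dist[OF u(1) u(1)] by linarith
      qed
      then show "\<exists>M. \<forall>m\<ge>M. \<forall>n\<ge>M. sa_dist S (u m) (u n) < \<epsilon>" by blast
    qed
    then show ?thesis
      using J class_eq_iff[OF F_cauchy v] lim by (auto simp: dom.compl_carrier)
  qed
  have im: "J ` sa_carrier (completion S) = sa_carrier (completion T)"
  proof
    show "J ` sa_carrier (completion S) \<subseteq> sa_carrier (completion T)"
    proof
      fix V assume "V \<in> J ` sa_carrier (completion S)"
      then obtain u where u: "u \<in> cauchy_seqs S" "V = J (cauchy_class S u)"
        unfolding dom.compl_carrier by blast
      show "V \<in> sa_carrier (completion T)"
        unfolding u(2) J[OF u(1)] compl_carrier using F_cauchy[OF u(1)] by (rule imageI)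
    qed
    show "sa_carrier (completion T) \<subseteq> J ` sa_carrier (completion S)"
    proof
      fix V assume "V \<in> sa_carrier (completion T)"
      then obtain v where "v \<in> cauchy_seqs T" "V = cauchy_class T v" unfolding compl_carrier by blast
      then show "V \<in> J ` sa_carrier (completion S)" using surj[of v] by blast
    qed
  qed
  have nrm: "sa_norm (completion T) (J U) = sa_norm (completion S) U" if Uc: "U \<in> sa_carrier (completion S)" for U
  proof -
    obtain u where u: "u \<in> cauchy_seqs S" "U = cauchy_class S u" using Uc unfolding dom.compl_carrier by blast
    show ?thesis
      using LIMSEQ_unique[OF compl_norm[OF F_cauchy[OF u(1)]], of "sa_norm (completion S) U"] dom.compl_norm[OF u(1)] u
      by (simp add: J F_norm dom.cauchy_carrier)
  qed
  have car: "U \<in> sa_carrier (completion S) \<Longrightarrow> \<exists>u\<in>cauchy_seqs S. U = cauchy_class S u" for U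
    unfolding dom.compl_carrier by blast
  show ?thesis
    unfolding star_isomorphic_def
  proof (intro exI[of _ J] conjI ballI allI)
    show "bij_betw J (sa_carrier (completion S)) (sa_carrier (completion T))"
      using inj im by (simp add: bij_betw_def)
    fix U assume "U \<in> sa_carrier (completion S)"
    then obtain u where u: "u \<in> cauchy_seqs S" and U: "U = cauchy_class S u" by (elim bexE[OF car])
    show "sa_norm (completion T) (J U) = sa_norm (completion S) U" using nrm \<open>U \<in> _\<close> .
    show "J (sa_scale (completion S) z U) = sa_scale (completion T) z (J U)" for z
      using u by (simp add: U dom.compl_scale compl_scale J dom.cauchy_scale F_cauchy F_scale dom.cauchy_carrier)
    show "J (sa_star (completion S) U) = sa_star (completion T) (J U)"
      using u by (simp add: U dom.compl_star compl_star J dom.cauchy_star F_cauchy F_star dom.cauchy_carrier)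
    fix V assume "V \<in> sa_carrier (completion S)"
    then obtain v where v: "v \<in> cauchy_seqs S" and V: "V = cauchy_class S v" by (elim bexE[OF car])
    show "J (sa_add (completion S) U V) = sa_add (completion T) (J U) (J V)"
      using u v by (simp add: U V dom.compl_add compl_add J dom.cauchy_add F_cauchy F_add dom.cauchy_carrier)
    show "J (sa_mult (completion S) U V) = sa_mult (completion T) (J U) (J V)"
      using u v by (simp add: U V dom.compl_mult compl_mult J dom.cauchy_mult F_cauchy F_mult dom.cauchy_carrier)
  qed
qed

end

subsection \<open>Block diagonal matrices and positions\<close>

text \<open>The first row of the block belonging to \<open>b\<close> when blocks of sizes
  \<open>w\<close> are listed along the diagonal in the order \<open>bs\<close>; this frees
  \<open>block_offset\<close> from the data of an AH-system.\<close>

definition off :: "('b \<Rightarrow> nat) \<Rightarrow> 'b list \<Rightarrow> 'b \<Rightarrow> nat" where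
  "off w bs b = sum_list (map w (takeWhile (\<lambda>b'. b' \<noteq> b) bs))"

lemma off_Cons: "off w (c # bs) b = (if b = c then 0 else w c + off w bs b)"
  by (auto simp: off_def)

lemma off_less: "b \<in> set bs \<Longrightarrow> r < w b \<Longrightarrow> off w bs b + r < sum_list (map w bs)"
  by (induction bs) (auto simp: off_Cons)

text \<open>With \<open>off_less\<close> and \<open>off_surj\<close> this says that each row of a
  block diagonal matrix is in exactly one way the start of a block plus a row inside that block. It
  is the inductive step behind the bijection between paths and matrix positions.\<close>

lemma off_inj:
  assumes "b \<in> set bs" "b' \<in> set bs" "r < w b" "r' < w b'" "off w bs b + r = off w bs b' + r'"
  shows "b = b' \<and> r = r'"
  using assms by (induction bs) (auto simp: off_Cons split: if_splits)

lemma off_surj: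
  assumes "k < sum_list (map w bs)" "distinct bs"
  shows "\<exists>b\<in>set bs. \<exists>r<w b. k = off w bs b + r"
  using assms
proof (induction bs arbitrary: k)
  case (Cons c bs)
  show ?case
  proof (cases "k < w c")
    case True
    then show ?thesis by (auto simp: off_Cons)
  next
    case False
    then have "k - w c < sum_list (map w bs)" using Cons.prems by auto
    then obtain b r where b: "b \<in> set bs" "r < w b" "k - w c = off w bs b + r"
      using Cons.IH[of "k - w c"] Cons.prems by auto
    then have "k = off w (c # bs) b + r" using False Cons.prems by (auto simp: off_Cons)
    then show ?thesis using b by auto
  qed
qed simp

lemma diag_block_mat_dims:
  assumes "\<And>b. b \<in> set bs \<Longrightarrow> M b \<in> carrier_mat (w b) (w b)"
  shows "diag_block_mat (map M bs) \<in> carrier_mat (sum_list (map w bs)) (sum_list (map w bs))"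
proof -
  have "map (dim_row \<circ> M) bs = map w bs" "map (dim_col \<circ> M) bs = map w bs" using assms by auto
  then show ?thesis by (auto simp: dim_diag_block_mat simp del: map_eq_conv)
qed

lemma diag_block_mat_index:
  assumes "\<And>b. b \<in> set bs \<Longrightarrow> M b \<in> carrier_mat (w b) (w b)" "b \<in> set bs" "b' \<in> set bs" "r < w b" "r' < w b'"
  shows "diag_block_mat (map M bs) $$ (off w bs b + r, off w bs b' + r') = (if b = b' then M b $$ (r, r') else 0)"
  using assms
proof (induction bs)
  case (Cons c bs)
  have dims: "diag_block_mat (map M bs) \<in> carrier_mat (sum_list (map w bs)) (sum_list (map w bs))"
    using Cons.prems(1) by (intro diag_block_mat_dims) auto
  have c: "dim_row (M c) = w c" "dim_col (M c) = w c" using Cons.prems(1)[of c] by auto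
  have d: "dim_row (diag_block_mat (map M bs)) = sum_list (map w bs)" "dim_col (diag_block_mat (map M bs)) = sum_list (map w bs)"
    using dims by auto
  have l: "b \<noteq> c \<Longrightarrow> off w bs b + r < sum_list (map w bs)" "b' \<noteq> c \<Longrightarrow> off w bs b' + r' < sum_list (map w bs)"
    using Cons.prems by (auto intro: off_less)
  show ?case
  proof (cases "b = c"; cases "b' = c")
    assume "b \<noteq> c" "b' \<noteq> c"
    then have "diag_block_mat (map M bs) $$ (off w bs b + r, off w bs b' + r') = (if b = b' then M b $$ (r, r') else 0)"
      using Cons.IH Cons.prems by auto
    then show ?thesis using \<open>b \<noteq> c\<close> \<open>b' \<noteq> c\<close> l d c by (auto simp: off_Cons Let_def)
  qed (use l d c Cons.prems(2-) in \<open>auto simp: off_Cons Let_def\<close>)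
qed simp

section \<open>Matrix sizes, positions of finite paths, and surjectivity of the
  eigenfunctions\<close>

locale AH =
  fixes D :: "('a, 'e) ah_data"
  assumes sys: "diagonal_AH_system D"
begin

lemma num_pos: "n \<ge> 1 \<Longrightarrow> num D n \<ge> 1"
  and siz_pos: "n \<ge> 1 \<Longrightarrow> i < num D n \<Longrightarrow> siz D n i \<ge> 1"
  and space_ne: "n \<ge> 1 \<Longrightarrow> i < num D n \<Longrightarrow> topspace (spc D n i) \<noteq> {}"
  and space_compact: "n \<ge> 1 \<Longrightarrow> i < num D n \<Longrightarrow> compact_space (spc D n i)"
  and space_Hausdorff: "n \<ge> 1 \<Longrightarrow> i < num D n \<Longrightarrow> Hausdorff_space (spc D n i)"
  and finite_edg: "n \<ge> 1 \<Longrightarrow> i < num D n \<Longrightarrow> j < num D (Suc n) \<Longrightarrow> finite (edg D n i j)"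
  and egn_continuous: "n \<ge> 1 \<Longrightarrow> i < num D n \<Longrightarrow> j < num D (Suc n) \<Longrightarrow> e \<in> edg D n i j \<Longrightarrow>
     continuous_map (spc D (Suc n) j) (spc D n i) (egn D n i j e)"
  and ord_distinct: "n \<ge> 1 \<Longrightarrow> j < num D (Suc n) \<Longrightarrow> distinct (ord D n j)"
  and ord_set: "n \<ge> 1 \<Longrightarrow> j < num D (Suc n) \<Longrightarrow> set (ord D n j) = {(i, e). i < num D n \<and> e \<in> edg D n i j}"
  and conn_in: "n \<ge> 1 \<Longrightarrow> f \<in> A_carrier D n \<Longrightarrow> conn D n f \<in> A_carrier D (Suc n)"
  and conn_one: "n \<ge> 1 \<Longrightarrow> conn D n (A_one D n) = A_one D (Suc n)"
  and conn_inj: "n \<ge> 1 \<Longrightarrow> inj_on (conn D n) (A_carrier D n)"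
  using sys unfolding diagonal_AH_system_def by blast+

lemma egn_in: "n \<ge> 1 \<Longrightarrow> i < num D n \<Longrightarrow> j < num D (Suc n) \<Longrightarrow> e \<in> edg D n i j \<Longrightarrow>
    t \<in> topspace (spc D (Suc n) j) \<Longrightarrow> egn D n i j e t \<in> topspace (spc D n i)"
  using continuous_map_image_subset_topspace[OF egn_continuous] by blast

lemma A_carrierI:
  assumes "\<And>i. i < num D n \<Longrightarrow> f i \<in> extensional (topspace (spc D n i))"
    "\<And>i x. i < num D n \<Longrightarrow> x \<in> topspace (spc D n i) \<Longrightarrow> f i x \<in> carrier_mat (siz D n i) (siz D n i)"
    "\<And>i a b. i < num D n \<Longrightarrow> a < siz D n i \<Longrightarrow> b < siz D n i \<Longrightarrow> continuous_map (spc D n i) euclidean (\<lambda>x. f i x $$ (a, b))"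
    "f \<in> extensional {..<num D n}"
  shows "f \<in> A_carrier D n"
  using assms unfolding A_carrier_def by (auto simp: PiE_iff)

lemma A_carrierD:
  assumes "f \<in> A_carrier D n"
  shows "i < num D n \<Longrightarrow> x \<in> topspace (spc D n i) \<Longrightarrow> f i x \<in> carrier_mat (siz D n i) (siz D n i)"
    "i < num D n \<Longrightarrow> a < siz D n i \<Longrightarrow> b < siz D n i \<Longrightarrow> continuous_map (spc D n i) euclidean (\<lambda>x. f i x $$ (a, b))"
    "f \<in> extensional {..<num D n}" "i < num D n \<Longrightarrow> f i \<in> extensional (topspace (spc D n i))"
  using assms unfolding A_carrier_def by (auto simp: PiE_iff)

lemma A_carrier_eqI:
  assumes "f \<in> A_carrier D n" "g \<in> A_carrier D n"
    "\<And>i x a b. i < num D n \<Longrightarrow> x \<in> topspace (spc D n i) \<Longrightarrow> a < siz D n i \<Longrightarrow> b < siz D n i \<Longrightarrow>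
      f i x $$ (a, b) = g i x $$ (a, b)"
  shows "f = g"
proof (rule extensionalityI[OF A_carrierD(3)[OF assms(1)] A_carrierD(3)[OF assms(2)]])
  fix i assume "i \<in> {..<num D n}"
  then have i: "i < num D n" by simp
  show "f i = g i"
  proof (rule extensionalityI[OF A_carrierD(4)[OF assms(1) i] A_carrierD(4)[OF assms(2) i]])
    fix x assume x: "x \<in> topspace (spc D n i)"
    show "f i x = g i x"
      using A_carrierD(1)[OF assms(1) i x] A_carrierD(1)[OF assms(2) i x] assms(3)[OF i x]
      by (intro eq_matI) auto
  qed
qed

lemma fibrewise_apply [simp]: "i < num D n \<Longrightarrow> x \<in> topspace (spc D n i) \<Longrightarrow> fibrewise D n F i x = F i x"
  by (simp add: fibrewise_def)

lemma fibrewise_carrier: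
  assumes "\<And>i x. i < num D n \<Longrightarrow> x \<in> topspace (spc D n i) \<Longrightarrow> F i x \<in> carrier_mat (siz D n i) (siz D n i)"
    "\<And>i a b. i < num D n \<Longrightarrow> a < siz D n i \<Longrightarrow> b < siz D n i \<Longrightarrow> continuous_map (spc D n i) euclidean (\<lambda>x. F i x $$ (a, b))"
  shows "fibrewise D n F \<in> A_carrier D n"
proof (rule A_carrierI)
  fix i a b assume i: "i < num D n" "a < siz D n i" "b < siz D n i"
  show "continuous_map (spc D n i) euclidean (\<lambda>x. fibrewise D n F i x $$ (a, b))"
    by (rule continuous_map_eq[OF assms(2)[OF i]]) (use i in auto)
qed (use assms in \<open>auto simp: fibrewise_def\<close>)

lemma A_one_in: "A_one D n \<in> A_carrier D n"
  unfolding A_one_def by (rule fibrewise_carrier) auto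

definition wt :: "nat \<Rightarrow> nat \<times> 'e \<Rightarrow> nat" where
  "wt n = (\<lambda>(i, e). siz D n i)"

lemma wt_apply [simp]: "wt n (i, e) = siz D n i"
  by (simp add: wt_def)

lemma block_offset_off: "block_offset D n j b = off (wt n) (ord D n j) b"
  by (simp add: block_offset_def off_def wt_def)

lemma conn_apply:
  assumes "j < num D (Suc n)" "t \<in> topspace (spc D (Suc n) j)"
  shows "conn D n f j t = diag_block_mat (map (\<lambda>(i, e). f i (egn D n i j e t)) (ord D n j))"
  using assms by (simp add: conn_def)

lemma conn_blocks:
  assumes "n \<ge> 1" "f \<in> A_carrier D n" "j < num D (Suc n)" "t \<in> topspace (spc D (Suc n) j)" "b \<in> set (ord D n j)"
  shows "(\<lambda>(i, e). f i (egn D n i j e t)) b \<in> carrier_mat (wt n b) (wt n b)"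
  using assms egn_in[OF assms(1) _ assms(3)] ord_set[OF assms(1,3)] by (auto simp: wt_def intro!: A_carrierD(1)[OF assms(2)])

text \<open>Unitality of the connecting map fixes the sizes: the image of the unit is block diagonal
  of the summed size and at the same time an identity matrix of size \<open>siz\<close>.\<close>

lemma siz_sum:
  assumes "n \<ge> 1" "j < num D (Suc n)"
  shows "siz D (Suc n) j = sum_list (map (wt n) (ord D n j))"
proof -
  \<comment> \<open>The dimensions are read off at a point, hence the appeal to nonempty
    spaces.\<close>
  obtain t where t: "t \<in> topspace (spc D (Suc n) j)" using space_ne assms by fastforce
  have "conn D n (A_one D n) j t \<in> carrier_mat (sum_list (map (wt n) (ord D n j))) (sum_list (map (wt n) (ord D n j)))"
    unfolding conn_apply[OF assms(2) t] by (rule diag_block_mat_dims[OF conn_blocks[OF assms(1) A_one_in assms(2) t]])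
  moreover have "conn D n (A_one D n) j t = 1\<^sub>m (siz D (Suc n) j)"
    using conn_one[OF assms(1)] t assms(2) by (simp add: A_one_def)
  ultimately show ?thesis by auto
qed

text \<open>An entry of the image survives only if row and column lie in the block of one and the
  same edge. This is the algebraic counterpart of two paths agreeing one edge earlier.\<close>

lemma conn_entry:
  assumes "n \<ge> 1" "f \<in> A_carrier D n" "j < num D (Suc n)" "t \<in> topspace (spc D (Suc n) j)"
    "i < num D n" "e \<in> edg D n i j" "i' < num D n" "e' \<in> edg D n i' j" "r < siz D n i" "r' < siz D n i'"
  shows "conn D n f j t $$ (block_offset D n j (i, e) + r, block_offset D n j (i', e') + r') =
    (if i = i' \<and> e = e' then f i (egn D n i j e t) $$ (r, r') else 0)"
  unfolding conn_apply[OF assms(3,4)] block_offset_off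
  using diag_block_mat_index[where w = "wt n" and bs = "ord D n j" and b = "(i, e)" and b' = "(i', e')" and r = r and r' = r', OF conn_blocks[OF assms(1-4)]] assms ord_set[OF assms(1,3)]
  by auto

lemma fin_paths_single: "[b] \<in> fin_paths D \<longleftrightarrow> b \<in> bedges D 0"
  by (auto simp: fin_paths_def)

lemma fin_paths_snoc:
  assumes "p \<noteq> []"
  shows "p @ [b] \<in> fin_paths D \<longleftrightarrow> p \<in> fin_paths D \<and> b \<in> bedges D (length p) \<and> bsrc b = btgt (last p)"
proof -
  have A: "(\<forall>m<length (p @ [b]). (p @ [b]) ! m \<in> bedges D m) \<longleftrightarrow> (\<forall>m<length p. p ! m \<in> bedges D m) \<and> b \<in> bedges D (length p)"
    by (auto simp: nth_append less_Suc_eq)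
  have B: "(\<forall>m. Suc m < length (p @ [b]) \<longrightarrow> bsrc ((p @ [b]) ! Suc m) = btgt ((p @ [b]) ! m)) \<longleftrightarrow>
     (\<forall>m. Suc m < length p \<longrightarrow> bsrc (p ! Suc m) = btgt (p ! m)) \<and> bsrc b = btgt (last p)" (is "?L \<longleftrightarrow> ?R")
  proof
    assume L: ?L
    then have "bsrc b = btgt (last p)" using assms L[rule_format, of "length p - 1"]
      by (auto simp: nth_append last_conv_nth)
    moreover have "bsrc (p ! Suc m) = btgt (p ! m)" if "Suc m < length p" for m
      using L[rule_format, of m] that by (auto simp: nth_append)
    ultimately show ?R by blast
  next
    assume ?R
    show ?L
    proof (intro allI impI)
      fix m assume "Suc m < length (p @ [b])"
      then consider "Suc m < length p" | "length p = Suc m" by fastforce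
      then show "bsrc ((p @ [b]) ! Suc m) = btgt ((p @ [b]) ! m)"
        by cases (use \<open>?R\<close> assms in \<open>auto simp: nth_append last_conv_nth\<close>)
    qed
  qed
  show ?thesis unfolding fin_paths_def mem_Collect_eq A B using assms by auto
qed

lemma pos_single: "pos D [Root a j] = a"
  by (simp add: pos_def)

lemma pos_upto_append: "n \<le> length p \<Longrightarrow> pos_upto D (p @ q) n = pos_upto D p n"
  by (induction n) (auto simp: nth_append split: bedge.splits)

lemma pos_snoc: "pos D (p @ [Edge i e j]) = block_offset D (length p) j (i, e) + pos D p"
  by (simp add: pos_def pos_upto_append)

definition paths_to :: "nat \<Rightarrow> nat \<Rightarrow> 'e bedge list set" where
  "paths_to n i = {p \<in> fin_paths D. length p = n \<and> btgt (last p) = i}"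

lemma bedges_0: "b \<in> bedges D 0 \<longleftrightarrow> (\<exists>a j. b = Root a j \<and> j < num D 1 \<and> a < siz D 1 j)"
  by (auto simp: bedges_def)

lemma bedges_pos: "n \<ge> 1 \<Longrightarrow> b \<in> bedges D n \<longleftrightarrow> (\<exists>i e j. b = Edge i e j \<and> i < num D n \<and> j < num D (Suc n) \<and> e \<in> edg D n i j)"
  by (auto simp: bedges_def)

lemma btgt_less: "b \<in> bedges D n \<Longrightarrow> btgt b < num D (Suc n)"
  by (auto simp: bedges_def split: if_splits)

lemma bsrc_less: "b \<in> bedges D n \<Longrightarrow> n \<ge> 1 \<Longrightarrow> bsrc b < num D n"
  by (auto simp: bedges_def split: if_splits)

lemma finite_bedges: "finite (bedges D n)"
proof (cases "n = 0")
  case True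
  have "bedges D n \<subseteq> (\<Union>j\<in>{..<num D 1}. \<Union>a\<in>{..<siz D 1 j}. {Root a j})" using True by (auto simp: bedges_def)
  then show ?thesis by (rule finite_subset) auto
next
  case False
  have "bedges D n \<subseteq> (\<Union>i\<in>{..<num D n}. \<Union>j\<in>{..<num D (Suc n)}. (\<lambda>e. Edge i e j) ` edg D n i j)"
    using False by (auto simp: bedges_def)
  then show ?thesis by (rule finite_subset) (use False finite_edg in auto)
qed

lemma fin_path_cases:
  assumes "p \<in> fin_paths D" "length p = Suc n"
  obtains (single) b where "p = [b]" "b \<in> bedges D 0" "n = 0"
    | (snoc) q b where "p = q @ [b]" "q \<in> fin_paths D" "length q = n" "n \<ge> 1" "b \<in> bedges D n" "bsrc b = btgt (last q)"
proof (cases p rule: rev_cases)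
  case Nil
  then show ?thesis using assms by simp
next
  case (snoc q b)
  show ?thesis
  proof (cases "q = []")
    case True
    then show ?thesis using that(1)[of b] snoc assms fin_paths_single by auto
  next
    case False
    then have "length q \<ge> 1" by (cases q) auto
    then show ?thesis using that(2)[of q b] snoc assms fin_paths_snoc[OF False, of b] by auto
  qed
qed

lemma paths_to_Suc:
  assumes "p \<in> paths_to (Suc n) j" "n \<ge> 1"
  obtains q i e where "p = q @ [Edge i e j]" "q \<in> paths_to n i" "i < num D n" "e \<in> edg D n i j"
proof -
  have p: "p \<in> fin_paths D" "length p = Suc n" "btgt (last p) = j" using assms by (auto simp: paths_to_def)
  from p(1,2) show thesis
  proof (cases rule: fin_path_cases)
    case (snoc q b)
    then obtain i e j' where b: "b = Edge i e j'" "i < num D n" "e \<in> edg D n i j'" using bedges_pos by auto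
    show thesis by (rule that[of q i e]) (use snoc b p(3) in \<open>auto simp: paths_to_def\<close>)
  qed (use assms in auto)
qed

text \<open>The last edge of a path picks a block and the remaining path a row in it, so the claim
  propagates by \<open>off_inj\<close> and \<open>off_surj\<close>; that the blocks fill the whole
  matrix is \<open>siz_sum\<close>. Levels are written as \<open>Suc n\<close> because finite paths
  are nonempty.\<close>

lemma pos_bij:
  assumes "j < num D (Suc n)"
  shows "bij_betw (pos D) (paths_to (Suc n) j) {..<siz D (Suc n) j}"
  using assms
proof (induction n arbitrary: j)
  case 0
  have "paths_to 1 j = (\<lambda>a. [Root a j]) ` {..<siz D 1 j}"
  proof (intro equalityI subsetI)
    fix p assume "p \<in> paths_to 1 j"
    then have p: "p \<in> fin_paths D" "length p = Suc 0" "btgt (last p) = j" by (auto simp: paths_to_def)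
    from p(1,2) show "p \<in> (\<lambda>a. [Root a j]) ` {..<siz D 1 j}"
      by (cases rule: fin_path_cases) (use p(3) in \<open>auto simp: bedges_0\<close>)
  qed (use 0 in \<open>auto simp: paths_to_def fin_paths_single bedges_0\<close>)
  then show ?case
    by (auto simp: bij_betw_def inj_on_def pos_single image_image)
next
  case (Suc n)
  let ?n = "Suc n"
  have inj: "inj_on (pos D) (paths_to (Suc ?n) j)"
  proof (rule inj_onI)
    fix p p' assume p: "p \<in> paths_to (Suc ?n) j" and p': "p' \<in> paths_to (Suc ?n) j" and eq: "pos D p = pos D p'"
    obtain q i e where q: "p = q @ [Edge i e j]" "q \<in> paths_to ?n i" "i < num D ?n" "e \<in> edg D ?n i j"
      by (rule paths_to_Suc[OF p]) auto
    obtain q' i' e' where q': "p' = q' @ [Edge i' e' j]" "q' \<in> paths_to ?n i'" "i' < num D ?n" "e' \<in> edg D ?n i' j"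
      by (rule paths_to_Suc[OF p']) auto
    have l: "length q = ?n" "length q' = ?n" using q q' by (auto simp: paths_to_def)
    have r: "pos D q < siz D ?n i" "pos D q' < siz D ?n i'"
      using Suc.IH[OF q(3)] Suc.IH[OF q'(3)] q(2) q'(2) by (auto simp: bij_betw_def)
    have "(i, e) = (i', e') \<and> pos D q = pos D q'"
      by (rule off_inj[of _ "ord D ?n j" _ _ "wt ?n"])
         (use eq q q' l r ord_set[of ?n j] Suc.prems in \<open>auto simp: pos_snoc block_offset_off wt_def\<close>)
    then show "p = p'" using Suc.IH[OF q(3)] q q' by (auto simp: bij_betw_def inj_on_def)
  qed
  have "pos D ` paths_to (Suc ?n) j = {..<siz D (Suc ?n) j}"
  proof (intro equalityI subsetI)
    fix k assume "k \<in> pos D ` paths_to (Suc ?n) j"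
    then obtain p where p: "p \<in> paths_to (Suc ?n) j" "k = pos D p" by blast
    obtain q i e where q: "p = q @ [Edge i e j]" "q \<in> paths_to ?n i" "i < num D ?n" "e \<in> edg D ?n i j"
      by (rule paths_to_Suc[OF p(1)]) auto
    have "pos D q < siz D ?n i" "length q = ?n" using Suc.IH[OF q(3)] q(2) by (auto simp: bij_betw_def paths_to_def)
    then show "k \<in> {..<siz D (Suc ?n) j}"
      using off_less[of "(i, e)" "ord D ?n j" "pos D q" "wt ?n"] ord_set[of ?n j] Suc.prems q siz_sum[of ?n j] p(2)
      by (auto simp: pos_snoc block_offset_off wt_def)
  next
    fix k assume "k \<in> {..<siz D (Suc ?n) j}"
    then have "k < sum_list (map (wt ?n) (ord D ?n j))" using siz_sum[of ?n j] Suc.prems by simp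
    then obtain b r where b: "b \<in> set (ord D ?n j)" "r < wt ?n b" "k = off (wt ?n) (ord D ?n j) b + r"
      using off_surj ord_distinct[of ?n j] Suc.prems by (metis le_add1 plus_1_eq_Suc)
    obtain i e where ie: "b = (i, e)" "i < num D ?n" "e \<in> edg D ?n i j" using b(1) ord_set[of ?n j] Suc.prems by auto
    have "r \<in> pos D ` paths_to ?n i" using Suc.IH[OF ie(2)] b(2) ie(1) by (auto simp: bij_betw_def wt_def)
    then obtain q where q: "q \<in> paths_to ?n i" "r = pos D q" by blast
    have qn: "q \<noteq> []" "length q = ?n" using q(1) by (auto simp: paths_to_def)
    have "q @ [Edge i e j] \<in> paths_to (Suc ?n) j"
      using q(1) qn ie Suc.prems fin_paths_snoc[OF qn(1), of "Edge i e j"] by (auto simp: paths_to_def bedges_pos)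
    moreover have "pos D (q @ [Edge i e j]) = k" using b(3) ie(1) q(2) qn by (simp add: pos_snoc block_offset_off)
    ultimately show "k \<in> pos D ` paths_to (Suc ?n) j" by blast
  qed
  then show ?case using inj by (simp add: bij_betw_def)
qed

lemma pos_bij_betw: "n \<ge> 1 \<Longrightarrow> j < num D n \<Longrightarrow> bij_betw (pos D) (paths_to n j) {..<siz D n j}"
  using pos_bij[of j "n - 1"] by simp

lemma fin_path_target:
  assumes "p \<in> fin_paths D"
  shows "length p \<ge> 1" "last p \<in> bedges D (length p - 1)" "btgt (last p) < num D (length p)"
proof -
  show l: "length p \<ge> 1" using assms by (cases p) (auto simp: fin_paths_def)
  show b: "last p \<in> bedges D (length p - 1)"
    using assms l by (auto simp: fin_paths_def last_conv_nth)
  show "btgt (last p) < num D (length p)" using btgt_less[OF b] l by (cases "length p") auto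
qed

lemma pos_less: "p \<in> fin_paths D \<Longrightarrow> pos D p < siz D (length p) (btgt (last p))"
  using bij_betwE[OF pos_bij_betw[OF fin_path_target(1,3)]] by (auto simp: paths_to_def)

lemma pos_inj:
  assumes "p \<in> fin_paths D" "q \<in> fin_paths D" "length p = length q" "btgt (last p) = btgt (last q)"
  shows "pos D p = pos D q \<longleftrightarrow> p = q"
  using inj_on_eq_iff[OF bij_betw_imp_inj_on[OF pos_bij_betw[OF fin_path_target(1,3)[OF assms(2)]]], of p q] assms
  by (auto simp: paths_to_def)

text \<open>Injectivity of the connecting map forces the eigenfunctions to be jointly surjective: a
  function vanishing on all their images would be annihilated.\<close>

lemma egn_surj:
  assumes n: "n \<ge> 1" and i: "i < num D n" and t: "t \<in> topspace (spc D n i)"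
  shows "\<exists>j e t'. j < num D (Suc n) \<and> e \<in> edg D n i j \<and> t' \<in> topspace (spc D (Suc n) j) \<and> egn D n i j e t' = t"
proof (rule ccontr)
  assume neg: "\<not> ?thesis"
  let ?X = "spc D n i"
  \<comment> \<open>A finite union of compact images in a Hausdorff space, hence closed; Urysohn's
    lemma then supplies a function that is 0 on it and 1 at \<open>t\<close>.\<close>
  define K where "K = (\<Union>j\<in>{..<num D (Suc n)}. \<Union>e\<in>edg D n i j. egn D n i j e ` topspace (spc D (Suc n) j))"
  have c: "closedin ?X (egn D n i j e ` topspace (spc D (Suc n) j))" if "j < num D (Suc n)" "e \<in> edg D n i j" for j e
  proof -
    have "compactin ?X (egn D n i j e ` topspace (spc D (Suc n) j))"
      using space_compact[of "Suc n" j] that egn_continuous[OF n i that]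
      by (auto intro: image_compactin simp: compact_space_def)
    then show ?thesis using compactin_imp_closedin space_Hausdorff[OF n i] by blast
  qed
  have "closedin ?X (\<Union>e\<in>edg D n i j. egn D n i j e ` topspace (spc D (Suc n) j))" if "j < num D (Suc n)" for j
    by (rule closedin_Union) (use c that finite_edg[OF n i] in auto)
  then have "closedin ?X K"
    unfolding K_def by (intro closedin_Union) auto
  moreover have "closedin ?X {t}" using t space_Hausdorff[OF n i] by (simp add: closedin_Hausdorff_singleton)
  moreover have "disjnt K {t}" using neg by (auto simp: K_def)
  moreover have "normal_space ?X"
    using compact_Hausdorff_or_regular_imp_normal_space space_Hausdorff[OF n i] space_compact[OF n i] by blast
  ultimately obtain g :: "'a \<Rightarrow> real" where g: "continuous_map ?X euclideanreal g" "g ` K \<subseteq> {0}" "g ` {t} \<subseteq> {1}"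
    using Urysohn_lemma_alt by metis
  define F where "F k x = (if k = i then complex_of_real (g x) else 0) \<cdot>\<^sub>m 1\<^sub>m (siz D n k)" for k x
  have F: "fibrewise D n F \<in> A_carrier D n"
  proof (rule fibrewise_carrier)
    fix k a b assume k: "k < num D n" "a < siz D n k" "b < siz D n k"
    have "continuous_map ?X euclidean (\<lambda>x. complex_of_real (g x))"
      using continuous_map_compose[OF g(1), of euclidean complex_of_real] by (simp add: comp_def continuous_intros)
    then show "continuous_map (spc D n k) euclidean (\<lambda>x. F k x $$ (a, b))"
      using k by (cases "k = i"; cases "a = b") (auto simp: F_def)
  qed (auto simp: F_def)
  \<comment> \<open>The zero element, written as a fibrewise family so that the two images can be
    compared block by block.\<close>
  define Z :: "nat \<Rightarrow> 'a \<Rightarrow> complex mat" where "Z k x = 0\<^sub>m (siz D n k) (siz D n k)" for k x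
  have Z: "fibrewise D n Z \<in> A_carrier D n" by (rule fibrewise_carrier) (auto simp: Z_def)
  have "conn D n (fibrewise D n F) = conn D n (fibrewise D n Z)"
  proof (rule A_carrier_eqI[OF conn_in[OF n F] conn_in[OF n Z]])
    fix j x a b assume j: "j < num D (Suc n)" "x \<in> topspace (spc D (Suc n) j)"
    have "map (\<lambda>(i, e). fibrewise D n F i (egn D n i j e x)) (ord D n j) =
       map (\<lambda>(i, e). fibrewise D n Z i (egn D n i j e x)) (ord D n j)"
    proof (rule map_cong[OF refl], clarsimp)
      fix k e assume "(k, e) \<in> set (ord D n j)"
      then have k: "k < num D n" "e \<in> edg D n k j" using ord_set[OF n j(1)] by auto
      have xx: "egn D n k j e x \<in> topspace (spc D n k)" using egn_in[OF n k(1) j(1) k(2) j(2)] .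
      have "k = i \<Longrightarrow> g (egn D n k j e x) = 0" using g(2) j k unfolding K_def by blast
      then have "F k (egn D n k j e x) = Z k (egn D n k j e x)" by (auto simp: F_def Z_def intro!: eq_matI)
      then show "fibrewise D n F k (egn D n k j e x) = fibrewise D n Z k (egn D n k j e x)" using k xx by simp
    qed
    then have "diag_block_mat (map (\<lambda>(i, e). fibrewise D n F i (egn D n i j e x)) (ord D n j)) =
       diag_block_mat (map (\<lambda>(i, e). fibrewise D n Z i (egn D n i j e x)) (ord D n j))" by (rule arg_cong)
    then show "conn D n (fibrewise D n F) j x $$ (a, b) = conn D n (fibrewise D n Z) j x $$ (a, b)"
      unfolding conn_apply[OF j] by simp
  qed
  then have "fibrewise D n F = fibrewise D n Z" using conn_inj[OF n] F Z by (auto simp: inj_on_def)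
  then have "F i t = Z i t" using fibrewise_apply[OF i t] by metis
  moreover have "F i t $$ (0, 0) = 1" using g(3) siz_pos[OF n i] by (simp add: F_def)
  moreover have "Z i t $$ (0, 0) = 0" using siz_pos[OF n i] by (simp add: Z_def)
  ultimately show False by simp
qed

end

subsection \<open>The space of labelled paths\<close>

lemma topology_eq_id:
  assumes "continuous_map S T (\<lambda>x. x)" "continuous_map T S (\<lambda>x. x)"
  shows "S = T"
proof -
  have top: "topspace S = topspace T" using assms by (auto simp: continuous_map_def)
  have "openin S U \<longleftrightarrow> openin T U" for U
  proof -
    have "openin T U \<Longrightarrow> openin S U"
      using openin_continuous_map_preimage[OF assms(1), of U] openin_subset[of T U] top
      by (simp add: Collect_conj_eq Int_absorb1)
    moreover have "openin S U \<Longrightarrow> openin T U"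
      using openin_continuous_map_preimage[OF assms(2), of U] openin_subset[of S U] top
      by (simp add: Collect_conj_eq Int_absorb1)
    ultimately show ?thesis by blast
  qed
  then show ?thesis by (simp add: topology_eq)
qed

lemma init_seg_Suc: "init_seg (Suc n) x = init_seg n x @ [x n]"
  by (simp add: init_seg_def)

lemma init_seg_length [simp]: "length (init_seg n x) = n"
  by (simp add: init_seg_def)

lemma init_seg_nth: "k < n \<Longrightarrow> init_seg n x ! k = x k"
  by (simp add: init_seg_def)

lemma last_init_seg [simp]: "last (init_seg (Suc n) x) = x n"
  by (simp add: init_seg_Suc)

lemma init_seg_eq_iff: "init_seg n x = init_seg n y \<longleftrightarrow> (\<forall>k<n. x k = y k)"
  by (auto simp: init_seg_def)

lemma init_seg_eq_list: "init_seg (length p) x = p \<longleftrightarrow> (\<forall>k<length p. x k = p ! k)"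
  by (auto simp: list_eq_iff_nth_eq init_seg_nth)

context AH begin

lemma vs_topspace: "topspace (vertex_space D n i) = (if n = 0 then {None} else Some ` topspace (spc D n i))"
  by (auto simp: vertex_space_def topspace_pullback_topology)

lemma vs_Some: "n \<ge> 1 \<Longrightarrow> continuous_map (spc D n i) (vertex_space D n i) Some"
  unfolding vertex_space_def by (auto intro!: continuous_map_pullback' simp: comp_def)

lemma vs_the: "n \<ge> 1 \<Longrightarrow> continuous_map (vertex_space D n i) (spc D n i) the"
  using continuous_map_pullback[of "spc D n i" "spc D n i" id "Some ` topspace (spc D n i)" the]
  unfolding vertex_space_def by auto

lemma vs_Hausdorff: "n = 0 \<or> i < num D n \<Longrightarrow> Hausdorff_space (vertex_space D n i)"
proof (cases "n = 0")
  case False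
  assume "n = 0 \<or> i < num D n"
  with False have "Hausdorff_space (spc D n i)" by (intro space_Hausdorff) auto
  then show ?thesis by (rule Hausdorff_space_injective_preimage[OF _ vs_the])
     (use False in \<open>auto simp: vs_topspace inj_on_def\<close>)
qed (simp add: vertex_space_def Hausdorff_space_discrete_topology)

lemma vs_compact: "n = 0 \<or> i < num D n \<Longrightarrow> compact_space (vertex_space D n i)"
proof (cases "n = 0")
  case False
  assume "n = 0 \<or> i < num D n"
  with False have "compactin (spc D n i) (topspace (spc D n i))"
    using space_compact[of n i] by (auto simp: compact_space_def)
  then have "compactin (vertex_space D n i) (Some ` topspace (spc D n i))"
    by (rule image_compactin) (use False vs_Some in auto)
  then show ?thesis using False by (simp add: compact_space_def vs_topspace)
qed (simp add: vertex_space_def compact_space_discrete_topology)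

lemma edge_label_continuous:
  assumes "b \<in> bedges D m"
  shows "continuous_map (vertex_space D (Suc m) (btgt b)) (vertex_space D m (bsrc b)) (edge_label D m b)"
proof (cases "m = 0")
  case True
  then show ?thesis using assms by (auto simp: bedges_0 edge_label_def vs_topspace)
next
  case False
  then obtain i e j where b: "b = Edge i e j" "i < num D m" "j < num D (Suc m)" "e \<in> edg D m i j"
    using assms bedges_pos[of m b] by auto
  have "continuous_map (vertex_space D (Suc m) j) (vertex_space D m i) (Some \<circ> egn D m i j e \<circ> the)"
    using False b by (intro continuous_map_compose[OF vs_the] continuous_map_compose[OF egn_continuous] vs_Some) auto
  then show ?thesis
    unfolding b(1) bsrc.simps btgt.simps by (rule continuous_map_eq) (auto simp: edge_label_def vs_topspace)
qed

lemma edge_label_in: "b \<in> bedges D m \<Longrightarrow> t \<in> topspace (vertex_space D (Suc m) (btgt b)) \<Longrightarrow>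
    edge_label D m b t \<in> topspace (vertex_space D m (bsrc b))"
  using continuous_map_image_subset_topspace[OF edge_label_continuous] by blast

lemma pathD:
  assumes "x \<in> labelled_paths D"
  shows "fst (x m) \<in> bedges D m" "bsrc (fst (x (Suc m))) = btgt (fst (x m))"
    "snd (x m) \<in> topspace (vertex_space D m (bsrc (fst (x m))))"
    "edge_label D m (fst (x m)) (snd (x (Suc m))) = snd (x m)" "fst \<circ> x \<in> inf_paths D"
  using assms by (auto simp: labelled_paths_def inf_paths_def)

lemma init_seg_fin_path:
  assumes "x \<in> inf_paths D" shows "init_seg (Suc n) x \<in> fin_paths D"
  using assms by (auto simp: inf_paths_def fin_paths_def init_seg_nth init_seg_def simp del: upt_Suc)

lemma vertex_ok: "b \<in> bedges D m \<Longrightarrow> m = 0 \<or> bsrc b < num D m"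
  using bsrc_less by fastforce

text \<open>A labelled path is a closed condition on a point of the compact space \<open>\<Prod>m. K m\<close>; all
  topological properties of the path space are inherited from there.\<close>

definition K :: "nat \<Rightarrow> ('e bedge \<times> 'a option) topology" where
  "K m = sum_topology (\<lambda>b. vertex_space D m (bsrc b)) (bedges D m)"

lemma K_topspace: "topspace (K m) = Sigma (bedges D m) (\<lambda>b. topspace (vertex_space D m (bsrc b)))"
  by (auto simp: K_def)

lemma K_openin: "openin (K m) W \<longleftrightarrow> W \<subseteq> topspace (K m) \<and> (\<forall>b\<in>bedges D m. openin (vertex_space D m (bsrc b)) {t. (b, t) \<in> W})"
  by (auto simp: K_def openin_sum_topology comp_def)

lemma K_piece: "b \<in> bedges D m \<Longrightarrow> openin (vertex_space D m (bsrc b)) U \<Longrightarrow> openin (K m) ({b} \<times> U)"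
  unfolding K_openin
proof (intro conjI ballI)
  fix c assume b: "b \<in> bedges D m" "openin (vertex_space D m (bsrc b)) U" "c \<in> bedges D m"
  show "openin (vertex_space D m (bsrc c)) {t. (c, t) \<in> {b} \<times> U}"
    using b(2) by (cases "c = b") auto
qed (auto simp: K_topspace dest: openin_subset)

lemma K_Hausdorff: "Hausdorff_space (K m)"
  unfolding Hausdorff_space_def
proof (intro allI impI, elim conjE)
  fix z z' assume a: "z \<in> topspace (K m)" "z' \<in> topspace (K m)" "z \<noteq> z'"
  obtain b t b' t' where z: "z = (b, t)" "z' = (b', t')" by (cases z, cases z')
  have b: "b \<in> bedges D m" "b' \<in> bedges D m" "t \<in> topspace (vertex_space D m (bsrc b))"
    "t' \<in> topspace (vertex_space D m (bsrc b'))" using a z by (auto simp: K_topspace)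
  show "\<exists>U V. openin (K m) U \<and> openin (K m) V \<and> z \<in> U \<and> z' \<in> V \<and> disjnt U V"
  proof (cases "b = b'")
    case True
    then have "t \<noteq> t'" using a z by auto
    then obtain U V where UV: "openin (vertex_space D m (bsrc b)) U" "openin (vertex_space D m (bsrc b)) V" "t \<in> U" "t' \<in> V" "disjnt U V"
      using vs_Hausdorff[OF vertex_ok[OF b(1)]] b True unfolding Hausdorff_space_def by meson
    have "z \<in> {b} \<times> U" "z' \<in> {b} \<times> V" "disjnt ({b} \<times> U) ({b} \<times> V)" using UV z True by (auto simp: disjnt_iff)
    then show ?thesis using K_piece[OF b(1) UV(1)] K_piece[OF b(1) UV(2)] by blast
  next
    case False
    let ?U = "{b} \<times> topspace (vertex_space D m (bsrc b))" and ?V = "{b'} \<times> topspace (vertex_space D m (bsrc b'))"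
    have "z \<in> ?U" "z' \<in> ?V" "disjnt ?U ?V" using False b z by (auto simp: disjnt_iff)
    then show ?thesis using K_piece[OF b(1) openin_topspace] K_piece[OF b(2) openin_topspace] by blast
  qed
qed

text \<open>Each level has finitely many edges, and each edge contributes a compact space.\<close>

lemma K_compact: "compact_space (K m)"
proof -
  have "compactin (K m) (Pair b ` topspace (vertex_space D m (bsrc b)))" if "b \<in> bedges D m" for b
    using vs_compact[OF vertex_ok[OF that]] that unfolding compact_space_def K_def
    by (intro image_compactin[OF _ continuous_map_component_injection]) auto
  then have "compactin (K m) (\<Union>b\<in>bedges D m. Pair b ` topspace (vertex_space D m (bsrc b)))"
    by (intro compactin_Union) (auto simp: finite_bedges)
  moreover have "(\<Union>b\<in>bedges D m. Pair b ` topspace (vertex_space D m (bsrc b))) = topspace (K m)"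
    by (auto simp: K_topspace)
  ultimately show ?thesis by (simp add: compact_space_def)
qed

abbreviation "PT \<equiv> product_topology K UNIV"
abbreviation "P \<equiv> labelled_paths D"
abbreviation "X \<equiv> labelled_path_space D"

lemma P_sub_PT: "P \<subseteq> topspace PT"
proof
  fix x assume x: "x \<in> P"
  have "x m \<in> topspace (K m)" for m
    using pathD(1)[OF x, of m] pathD(3)[OF x, of m] by (cases "x m") (auto simp: K_topspace)
  then show "x \<in> topspace PT" by auto
qed

lemma PT_piece:
  assumes "b \<in> bedges D m" "openin (vertex_space D m (bsrc b)) U"
  shows "openin PT {x \<in> topspace PT. fst (x m) = b \<and> snd (x m) \<in> U}"
proof -
  have "openin PT {x \<in> topspace PT. x m \<in> {b} \<times> U}"
    by (rule openin_continuous_map_preimage[where f = "\<lambda>x. x m", OF _ K_piece[OF assms]])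
       (rule continuous_map_product_projection, simp)
  then show ?thesis by (rule back_subst[of "openin PT"]) (auto simp: mem_Times_iff)
qed

lemma cylinder_sub: "cylinder D p U \<subseteq> P"
  by (auto simp: cylinder_def)

lemma X_topspace: "topspace X = P"
proof -
  have "x \<in> \<Union>{cylinder D p U | p U. p \<in> fin_paths D \<and> openin (vertex_space D (length p - 1) (bsrc (last p))) U}" if x: "x \<in> P" for x
  proof -
    let ?p = "init_seg 1 (fst \<circ> x)" and ?U = "topspace (vertex_space D 0 (bsrc (fst (x 0))))"
    have "last ?p = fst (x 0)" using last_init_seg[of 0 "fst \<circ> x"] by simp
    then have "x \<in> cylinder D ?p ?U" "?p \<in> fin_paths D" "openin (vertex_space D (length ?p - 1) (bsrc (last ?p))) ?U"
      using x pathD(3)[OF x, of 0] init_seg_fin_path[OF pathD(5)[OF x], of 0] by (auto simp: cylinder_def)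
    then show ?thesis by blast
  qed
  then show ?thesis using cylinder_sub by (fastforce simp: labelled_path_space_def)
qed

lemma cylinder_open: "p \<in> fin_paths D \<Longrightarrow> openin (vertex_space D (length p - 1) (bsrc (last p))) U \<Longrightarrow> openin X (cylinder D p U)"
  unfolding labelled_path_space_def by (rule topology_generated_by_Basis) blast

lemma cylinder_open': "x \<in> P \<Longrightarrow> openin (vertex_space D m (bsrc (fst (x m)))) U \<Longrightarrow> openin X (cylinder D (init_seg (Suc m) (fst \<circ> x)) U)"
  using cylinder_open[OF init_seg_fin_path[OF pathD(5)], of x m U] by simp

lemma X_coord: "continuous_map X (K m) (\<lambda>x. x m)"
  unfolding continuous_map_def
proof (intro conjI allI impI)
  show "(\<lambda>x. x m) \<in> topspace X \<rightarrow> topspace (K m)"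
    unfolding X_topspace using P_sub_PT by auto
  fix W assume W: "openin (K m) W"
  show "openin X {x \<in> topspace X. x m \<in> W}"
  proof (subst openin_subopen, intro ballI)
    fix x assume "x \<in> {x \<in> topspace X. x m \<in> W}"
    then have x: "x \<in> P" "x m \<in> W" by (auto simp: X_topspace)
    let ?U = "{t. (fst (x m), t) \<in> W}"
    have U: "openin (vertex_space D m (bsrc (fst (x m)))) ?U" using W pathD(1)[OF x(1)] by (auto simp: K_openin)
    have "cylinder D (init_seg (Suc m) (fst \<circ> x)) ?U \<subseteq> {x \<in> topspace X. x m \<in> W}"
    proof
      fix y assume "y \<in> cylinder D (init_seg (Suc m) (fst \<circ> x)) ?U"
      then have "y \<in> P" "fst (y m) = fst (x m)" "(fst (x m), snd (y m)) \<in> W"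
        by (auto simp: cylinder_def init_seg_eq_iff)
      then show "y \<in> {x \<in> topspace X. x m \<in> W}" unfolding X_topspace by (metis (mono_tags) mem_Collect_eq prod.collapse)
    qed
    moreover have "x \<in> cylinder D (init_seg (Suc m) (fst \<circ> x)) ?U" using x by (auto simp: cylinder_def)
    ultimately show "\<exists>T. openin X T \<and> x \<in> T \<and> T \<subseteq> {x \<in> topspace X. x m \<in> W}"
      using cylinder_open'[OF x(1) U] by blast
  qed
qed

text \<open>The coordinate maps are continuous for the cylinder topology. Conversely a cylinder is
  cut out of \<open>P\<close> by finitely many coordinate conditions: \<open>?O\<close> fixes the
  edges, and \<open>?L\<close> the last edge together with its label.\<close>

lemma X_subtopology: "X = subtopology PT P"
proof (rule topology_eq_id)
  show "continuous_map X (subtopology PT P) (\<lambda>x. x)"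
    by (auto simp: continuous_map_in_subtopology X_topspace continuous_map_componentwise_UNIV X_coord)
  show "continuous_map (subtopology PT P) X (\<lambda>x. x)"
    unfolding labelled_path_space_def
  proof (rule continuous_on_generated_topo)
    show "(\<lambda>x. x) ` topspace (subtopology PT P) \<subseteq> \<Union> {cylinder D p U |p U. p \<in> fin_paths D \<and> openin (vertex_space D (length p - 1) (bsrc (last p))) U}"
      using X_topspace by (auto simp: labelled_path_space_def)
    fix C assume "C \<in> {cylinder D p U |p U. p \<in> fin_paths D \<and> openin (vertex_space D (length p - 1) (bsrc (last p))) U}"
    then obtain p U where C: "C = cylinder D p U" "p \<in> fin_paths D" "openin (vertex_space D (length p - 1) (bsrc (last p))) U" by blast
    have len: "length p \<ge> 1" using fin_path_target(1)[OF C(2)] .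
    have edge: "k < length p \<Longrightarrow> p ! k \<in> bedges D k" for k using C(2) by (auto simp: fin_paths_def)
    let ?O = "\<lambda>k. {x \<in> topspace PT. fst (x k) = p ! k \<and> snd (x k) \<in> topspace (vertex_space D k (bsrc (p ! k)))}"
    let ?L = "{x \<in> topspace PT. fst (x (length p - 1)) = last p \<and> snd (x (length p - 1)) \<in> U}"
    have "openin PT (?L \<inter> (\<Inter>k\<in>{..<length p}. ?O k))"
    proof (rule openin_Int)
      show "openin PT ?L" using len fin_path_target(2)[OF C(2)] C(3) by (intro PT_piece) auto
      have "openin PT (?O k)" if "k < length p" for k using edge[OF that] by (intro PT_piece) auto
      moreover have "0 \<in> {..<length p}" using len by (cases p) auto
      ultimately show "openin PT (\<Inter>k\<in>{..<length p}. ?O k)" by (intro openin_INT2) blast+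
    qed
    moreover have "(\<lambda>x. x) -` C \<inter> topspace (subtopology PT P) = (?L \<inter> (\<Inter>k\<in>{..<length p}. ?O k)) \<inter> P"
    proof (intro equalityI subsetI)
      fix x assume "x \<in> (\<lambda>x. x) -` C \<inter> topspace (subtopology PT P)"
      then have x: "x \<in> P" "\<And>k. k < length p \<Longrightarrow> fst (x k) = p ! k" "snd (x (length p - 1)) \<in> U"
        by (auto simp: C cylinder_def init_seg_eq_list)
      moreover have "fst (x (length p - 1)) = last p" using x(2)[of "length p - 1"] len by (subst last_conv_nth) auto
      moreover have "x \<in> topspace PT" using P_sub_PT x(1) by auto
      moreover have "snd (x k) \<in> topspace (vertex_space D k (bsrc (p ! k)))" if "k < length p" for k
        using pathD(3)[OF x(1), of k] x(2)[OF that] by simp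
      ultimately show "x \<in> (?L \<inter> (\<Inter>k\<in>{..<length p}. ?O k)) \<inter> P" by blast
    next
      fix x assume "x \<in> (?L \<inter> (\<Inter>k\<in>{..<length p}. ?O k)) \<inter> P"
      then show "x \<in> (\<lambda>x. x) -` C \<inter> topspace (subtopology PT P)" using P_sub_PT
        by (auto simp: C cylinder_def init_seg_eq_list)
    qed
    ultimately show "openin (subtopology PT P) ((\<lambda>x. x) -` C \<inter> topspace (subtopology PT P))"
      by (auto simp: openin_subtopology)
  qed
qed

text \<open>A point of the product fails to be a path because of two neighbouring coordinates.
  Endpoints that do not match are detected by edges, which are locally constant; a wrong label stays
  wrong nearby, since eigenfunctions are continuous and the vertex spaces Hausdorff.\<close>

lemma closedin_P: "closedin PT P"
  unfolding closedin_def
proof (intro conjI P_sub_PT, subst openin_subopen, intro ballI)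
  fix x assume "x \<in> topspace PT - P"
  then have x: "x \<in> topspace PT" "x \<notin> P" by auto
  let ?b = "\<lambda>m. fst (x m)" and ?t = "\<lambda>m. snd (x m)"
  have xe: "?b m \<in> bedges D m" "?t m \<in> topspace (vertex_space D m (bsrc (?b m)))" for m
  proof -
    have "x m \<in> topspace (K m)" using x(1) by auto
    then show "?b m \<in> bedges D m" "?t m \<in> topspace (vertex_space D m (bsrc (?b m)))" by (auto simp: K_topspace)
  qed
  obtain m where m: "bsrc (?b (Suc m)) \<noteq> btgt (?b m) \<or> bsrc (?b (Suc m)) = btgt (?b m) \<and> edge_label D m (?b m) (?t (Suc m)) \<noteq> ?t m"
    using x(2) xe by (auto simp: labelled_paths_def inf_paths_def)
  from m show "\<exists>T. openin PT T \<and> x \<in> T \<and> T \<subseteq> topspace PT - P"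
  proof
    assume ne: "bsrc (?b (Suc m)) \<noteq> btgt (?b m)"
    let ?O = "\<lambda>k. {y \<in> topspace PT. fst (y k) = ?b k \<and> snd (y k) \<in> topspace (vertex_space D k (bsrc (?b k)))}"
    have "openin PT (?O m \<inter> ?O (Suc m))" using xe by (intro openin_Int PT_piece) auto
    moreover have "x \<in> ?O m \<inter> ?O (Suc m)" using x(1) xe by auto
    moreover have "?O m \<inter> ?O (Suc m) \<subseteq> topspace PT - P" 
    proof
      fix y assume y: "y \<in> ?O m \<inter> ?O (Suc m)"
      then show "y \<in> topspace PT - P" using ne pathD(2)[of y m] by auto
    qed
    ultimately show ?thesis by blast
  next
    assume ne: "bsrc (?b (Suc m)) = btgt (?b m) \<and> edge_label D m (?b m) (?t (Suc m)) \<noteq> ?t m"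
    let ?V = "vertex_space D m (bsrc (?b m))" and ?V' = "vertex_space D (Suc m) (bsrc (?b (Suc m)))"
    have cont: "continuous_map ?V' ?V (edge_label D m (?b m))" using edge_label_continuous[OF xe(1), of m] ne by simp
    have "edge_label D m (?b m) (?t (Suc m)) \<in> topspace ?V" using cont xe(2)[of "Suc m"] by (auto simp: continuous_map_def)
    then obtain U W where UW: "openin ?V U" "openin ?V W" "edge_label D m (?b m) (?t (Suc m)) \<in> U" "?t m \<in> W" "disjnt U W"
      using vs_Hausdorff[OF vertex_ok[OF xe(1)], of m] xe(2)[of m] ne unfolding Hausdorff_space_def by meson
    let ?U' = "{t \<in> topspace ?V'. edge_label D m (?b m) t \<in> U}"
    have U': "openin ?V' ?U'" using openin_continuous_map_preimage[OF cont UW(1)] .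
    let ?O1 = "{y \<in> topspace PT. fst (y m) = ?b m \<and> snd (y m) \<in> W}"
    let ?O2 = "{y \<in> topspace PT. fst (y (Suc m)) = ?b (Suc m) \<and> snd (y (Suc m)) \<in> ?U'}"
    have "openin PT (?O1 \<inter> ?O2)" using xe UW U' by (intro openin_Int PT_piece) auto
    moreover have "x \<in> ?O1 \<inter> ?O2" using x(1) xe UW by auto
    moreover have "?O1 \<inter> ?O2 \<subseteq> topspace PT - P"
    proof
      fix y assume y: "y \<in> ?O1 \<inter> ?O2"
      then have "edge_label D m (fst (y m)) (snd (y (Suc m))) \<noteq> snd (y m)" using UW(5) by (auto simp: disjnt_iff)
      then show "y \<in> topspace PT - P" using y pathD(4)[of y m] by auto
    qed
    ultimately show ?thesis by blast
  qed
qed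

lemma X_compact: "compact_space X"
proof -
  have "compact_space PT" by (simp add: compact_space_product_topology K_compact)
  then have "compactin PT P" using closedin_compact_space closedin_P by blast
  then show ?thesis using P_sub_PT by (simp add: X_subtopology compact_space_subtopology)
qed

text \<open>Replacing \<open>U\<close> by its preimage under the label of edge \<open>m\<close>
  moves the condition one level up. A neighbourhood of \<open>x\<close> can thus be described at any
  sufficiently deep level.\<close>

lemma cylinder_up:
  assumes x: "x \<in> P" and U: "openin (vertex_space D m (bsrc (fst (x m)))) U" "snd (x m) \<in> U"
    and sub: "cylinder D (init_seg (Suc m) (fst \<circ> x)) U \<subseteq> W"
  shows "\<exists>U'. openin (vertex_space D (Suc m) (bsrc (fst (x (Suc m))))) U' \<and> snd (x (Suc m)) \<in> U' \<and>
     cylinder D (init_seg (Suc (Suc m)) (fst \<circ> x)) U' \<subseteq> W"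
proof -
  let ?V' = "vertex_space D (Suc m) (bsrc (fst (x (Suc m))))"
  let ?U' = "{t \<in> topspace ?V'. edge_label D m (fst (x m)) t \<in> U}"
  have "openin ?V' ?U'"
    by (rule openin_continuous_map_preimage[OF _ U(1)])
       (use edge_label_continuous[OF pathD(1)[OF x], of m] pathD(2)[OF x, of m] in simp)
  moreover have "snd (x (Suc m)) \<in> ?U'" using pathD(3)[OF x, of "Suc m"] pathD(4)[OF x, of m] U(2) by auto
  moreover have "cylinder D (init_seg (Suc (Suc m)) (fst \<circ> x)) ?U' \<subseteq> cylinder D (init_seg (Suc m) (fst \<circ> x)) U"
  proof
    fix y assume y: "y \<in> cylinder D (init_seg (Suc (Suc m)) (fst \<circ> x)) ?U'"
    then have "y \<in> P" "\<forall>k<Suc (Suc m). fst (y k) = fst (x k)" "edge_label D m (fst (x m)) (snd (y (Suc m))) \<in> U"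
      by (auto simp: cylinder_def init_seg_eq_iff)
    then show "y \<in> cylinder D (init_seg (Suc m) (fst \<circ> x)) U"
      using pathD(4)[of y m] by (auto simp: cylinder_def init_seg_eq_iff)
  qed
  ultimately show ?thesis using sub by blast
qed

lemma cylinder_up_ge:
  assumes x: "x \<in> P" and U: "openin (vertex_space D m (bsrc (fst (x m)))) U" "snd (x m) \<in> U"
    and sub: "cylinder D (init_seg (Suc m) (fst \<circ> x)) U \<subseteq> W" and "m \<le> m'"
  shows "\<exists>U'. openin (vertex_space D m' (bsrc (fst (x m')))) U' \<and> snd (x m') \<in> U' \<and>
     cylinder D (init_seg (Suc m') (fst \<circ> x)) U' \<subseteq> W"
  using \<open>m \<le> m'\<close>
proof (induction rule: dec_induct)
  case base
  then show ?case using U sub by blast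
next
  case (step k)
  then show ?case using cylinder_up[OF x] by blast
qed

text \<open>The cylinders enter only as generators of the topology. Lifting two of them to a common
  level makes their intersection contain a cylinder around \<open>x\<close>; so the cylinders around
  \<open>x\<close> form a neighbourhood base, even with the level prescribed beyond some
  bound.\<close>

lemma cylinder_base:
  assumes "openin X W" "x \<in> W"
  shows "\<exists>M. \<forall>m\<ge>M. \<exists>U. openin (vertex_space D m (bsrc (fst (x m)))) U \<and> snd (x m) \<in> U \<and>
     cylinder D (init_seg (Suc m) (fst \<circ> x)) U \<subseteq> W"
proof -
  have xP: "x \<in> P" using assms openin_subset X_topspace by fastforce
  have "generate_topology_on {cylinder D p U |p U. p \<in> fin_paths D \<and> openin (vertex_space D (length p - 1) (bsrc (last p))) U} W"
    using assms(1) by (simp add: labelled_path_space_def openin_topology_generated_by_iff)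
  then show ?thesis using assms(2)
  proof (induction rule: generate_topology_on.induct)
    case (Int a b)
    from Int.prems have ab: "x \<in> a" "x \<in> b" by auto
    from Int.IH(1)[OF ab(1)] Int.IH(2)[OF ab(2)] obtain M N where M: "\<And>m. m \<ge> M \<Longrightarrow> \<exists>U. openin (vertex_space D m (bsrc (fst (x m)))) U \<and> snd (x m) \<in> U \<and>
        cylinder D (init_seg (Suc m) (fst \<circ> x)) U \<subseteq> a"
      and N: "\<And>m. m \<ge> N \<Longrightarrow> \<exists>U. openin (vertex_space D m (bsrc (fst (x m)))) U \<and> snd (x m) \<in> U \<and>
        cylinder D (init_seg (Suc m) (fst \<circ> x)) U \<subseteq> b" by blast
    show ?case
    proof (intro exI[of _ "max M N"] allI impI)
      fix m assume "max M N \<le> m"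
      then obtain U V where U: "openin (vertex_space D m (bsrc (fst (x m)))) U" "snd (x m) \<in> U"
          "cylinder D (init_seg (Suc m) (fst \<circ> x)) U \<subseteq> a"
        and V: "openin (vertex_space D m (bsrc (fst (x m)))) V" "snd (x m) \<in> V"
          "cylinder D (init_seg (Suc m) (fst \<circ> x)) V \<subseteq> b" using M[of m] N[of m] by auto
      have "cylinder D (init_seg (Suc m) (fst \<circ> x)) (U \<inter> V) \<subseteq> a \<inter> b" using U(3) V(3) by (auto simp: cylinder_def)
      then show "\<exists>U. openin (vertex_space D m (bsrc (fst (x m)))) U \<and> snd (x m) \<in> U \<and>
          cylinder D (init_seg (Suc m) (fst \<circ> x)) U \<subseteq> a \<inter> b" using U V by (intro exI[of _ "U \<inter> V"]) auto
    qed
  next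
    case (UN Q)
    then obtain k where k: "k \<in> Q" "x \<in> k" by blast
    then obtain M where "\<forall>m\<ge>M. \<exists>U. openin (vertex_space D m (bsrc (fst (x m)))) U \<and> snd (x m) \<in> U \<and>
        cylinder D (init_seg (Suc m) (fst \<circ> x)) U \<subseteq> k" using UN.IH by blast
    then show ?case using k(1) by (meson Sup_upper order_trans)
  next
    case (Basis s)
    then obtain p U where s: "s = cylinder D p U" "p \<in> fin_paths D" "openin (vertex_space D (length p - 1) (bsrc (last p))) U" by blast
    let ?m = "length p - 1"
    have l: "Suc ?m = length p" using fin_path_target(1)[OF s(2)] by simp
    have eq: "init_seg (Suc ?m) (fst \<circ> x) = p" "snd (x ?m) \<in> U" using Basis.prems s l by (auto simp: cylinder_def)
    then have "fst (x ?m) = last p" by (metis comp_apply last_init_seg)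
    then have "\<forall>m\<ge>?m. \<exists>U. openin (vertex_space D m (bsrc (fst (x m)))) U \<and> snd (x m) \<in> U \<and>
        cylinder D (init_seg (Suc m) (fst \<circ> x)) U \<subseteq> s"
      using cylinder_up_ge[OF xP, of ?m U s] s eq by auto
    then show ?case by blast
  qed simp
qed

text \<open>Initial segments are locally constant on the path space, so continuity is only at stake
  in the label at level \<open>m\<close>, separately for each segment.\<close>

lemma continuous_level:
  assumes "\<And>p. p \<in> fin_paths D \<Longrightarrow> length p = Suc m \<Longrightarrow> continuous_map (vertex_space D m (bsrc (last p))) T (G p)"
  shows "continuous_map X T (\<lambda>x. G (init_seg (Suc m) (fst \<circ> x)) (snd (x m)))"
  unfolding continuous_map_def
proof (intro conjI allI impI)
  show "(\<lambda>x. G (init_seg (Suc m) (fst \<circ> x)) (snd (x m))) \<in> topspace X \<rightarrow> topspace T"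
  proof (intro funcsetI)
    fix x assume "x \<in> topspace X"
    then have x: "x \<in> P" by (simp add: X_topspace)
    show "G (init_seg (Suc m) (fst \<circ> x)) (snd (x m)) \<in> topspace T"
      using assms[OF init_seg_fin_path[OF pathD(5)[OF x]], of m] pathD(3)[OF x, of m] by (auto simp: continuous_map_def)
  qed
  fix V assume V: "openin T V"
  show "openin X {x \<in> topspace X. G (init_seg (Suc m) (fst \<circ> x)) (snd (x m)) \<in> V}"
  proof (subst openin_subopen, intro ballI)
    fix x assume "x \<in> {x \<in> topspace X. G (init_seg (Suc m) (fst \<circ> x)) (snd (x m)) \<in> V}"
    then have x: "x \<in> P" "G (init_seg (Suc m) (fst \<circ> x)) (snd (x m)) \<in> V" by (auto simp: X_topspace)
    let ?p = "init_seg (Suc m) (fst \<circ> x)"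
    let ?U = "{t \<in> topspace (vertex_space D m (bsrc (fst (x m)))). G ?p t \<in> V}"
    have U: "openin (vertex_space D m (bsrc (fst (x m)))) ?U"
      using openin_continuous_map_preimage[OF assms[OF init_seg_fin_path[OF pathD(5)[OF x(1)]], of m] V] by simp
    have "cylinder D ?p ?U \<subseteq> {x \<in> topspace X. G (init_seg (Suc m) (fst \<circ> x)) (snd (x m)) \<in> V}"
      by (auto simp: cylinder_def X_topspace)
    moreover have "x \<in> cylinder D ?p ?U" using x pathD(3)[OF x(1), of m] by (auto simp: cylinder_def)
    ultimately show "\<exists>T. openin X T \<and> x \<in> T \<and> T \<subseteq> {x \<in> topspace X. G (init_seg (Suc m) (fst \<circ> x)) (snd (x m)) \<in> V}"
      using cylinder_open'[OF x(1) U] by blast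
  qed
qed

text \<open>Labels are pushed downwards by the eigenfunctions, so they need to be prescribed only
  from level \<open>n\<close> on; each induction step fills in the one label directly below.\<close>

lemma build_path:
  assumes x0: "x0 \<in> inf_paths D"
    and s: "\<And>m. m \<ge> n \<Longrightarrow> s m \<in> topspace (vertex_space D m (bsrc (x0 m))) \<and> edge_label D m (x0 m) (s (Suc m)) = s m"
  shows "\<exists>x\<in>P. fst \<circ> x = x0 \<and> (\<forall>m\<ge>n. snd (x m) = s m)"
  using s
proof (induction n arbitrary: s)
  case 0
  then have "(\<lambda>m. (x0 m, s m)) \<in> P" using x0 by (auto simp: labelled_paths_def comp_def)
  then show ?case by (intro bexI[of _ "\<lambda>m. (x0 m, s m)"]) (auto simp: comp_def)
next
  case (Suc n)
  define s' where "s' = s(n := edge_label D n (x0 n) (s (Suc n)))"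
  have x0': "x0 m \<in> bedges D m" "bsrc (x0 (Suc m)) = btgt (x0 m)" for m using x0 by (auto simp: inf_paths_def)
  have "s' m \<in> topspace (vertex_space D m (bsrc (x0 m))) \<and> edge_label D m (x0 m) (s' (Suc m)) = s' m" if "m \<ge> n" for m
  proof (cases "m = n")
    case True
    then show ?thesis using Suc.prems[of "Suc n"] x0' edge_label_in[OF x0'(1), of "s (Suc n)" n] by (auto simp: s'_def)
  next
    case False
    then show ?thesis using Suc.prems[of m] that by (auto simp: s'_def)
  qed
  then obtain x where "x \<in> P" "fst \<circ> x = x0" "\<forall>m\<ge>n. snd (x m) = s' m" using Suc.IH by blast
  then show ?case by (intro bexI[of _ x]) (auto simp: s'_def)
qed

lemma labels_determined:
  assumes x: "x \<in> P" and y: "y \<in> P" and "m \<le> n" "\<And>k. m \<le> k \<Longrightarrow> k < n \<Longrightarrow> fst (x k) = fst (y k)" "snd (x n) = snd (y n)"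
  shows "snd (x m) = snd (y m)"
  using assms(3-)
proof (induction rule: inc_induct)
  case (step k)
  then show ?case using pathD(4)[OF x, of k] pathD(4)[OF y, of k] by (metis Suc_leD le_refl)
qed

text \<open>Joint surjectivity of the eigenfunctions lifts \<open>t\<close> through all later levels
  by dependent choice, while \<open>p\<close> supplies the edges below. Hence every matrix position
  over every point of level \<open>n\<close> is visited by a labelled path.\<close>

lemma level_surj:
  assumes n: "n \<ge> 1" and i: "i < num D n" and t: "t \<in> topspace (spc D n i)" and p: "p \<in> paths_to n i"
  shows "\<exists>x\<in>P. init_seg n (fst \<circ> x) = p \<and> snd (x n) = Some t \<and> bsrc (fst (x n)) = i"
proof -
  \<comment> \<open>\<open>?Q\<close> joins a point to a preimage one level up; \<open>?S\<close>
    keeps each point in its space and pins the sequence to \<open>(i, t)\<close> at its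
    start.\<close>
  let ?Q = "\<lambda>k (a :: nat \<times> 'a) b. \<exists>e\<in>edg D (n + k) (fst a) (fst b). egn D (n + k) (fst a) (fst b) e (snd b) = snd a"
  let ?S = "\<lambda>k (a :: nat \<times> 'a). fst a < num D (n + k) \<and> snd a \<in> topspace (spc D (n + k) (fst a)) \<and> (k = 0 \<longrightarrow> a = (i, t))"
  have "\<exists>f. \<forall>k. ?S k (f k) \<and> ?Q k (f k) (f (Suc k))"
  proof (rule dependent_nat_choice)
    show "\<exists>a. ?S 0 a" using i t by (intro exI[of _ "(i, t)"]) auto
    fix a k assume "?S k a"
    then obtain j e t' where "j < num D (Suc (n + k))" "e \<in> edg D (n + k) (fst a) j" "t' \<in> topspace (spc D (Suc (n + k)) j)"
        "egn D (n + k) (fst a) j e t' = snd a"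
      using egn_surj[of "n + k" "fst a" "snd a"] n by auto
    then show "\<exists>b. ?S (Suc k) b \<and> ?Q k a b" by (intro exI[of _ "(j, t')"]) auto
  qed
  then obtain f where f: "\<And>k. ?S k (f k)" "\<And>k. ?Q k (f k) (f (Suc k))" by blast
  then obtain e where e: "\<And>k. e k \<in> edg D (n + k) (fst (f k)) (fst (f (Suc k)))"
     "\<And>k. egn D (n + k) (fst (f k)) (fst (f (Suc k))) (e k) (snd (f (Suc k))) = snd (f k)" by metis
  define x0 where "x0 m = (if m < n then p ! m else Edge (fst (f (m - n))) (e (m - n)) (fst (f (Suc (m - n)))))" for m
  have pp: "p \<in> fin_paths D" "length p = n" "btgt (last p) = i" using p by (auto simp: paths_to_def)
  have f0: "f 0 = (i, t)" using f(1)[of 0] by auto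
  have x0: "x0 \<in> inf_paths D"
    unfolding inf_paths_def
  proof (intro CollectI allI conjI)
    fix m
    show "x0 m \<in> bedges D m"
    proof (cases "m < n")
      case True
      then show ?thesis using pp by (auto simp: x0_def fin_paths_def)
    next
      case False
      then show ?thesis using f(1)[of "m - n"] f(1)[of "Suc (m - n)"] e(1)[of "m - n"] n
        by (auto simp: x0_def bedges_pos)
    qed
    consider "Suc m < n" | "Suc m = n" | "n \<le> m" by linarith
    then show "bsrc (x0 (Suc m)) = btgt (x0 m)"
    proof cases
      case 1
      then show ?thesis using pp by (auto simp: x0_def fin_paths_def)
    next
      case 2
      then have "last p = p ! m" using pp by (metis diff_Suc_1 fin_path_target(1) last_conv_nth list.size(3) not_one_le_zero)
      then show ?thesis using 2 f0 pp by (auto simp: x0_def)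
    next
      case 3
      then show ?thesis by (auto simp: x0_def Suc_diff_le)
    qed
  qed
  have "\<exists>x\<in>P. fst \<circ> x = x0 \<and> (\<forall>m\<ge>n. snd (x m) = Some (snd (f (m - n))))"
  proof (rule build_path[OF x0])
    fix m assume m: "m \<ge> n"
    show "Some (snd (f (m - n))) \<in> topspace (vertex_space D m (bsrc (x0 m))) \<and>
        edge_label D m (x0 m) (Some (snd (f (Suc m - n)))) = Some (snd (f (m - n)))"
      using m f(1)[of "m - n"] e(2)[of "m - n"] n by (auto simp: vs_topspace x0_def edge_label_def Suc_diff_le)
  qed
  then obtain x where x: "x \<in> P" "fst \<circ> x = x0" "\<forall>m\<ge>n. snd (x m) = Some (snd (f (m - n)))" by blast
  have "init_seg n (fst \<circ> x) = p" unfolding x(2) using pp init_seg_eq_list[of p x0] by (auto simp: x0_def)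
  moreover have "bsrc (fst (x n)) = i" using x(2) f0 by (auto simp: x0_def fun_eq_iff)
  ultimately show ?thesis using x f0 by (intro bexI[of _ x]) auto
qed

text \<open>Edges below level \<open>n\<close> may be exchanged as long as they still form a path,
  since the labels of the tail determine all lower ones. This produces arrows with prescribed
  underlying edges.\<close>

lemma change_prefix:
  assumes y: "y \<in> P" and x0: "x0 \<in> inf_paths D" and eq: "\<And>m. m \<ge> n \<Longrightarrow> x0 m = fst (y m)"
  shows "\<exists>x\<in>P. fst \<circ> x = x0 \<and> (\<forall>m\<ge>n. x m = y m)"
proof -
  have "\<exists>x\<in>P. fst \<circ> x = x0 \<and> (\<forall>m\<ge>n. snd (x m) = snd (y m))"
    by (rule build_path[OF x0]) (use pathD[OF y] eq in auto)
  then obtain x where x: "x \<in> P" "fst \<circ> x = x0" "\<forall>m\<ge>n. snd (x m) = snd (y m)" by blast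
  then have "x m = y m" if "m \<ge> n" for m using eq[OF that] that by (metis comp_apply prod.expand)
  then show ?thesis using x by blast
qed

end

subsection \<open>The groupoid of labelled paths\<close>

lemma labelled_groupoid_simps [simp]:
  "gp_top (labelled_groupoid D) = labelled_groupoid_top D"
  "gp_comp (labelled_groupoid D) (x, y) (y', z) = (x, z)"
  "gp_inv (labelled_groupoid D) (x, y) = (y, x)"
  "gp_rng (labelled_groupoid D) (x, y) = (x, x)"
  "gp_src (labelled_groupoid D) (x, y) = (y, y)"
  by (simp_all add: labelled_groupoid_def relation_groupoid_def)

context AH begin

abbreviation "R \<equiv> tail_equal_from D"
abbreviation "PP \<equiv> prod_topology X X"
abbreviation "Gt \<equiv> labelled_groupoid_top D"

lemma R_iff: "(x, y) \<in> R n \<longleftrightarrow> x \<in> P \<and> y \<in> P \<and> (\<forall>m\<ge>n. x m = y m)"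
  by (simp add: tail_equal_from_def)

lemma R_mono: "n \<le> m \<Longrightarrow> R n \<subseteq> R m"
  by (auto simp: tail_equal_from_def)

lemma R_refl: "x \<in> P \<Longrightarrow> (x, x) \<in> R n" by (simp add: R_iff)
lemma R_sym: "(x, y) \<in> R n \<Longrightarrow> (y, x) \<in> R n" by (simp add: R_iff)
lemma R_trans: "(x, y) \<in> R n \<Longrightarrow> (y, z) \<in> R n \<Longrightarrow> (x, z) \<in> R n" by (simp add: R_iff)

text \<open>Below level \<open>m\<close> the labels are images of the common label there under the
  edges passed, so equal edges force equal labels. Membership in \<open>R n\<close> is thereby a
  condition on finitely many edges, hence open within \<open>R m\<close>.\<close>

lemma R_char:
  assumes "(x, y) \<in> R m" "n \<le> m"
  shows "(x, y) \<in> R n \<longleftrightarrow> (\<forall>k. n \<le> k \<and> k < m \<longrightarrow> fst (x k) = fst (y k))"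
proof
  assume a: "\<forall>k. n \<le> k \<and> k < m \<longrightarrow> fst (x k) = fst (y k)"
  have xy: "x \<in> P" "y \<in> P" "\<And>k. k \<ge> m \<Longrightarrow> x k = y k" using assms(1) by (auto simp: R_iff)
  have "x k = y k" if "k \<ge> n" for k
  proof (cases "k < m")
    case True
    have "snd (x k) = snd (y k)"
      by (rule labels_determined[OF xy(1,2), of k m]) (use True a that xy(3)[of m] in auto)
    then show ?thesis using a True that by (simp add: prod_eq_iff)
  qed (use xy(3) in auto)
  then show "(x, y) \<in> R n" using xy by (simp add: R_iff)
qed (auto simp: R_iff)

lemma R_sub_PP: "R n \<subseteq> topspace PP"
  by (auto simp: X_topspace tail_equal_from_def)

text \<open>Edges form the discrete part of a coordinate, so sharing the edge \<open>k\<close>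
  persists on a product of two neighbourhoods.\<close>

lemma same_edge_open: "openin PP {z \<in> topspace PP. fst (fst z k) = fst (snd z k)}"
proof (subst openin_subopen, intro ballI)
  fix z assume z: "z \<in> {z \<in> topspace PP. fst (fst z k) = fst (snd z k)}"
  obtain x y where xy: "z = (x, y)" by (cases z)
  have x: "x \<in> P" "y \<in> P" "fst (x k) = fst (y k)" using z xy by (auto simp: X_topspace)
  let ?b = "fst (x k)"
  let ?E = "{x \<in> topspace X. x k \<in> {?b} \<times> topspace (vertex_space D k (bsrc ?b))}"
  have E: "openin X ?E"
    by (rule openin_continuous_map_preimage[OF X_coord K_piece[OF pathD(1)[OF x(1)] openin_topspace]])
  have "z \<in> ?E \<times> ?E" using x xy pathD(3)[OF x(1), of k] pathD(3)[OF x(2), of k] by (auto simp: X_topspace mem_Times_iff)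
  moreover have "?E \<times> ?E \<subseteq> {z \<in> topspace PP. fst (fst z k) = fst (snd z k)}" by (auto simp: mem_Times_iff)
  ultimately show "\<exists>T. openin PP T \<and> z \<in> T \<and> T \<subseteq> {z \<in> topspace PP. fst (fst z k) = fst (snd z k)}"
    using E by (intro exI[of _ "?E \<times> ?E"]) (auto simp: openin_prod_Times_iff)
qed

lemma R_open_in:
  assumes "n \<le> m" shows "openin (subtopology PP (R m)) (R n)"
proof -
  let ?O = "\<lambda>k. {z \<in> topspace PP. fst (fst z k) = fst (snd z k)}"
  have "openin PP (topspace PP \<inter> \<Inter>(?O ` {n..<m}))"
    by (rule openin_Int_Inter) (auto simp: same_edge_open simp del: topspace_prod_topology)
  moreover have "R n = (topspace PP \<inter> \<Inter>(?O ` {n..<m})) \<inter> R m"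
  proof (intro equalityI subsetI)
    fix z assume z: "z \<in> R n"
    then have "z \<in> R m" using R_mono[OF assms] by auto
    then show "z \<in> (topspace PP \<inter> \<Inter>(?O ` {n..<m})) \<inter> R m"
      using z R_sub_PP by (cases z) (auto simp: R_iff X_topspace)
  next
    fix z assume "z \<in> (topspace PP \<inter> \<Inter>(?O ` {n..<m})) \<inter> R m"
    then show "z \<in> R n" using R_char[of "fst z" "snd z" m n] assms by (cases z) auto
  qed
  ultimately show ?thesis by (auto simp: openin_subtopology)
qed

lemma G_istopology:
  "istopology (\<lambda>W. W \<subseteq> (\<Union>n. R n) \<and> (\<forall>n. openin (subtopology PP (R n)) (W \<inter> R n)))"
proof -
  have 1: "openin (subtopology PP (R n)) (S \<inter> T \<inter> R n)"
    if "openin (subtopology PP (R n)) (S \<inter> R n)" "openin (subtopology PP (R n)) (T \<inter> R n)" for S T n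
    using openin_Int[OF that] by (simp add: Int_ac)
  have 2: "openin (subtopology PP (R n)) (\<Union>\<K> \<inter> R n)"
    if "\<And>S. S \<in> \<K> \<Longrightarrow> openin (subtopology PP (R n)) (S \<inter> R n)" for \<K> n
  proof -
    have "openin (subtopology PP (R n)) (\<Union>S\<in>\<K>. S \<inter> R n)" by (intro openin_Union) (use that in auto)
    then show ?thesis unfolding Int_Union2 .
  qed
  show ?thesis
    unfolding istopology_def
  proof (intro conjI allI impI)
    fix S T n
    assume S: "S \<subseteq> (\<Union>n. R n) \<and> (\<forall>n. openin (subtopology PP (R n)) (S \<inter> R n))"
      and T: "T \<subseteq> (\<Union>n. R n) \<and> (\<forall>n. openin (subtopology PP (R n)) (T \<inter> R n))"
    show "S \<inter> T \<subseteq> (\<Union>n. R n)" using S by (meson Int_lower1 order_trans)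
    show "openin (subtopology PP (R n)) (S \<inter> T \<inter> R n)" using 1[of n S T] S T by simp
  next
    fix \<K> n assume a: "\<forall>S\<in>\<K>. S \<subseteq> (\<Union>n. R n) \<and> (\<forall>n. openin (subtopology PP (R n)) (S \<inter> R n))"
    show "\<Union>\<K> \<subseteq> (\<Union>n. R n)" using a by (simp add: Sup_le_iff)
    show "openin (subtopology PP (R n)) (\<Union>\<K> \<inter> R n)" using 2[of \<K> n] a by simp
  qed
qed

lemma G_openin: "openin Gt W \<longleftrightarrow> W \<subseteq> (\<Union>n. R n) \<and> (\<forall>n. openin (subtopology PP (R n)) (W \<inter> R n))"
  unfolding labelled_groupoid_top_def using G_istopology by (simp add: topology_inverse')

lemma R_top: "topspace (subtopology PP (R n)) = R n"
  unfolding topspace_subtopology using R_sub_PP by blast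

lemma G_topspace: "topspace Gt = (\<Union>n. R n)"
proof -
  have "openin (subtopology PP (R n)) ((\<Union>n. R n) \<inter> R n)" for n
    using openin_topspace[of "subtopology PP (R n)"] R_top[of n] by (simp add: Int_absorb1 UN_upper)
  then have "openin Gt (\<Union>n. R n)" by (simp add: G_openin)
  moreover have "openin Gt (topspace Gt)" by simp
  ultimately show ?thesis using openin_subset G_openin by (metis subset_antisym)
qed

lemma R_open: "openin Gt (R n)"
  unfolding G_openin
proof (intro conjI allI)
  fix m
  show "openin (subtopology PP (R m)) (R n \<inter> R m)"
  proof (cases "n \<le> m")
    case True
    then show ?thesis using R_open_in[OF True] R_mono[OF True] by (simp add: Int_absorb2)
  next
    case False
    then have "R n \<inter> R m = R m" using R_mono[of m n] by auto
    then show ?thesis using openin_topspace[of "subtopology PP (R m)"] R_top by metis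
  qed
qed auto

text \<open>Openness in one piece passes to every other piece because \<open>R n\<close> is itself
  open for the limit topology. That topology is therefore glued from open subspaces.\<close>

lemma G_open_in_R:
  assumes "openin (subtopology PP (R n)) S" shows "openin Gt S"
  unfolding G_openin
proof (intro conjI allI)
  have S: "S \<subseteq> R n" using openin_subset[OF assms] R_top by auto
  then show "S \<subseteq> (\<Union>n. R n)" by auto
  obtain T where T: "openin PP T" "S = T \<inter> R n" using assms by (auto simp: openin_subtopology)
  fix m
  show "openin (subtopology PP (R m)) (S \<inter> R m)"
  proof -
    have "openin (subtopology PP (R m)) (R n \<inter> R m)" using R_open[of n] by (simp add: G_openin)
    moreover have "openin (subtopology PP (R m)) (T \<inter> R m)" using T by (auto simp: openin_subtopology)
    ultimately have "openin (subtopology PP (R m)) ((R n \<inter> R m) \<inter> (T \<inter> R m))" by (rule openin_Int)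
    moreover have "(R n \<inter> R m) \<inter> (T \<inter> R m) = S \<inter> R m" using T by auto
    ultimately show ?thesis by simp
  qed
qed

lemma G_sub: "subtopology Gt (R n) = subtopology PP (R n)"
  unfolding topology_eq
proof (intro allI iffI)
  fix S assume "openin (subtopology Gt (R n)) S"
  then obtain T where T: "openin Gt T" "S = T \<inter> R n" by (auto simp: openin_subtopology)
  then show "openin (subtopology PP (R n)) S" using G_openin by simp
next
  fix S assume a: "openin (subtopology PP (R n)) S"
  then have "S \<subseteq> R n" using openin_subset[OF a] R_top by auto
  then show "openin (subtopology Gt (R n)) S"
    using G_open_in_R[OF a] by (simp add: openin_open_subtopology R_open)
qed

text \<open>With \<open>G_openI\<close> this describes the topology by boxes cut down to a single
  \<open>R n\<close>; any \<open>n\<close> whose piece contains the given arrow will do.\<close>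

lemma G_nbhd:
  assumes "openin Gt W" "(x, y) \<in> W" "(x, y) \<in> R n"
  shows "\<exists>U V. openin X U \<and> openin X V \<and> x \<in> U \<and> y \<in> V \<and> (U \<times> V) \<inter> R n \<subseteq> W"
proof -
  obtain T where T: "openin PP T" "W \<inter> R n = T \<inter> R n"
    using assms(1)[unfolded G_openin, THEN conjunct2, rule_format, of n] by (auto simp: openin_subtopology)
  have xy: "(x, y) \<in> T" using T(2) assms(2,3) by blast
  then obtain U V where "openin X U" "openin X V" "x \<in> U" "y \<in> V" "U \<times> V \<subseteq> T"
    using T(1)[unfolded openin_prod_topology_alt, rule_format, OF xy] by blast
  moreover from this(5) have "(U \<times> V) \<inter> R n \<subseteq> W" using T(2) by blast
  ultimately show ?thesis by blast
qed

lemma G_openI: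
  assumes "\<And>x y. (x, y) \<in> W \<Longrightarrow> \<exists>n U V. openin X U \<and> openin X V \<and> x \<in> U \<and> y \<in> V \<and> (x, y) \<in> R n \<and> (U \<times> V) \<inter> R n \<subseteq> W"
  shows "openin Gt W"
proof (subst openin_subopen, intro ballI)
  fix z assume z: "z \<in> W"
  obtain x y where xy: "z = (x, y)" by (cases z)
  obtain n U V where U: "openin X U" "openin X V" "x \<in> U" "y \<in> V" "(x, y) \<in> R n" "(U \<times> V) \<inter> R n \<subseteq> W"
    using assms[of x y] z xy by auto
  have "openin PP (U \<times> V)" using U(1,2) by (simp add: openin_prod_Times_iff)
  then have "openin Gt ((U \<times> V) \<inter> R n)"
    by (intro G_open_in_R[of n]) (auto simp: openin_subtopology)
  moreover have "z \<in> (U \<times> V) \<inter> R n" using U xy by simp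
  ultimately show "\<exists>T. openin Gt T \<and> z \<in> T \<and> T \<subseteq> W" using U(6) by blast
qed

lemma G_arrow: "(x, y) \<in> topspace Gt \<longleftrightarrow> (\<exists>n. (x, y) \<in> R n)"
  by (simp add: G_topspace)

lemma G_arrow_P: "(x, y) \<in> topspace Gt \<Longrightarrow> x \<in> P \<and> y \<in> P"
  by (auto simp: G_arrow R_iff)

lemma G_refl: "x \<in> P \<Longrightarrow> (x, x) \<in> topspace Gt"
  using G_arrow R_refl by blast

lemma G_sym: "(x, y) \<in> topspace Gt \<Longrightarrow> (y, x) \<in> topspace Gt"
  using G_arrow R_sym by blast

lemma G_common:
  assumes "(x, y) \<in> topspace Gt" "(y', z) \<in> topspace Gt"
  obtains n where "(x, y) \<in> R n" "(y', z) \<in> R n"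
proof -
  obtain n m where "(x, y) \<in> R n" "(y', z) \<in> R m" using assms G_arrow by blast
  then have "(x, y) \<in> R (max n m)" "(y', z) \<in> R (max n m)" using R_mono[of n "max n m"] R_mono[of m "max n m"] by auto
  then show thesis using that by blast
qed

lemma G_trans: "(x, y) \<in> topspace Gt \<Longrightarrow> (y, z) \<in> topspace Gt \<Longrightarrow> (x, z) \<in> topspace Gt"
  using G_common R_trans G_arrow by metis

lemma G_pos_level: "(x, y) \<in> topspace Gt \<Longrightarrow> \<exists>n\<ge>N. (x, y) \<in> R n"
  using R_mono[OF max.cobounded1] G_arrow by (meson max.cobounded2 subsetD)

lemma G_fst: "continuous_map Gt X fst"
  unfolding continuous_map_def
proof (intro conjI allI impI)
  show "fst \<in> topspace Gt \<rightarrow> topspace X" using G_arrow_P by (auto simp: X_topspace)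
  fix U assume U: "openin X U"
  show "openin Gt {z \<in> topspace Gt. fst z \<in> U}"
  proof (rule G_openI)
    fix x y assume a: "(x, y) \<in> {z \<in> topspace Gt. fst z \<in> U}"
    then obtain n where "(x, y) \<in> R n" using G_arrow by auto
    then show "\<exists>n U' V. openin X U' \<and> openin X V \<and> x \<in> U' \<and> y \<in> V \<and> (x, y) \<in> R n \<and> (U' \<times> V) \<inter> R n \<subseteq> {z \<in> topspace Gt. fst z \<in> U}"
      using a U by (intro exI[of _ n] exI[of _ U] exI[of _ P]) (auto simp: X_topspace[symmetric] G_topspace R_iff)
  qed
qed

lemma G_inv: "continuous_map Gt Gt (\<lambda>z. (snd z, fst z))"
  unfolding continuous_map_def
proof (intro conjI allI impI)
  show "(\<lambda>z. (snd z, fst z)) \<in> topspace Gt \<rightarrow> topspace Gt" using G_sym by auto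
  fix W assume W: "openin Gt W"
  show "openin Gt {z \<in> topspace Gt. (snd z, fst z) \<in> W}"
  proof (rule G_openI)
    fix x y assume a: "(x, y) \<in> {z \<in> topspace Gt. (snd z, fst z) \<in> W}"
    then obtain n where n: "(x, y) \<in> R n" using G_arrow by auto
    have "(y, x) \<in> W" using a by simp
    then obtain U V where "openin X U" "openin X V" "y \<in> U" "x \<in> V" "(U \<times> V) \<inter> R n \<subseteq> W"
      using G_nbhd[OF W _ R_sym[OF n]] by blast
    then show "\<exists>n U V. openin X U \<and> openin X V \<and> x \<in> U \<and> y \<in> V \<and> (x, y) \<in> R n \<and> (U \<times> V) \<inter> R n \<subseteq> {z \<in> topspace Gt. (snd z, fst z) \<in> W}"
      using n R_sym G_topspace by (intro exI[of _ n] exI[of _ V] exI[of _ U]) auto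
  qed
qed

lemma G_snd: "continuous_map Gt X snd"
  using continuous_map_compose[OF G_inv G_fst] by (simp add: comp_def)

text \<open>Agreement at one level is the equaliser of two continuous maps into the Hausdorff space
  \<open>K m\<close>.\<close>

lemma R_closed: "closedin PP (R n)"
proof -
  have "closedin PP {z \<in> topspace PP. fst z m = snd z m}" for m
  proof -
    have "continuous_map PP (K m) (\<lambda>z. fst z m)" "continuous_map PP (K m) (\<lambda>z. snd z m)"
      using continuous_map_compose[OF continuous_map_fst X_coord] continuous_map_compose[OF continuous_map_snd X_coord]
      by (auto simp: comp_def)
    then show ?thesis by (rule closedin_continuous_maps_eq[OF K_Hausdorff])
  qed
  then have "closedin PP (\<Inter>m\<in>{n..}. {z \<in> topspace PP. fst z m = snd z m})" by (intro closedin_INT) auto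
  moreover have "(\<Inter>m\<in>{n..}. {z \<in> topspace PP. fst z m = snd z m}) = R n"
    by (auto simp: X_topspace R_iff)
  ultimately show ?thesis by simp
qed

text \<open>Compactness is inherited from the compact product and survives the change of topology
  because both topologies coincide on \<open>R n\<close>.\<close>

lemma R_compact: "compactin Gt (R n)"
proof -
  have "compact_space PP" by (simp add: compact_space_prod_topology X_compact)
  then have "compactin PP (R n)" using closedin_compact_space R_closed by blast
  then have "compactin (subtopology PP (R n)) (R n)" by (simp add: compactin_subtopology)
  then have "compactin (subtopology Gt (R n)) (R n)" by (simp add: G_sub)
  then show ?thesis by (simp add: compactin_subtopology)
qed

text \<open>The sets \<open>R n\<close> form an increasing open cover of the arrows. This ties
  compact supports to a single level.\<close>

lemma compact_in_level:
  assumes "compactin Gt S" shows "\<exists>n\<ge>1. S \<subseteq> R n"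
proof -
  have "S \<subseteq> \<Union>(range R)" using compactin_subset_topspace[OF assms] by (simp add: G_topspace)
  then obtain F where F: "finite F" "F \<subseteq> range R" "S \<subseteq> \<Union>F"
    using assms R_open unfolding compactin_def by (metis (no_types, lifting) rangeE)
  then obtain I where I: "finite I" "F = R ` I" by (meson finite_subset_image)
  \<comment> \<open>Inserting 1 covers an empty index set and forces the level to be at least 1,
    where nonempty initial segments exist.\<close>
  have "R i \<subseteq> R (Max (insert 1 I))" if "i \<in> I" for i using I that by (intro R_mono Max_ge) auto
  then have "S \<subseteq> R (Max (insert 1 I))" using F(3) I by blast
  moreover have "Max (insert 1 I) \<ge> 1" using I by simp
  ultimately show ?thesis by blast
qed

lemma composable_iff: "(g, h) \<in> gp_composable (labelled_groupoid D) \<longleftrightarrow> g \<in> topspace Gt \<and> h \<in> topspace Gt \<and> snd g = fst h"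
  by (cases g; cases h) (auto simp: gp_composable_def)

lemma labelled_topological_groupoid: "topological_groupoid (labelled_groupoid D)"
  unfolding topological_groupoid_def
proof (intro conjI)
  let ?G = "labelled_groupoid D"
  show "\<forall>g\<in>gp_arrows ?G. gp_src ?G g \<in> gp_arrows ?G \<and> gp_rng ?G g \<in> gp_arrows ?G \<and> gp_inv ?G g \<in> gp_arrows ?G \<and>
        gp_src ?G (gp_src ?G g) = gp_src ?G g \<and> gp_rng ?G (gp_src ?G g) = gp_src ?G g \<and>
        gp_src ?G (gp_rng ?G g) = gp_rng ?G g \<and> gp_rng ?G (gp_rng ?G g) = gp_rng ?G g \<and>
        gp_src ?G (gp_inv ?G g) = gp_rng ?G g \<and> gp_rng ?G (gp_inv ?G g) = gp_src ?G g \<and>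
        gp_comp ?G (gp_rng ?G g) g = g \<and> gp_comp ?G g (gp_src ?G g) = g \<and>
        gp_comp ?G g (gp_inv ?G g) = gp_rng ?G g \<and> gp_comp ?G (gp_inv ?G g) g = gp_src ?G g"
    using G_refl G_arrow_P G_sym by auto
  show "\<forall>(g, h)\<in>gp_composable ?G. gp_comp ?G g h \<in> gp_arrows ?G \<and>
        gp_src ?G (gp_comp ?G g h) = gp_src ?G h \<and> gp_rng ?G (gp_comp ?G g h) = gp_rng ?G g"
    using G_trans by (auto simp: composable_iff)
  show "\<forall>g h k. (g, h) \<in> gp_composable ?G \<and> (h, k) \<in> gp_composable ?G \<longrightarrow>
        gp_comp ?G (gp_comp ?G g h) k = gp_comp ?G g (gp_comp ?G h k)"
    by (auto simp: composable_iff)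
  show "continuous_map (gp_top ?G) (gp_top ?G) (gp_inv ?G)"
    using G_inv by (simp add: labelled_groupoid_def relation_groupoid_def case_prod_unfold)
  let ?CT = "subtopology (prod_topology Gt Gt) (gp_composable ?G)"
  have "continuous_map ?CT Gt (\<lambda>(g, h). gp_comp ?G g h)"
    unfolding continuous_map_def
  proof (intro conjI allI impI)
    show "(\<lambda>(g, h). gp_comp ?G g h) \<in> topspace ?CT \<rightarrow> topspace Gt"
      using G_trans by (auto simp: composable_iff)
    fix W assume W: "openin Gt W"
    show "openin ?CT {z \<in> topspace ?CT. (\<lambda>(g, h). gp_comp ?G g h) z \<in> W}"
    proof (subst openin_subopen, intro ballI)
      fix z assume z: "z \<in> {z \<in> topspace ?CT. (\<lambda>(g, h). gp_comp ?G g h) z \<in> W}"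
      then obtain x y w where zz: "z = ((x, y), (y, w))" "(x, y) \<in> topspace Gt" "(y, w) \<in> topspace Gt" "(x, w) \<in> W"
        by (auto simp: composable_iff)
      obtain n where n: "(x, y) \<in> R n" "(y, w) \<in> R n" using G_common zz by blast
      obtain U V where UV: "openin X U" "openin X V" "x \<in> U" "w \<in> V" "(U \<times> V) \<inter> R n \<subseteq> W"
        using G_nbhd[OF W zz(4) R_trans[OF n]] by blast
      \<comment> \<open>Only the outer ends need control: for factors in a common \<open>R n\<close>
        transitivity puts the product into \<open>R n\<close> again, whatever the middle path
        is.\<close>
      let ?A = "{g \<in> topspace Gt. fst g \<in> U} \<inter> R n" and ?B = "{g \<in> topspace Gt. snd g \<in> V} \<inter> R n"
      have "openin Gt ?A" "openin Gt ?B"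
        using openin_continuous_map_preimage[OF G_fst UV(1)] openin_continuous_map_preimage[OF G_snd UV(2)] R_open
        by (auto intro: openin_Int)
      then have "openin ?CT ((?A \<times> ?B) \<inter> gp_composable ?G)"
        unfolding openin_subtopology using openin_prod_Times_iff by blast
      moreover have "z \<in> (?A \<times> ?B) \<inter> gp_composable ?G" using zz n UV by (auto simp: composable_iff)
      moreover have "(?A \<times> ?B) \<inter> gp_composable ?G \<subseteq> {z \<in> topspace ?CT. (\<lambda>(g, h). gp_comp ?G g h) z \<in> W}"
      proof
        fix v assume v: "v \<in> (?A \<times> ?B) \<inter> gp_composable ?G"
        then obtain a b c where vv: "v = ((a, b), (b, c))" by (auto simp: composable_iff)
        then have "(a, c) \<in> (U \<times> V) \<inter> R n" using v R_trans by auto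
        then show "v \<in> {z \<in> topspace ?CT. (\<lambda>(g, h). gp_comp ?G g h) z \<in> W}" using UV(5) v vv by auto
      qed
      ultimately show "\<exists>T. openin ?CT T \<and> z \<in> T \<and> T \<subseteq> {z \<in> topspace ?CT. (\<lambda>(g, h). gp_comp ?G g h) z \<in> W}" by blast
    qed
  qed
  then show "continuous_map (subtopology (prod_topology (gp_top ?G) (gp_top ?G)) (gp_composable ?G)) (gp_top ?G)
       (\<lambda>(g, h). gp_comp ?G g h)" by simp
qed

end

subsection \<open>Norms of kernels\<close>

text \<open>\<open>kbound S f c\<close> says that the kernel \<open>f\<close> has norm at most \<open>c\<close> on \<open>\<ell>\<^sup>2(S)\<close>; testing on finite
  subsets of \<open>S\<close> avoids all questions of summability.\<close>

definition kbound :: "'p set \<Rightarrow> ('p \<times> 'p \<Rightarrow> complex) \<Rightarrow> real \<Rightarrow> bool" where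
  "kbound S f c \<longleftrightarrow> 0 \<le> c \<and> (\<forall>F v. finite F \<longrightarrow> F \<subseteq> S \<longrightarrow>
     L2_set (\<lambda>x. cmod (\<Sum>z\<in>F. f (x, z) * v z)) F \<le> c * L2_set (\<lambda>z. cmod (v z)) F)"

lemma kboundI:
  assumes "0 \<le> c" "\<And>F v. finite F \<Longrightarrow> F \<subseteq> S \<Longrightarrow>
     L2_set (\<lambda>x. cmod (\<Sum>z\<in>F. f (x, z) * v z)) F \<le> c * L2_set (\<lambda>z. cmod (v z)) F"
  shows "kbound S f c"
  using assms by (simp add: kbound_def)

lemma kboundD:
  assumes "kbound S f c" "finite F" "F \<subseteq> S"
  shows "L2_set (\<lambda>x. cmod (\<Sum>z\<in>F. f (x, z) * v z)) F \<le> c * L2_set (\<lambda>z. cmod (v z)) F"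
  using assms by (simp add: kbound_def)

lemma kbound_nonneg: "kbound S f c \<Longrightarrow> 0 \<le> c"
  by (simp add: kbound_def)

lemma L2_set_subset: "finite B \<Longrightarrow> A \<subseteq> B \<Longrightarrow> L2_set f A \<le> L2_set f B"
  unfolding L2_set_def by (intro real_sqrt_le_mono sum_mono2) auto

text \<open>Extending vectors by zero shows that compressing a kernel to a smaller set does not
  raise its bound. A finite part of a tail class can thus be treated through the whole
  class.\<close>

lemma kbound_subset:
  assumes "finite B" "A \<subseteq> B" "0 \<le> c"
    and b: "\<And>v. L2_set (\<lambda>x. cmod (\<Sum>z\<in>B. f (x, z) * v z)) B \<le> c * L2_set (\<lambda>z. cmod (v z)) B"
  shows "L2_set (\<lambda>x. cmod (\<Sum>z\<in>A. f (x, z) * v z)) A \<le> c * L2_set (\<lambda>z. cmod (v z)) A"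
proof -
  let ?v = "\<lambda>z. if z \<in> A then v z else 0"
  have s: "(\<Sum>z\<in>B. f (x, z) * ?v z) = (\<Sum>z\<in>A. f (x, z) * v z)" for x
    by (rule sum.mono_neutral_cong_right) (use assms in auto)
  have "(\<Sum>z\<in>B. (cmod (?v z))\<^sup>2) = (\<Sum>z\<in>A. (cmod (v z))\<^sup>2)"
    by (rule sum.mono_neutral_cong_right) (use assms in auto)
  then have l: "L2_set (\<lambda>z. cmod (?v z)) B = L2_set (\<lambda>z. cmod (v z)) A" by (simp add: L2_set_def)
  have "L2_set (\<lambda>x. cmod (\<Sum>z\<in>A. f (x, z) * v z)) A \<le> L2_set (\<lambda>x. cmod (\<Sum>z\<in>B. f (x, z) * ?v z)) B"
    unfolding s by (rule L2_set_subset[OF assms(1,2)])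
  also have "\<dots> \<le> c * L2_set (\<lambda>z. cmod (?v z)) B" by (rule b)
  finally show ?thesis unfolding l .
qed

lemma kbound_cong:
  assumes "kbound S f c" "\<And>x y. x \<in> S \<Longrightarrow> y \<in> S \<Longrightarrow> f (x, y) = g (x, y)"
  shows "kbound S g c"
proof (rule kboundI[OF kbound_nonneg[OF assms(1)]])
  fix F v assume F: "finite F" "F \<subseteq> S"
  have "L2_set (\<lambda>x. cmod (\<Sum>z\<in>F. g (x, z) * v z)) F = L2_set (\<lambda>x. cmod (\<Sum>z\<in>F. f (x, z) * v z)) F"
    using F assms(2) by (intro L2_set_cong arg_cong[where f = cmod] sum.cong) (auto simp: subset_iff)
  then show "L2_set (\<lambda>x. cmod (\<Sum>z\<in>F. g (x, z) * v z)) F \<le> c * L2_set (\<lambda>z. cmod (v z)) F"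
    using kboundD[OF assms(1) F] by simp
qed

lemma kbound_add:
  assumes "kbound S f c" "kbound S g d" shows "kbound S (\<lambda>z. f z + g z) (c + d)"
proof (rule kboundI)
  show "0 \<le> c + d" using assms by (simp add: kbound_def)
  fix F v assume F: "finite F" "F \<subseteq> S"
  have "L2_set (\<lambda>x. cmod (\<Sum>z\<in>F. (f (x, z) + g (x, z)) * v z)) F
      \<le> L2_set (\<lambda>x. cmod (\<Sum>z\<in>F. f (x, z) * v z) + cmod (\<Sum>z\<in>F. g (x, z) * v z)) F"
    by (intro L2_set_mono) (auto simp: distrib_right sum.distrib norm_triangle_ineq)
  also have "\<dots> \<le> L2_set (\<lambda>x. cmod (\<Sum>z\<in>F. f (x, z) * v z)) F + L2_set (\<lambda>x. cmod (\<Sum>z\<in>F. g (x, z) * v z)) F"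
    by (rule L2_set_triangle_ineq)
  also have "\<dots> \<le> (c + d) * L2_set (\<lambda>z. cmod (v z)) F"
    using kboundD[OF assms(1) F, of v] kboundD[OF assms(2) F, of v] by (simp add: distrib_right)
  finally show "L2_set (\<lambda>x. cmod (\<Sum>z\<in>F. (f (x, z) + g (x, z)) * v z)) F \<le> (c + d) * L2_set (\<lambda>z. cmod (v z)) F" .
qed

lemma kbound_scale:
  assumes "kbound S f c" shows "kbound S (\<lambda>z. a * f z) (cmod a * c)"
proof (rule kboundI)
  show "0 \<le> cmod a * c" using assms by (simp add: kbound_def)
  fix F v assume F: "finite F" "F \<subseteq> S"
  have "(\<Sum>z\<in>F. (a * f (x, z)) * v z) = a * (\<Sum>z\<in>F. f (x, z) * v z)" for x
    by (simp add: sum_distrib_left mult.assoc)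
  then have "L2_set (\<lambda>x. cmod (\<Sum>z\<in>F. (a * f (x, z)) * v z)) F = cmod a * L2_set (\<lambda>x. cmod (\<Sum>z\<in>F. f (x, z) * v z)) F"
    by (simp add: norm_mult L2_set_right_distrib)
  also have "\<dots> \<le> cmod a * (c * L2_set (\<lambda>z. cmod (v z)) F)"
    using kboundD[OF assms F] by (intro mult_left_mono) auto
  finally show "L2_set (\<lambda>x. cmod (\<Sum>z\<in>F. (a * f (x, z)) * v z)) F \<le> cmod a * c * L2_set (\<lambda>z. cmod (v z)) F"
    by (simp add: mult.assoc)
qed

lemma kbound_zero: "kbound S (\<lambda>z. 0) 0"
  by (rule kboundI) (auto simp: L2_set_def)

lemma kbound_sum:
  assumes "finite I" "\<And>i. i \<in> I \<Longrightarrow> kbound S (f i) (c i)"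
  shows "kbound S (\<lambda>z. \<Sum>i\<in>I. f i z) (\<Sum>i\<in>I. c i)"
  using assms by (induction I rule: finite_induct) (auto simp: kbound_zero intro: kbound_add)

text \<open>Bounds multiply as for composed operators, but the intermediate points may leave the
  test set \<open>F\<close>; hence the larger finite set \<open>E\<close> over which the product is
  summed.\<close>

lemma kbound_mult:
  assumes f: "kbound S f c" and g: "kbound S g d"
    and h: "\<And>F. finite F \<Longrightarrow> F \<subseteq> S \<Longrightarrow> \<exists>E. finite E \<and> F \<subseteq> E \<and> E \<subseteq> S \<and>
      (\<forall>x\<in>F. \<forall>z\<in>F. h (x, z) = (\<Sum>y\<in>E. f (x, y) * g (y, z)))"
  shows "kbound S h (c * d)"
proof (rule kboundI)
  have cd: "0 \<le> c" "0 \<le> d" using f g by (auto simp: kbound_def)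
  then show "0 \<le> c * d" by simp
  fix F and v :: "'a \<Rightarrow> complex" assume F: "finite F" "F \<subseteq> S"
  obtain E where E: "finite E" "F \<subseteq> E" "E \<subseteq> S" "\<And>x z. x \<in> F \<Longrightarrow> z \<in> F \<Longrightarrow> h (x, z) = (\<Sum>y\<in>E. f (x, y) * g (y, z))"
    using h[OF F] by blast
  let ?v = "\<lambda>z. if z \<in> F then v z else 0"
  let ?w = "\<lambda>y. \<Sum>z\<in>E. g (y, z) * ?v z"
  have w: "?w y = (\<Sum>z\<in>F. g (y, z) * v z)" for y
    by (rule sum.mono_neutral_cong_right) (use E in auto)
  have eq: "(\<Sum>z\<in>F. h (x, z) * v z) = (\<Sum>y\<in>E. f (x, y) * ?w y)" if "x \<in> F" for x
  proof -
    have "(\<Sum>z\<in>F. h (x, z) * v z) = (\<Sum>z\<in>F. \<Sum>y\<in>E. f (x, y) * (g (y, z) * v z))"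
      using E(4)[OF that] by (intro sum.cong refl) (simp add: sum_distrib_right mult.assoc)
    also have "\<dots> = (\<Sum>y\<in>E. \<Sum>z\<in>F. f (x, y) * (g (y, z) * v z))" by (rule sum.swap)
    finally show ?thesis unfolding w by (simp add: sum_distrib_left)
  qed
  have "L2_set (\<lambda>x. cmod (\<Sum>z\<in>F. h (x, z) * v z)) F = L2_set (\<lambda>x. cmod (\<Sum>y\<in>E. f (x, y) * ?w y)) F"
    by (intro L2_set_cong refl) (simp only: eq)
  also have "\<dots> \<le> L2_set (\<lambda>x. cmod (\<Sum>y\<in>E. f (x, y) * ?w y)) E" by (rule L2_set_subset[OF E(1,2)])
  also have "\<dots> \<le> c * L2_set (\<lambda>y. cmod (?w y)) E" by (rule kboundD[OF f E(1,3)])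
  also have "\<dots> \<le> c * (d * L2_set (\<lambda>z. cmod (?v z)) E)"
    by (rule mult_left_mono[OF kboundD[OF g E(1,3)] cd(1)])
  also have "L2_set (\<lambda>z. cmod (?v z)) E = L2_set (\<lambda>z. cmod (v z)) F"
  proof -
    have "(\<Sum>z\<in>E. (cmod (?v z))\<^sup>2) = (\<Sum>z\<in>F. (cmod (v z))\<^sup>2)"
      by (rule sum.mono_neutral_cong_right) (use E in auto)
    then show ?thesis by (simp add: L2_set_def)
  qed
  finally show "L2_set (\<lambda>x. cmod (\<Sum>z\<in>F. h (x, z) * v z)) F \<le> c * d * L2_set (\<lambda>z. cmod (v z)) F"
    by (simp add: mult.assoc)
qed

text \<open>With \<open>w\<close> the adjoint applied to \<open>v\<close>, the squared norm of
  \<open>w\<close> is the pairing of \<open>v\<close> with the kernel applied to \<open>w\<close>,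
  hence at most \<open>c\<close> times the norms of \<open>v\<close> and \<open>w\<close>; one norm
  of \<open>w\<close> cancels.\<close>

lemma kbound_adjoint:
  assumes f: "kbound S f c" shows "kbound S (\<lambda>(x, y). cnj (f (y, x))) c"
proof (rule kboundI[OF kbound_nonneg[OF f]])
  fix F :: "'a set" and v :: "'a \<Rightarrow> complex" assume F: "finite F" "F \<subseteq> S"
  let ?w = "\<lambda>x. \<Sum>z\<in>F. cnj (f (z, x)) * v z"
  let ?u = "\<lambda>z. \<Sum>x\<in>F. f (z, x) * ?w x"
  let ?W = "L2_set (\<lambda>x. cmod (?w x)) F" and ?V = "L2_set (\<lambda>z. cmod (v z)) F"
  have c: "0 \<le> c" using f by (simp add: kbound_def)
  have "complex_of_real (\<Sum>x\<in>F. (cmod (?w x))\<^sup>2) = (\<Sum>x\<in>F. ?w x * cnj (?w x))"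
    unfolding of_real_sum by (intro sum.cong refl complex_norm_square)
  also have "\<dots> = (\<Sum>x\<in>F. \<Sum>z\<in>F. cnj (f (z, x)) * v z * cnj (?w x))"
    by (simp add: sum_distrib_right)
  also have "\<dots> = (\<Sum>z\<in>F. \<Sum>x\<in>F. cnj (f (z, x)) * v z * cnj (?w x))" by (rule sum.swap)
  also have "\<dots> = (\<Sum>z\<in>F. v z * cnj (?u z))"
    by (intro sum.cong refl) (simp add: sum_distrib_left mult_ac)
  finally have "(\<Sum>x\<in>F. (cmod (?w x))\<^sup>2) = cmod (\<Sum>z\<in>F. v z * cnj (?u z))"
    by (metis (no_types, lifting) norm_of_real abs_of_nonneg sum_nonneg zero_le_power2)
  also have "\<dots> \<le> (\<Sum>z\<in>F. \<bar>cmod (v z)\<bar> * \<bar>cmod (?u z)\<bar>)"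
    by (rule order_trans[OF norm_sum]) (simp only: norm_mult complex_mod_cnj abs_norm_cancel order_refl)
  also have "\<dots> \<le> ?V * L2_set (\<lambda>z. cmod (?u z)) F" by (rule L2_set_mult_ineq)
  also have "\<dots> \<le> ?V * (c * ?W)" by (rule mult_left_mono[OF kboundD[OF f F]]) simp
  finally have le: "?W * ?W \<le> c * ?V * ?W"
    by (simp add: L2_set_def sum_nonneg mult_ac)
  have "?W \<le> c * ?V"
  proof (cases "?W = 0")
    case True
    then show ?thesis using c by simp
  next
    case False
    then have "?W > 0" using L2_set_nonneg[of "\<lambda>x. cmod (?w x)" F] by linarith
    then show ?thesis using le mult_le_cancel_right_pos by blast
  qed
  then show "L2_set (\<lambda>x. cmod (\<Sum>z\<in>F. (case (x, z) of (x, y) \<Rightarrow> cnj (f (y, x))) * v z)) F \<le> c * ?V" by simp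
qed

text \<open>The kernel is tested on the unit vector at \<open>y\<close>; the set
  \<open>{x, y}\<close> serves the case \<open>x = y\<close> as well.\<close>

lemma kbound_entry:
  assumes "kbound S f c" "x \<in> S" "y \<in> S" shows "cmod (f (x, y)) \<le> c"
proof -
  let ?v = "\<lambda>z. if z = y then 1 else 0 :: complex"
  have s: "(\<Sum>z\<in>{x, y}. f (a, z) * ?v z) = f (a, y)" for a
  proof -
    have "(\<Sum>z\<in>{x, y}. f (a, z) * ?v z) = (\<Sum>z\<in>{y}. f (a, z) * ?v z)"
      by (rule sum.mono_neutral_right) auto
    then show ?thesis by simp
  qed
  have "(\<Sum>z\<in>{x, y}. (cmod (?v z))\<^sup>2) = (\<Sum>z\<in>{y}. (cmod (?v z))\<^sup>2)"
    by (rule sum.mono_neutral_right) auto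
  then have n: "L2_set (\<lambda>z. cmod (?v z)) {x, y} = 1" by (simp add: L2_set_def)
  have "cmod (f (x, y)) \<le> L2_set (\<lambda>a. cmod (f (a, y))) {x, y}"
    by (rule member_le_L2_set) auto
  also have "\<dots> \<le> c * L2_set (\<lambda>z. cmod (?v z)) {x, y}"
    using kboundD[OF assms(1), of "{x, y}" ?v] assms(2,3) by (simp only: s) simp
  finally show ?thesis unfolding n by simp
qed

text \<open>A kernel supported on the graph of a partial bijection is a weighted partial isometry.\<close>

lemma kbound_partial_bij:
  assumes "0 \<le> s" "\<And>x y. x \<in> S \<Longrightarrow> y \<in> S \<Longrightarrow> cmod (f (x, y)) \<le> s"
    and row: "\<And>x y y'. f (x, y) \<noteq> 0 \<Longrightarrow> f (x, y') \<noteq> 0 \<Longrightarrow> y = y'"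
    and col: "\<And>x x' y. f (x, y) \<noteq> 0 \<Longrightarrow> f (x', y) \<noteq> 0 \<Longrightarrow> x = x'"
  shows "kbound S f s"
proof (rule kboundI[OF assms(1)])
  fix F v assume F: "finite F" "F \<subseteq> S"
  \<comment> \<open>\<open>?n x z\<close> charges the mass of \<open>v\<close> at \<open>z\<close>
    to each row \<open>x\<close> meeting column \<open>z\<close>; a column meets at most one row, so
    after exchanging the sums no mass is counted twice.\<close>
  let ?n = "\<lambda>x z. if f (x, z) \<noteq> 0 then (cmod (v z))\<^sup>2 else 0"
  have 1: "(cmod (\<Sum>z\<in>F. f (x, z) * v z))\<^sup>2 \<le> (\<Sum>z\<in>F. s\<^sup>2 * ?n x z)" if x: "x \<in> F" for x
  proof (cases "\<exists>z\<in>F. f (x, z) \<noteq> 0")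
    case True
    then obtain y where y: "y \<in> F" "f (x, y) \<noteq> 0" by blast
    have "(\<Sum>z\<in>F. f (x, z) * v z) = (\<Sum>z\<in>{y}. f (x, z) * v z)"
    proof (rule sum.mono_neutral_right[OF F(1)])
      show "\<forall>z\<in>F - {y}. f (x, z) * v z = 0" using row[OF y(2)] by (metis DiffD2 mult_zero_left singletonI)
    qed (use y in simp)
    then have "(cmod (\<Sum>z\<in>F. f (x, z) * v z))\<^sup>2 = (cmod (f (x, y)))\<^sup>2 * (cmod (v y))\<^sup>2"
      by (simp add: norm_mult power_mult_distrib)
    also have "\<dots> \<le> s\<^sup>2 * (cmod (v y))\<^sup>2"
      using assms(2)[of x y] x y F by (intro mult_right_mono power_mono) auto
    also have "\<dots> = (\<Sum>z\<in>{y}. s\<^sup>2 * ?n x z)" using y by simp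
    also have "\<dots> \<le> (\<Sum>z\<in>F. s\<^sup>2 * ?n x z)" using y F by (intro sum_mono2) auto
    finally show ?thesis .
  next
    case False
    then have "(\<Sum>z\<in>F. f (x, z) * v z) = 0" by (intro sum.neutral) auto
    then show ?thesis by (simp add: sum_nonneg)
  qed
  have 2: "(\<Sum>x\<in>F. ?n x z) \<le> (cmod (v z))\<^sup>2" if z: "z \<in> F" for z
  proof (cases "\<exists>x\<in>F. f (x, z) \<noteq> 0")
    case True
    then obtain x where x: "x \<in> F" "f (x, z) \<noteq> 0" by blast
    have "(\<Sum>x\<in>F. ?n x z) = (\<Sum>x\<in>{x}. ?n x z)"
    proof (rule sum.mono_neutral_right[OF F(1)])
      show "\<forall>x'\<in>F - {x}. ?n x' z = 0" using col[OF x(2)] by (metis DiffD2 singletonI)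
    qed (use x in simp)
    then show ?thesis using x by simp
  next
    case False
    then have "(\<Sum>x\<in>F. ?n x z) = 0" by (intro sum.neutral) auto
    then show ?thesis by simp
  qed
  have "(\<Sum>x\<in>F. (cmod (\<Sum>z\<in>F. f (x, z) * v z))\<^sup>2) \<le> (\<Sum>x\<in>F. \<Sum>z\<in>F. s\<^sup>2 * ?n x z)"
    by (intro sum_mono 1)
  also have "\<dots> = (\<Sum>z\<in>F. s\<^sup>2 * (\<Sum>x\<in>F. ?n x z))" by (subst sum.swap) (simp add: sum_distrib_left)
  also have "\<dots> \<le> (\<Sum>z\<in>F. s\<^sup>2 * (cmod (v z))\<^sup>2)" by (intro sum_mono mult_left_mono 2) auto
  also have "\<dots> = s\<^sup>2 * (\<Sum>z\<in>F. (cmod (v z))\<^sup>2)" by (simp add: sum_distrib_left)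
  finally have "L2_set (\<lambda>x. cmod (\<Sum>z\<in>F. f (x, z) * v z)) F \<le> sqrt (s\<^sup>2 * (\<Sum>z\<in>F. (cmod (v z))\<^sup>2))"
    unfolding L2_set_def by (rule real_sqrt_le_mono)
  then show "L2_set (\<lambda>x. cmod (\<Sum>z\<in>F. f (x, z) * v z)) F \<le> s * L2_set (\<lambda>z. cmod (v z)) F"
    using assms(1) by (simp add: L2_set_def real_sqrt_mult)
qed

text \<open>A kernel supported on the equivalence relation of equal values of \<open>k\<close> is block diagonal,
  so it may be estimated block by block.\<close>

lemma kbound_blocks:
  assumes "0 \<le> c" and supp: "\<And>x y. f (x, y) \<noteq> 0 \<Longrightarrow> k x = k y"
    and b: "\<And>F v. finite F \<Longrightarrow> F \<subseteq> S \<Longrightarrow> F \<noteq> {} \<Longrightarrow> (\<And>x y. x \<in> F \<Longrightarrow> y \<in> F \<Longrightarrow> k x = k y) \<Longrightarrow>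
     L2_set (\<lambda>x. cmod (\<Sum>z\<in>F. f (x, z) * v z)) F \<le> c * L2_set (\<lambda>z. cmod (v z)) F"
  shows "kbound S f c"
proof (rule kboundI[OF assms(1)])
  fix F v assume F: "finite F" "F \<subseteq> S"
  let ?C = "\<lambda>t. {x \<in> F. k x = t}"
  have blk: "(\<Sum>x\<in>?C t. (cmod (\<Sum>z\<in>F. f (x, z) * v z))\<^sup>2) \<le> c\<^sup>2 * (\<Sum>z\<in>?C t. (cmod (v z))\<^sup>2)" if t: "t \<in> k ` F" for t
  proof -
    have eq: "(\<Sum>z\<in>F. f (x, z) * v z) = (\<Sum>z\<in>?C t. f (x, z) * v z)" if "x \<in> ?C t" for x
      by (rule sum.mono_neutral_right) (use F that supp in auto)
    have "L2_set (\<lambda>x. cmod (\<Sum>z\<in>?C t. f (x, z) * v z)) (?C t) \<le> c * L2_set (\<lambda>z. cmod (v z)) (?C t)"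
      by (rule b) (use F t in auto)
    then have "(L2_set (\<lambda>x. cmod (\<Sum>z\<in>?C t. f (x, z) * v z)) (?C t))\<^sup>2 \<le> (c * L2_set (\<lambda>z. cmod (v z)) (?C t))\<^sup>2"
      by (intro power_mono) auto
    then have "(\<Sum>x\<in>?C t. (cmod (\<Sum>z\<in>?C t. f (x, z) * v z))\<^sup>2) \<le> c\<^sup>2 * (\<Sum>z\<in>?C t. (cmod (v z))\<^sup>2)"
      by (simp add: L2_set_def sum_nonneg power_mult_distrib)
    moreover have "(\<Sum>x\<in>?C t. (cmod (\<Sum>z\<in>F. f (x, z) * v z))\<^sup>2) = (\<Sum>x\<in>?C t. (cmod (\<Sum>z\<in>?C t. f (x, z) * v z))\<^sup>2)"
      by (rule sum.cong[OF refl]) (simp only: eq)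
    ultimately show ?thesis by simp
  qed
  have "(\<Sum>x\<in>F. (cmod (\<Sum>z\<in>F. f (x, z) * v z))\<^sup>2) = (\<Sum>t\<in>k ` F. \<Sum>x\<in>?C t. (cmod (\<Sum>z\<in>F. f (x, z) * v z))\<^sup>2)"
    by (rule sum.image_gen[OF F(1)])
  also have "\<dots> \<le> (\<Sum>t\<in>k ` F. c\<^sup>2 * (\<Sum>z\<in>?C t. (cmod (v z))\<^sup>2))" by (intro sum_mono blk)
  also have "\<dots> = c\<^sup>2 * (\<Sum>z\<in>F. (cmod (v z))\<^sup>2)"
    by (simp only: sum_distrib_left[symmetric] sum.image_gen[OF F(1), of "\<lambda>z. (cmod (v z))\<^sup>2" k])
  finally have "L2_set (\<lambda>x. cmod (\<Sum>z\<in>F. f (x, z) * v z)) F \<le> sqrt (c\<^sup>2 * (\<Sum>z\<in>F. (cmod (v z))\<^sup>2))"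
    unfolding L2_set_def by (rule real_sqrt_le_mono)
  then show "L2_set (\<lambda>x. cmod (\<Sum>z\<in>F. f (x, z) * v z)) F \<le> c * L2_set (\<lambda>z. cmod (v z)) F"
    using assms(1) by (simp add: L2_set_def real_sqrt_mult)
qed

section \<open>Finite tail classes, convolution and the reduced norm\<close>

context AH begin

abbreviation "GG \<equiv> labelled_groupoid D"

definition suppR :: "nat \<Rightarrow> ((nat \<Rightarrow> 'e bedge \<times> 'a option) \<times> (nat \<Rightarrow> 'e bedge \<times> 'a option) \<Rightarrow> complex) \<Rightarrow> bool" where
  "suppR n f \<longleftrightarrow> (\<forall>x y. f (x, y) \<noteq> 0 \<longrightarrow> (x, y) \<in> R n)"

definition CR :: "nat \<Rightarrow> ((nat \<Rightarrow> 'e bedge \<times> 'a option) \<times> (nat \<Rightarrow> 'e bedge \<times> 'a option) \<Rightarrow> complex) set" where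
  "CR n = {f. suppR n f \<and> continuous_map (subtopology PP (R n)) euclidean f}"

definition cls :: "nat \<Rightarrow> (nat \<Rightarrow> 'e bedge \<times> 'a option) \<Rightarrow> (nat \<Rightarrow> 'e bedge \<times> 'a option) set" where
  "cls n x = {y. (x, y) \<in> R n}"

text \<open>Shifted by \<open>n\<close>, so that agreement from level \<open>n\<close> on becomes
  equality of two values, the shape that \<open>kbound_blocks\<close> expects.\<close>

definition tl_of :: "nat \<Rightarrow> (nat \<Rightarrow> 'e bedge \<times> 'a option) \<Rightarrow> nat \<Rightarrow> 'e bedge \<times> 'a option" where
  "tl_of n x = (\<lambda>m. x (m + n))"

lemma tl_of_eq: "tl_of n x = tl_of n y \<longleftrightarrow> (\<forall>m\<ge>n. x m = y m)"
  unfolding tl_of_def fun_eq_iff by (metis le_add2 le_Suc_ex add.commute)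

lemma R_tl: "(x, y) \<in> R n \<longleftrightarrow> x \<in> P \<and> y \<in> P \<and> tl_of n x = tl_of n y"
  by (simp add: R_iff tl_of_eq)

lemma suppRD: "suppR n f \<Longrightarrow> (x, y) \<notin> R n \<Longrightarrow> f (x, y) = 0"
  by (auto simp: suppR_def)

lemma suppR_mono: "suppR n f \<Longrightarrow> n \<le> m \<Longrightarrow> suppR m f"
  unfolding suppR_def using R_mono by blast

lemma R_eqI:
  assumes "(x, y) \<in> R n" "init_seg n (fst \<circ> x) = init_seg n (fst \<circ> y)"
  shows "x = y"
proof -
  have "(x, y) \<in> R 0" using R_char[OF assms(1), of 0] assms(2) by (auto simp: init_seg_eq_iff)
  then show ?thesis by (auto simp: R_iff)
qed

definition fpaths :: "nat \<Rightarrow> 'e bedge list set" where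
  "fpaths n = {p \<in> fin_paths D. length p = n}"

lemma finite_fpaths: "finite (fpaths n)"
proof -
  have "fpaths n \<subseteq> {p. set p \<subseteq> (\<Union>k<n. bedges D k) \<and> length p = n}"
    by (auto simp: fpaths_def fin_paths_def in_set_conv_nth intro!: bexI)
  moreover have "finite {p. set p \<subseteq> (\<Union>k<n. bedges D k) \<and> length p = n}"
    by (intro finite_lists_length_eq) (auto simp: finite_bedges)
  ultimately show ?thesis by (rule finite_subset)
qed

lemma init_in_fpaths: "n \<ge> 1 \<Longrightarrow> x \<in> P \<Longrightarrow> init_seg n (fst \<circ> x) \<in> fpaths n"
  using init_seg_fin_path[OF pathD(5), of x "n - 1"] by (simp add: fpaths_def)

text \<open>Members of a class share their tail, so they are told apart by their initial segments,
  of which there are finitely many.\<close>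

lemma finite_cls1: "n \<ge> 1 \<Longrightarrow> finite (cls n x)"
proof -
  assume n: "n \<ge> 1"
  have "inj_on (\<lambda>y. init_seg n (fst \<circ> y)) (cls n x)"
    by (rule inj_onI) (auto simp: cls_def intro: R_eqI R_trans R_sym)
  moreover have "(\<lambda>y. init_seg n (fst \<circ> y)) ` cls n x \<subseteq> fpaths n"
    using init_in_fpaths[OF n] by (auto simp: cls_def R_iff)
  ultimately show ?thesis using finite_fpaths finite_imageD finite_subset by blast
qed

lemma finite_cls: "finite (cls n x)"
  using finite_cls1[of "Suc n" x] R_mono[of n "Suc n"] by (auto simp: cls_def intro: finite_subset[rotated])

lemma src_fibre_GG: "z \<in> P \<Longrightarrow> src_fibre GG (z, z) = (\<lambda>y. (y, z)) ` {y. (y, z) \<in> topspace Gt}"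
  by (auto simp: src_fibre_def)

text \<open>Arrows with source \<open>z\<close> are pairs \<open>(y, z)\<close>, and
  \<open>(x, z)\<close> times the inverse of \<open>(y, z)\<close> is \<open>(x, y)\<close>; so the
  sum over the source fibre is a matrix product. It is finite once all nonzero terms lie over
  \<open>E\<close>.\<close>

lemma conv_eq:
  assumes "(x, z) \<in> topspace Gt" "finite E" "\<And>y. y \<in> E \<Longrightarrow> (y, z) \<in> topspace Gt"
    and 0: "\<And>y. (y, z) \<in> topspace Gt \<Longrightarrow> y \<notin> E \<Longrightarrow> f (x, y) * g (y, z) = 0"
  shows "convolve GG f g (x, z) = (\<Sum>y\<in>E. f (x, y) * g (y, z))"
proof -
  have z: "z \<in> P" using assms(1) G_arrow_P by blast
  let ?I = "{y. (y, z) \<in> topspace Gt}"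
  have "convolve GG f g (x, z) = (\<Sum>\<^sub>\<infinity>h\<in>(\<lambda>y. (y, z)) ` ?I. f (gp_comp GG (x, z) (gp_inv GG h)) * g h)"
    using assms(1) src_fibre_GG[OF z] by (simp add: convolve_def)
  also have "\<dots> = (\<Sum>\<^sub>\<infinity>y\<in>?I. f (x, y) * g (y, z))"
    by (subst infsum_reindex) (auto simp: inj_on_def comp_def)
  also have "\<dots> = (\<Sum>\<^sub>\<infinity>y\<in>E. f (x, y) * g (y, z))"
    by (rule infsum_cong_neutral) (use assms(3) 0 in auto)
  also have "\<dots> = (\<Sum>y\<in>E. f (x, y) * g (y, z))" using assms(2) by simp
  finally show ?thesis .
qed

lemma conv_outside: "g \<notin> topspace Gt \<Longrightarrow> convolve GG f \<xi> g = 0"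
  by (simp add: convolve_def)

lemma conv_cls:
  assumes "suppR n f" "(x, z) \<in> topspace Gt"
  shows "convolve GG f g (x, z) = (\<Sum>y\<in>cls n x. f (x, y) * g (y, z))"
proof (rule conv_eq[OF assms(2) finite_cls])
  fix y
  show "(y, z) \<in> topspace Gt" if "y \<in> cls n x"
    using that assms(2) G_trans G_arrow R_sym by (auto simp: cls_def) blast
  show "f (x, y) * g (y, z) = 0" if "y \<notin> cls n x"
    using that suppRD[OF assms(1)] by (auto simp: cls_def)
qed

text \<open>The reduced norm is the norm of the kernel as an operator on the square summable functions
  on the path space; the regular representations are its restrictions to the tail-equivalence
  classes.\<close>

lemma convolve_ell2:
  assumes s: "suppR n f" and k: "kbound P f c" and w: "w \<in> P" and xi: "\<xi> \<in> ell2 (src_fibre GG (w, w))"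
  shows "convolve GG f \<xi> \<in> ell2 (src_fibre GG (w, w))"
    "ell2_norm (src_fibre GG (w, w)) (convolve GG f \<xi>) \<le> c * ell2_norm (src_fibre GG (w, w)) \<xi>"
proof -
  let ?I = "src_fibre GG (w, w)" and ?\<eta> = "convolve GG f \<xi>"
  have c: "0 \<le> c" using k by (simp add: kbound_def)
  have sx: "(\<lambda>g. (cmod (\<xi> g))\<^sup>2) summable_on ?I" using xi by (simp add: ell2_def)
  let ?N = "\<Sum>\<^sub>\<infinity>g\<in>?I. (cmod (\<xi> g))\<^sup>2"
  have N: "0 \<le> ?N" by (intro infsum_nonneg) auto
  have fin: "(\<Sum>g\<in>F. (cmod (?\<eta> g))\<^sup>2) \<le> c\<^sup>2 * ?N" if F: "finite F" "F \<subseteq> ?I" for F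
  proof -
    have Fw: "g = (fst g, w)" "(fst g, w) \<in> topspace Gt" if "g \<in> F" for g
      using F that src_fibre_GG[OF w] by auto
    define F' where "F' = fst ` F"
    \<comment> \<open>All points that \<open>f\<close> can reach from \<open>F'\<close>; on this
      finite set the convolution at points of \<open>F'\<close> is a finite matrix product.\<close>
    define E where "E = (\<Union>x\<in>F'. cls n x)"
    have F': "finite F'" "F = (\<lambda>x. (x, w)) ` F'" using F(1) Fw by (auto simp: F'_def image_image)
    have arr: "(x, w) \<in> topspace Gt" if "x \<in> F'" for x using that Fw by (auto simp: F'_def)
    have E: "finite E" using F'(1) by (auto simp: E_def finite_cls)
    have sub: "F' \<subseteq> E" using arr G_arrow_P R_refl by (fastforce simp: E_def cls_def)
    have Earr: "(y, w) \<in> topspace Gt" if "y \<in> E" for y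
      using that arr G_trans G_arrow R_sym unfolding E_def cls_def by blast
    then have EP: "E \<subseteq> P" using G_arrow_P by blast
    have val: "?\<eta> (x, w) = (\<Sum>y\<in>E. f (x, y) * \<xi> (y, w))" if x: "x \<in> F'" for x
    proof (rule conv_eq[OF arr[OF x] E Earr])
      fix y assume "y \<notin> E"
      then have "(x, y) \<notin> R n" using x by (auto simp: E_def cls_def)
      then show "f (x, y) * \<xi> (y, w) = 0" using suppRD[OF s] by simp
    qed
    have inj: "inj_on (\<lambda>x. (x, w)) A" for A :: "(nat \<Rightarrow> 'e bedge \<times> 'a option) set" by (auto simp: inj_on_def)
    have "(\<Sum>g\<in>F. (cmod (?\<eta> g))\<^sup>2) = (\<Sum>x\<in>F'. (cmod (\<Sum>y\<in>E. f (x, y) * \<xi> (y, w)))\<^sup>2)"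
      unfolding F'(2) sum.reindex[OF inj] by (intro sum.cong refl) (simp add: val)
    also have "\<dots> \<le> (\<Sum>x\<in>E. (cmod (\<Sum>y\<in>E. f (x, y) * \<xi> (y, w)))\<^sup>2)" using sub E by (intro sum_mono2) auto
    also have "\<dots> = (L2_set (\<lambda>x. cmod (\<Sum>y\<in>E. f (x, y) * \<xi> (y, w))) E)\<^sup>2" by (simp add: L2_set_def sum_nonneg)
    also have "\<dots> \<le> (c * L2_set (\<lambda>y. cmod (\<xi> (y, w))) E)\<^sup>2"
      by (intro power_mono kboundD[OF k E EP, of "\<lambda>y. \<xi> (y, w)"]) auto
    also have "\<dots> = c\<^sup>2 * (\<Sum>y\<in>E. (cmod (\<xi> (y, w)))\<^sup>2)" by (simp add: L2_set_def sum_nonneg power_mult_distrib)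
    also have "(\<Sum>y\<in>E. (cmod (\<xi> (y, w)))\<^sup>2) = (\<Sum>g\<in>(\<lambda>y. (y, w)) ` E. (cmod (\<xi> g))\<^sup>2)"
      by (simp add: sum.reindex[OF inj])
    also have "c\<^sup>2 * \<dots> \<le> c\<^sup>2 * ?N"
      by (intro mult_left_mono finite_sum_le_infsum[OF sx]) (use E Earr src_fibre_GG[OF w] in auto)
    finally show ?thesis .
  qed
  have sm: "(\<lambda>g. (cmod (?\<eta> g))\<^sup>2) summable_on ?I"
    by (rule nonneg_bdd_above_summable_on) (auto intro!: bdd_aboveI[where M = "c\<^sup>2 * ?N"] fin)
  then show "?\<eta> \<in> ell2 ?I" by (simp add: ell2_def)
  have "(\<Sum>\<^sub>\<infinity>g\<in>?I. (cmod (?\<eta> g))\<^sup>2) \<le> c\<^sup>2 * ?N" by (rule infsum_le_finite_sums[OF sm fin])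
  then have "sqrt (\<Sum>\<^sub>\<infinity>g\<in>?I. (cmod (?\<eta> g))\<^sup>2) \<le> sqrt (c\<^sup>2 * ?N)" by (rule real_sqrt_le_mono)
  then show "ell2_norm ?I ?\<eta> \<le> c * ell2_norm ?I \<xi>" using c by (simp add: ell2_norm_def real_sqrt_mult)
qed

lemma gp_units_GG: "gp_units GG = (\<lambda>w. (w, w)) ` P"
  using G_refl G_arrow_P by (auto simp: gp_units_def)

text \<open>Converse to \<open>convolve_ell2\<close>: a finite set inside one tail class sits in the
  source fibre of any of its members \<open>w\<close>, where a vector extended by zero is an
  admissible test vector. The crude bound \<open>c0\<close> gives the summability that allows a
  finite sum to be compared with the norm on the fibre.\<close>

lemma kbound_from_ell2:
  assumes s: "suppR n f" and k: "kbound P f c0" and c: "0 \<le> c"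
    and b: "\<And>w \<xi>. w \<in> P \<Longrightarrow> \<xi> \<in> ell2 (src_fibre GG (w, w)) \<Longrightarrow> ell2_norm (src_fibre GG (w, w)) \<xi> \<le> 1 \<Longrightarrow>
      ell2_norm (src_fibre GG (w, w)) (convolve GG f \<xi>) \<le> c"
  shows "kbound P f c"
proof (rule kbound_blocks[OF c, where k = "tl_of n"])
  show "tl_of n x = tl_of n y" if "f (x, y) \<noteq> 0" for x y using s that by (auto simp: suppR_def R_tl)
  fix F v
  assume F: "finite F" "F \<subseteq> P" "F \<noteq> {}" and tl: "\<And>x y. x \<in> F \<Longrightarrow> y \<in> F \<Longrightarrow> tl_of n x = tl_of n y"
  obtain w where w: "w \<in> F" using F by blast
  then have wP: "w \<in> P" using F by auto
  let ?I = "src_fibre GG (w, w)"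
  have arr: "(x, w) \<in> topspace Gt" if "x \<in> F" for x using tl[OF that w] that F w G_arrow R_tl by blast
  let ?V = "L2_set (\<lambda>z. cmod (v z)) F"
  show "L2_set (\<lambda>x. cmod (\<Sum>z\<in>F. f (x, z) * v z)) F \<le> c * ?V"
  proof (cases "?V = 0")
    case True
    then have "\<forall>z\<in>F. v z = 0" using F(1) by (simp add: L2_set_eq_0_iff)
    then have "L2_set (\<lambda>x. cmod (\<Sum>z\<in>F. f (x, z) * v z)) F = 0" using F(1) by (simp add: L2_set_eq_0_iff)
    then show ?thesis using True by simp
  next
    case False
    then have V: "?V > 0" using L2_set_nonneg[of "\<lambda>z. cmod (v z)" F] by linarith
    define \<xi> where "\<xi> g = (if fst g \<in> F \<and> snd g = w then v (fst g) / complex_of_real ?V else 0)" for g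
    let ?J = "(\<lambda>x. (x, w)) ` F"
    have J: "finite ?J" "?J \<subseteq> ?I" using F arr src_fibre_GG[OF wP] by auto
    have inj: "inj_on (\<lambda>x. (x, w)) F" by (auto simp: inj_on_def)
    have out: "\<xi> g = 0" if "g \<notin> ?J" for g using that by (auto simp: \<xi>_def image_iff)
    have ell: "\<xi> \<in> ell2 ?I"
      unfolding ell2_def mem_Collect_eq
      by (subst summable_on_cong_neutral[where T = ?J and g = "\<lambda>g. (cmod (\<xi> g))\<^sup>2"]) (use J out in auto)
    have "(\<Sum>\<^sub>\<infinity>g\<in>?I. (cmod (\<xi> g))\<^sup>2) = (\<Sum>\<^sub>\<infinity>g\<in>?J. (cmod (\<xi> g))\<^sup>2)"
      by (rule infsum_cong_neutral) (use J out in auto)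
    also have "\<dots> = (\<Sum>g\<in>?J. (cmod (\<xi> g))\<^sup>2)" using J by simp
    also have "\<dots> = (\<Sum>z\<in>F. (cmod (v z) / ?V)\<^sup>2)"
      unfolding sum.reindex[OF inj] by (intro sum.cong refl) (simp add: \<xi>_def norm_divide)
    also have "\<dots> = (\<Sum>z\<in>F. (cmod (v z))\<^sup>2) / ?V\<^sup>2" by (simp add: power_divide sum_divide_distrib)
    also have "\<dots> = 1" using V by (simp add: L2_set_def sum_nonneg)
    finally have n1: "ell2_norm ?I \<xi> \<le> 1" by (simp add: ell2_norm_def)
    have le: "ell2_norm ?I (convolve GG f \<xi>) \<le> c" using b[OF wP ell n1] .
    have val: "convolve GG f \<xi> (x, w) = (\<Sum>z\<in>F. f (x, z) * v z) / complex_of_real ?V" if "x \<in> F" for x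
    proof -
      have "convolve GG f \<xi> (x, w) = (\<Sum>z\<in>F. f (x, z) * \<xi> (z, w))"
        by (rule conv_eq[OF arr[OF that] F(1) arr]) (auto simp: \<xi>_def)
      then show ?thesis by (simp add: \<xi>_def sum_divide_distrib)
    qed
    have sm: "(\<lambda>g. (cmod (convolve GG f \<xi> g))\<^sup>2) summable_on ?I"
      using convolve_ell2(1)[OF s k wP ell] by (simp add: ell2_def)
    have "(\<Sum>x\<in>F. (cmod (\<Sum>z\<in>F. f (x, z) * v z) / ?V)\<^sup>2) = (\<Sum>g\<in>?J. (cmod (convolve GG f \<xi> g))\<^sup>2)"
      unfolding sum.reindex[OF inj] by (intro sum.cong refl) (simp add: val norm_divide)
    also have "\<dots> \<le> (\<Sum>\<^sub>\<infinity>g\<in>?I. (cmod (convolve GG f \<xi> g))\<^sup>2)"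
      by (rule finite_sum_le_infsum[OF sm J]) auto
    finally have "L2_set (\<lambda>x. cmod (\<Sum>z\<in>F. f (x, z) * v z) / ?V) F \<le> ell2_norm ?I (convolve GG f \<xi>)"
      unfolding L2_set_def ell2_norm_def by (rule real_sqrt_le_mono)
    then have "L2_set (\<lambda>x. (1 / ?V) * cmod (\<Sum>z\<in>F. f (x, z) * v z)) F \<le> c" using le by simp
    then have "(1 / ?V) * L2_set (\<lambda>x. cmod (\<Sum>z\<in>F. f (x, z) * v z)) F \<le> c" 
      using V L2_set_right_distrib[of "1 / ?V" "\<lambda>x. cmod (\<Sum>z\<in>F. f (x, z) * v z)" F] by simp
    then show ?thesis using V by (simp add: field_simps)
  qed
qed

text \<open>Provides a unit, so that the supremum in the reduced norm does not range over the empty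
  set.\<close>

lemma P_nonempty: "P \<noteq> {}"
proof -
  obtain t where t: "t \<in> topspace (spc D 1 0)" using space_ne[of 1 0] num_pos[of 1] by fastforce
  have n: "(1::nat) \<ge> 1" "0 < num D 1" using num_pos[of 1] by auto
  have "0 \<in> pos D ` paths_to 1 0" using pos_bij_betw[OF n] siz_pos[OF n] by (auto simp: bij_betw_def)
  then show ?thesis using level_surj[OF n t] by blast
qed

text \<open>The a priori bound \<open>c0\<close> makes the set under the supremum bounded; the
  reduced norm is then the least kernel bound. Norm estimates can hence be proved on
  kernels.\<close>

lemma reduced_norm_le_iff:
  assumes s: "suppR n f" and k: "kbound P f c0"
  shows "0 \<le> reduced_norm GG f" "0 \<le> c \<Longrightarrow> reduced_norm GG f \<le> c \<longleftrightarrow> kbound P f c"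
proof -
  let ?S = "{ell2_norm (src_fibre GG u) (convolve GG f \<xi>) | u \<xi>. u \<in> gp_units GG \<and> \<xi> \<in> ell2 (src_fibre GG u) \<and> ell2_norm (src_fibre GG u) \<xi> \<le> 1}"
  have ub: "s \<le> c" if c: "kbound P f c" and sS: "s \<in> ?S" for s c
  proof -
    obtain w \<xi> where w: "w \<in> P" "\<xi> \<in> ell2 (src_fibre GG (w, w))" "ell2_norm (src_fibre GG (w, w)) \<xi> \<le> 1"
      "s = ell2_norm (src_fibre GG (w, w)) (convolve GG f \<xi>)" using sS by (auto simp: gp_units_GG)
    have "s \<le> c * ell2_norm (src_fibre GG (w, w)) \<xi>" using convolve_ell2(2)[OF s c w(1,2)] w(4) by simp
    also have "\<dots> \<le> c" using w(3) kbound_nonneg[OF c] by (simp add: mult_left_le)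
    finally show ?thesis .
  qed
  have bdd: "bdd_above ?S" using ub[OF k] by (rule bdd_aboveI)
  obtain w where w: "w \<in> P" using P_nonempty by blast
  have "(\<lambda>_. 0) \<in> ell2 (src_fibre GG (w, w))" "ell2_norm (src_fibre GG (w, w)) (\<lambda>_. 0) \<le> 1" by (auto simp: ell2_def ell2_norm_def)
  then have ne: "ell2_norm (src_fibre GG (w, w)) (convolve GG f (\<lambda>_. 0)) \<in> ?S" using w by (auto simp: gp_units_GG)
  show "0 \<le> reduced_norm GG f"
    unfolding reduced_norm_def
    by (rule order_trans[OF _ cSup_upper[OF ne bdd]]) (auto simp: ell2_norm_def intro!: infsum_nonneg)
  assume c: "0 \<le> c"
  show "reduced_norm GG f \<le> c \<longleftrightarrow> kbound P f c"
  proof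
    assume "kbound P f c"
    then show "reduced_norm GG f \<le> c" unfolding reduced_norm_def using ne ub by (intro cSup_least) auto
  next
    assume le: "reduced_norm GG f \<le> c"
    show "kbound P f c"
    proof (rule kbound_from_ell2[OF s k c])
      fix w \<xi> assume w: "w \<in> P" "\<xi> \<in> ell2 (src_fibre GG (w, w))" "ell2_norm (src_fibre GG (w, w)) \<xi> \<le> 1"
      then have "ell2_norm (src_fibre GG (w, w)) (convolve GG f \<xi>) \<in> ?S" by (auto simp: gp_units_GG)
      then have "ell2_norm (src_fibre GG (w, w)) (convolve GG f \<xi>) \<le> reduced_norm GG f"
        unfolding reduced_norm_def using bdd by (rule cSup_upper)
      then show "ell2_norm (src_fibre GG (w, w)) (convolve GG f \<xi>) \<le> c" using le by simp
    qed
  qed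
qed

end

lemma continuous_map_mult_complex:
  fixes f g :: "'x \<Rightarrow> complex"
  shows "continuous_map X euclidean f \<Longrightarrow> continuous_map X euclidean g \<Longrightarrow> continuous_map X euclidean (\<lambda>x. f x * g x)"
  by (simp add: continuous_map_atin tendsto_mult)

lemma continuous_map_cnj:
  fixes f :: "'x \<Rightarrow> complex"
  shows "continuous_map X euclidean f \<Longrightarrow> continuous_map X euclidean (\<lambda>x. cnj (f x))"
  by (simp add: continuous_map_atin tendsto_cnj)

section \<open>Exchanging the initial segments of labelled paths\<close>

context AH begin

lemma init_paths_to: "n \<ge> 1 \<Longrightarrow> x \<in> P \<Longrightarrow> init_seg n (fst \<circ> x) \<in> paths_to n (bsrc (fst (x n)))"
  using init_in_fpaths[of n x] pathD(2)[of x "n - 1"] last_init_seg[of "n - 1" "fst \<circ> x"]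
  by (auto simp: paths_to_def fpaths_def)

text \<open>Puts \<open>q\<close> in place of the initial segment of \<open>x\<close> and keeps the
  tail. By \<open>R_eqI\<close> at most one path qualifies, so the choice operator merely encodes a
  partial function.\<close>

definition sw :: "'e bedge list \<Rightarrow> (nat \<Rightarrow> 'e bedge \<times> 'a option) \<Rightarrow> nat \<Rightarrow> 'e bedge \<times> 'a option" where
  "sw q x = (SOME y. (x, y) \<in> R (length q) \<and> init_seg (length q) (fst \<circ> y) = q)"

lemma sw:
  assumes n: "n \<ge> 1" and q: "q \<in> paths_to n (bsrc (fst (x n)))" and x: "x \<in> P"
  shows "(x, sw q x) \<in> R n" "init_seg n (fst \<circ> sw q x) = q"
proof -
  have l: "length q = n" "q \<in> fin_paths D" "btgt (last q) = bsrc (fst (x n))" using q by (auto simp: paths_to_def)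
  define x0 where "x0 m = (if m < n then q ! m else fst (x m))" for m
  have "x0 \<in> inf_paths D"
    unfolding inf_paths_def
  proof (intro CollectI allI conjI)
    fix m
    show "x0 m \<in> bedges D m" using l pathD(1)[OF x, of m] by (auto simp: x0_def fin_paths_def)
    consider "Suc m < n" | "Suc m = n" | "n \<le> m" by linarith
    then show "bsrc (x0 (Suc m)) = btgt (x0 m)"
    proof cases
      case 1
      then show ?thesis using l by (auto simp: x0_def fin_paths_def)
    next
      case 2
      then have "last q = q ! m" using l by (subst last_conv_nth) auto
      then show ?thesis using 2 l by (auto simp: x0_def)
    next
      case 3
      then show ?thesis using pathD(2)[OF x] by (auto simp: x0_def)
    qed
  qed
  then obtain y where y: "y \<in> P" "fst \<circ> y = x0" "\<forall>m\<ge>n. y m = x m"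
    using change_prefix[OF x, of x0 n] by (auto simp: x0_def)
  have "(x, y) \<in> R (length q) \<and> init_seg (length q) (fst \<circ> y) = q"
    unfolding y(2) init_seg_eq_list using y l x by (auto simp: R_iff x0_def)
  then have "(x, sw q x) \<in> R (length q) \<and> init_seg (length q) (fst \<circ> sw q x) = q"
    unfolding sw_def
    by (rule someI[where P = "\<lambda>y. (x, y) \<in> R (length q) \<and> init_seg (length q) (fst \<circ> y) = q"])
  then show "(x, sw q x) \<in> R n" "init_seg n (fst \<circ> sw q x) = q" using l by auto
qed

lemma sw_eq:
  assumes "n \<ge> 1" "(x, y) \<in> R n"
  shows "sw (init_seg n (fst \<circ> y)) x = y"
proof -
  have xy: "x \<in> P" "y \<in> P" "x n = y n" using assms(2) by (auto simp: R_iff)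
  have q: "init_seg n (fst \<circ> y) \<in> paths_to n (bsrc (fst (x n)))" using init_paths_to[OF assms(1) xy(2)] xy(3) by simp
  show ?thesis
    by (rule R_eqI[OF R_trans[OF R_sym[OF sw(1)[OF assms(1) q xy(1)]] assms(2)]]) (rule sw(2)[OF assms(1) q xy(1)])
qed

text \<open>Reindexes a tail class by the finite paths into one vertex. The new index set depends on
  \<open>x\<close> only through that vertex, which allows sums over classes to be recognised as
  continuous.\<close>

lemma cls_bij:
  assumes "n \<ge> 1" "x \<in> P"
  shows "bij_betw (\<lambda>q. sw q x) (paths_to n (bsrc (fst (x n)))) (cls n x)"
proof (rule bij_betw_byWitness[where f' = "\<lambda>y. init_seg n (fst \<circ> y)"])
  show "\<forall>q\<in>paths_to n (bsrc (fst (x n))). init_seg n (fst \<circ> sw q x) = q" using sw(2)[OF assms(1) _ assms(2)] by blast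
  show "\<forall>y\<in>cls n x. sw (init_seg n (fst \<circ> y)) x = y" using sw_eq[OF assms(1)] by (auto simp: cls_def)
  show "(\<lambda>q. sw q x) ` paths_to n (bsrc (fst (x n))) \<subseteq> cls n x" using sw(1)[OF assms(1) _ assms(2)] by (auto simp: cls_def)
  show "(\<lambda>y. init_seg n (fst \<circ> y)) ` cls n x \<subseteq> paths_to n (bsrc (fst (x n)))"
    using init_paths_to[OF assms(1)] by (auto simp: cls_def R_iff)
qed

lemma sw_continuous:
  assumes n: "n \<ge> 1" and q: "q \<in> paths_to n i"
  shows "continuous_map (subtopology X {x. bsrc (fst (x n)) = i}) X (sw q)"
  unfolding continuous_map_def
proof (intro conjI allI impI)
  let ?S = "subtopology X {x. bsrc (fst (x n)) = i}"
  have S: "x \<in> topspace ?S \<longleftrightarrow> x \<in> P \<and> bsrc (fst (x n)) = i" for x by (auto simp: X_topspace)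
  have swx: "(x, sw q x) \<in> R n" "init_seg n (fst \<circ> sw q x) = q" if "x \<in> topspace ?S" for x
    using sw[OF n, of q x] q that S by auto
  show "sw q \<in> topspace ?S \<rightarrow> topspace X" using swx(1) by (auto simp: X_topspace R_iff simp del: topspace_subtopology)
  fix W assume W: "openin X W"
  show "openin ?S {x \<in> topspace ?S. sw q x \<in> W}"
  proof (subst openin_subopen, intro ballI)
    fix x assume "x \<in> {x \<in> topspace ?S. sw q x \<in> W}"
    then have x: "x \<in> topspace ?S" "sw q x \<in> W" by auto
    let ?y = "sw q x"
    obtain M where M: "\<forall>m\<ge>M. \<exists>U. openin (vertex_space D m (bsrc (fst (?y m)))) U \<and> snd (?y m) \<in> U \<and>
       cylinder D (init_seg (Suc m) (fst \<circ> ?y)) U \<subseteq> W" using cylinder_base[OF W x(2)] by blast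
    \<comment> \<open>From level \<open>n\<close> on the path and its modification agree, so at such
      a level \<open>m\<close> the same \<open>U\<close> describes a neighbourhood of both.\<close>
    define m where "m = max M n"
    have m: "m \<ge> M" "m \<ge> n" by (auto simp: m_def)
    obtain U where U: "openin (vertex_space D m (bsrc (fst (?y m)))) U" "snd (?y m) \<in> U"
       "cylinder D (init_seg (Suc m) (fst \<circ> ?y)) U \<subseteq> W" using M m by blast
    have xy: "x \<in> P" "\<And>k. k \<ge> n \<Longrightarrow> ?y k = x k" using swx(1)[OF x(1)] by (auto simp: R_iff)
    let ?C = "cylinder D (init_seg (Suc m) (fst \<circ> x)) U"
    have C: "openin X ?C" using cylinder_open'[OF xy(1), of m U] U(1) xy(2) m by simp
    have sub: "?C \<inter> {x. bsrc (fst (x n)) = i} \<subseteq> {x \<in> topspace ?S. sw q x \<in> W}"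
    proof
      fix x' assume "x' \<in> ?C \<inter> {x. bsrc (fst (x n)) = i}"
      then have x': "x' \<in> topspace ?S" "\<And>k. k \<le> m \<Longrightarrow> fst (x' k) = fst (x k)" "snd (x' m) \<in> U"
        unfolding S by (auto simp: cylinder_def init_seg_eq_iff less_Suc_eq_le)
      have y': "sw q x' \<in> P" "\<And>k. k \<ge> n \<Longrightarrow> sw q x' k = x' k" using swx(1)[OF x'(1)] by (auto simp: R_iff)
      have "fst (sw q x' k) = fst (?y k)" if "k \<le> m" for k
      proof (cases "k < n")
        case True
        have "init_seg n (fst \<circ> sw q x') = init_seg n (fst \<circ> ?y)" using swx(2) x(1) x'(1) by simp
        then show ?thesis using True by (auto simp: init_seg_eq_iff)
      next
        case False
        then show ?thesis using y'(2) xy(2) x'(2) that by simp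
      qed
      then have "sw q x' \<in> cylinder D (init_seg (Suc m) (fst \<circ> ?y)) U"
        using y' x'(3) m by (auto simp: cylinder_def init_seg_eq_iff)
      then show "x' \<in> {x \<in> topspace ?S. sw q x \<in> W}" using U(3) x'(1) by blast
    qed
    have "openin ?S (?C \<inter> {x. bsrc (fst (x n)) = i})" using C by (auto simp: openin_subtopology)
    moreover have "x \<in> ?C \<inter> {x. bsrc (fst (x n)) = i}" using x(1) U(2) xy(2) m unfolding S by (auto simp: cylinder_def)
    ultimately show "\<exists>T. openin ?S T \<and> x \<in> T \<and> T \<subseteq> {x \<in> topspace ?S. sw q x \<in> W}" using sub by blast
  qed
qed

subsection \<open>The convolution algebra\<close>

lemma R_compl_open: "openin Gt (topspace Gt - R n)"
  unfolding G_openin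
proof (intro conjI allI)
  fix m
  have "openin PP (topspace PP - R n)" using R_closed by blast
  then have "openin (subtopology PP (R m)) ((topspace PP - R n) \<inter> R m)" by (auto simp: openin_subtopology)
  moreover have "(topspace PP - R n) \<inter> R m = (topspace Gt - R n) \<inter> R m"
    using R_sub_PP[of m] G_topspace by blast
  ultimately show "openin (subtopology PP (R m)) ((topspace Gt - R n) \<inter> R m)" by simp
qed (auto simp: G_topspace)

lemma R_closed_G: "closedin Gt (R n)"
  unfolding closedin_def using R_compl_open G_topspace by auto

text \<open>\<open>R n\<close> is open and closed, so a continuous function on it may be extended by
  zero.\<close>

lemma CR_continuous:
  assumes "f \<in> CR n" shows "continuous_map Gt euclidean f"
proof (rule pasting_lemma[where I = "{True, False}" and T = "\<lambda>b. if b then R n else topspace Gt - R n" and f = "\<lambda>b. if b then f else (\<lambda>_. 0)"])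
  show "openin Gt (if b then R n else topspace Gt - R n)" for b using R_open R_compl_open by simp
  show "continuous_map (subtopology Gt (if b then R n else topspace Gt - R n)) euclidean (if b then f else (\<lambda>_. 0))" for b
    using assms by (auto simp: CR_def G_sub)
  fix x assume x: "x \<in> topspace Gt"
  have "f x = 0" if "x \<notin> R n" using assms that suppRD[of n f "fst x" "snd x"] by (auto simp: CR_def)
  then show "\<exists>j. j \<in> {True, False} \<and> x \<in> (if j then R n else topspace Gt - R n) \<and> f x = (if j then f else (\<lambda>_. 0)) x"
    using x by (intro exI[of _ "x \<in> R n"]) auto
qed (auto split: if_splits)

lemma CR_supp: "f \<in> CR n \<Longrightarrow> suppR n f" by (simp add: CR_def)

lemma CR_iff: "f \<in> CR n \<longleftrightarrow> suppR n f \<and> continuous_map Gt euclidean f"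
  using CR_continuous continuous_map_from_subtopology[of Gt euclidean f "R n"] by (auto simp: CR_def G_sub)

lemma CR_mono: "f \<in> CR n \<Longrightarrow> n \<le> m \<Longrightarrow> f \<in> CR m"
  using suppR_mono by (auto simp: CR_iff)

text \<open>A compact support lies in some \<open>R n\<close> by \<open>compact_in_level\<close>;
  conversely \<open>R n\<close> is compact and closed, so a support inside it has compact
  closure.\<close>

lemma Cc_iff: "f \<in> Cc GG \<longleftrightarrow> (\<exists>n\<ge>1. f \<in> CR n)"
proof
  assume f: "f \<in> Cc GG"
  let ?S = "{g \<in> topspace Gt. f g \<noteq> 0}"
  obtain n where n: "n \<ge> 1" "Gt closure_of ?S \<subseteq> R n"
    using f compact_in_level[of "Gt closure_of ?S"] by (auto simp: Cc_def)
  have "?S \<subseteq> R n" using closure_of_subset[of ?S Gt] n(2) by auto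
  then have "suppR n f" using f by (auto simp: suppR_def Cc_def)
  then show "\<exists>n\<ge>1. f \<in> CR n" using f n(1) by (auto simp: CR_iff Cc_def)
next
  assume "\<exists>n\<ge>1. f \<in> CR n"
  then obtain n where n: "f \<in> CR n" by blast
  let ?S = "{g \<in> topspace Gt. f g \<noteq> 0}"
  have "?S \<subseteq> R n" using CR_supp[OF n] by (auto simp: suppR_def)
  then have "Gt closure_of ?S \<subseteq> R n" using closure_of_minimal R_closed_G by blast
  then have "compactin Gt (Gt closure_of ?S)"
    using closed_compactin[OF R_compact] closedin_closure_of by blast
  moreover have "f g = 0" if "g \<notin> topspace Gt" for g
    using that CR_supp[OF n] G_topspace by (cases g) (auto simp: suppR_def)
  ultimately show "f \<in> Cc GG" using n by (simp add: Cc_def CR_iff)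
qed

lemma Cc_common:
  assumes "f \<in> Cc GG" "g \<in> Cc GG"
  obtains n where "n \<ge> 1" "f \<in> CR n" "g \<in> CR n"
proof -
  obtain n m where "n \<ge> 1" "f \<in> CR n" "m \<ge> 1" "g \<in> CR m" using assms Cc_iff by blast
  then show thesis using that[of "max n m"] CR_mono[of f n "max n m"] CR_mono[of g m "max n m"] by auto
qed

lemma CR_bounded:
  assumes "f \<in> CR n" shows "\<exists>s\<ge>0. \<forall>z. cmod (f z) \<le> s"
proof -
  have "compactin euclidean (f ` R n)" by (rule image_compactin[OF R_compact CR_continuous[OF assms]])
  then have "bounded (f ` R n)" by (simp add: compact_imp_bounded)
  then obtain s where s: "\<forall>z\<in>R n. cmod (f z) \<le> s" by (auto simp: bounded_iff)
  have "cmod (f z) \<le> max s 0" for z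
    using s suppRD[OF CR_supp[OF assms], of "fst z" "snd z"] by (cases "z \<in> R n") auto
  then show ?thesis by (meson max.cobounded2)
qed

text \<open>Sorting arrows by the initial segments of both ends writes \<open>f\<close> as a sum
  with one piece for each pair of segments; each piece lives on the graph of a partial bijection and
  is bounded by \<open>s\<close>. The constant counts the pairs.\<close>

lemma kbound_of_bounded:
  assumes f: "suppR n f" and n: "n \<ge> 1" and s: "0 \<le> s" "\<And>z. cmod (f z) \<le> s"
  shows "kbound P f (real (card (fpaths n \<times> fpaths n)) * s)"
proof -
  define g where "g pq z = (if init_seg n (fst \<circ> fst z) = fst pq \<and> init_seg n (fst \<circ> snd z) = snd pq then f z else 0)" for pq z
  have "kbound P (g pq) s" for pq
  proof (rule kbound_partial_bij[OF s(1)])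
    show "cmod (g pq (x, y)) \<le> s" for x y using s by (auto simp: g_def)
    fix x x' y y'
    show "y = y'" if "g pq (x, y) \<noteq> 0" "g pq (x, y') \<noteq> 0"
    proof -
      have "(x, y) \<in> R n" "(x, y') \<in> R n" "init_seg n (fst \<circ> y) = init_seg n (fst \<circ> y')"
        using that f by (auto simp: g_def suppR_def split: if_splits)
      then show ?thesis using R_eqI R_trans R_sym by blast
    qed
    show "x = x'" if "g pq (x, y) \<noteq> 0" "g pq (x', y) \<noteq> 0"
    proof -
      have "(x, y) \<in> R n" "(x', y) \<in> R n" "init_seg n (fst \<circ> x) = init_seg n (fst \<circ> x')"
        using that f by (auto simp: g_def suppR_def split: if_splits)
      then show ?thesis using R_eqI R_trans R_sym by blast
    qed
  qed
  then have "kbound P (\<lambda>z. \<Sum>pq\<in>fpaths n \<times> fpaths n. g pq z) (\<Sum>pq\<in>fpaths n \<times> fpaths n. s)"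
    by (intro kbound_sum) (auto simp: finite_fpaths)
  then have "kbound P (\<lambda>z. \<Sum>pq\<in>fpaths n \<times> fpaths n. g pq z) (real (card (fpaths n \<times> fpaths n)) * s)" by simp
  then show ?thesis
  proof (rule kbound_cong)
    fix x y assume xy: "x \<in> P" "y \<in> P"
    let ?pq = "(init_seg n (fst \<circ> x), init_seg n (fst \<circ> y))"
    have "(\<Sum>pq\<in>fpaths n \<times> fpaths n. g pq (x, y)) = (\<Sum>pq\<in>{?pq}. g pq (x, y))"
      by (rule sum.mono_neutral_right) (use finite_fpaths init_in_fpaths[OF n] xy in \<open>auto simp: g_def\<close>)
    then show "(\<Sum>pq\<in>fpaths n \<times> fpaths n. g pq (x, y)) = f (x, y)" by (simp add: g_def)
  qed
qed

lemma CR_kbound: "f \<in> CR n \<Longrightarrow> n \<ge> 1 \<Longrightarrow> \<exists>c. kbound P f c"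
  using CR_bounded kbound_of_bounded CR_supp by metis

lemma CR_zero: "(\<lambda>_. 0) \<in> CR n" by (simp add: CR_iff suppR_def)

lemma suppR_add:
  assumes "suppR n f" "suppR n g" shows "suppR n (\<lambda>z. f z + g z)"
  unfolding suppR_def
proof (intro allI impI)
  fix x y assume "f (x, y) + g (x, y) \<noteq> 0"
  then have "f (x, y) \<noteq> 0 \<or> g (x, y) \<noteq> 0" by auto
  then show "(x, y) \<in> R n" using assms by (auto simp: suppR_def)
qed

lemma CR_add: "f \<in> CR n \<Longrightarrow> g \<in> CR n \<Longrightarrow> (\<lambda>z. f z + g z) \<in> CR n"
  unfolding CR_iff using suppR_add by (auto intro: continuous_map_add)

lemma CR_scale: "f \<in> CR n \<Longrightarrow> (\<lambda>z. c * f z) \<in> CR n"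
  unfolding CR_iff suppR_def by (auto intro!: continuous_map_mult_complex)

lemma star_eq: "sa_star (Cc_alg GG) f = (\<lambda>z. if z \<in> topspace Gt then cnj (f (snd z, fst z)) else 0)"
  by (auto simp: Cc_alg_def fun_eq_iff)

lemma CR_star: "f \<in> CR n \<Longrightarrow> sa_star (Cc_alg GG) f \<in> CR n"
proof -
  assume f: "f \<in> CR n"
  have "continuous_map Gt euclidean (\<lambda>z. cnj (f (snd z, fst z)))"
    using continuous_map_cnj[OF continuous_map_compose[OF G_inv CR_continuous[OF f]]] by (simp add: comp_def)
  then have "continuous_map Gt euclidean (sa_star (Cc_alg GG) f)"
    by (rule continuous_map_eq) (auto simp: star_eq)
  moreover have "suppR n (sa_star (Cc_alg GG) f)"
    using CR_supp[OF f] R_sym by (auto simp: suppR_def star_eq split: if_splits)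
  ultimately show ?thesis by (simp add: CR_iff)
qed

lemma conv_supp:
  assumes "suppR n f" "suppR n g" shows "suppR n (convolve GG f g)"
  unfolding suppR_def
proof (intro allI impI)
  fix x z assume nz: "convolve GG f g (x, z) \<noteq> 0"
  then have arr: "(x, z) \<in> topspace Gt" using conv_outside by blast
  have "\<exists>y\<in>cls n x. f (x, y) * g (y, z) \<noteq> 0"
    using nz unfolding conv_cls[OF assms(1) arr] by (meson sum.neutral)
  then show "(x, z) \<in> R n" using assms R_trans unfolding suppR_def by (metis mult_eq_0_iff)
qed

lemma conv_kbound:
  assumes s: "suppR n f" "suppR n g" and k: "kbound P f c" "kbound P g d"
  shows "kbound P (convolve GG f g) (c * d)"
proof (rule kbound_mult[OF k])
  fix F assume F: "finite F" "F \<subseteq> P"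
  \<comment> \<open>Again the points reached by \<open>f\<close> from \<open>F\<close>; they include
    \<open>F\<close> because a class contains its base point.\<close>
  let ?E = "\<Union>x\<in>F. cls n x"
  have E: "finite ?E" "?E \<subseteq> P" "F \<subseteq> ?E" using F finite_cls R_refl by (auto simp: cls_def R_iff)
  have "convolve GG f g (x, z) = (\<Sum>y\<in>?E. f (x, y) * g (y, z))" if "x \<in> F" for x z
  proof (cases "(x, z) \<in> topspace Gt")
    case True
    have "(\<Sum>y\<in>?E. f (x, y) * g (y, z)) = (\<Sum>y\<in>cls n x. f (x, y) * g (y, z))"
      by (rule sum.mono_neutral_right[OF E(1)]) (use that suppRD[OF s(1)] in \<open>auto simp: cls_def\<close>)
    then show ?thesis using conv_cls[OF s(1) True] by simp
  next
    case False
    have "f (x, y) * g (y, z) = 0" for y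
      using False s R_trans G_arrow unfolding suppR_def by (metis mult_eq_0_iff)
    then show ?thesis using conv_outside[OF False] by simp
  qed
  then show "\<exists>E. finite E \<and> F \<subseteq> E \<and> E \<subseteq> P \<and> (\<forall>x\<in>F. \<forall>z\<in>F. convolve GG f g (x, z) = (\<Sum>y\<in>E. f (x, y) * g (y, z)))"
    using E by blast
qed

text \<open>Where the vertex at level \<open>n\<close> is a fixed \<open>i\<close>, the class of a
  path is enumerated by \<open>paths_to n i\<close> through the continuous maps \<open>sw q\<close>,
  and the convolution is a finite sum of products of continuous functions. These regions are open,
  so the pieces glue.\<close>

lemma CR_conv:
  assumes n: "n \<ge> 1" and f: "f \<in> CR n" and g: "g \<in> CR n"
  shows "convolve GG f g \<in> CR n"
proof -
  let ?T = "subtopology PP (R n)"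
  let ?O = "\<lambda>i. {z \<in> R n. bsrc (fst (fst z n)) = i}"
  have top: "topspace ?T = R n" by (rule R_top)
  have fstT: "continuous_map ?T X fst" "continuous_map ?T X snd"
    by (auto intro: continuous_map_from_subtopology continuous_map_fst continuous_map_snd)
  have fc: "continuous_map ?T euclidean f" "continuous_map ?T euclidean g" using f g by (auto simp: CR_def)
  have "continuous_map ?T euclidean (convolve GG f g)"
  proof (rule pasting_lemma[where I = "UNIV :: nat set" and T = ?O and
      f = "\<lambda>i z. \<Sum>q\<in>paths_to n i. f (fst z, sw q (fst z)) * g (sw q (fst z), snd z)"])
    fix i :: nat
    show "openin ?T (?O i)"
    proof -
      have c: "continuous_map ?T (K n) (\<lambda>z. fst z n)" using continuous_map_compose[OF fstT(1) X_coord] by (simp add: comp_def)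
      have "openin (K n) {w \<in> topspace (K n). bsrc (fst w) = i}"
        unfolding K_openin
      proof (intro conjI ballI)
        fix b assume b: "b \<in> bedges D n"
        have "{t. (b, t) \<in> {w \<in> topspace (K n). bsrc (fst w) = i}} = (if bsrc b = i then topspace (vertex_space D n (bsrc b)) else {})"
          using b by (auto simp: K_topspace)
        then show "openin (vertex_space D n (bsrc b)) {t. (b, t) \<in> {w \<in> topspace (K n). bsrc (fst w) = i}}" by simp
      qed auto
      from openin_continuous_map_preimage[OF c this]
      have "openin ?T {z \<in> R n. fst z n \<in> {w \<in> topspace (K n). bsrc (fst w) = i}}" unfolding top .
      moreover have "{z \<in> R n. fst z n \<in> {w \<in> topspace (K n). bsrc (fst w) = i}} = ?O i"
        using c unfolding continuous_map_def top by auto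
      ultimately show ?thesis by simp
    qed
    let ?Ti = "subtopology ?T (?O i)"
    show "continuous_map ?Ti euclidean (\<lambda>z. \<Sum>q\<in>paths_to n i. f (fst z, sw q (fst z)) * g (sw q (fst z), snd z))"
    proof (rule continuous_map_sum)
      show "finite (paths_to n i)" using finite_fpaths[of n] by (rule finite_subset[rotated]) (auto simp: paths_to_def fpaths_def)
      fix q assume q: "q \<in> paths_to n i"
      have Ti: "z \<in> topspace ?Ti \<longleftrightarrow> z \<in> R n \<and> bsrc (fst (fst z n)) = i" for z
        using top by (auto simp: topspace_subtopology)
      have c1: "continuous_map ?Ti X fst" "continuous_map ?Ti X snd" using fstT by (auto intro: continuous_map_from_subtopology)
      have "continuous_map ?Ti (subtopology X {x. bsrc (fst (x n)) = i}) fst"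
        using c1(1) Ti by (auto simp: continuous_map_in_subtopology)
      then have c2: "continuous_map ?Ti X (\<lambda>z. sw q (fst z))"
        using continuous_map_compose[OF _ sw_continuous[OF n q]] by (force simp: comp_def)
      have sR: "(fst z, sw q (fst z)) \<in> R n" if "z \<in> topspace ?Ti" for z
        using that q Ti[of z] sw(1)[OF n, of q "fst z"] by (cases z) (auto simp: R_iff)
      have "continuous_map ?Ti ?T (\<lambda>z. (fst z, sw q (fst z)))"
        unfolding continuous_map_in_subtopology using sR c1 c2 by (auto simp: continuous_map_pairedI)
      then have 1: "continuous_map ?Ti euclidean (\<lambda>z. f (fst z, sw q (fst z)))"
        using continuous_map_compose[OF _ fc(1)] by (force simp: comp_def)
      have sR2: "(sw q (fst z), snd z) \<in> R n" if z: "z \<in> topspace ?Ti" for z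
        using R_trans[OF R_sym[OF sR[OF z]], of "snd z"] Ti[of z] z by (cases z) auto
      have "continuous_map ?Ti ?T (\<lambda>z. (sw q (fst z), snd z))"
        unfolding continuous_map_in_subtopology using sR2 c1 c2 by (auto simp: continuous_map_pairedI)
      then have 2: "continuous_map ?Ti euclidean (\<lambda>z. g (sw q (fst z), snd z))"
        using continuous_map_compose[OF _ fc(2)] by (force simp: comp_def)
      show "continuous_map ?Ti euclidean (\<lambda>z. f (fst z, sw q (fst z)) * g (sw q (fst z), snd z))"
        by (rule continuous_map_mult_complex[OF 1 2])
    qed
  next
    fix z assume "z \<in> topspace ?T"
    then have z: "z \<in> R n" using top by simp
    obtain x y where xy: "z = (x, y)" by (cases z)
    have x: "x \<in> P" "(x, y) \<in> topspace Gt" using z xy G_arrow by (auto simp: R_iff)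
    have "convolve GG f g z = (\<Sum>q\<in>paths_to n (bsrc (fst (x n))). f (x, sw q x) * g (sw q x, y))"
      unfolding xy conv_cls[OF CR_supp[OF f] x(2)] by (rule sum.reindex_bij_betw[OF cls_bij[OF n x(1)], symmetric])
    then show "\<exists>i. i \<in> UNIV \<and> z \<in> ?O i \<and> convolve GG f g z = (\<Sum>q\<in>paths_to n i. f (fst z, sw q (fst z)) * g (sw q (fst z), snd z))"
      using z xy by (intro exI[of _ "bsrc (fst (x n))"]) auto
  qed auto
  then show ?thesis using conv_supp[OF CR_supp[OF f] CR_supp[OF g]] by (simp add: CR_def)
qed

abbreviation "N \<equiv> reduced_norm GG"

lemma N_nonneg: "f \<in> Cc GG \<Longrightarrow> 0 \<le> N f"
  using reduced_norm_le_iff(1) CR_supp CR_kbound Cc_iff by metis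

lemma N_le_iff: "f \<in> Cc GG \<Longrightarrow> 0 \<le> c \<Longrightarrow> N f \<le> c \<longleftrightarrow> kbound P f c"
  using reduced_norm_le_iff(2) CR_supp CR_kbound Cc_iff by metis

lemma N_leI: "f \<in> Cc GG \<Longrightarrow> kbound P f c \<Longrightarrow> N f \<le> c"
  using N_le_iff kbound_nonneg by blast

lemma N_kbound: "f \<in> Cc GG \<Longrightarrow> kbound P f (N f)"
  using N_le_iff N_nonneg by blast

lemma N_entry: "f \<in> Cc GG \<Longrightarrow> x \<in> P \<Longrightarrow> y \<in> P \<Longrightarrow> cmod (f (x, y)) \<le> N f"
  by (rule kbound_entry[OF N_kbound])

lemma Cc_add: "f \<in> Cc GG \<Longrightarrow> g \<in> Cc GG \<Longrightarrow> (\<lambda>z. f z + g z) \<in> Cc GG"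
  by (erule (1) Cc_common) (use CR_add Cc_iff in blast)

lemma Cc_scale: "f \<in> Cc GG \<Longrightarrow> (\<lambda>z. c * f z) \<in> Cc GG"
  using CR_scale Cc_iff by blast

lemma Cc_star: "f \<in> Cc GG \<Longrightarrow> sa_star (Cc_alg GG) f \<in> Cc GG"
  using CR_star Cc_iff by blast

lemma Cc_conv: "f \<in> Cc GG \<Longrightarrow> g \<in> Cc GG \<Longrightarrow> convolve GG f g \<in> Cc GG"
  by (erule (1) Cc_common) (use CR_conv Cc_iff in blast)

lemma N_add: "f \<in> Cc GG \<Longrightarrow> g \<in> Cc GG \<Longrightarrow> N (\<lambda>z. f z + g z) \<le> N f + N g"
  by (intro N_leI Cc_add kbound_add N_kbound)

lemma N_scale: "f \<in> Cc GG \<Longrightarrow> N (\<lambda>z. c * f z) \<le> cmod c * N f"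
  by (intro N_leI Cc_scale kbound_scale N_kbound)

lemma N_conv:
  assumes "f \<in> Cc GG" "g \<in> Cc GG" shows "N (convolve GG f g) \<le> N f * N g"
proof -
  obtain n where n: "n \<ge> 1" "f \<in> CR n" "g \<in> CR n" using Cc_common[OF assms] by blast
  show ?thesis
    by (intro N_leI Cc_conv conv_kbound[OF CR_supp[OF n(2)] CR_supp[OF n(3)]] N_kbound assms)
qed

lemma N_star:
  assumes "f \<in> Cc GG" shows "N (sa_star (Cc_alg GG) f) \<le> N f"
proof (rule N_leI[OF Cc_star[OF assms]])
  have out: "f (y, x) = 0" if "(x, y) \<notin> topspace Gt" for x y
    using assms that G_sym by (auto simp: Cc_def)
  show "kbound P (sa_star (Cc_alg GG) f) (N f)"
    by (rule kbound_cong[OF kbound_adjoint[OF N_kbound[OF assms]]]) (auto simp: star_eq out)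
qed

lemma Cc_alg_simps [simp]:
  "sa_carrier (Cc_alg GG) = Cc GG" "sa_add (Cc_alg GG) f g = (\<lambda>z. f z + g z)"
  "sa_mult (Cc_alg GG) f g = convolve GG f g" "sa_scale (Cc_alg GG) c f = (\<lambda>z. c * f z)"
  "sa_norm (Cc_alg GG) f = N f"
  by (auto simp: Cc_alg_def)

lemma Cc_dist: "sa_dist (Cc_alg GG) f g = N (\<lambda>z. f z - g z)"
  by (simp add: sa_dist_def)

lemma Cc_diff: "f \<in> Cc GG \<Longrightarrow> g \<in> Cc GG \<Longrightarrow> (\<lambda>z. f z - g z) \<in> Cc GG"
  using Cc_add[OF _ Cc_scale[of g "-1"], of f] by simp

lemma N_minus: "f \<in> Cc GG \<Longrightarrow> g \<in> Cc GG \<Longrightarrow> N (\<lambda>z. f z - g z) = N (\<lambda>z. g z - f z)"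
  using N_scale[OF Cc_diff, of f g "-1"] N_scale[OF Cc_diff, of g f "-1"] by (simp add: order_antisym)

lemma N_zero: "N (\<lambda>_. 0) = 0"
proof -
  have z: "(\<lambda>_. 0) \<in> Cc GG" using CR_zero Cc_iff by blast
  show ?thesis using N_leI[OF z kbound_zero] N_nonneg[OF z] by simp
qed

lemma N_norm_diff: "f \<in> Cc GG \<Longrightarrow> g \<in> Cc GG \<Longrightarrow> N f \<le> N g + N (\<lambda>z. f z - g z)"
  using N_add[of g "\<lambda>z. f z - g z"] Cc_diff by simp

text \<open>The usual telescoping of a difference of two products; it yields the bound
  \<open>dist_mult\<close>.\<close>

lemma conv_diff:
  assumes "a \<in> Cc GG" "b \<in> Cc GG" "a' \<in> Cc GG" "b' \<in> Cc GG"
  shows "(\<lambda>z. convolve GG a b z - convolve GG a' b' z) =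
    (\<lambda>z. convolve GG a (\<lambda>z. b z - b' z) z + convolve GG (\<lambda>z. a z - a' z) b' z)"
proof
  fix w :: "(nat \<Rightarrow> 'e bedge \<times> 'a option) \<times> (nat \<Rightarrow> 'e bedge \<times> 'a option)"
  obtain n where n: "a \<in> CR n" "a' \<in> CR n" using Cc_common[OF assms(1,3)] by blast
  have s: "suppR n a" "suppR n a'" using n CR_supp by auto
  have "suppR n (\<lambda>z. - 1 * a' z)" using CR_supp[OF CR_scale[OF n(2)]] .
  then have s3: "suppR n (\<lambda>z. a z - a' z)" using suppR_add[OF s(1)] by fastforce
  obtain x z where w: "w = (x, z)" by (cases w)
  show "convolve GG a b w - convolve GG a' b' w = convolve GG a (\<lambda>z. b z - b' z) w + convolve GG (\<lambda>z. a z - a' z) b' w"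
  proof (cases "w \<in> topspace Gt")
    case True
    then have arr: "(x, z) \<in> topspace Gt" using w by simp
    show ?thesis
      unfolding w conv_cls[OF s(1) arr] conv_cls[OF s(2) arr] conv_cls[OF s3 arr]
      by (simp add: sum_subtractf[symmetric] sum.distrib[symmetric] algebra_simps)
  qed (simp add: conv_outside)
qed

lemma Cc_normed_star: "normed_star (Cc_alg GG)"
proof
  fix a b a' b' assume ab: "a \<in> sa_carrier (Cc_alg GG)" "b \<in> sa_carrier (Cc_alg GG)"
  then have a: "a \<in> Cc GG" "b \<in> Cc GG" by auto
  show "\<bar>sa_norm (Cc_alg GG) a - sa_norm (Cc_alg GG) b\<bar> \<le> sa_dist (Cc_alg GG) a b"
    using N_norm_diff[OF a] N_norm_diff[OF a(2,1)] N_minus[OF a] by (simp add: Cc_dist)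
  show "sa_dist (Cc_alg GG) a b = sa_dist (Cc_alg GG) b a" using N_minus[OF a] by (simp add: Cc_dist)
  show "sa_dist (Cc_alg GG) (sa_scale (Cc_alg GG) z a) (sa_scale (Cc_alg GG) z b) \<le> cmod z * sa_dist (Cc_alg GG) a b" for z
    using N_scale[OF Cc_diff[OF a], of z] by (simp add: Cc_dist right_diff_distrib)
  have "sa_star (Cc_alg GG) (\<lambda>z. a z - b z) = (\<lambda>z. sa_star (Cc_alg GG) a z - sa_star (Cc_alg GG) b z)"
    by (auto simp: star_eq)
  then show "sa_dist (Cc_alg GG) (sa_star (Cc_alg GG) a) (sa_star (Cc_alg GG) b) \<le> sa_dist (Cc_alg GG) a b"
    using N_star[OF Cc_diff[OF a]] by (simp add: Cc_dist)
  assume "a' \<in> sa_carrier (Cc_alg GG)"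
  then have a': "a' \<in> Cc GG" by simp
  show "sa_dist (Cc_alg GG) a a' \<le> sa_dist (Cc_alg GG) a b + sa_dist (Cc_alg GG) b a'"
    using N_add[OF Cc_diff[OF a] Cc_diff[OF a(2) a']] by (simp add: Cc_dist)
  assume "b' \<in> sa_carrier (Cc_alg GG)"
  then have b': "b' \<in> Cc GG" by simp
  show "sa_dist (Cc_alg GG) (sa_add (Cc_alg GG) a b) (sa_add (Cc_alg GG) a' b') \<le> sa_dist (Cc_alg GG) a a' + sa_dist (Cc_alg GG) b b'"
    using N_add[OF Cc_diff[OF a(1) a'] Cc_diff[OF a(2) b']] by (simp add: Cc_dist algebra_simps)
  have "N (\<lambda>z. convolve GG a b z - convolve GG a' b' z)
      \<le> N (convolve GG a (\<lambda>z. b z - b' z)) + N (convolve GG (\<lambda>z. a z - a' z) b')"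
    unfolding conv_diff[OF a a' b'] by (intro N_add Cc_conv Cc_diff a a' b')
  also have "\<dots> \<le> N a * N (\<lambda>z. b z - b' z) + N (\<lambda>z. a z - a' z) * N b'"
    by (intro add_mono N_conv Cc_diff a a' b')
  finally show "sa_dist (Cc_alg GG) (sa_mult (Cc_alg GG) a b) (sa_mult (Cc_alg GG) a' b')
     \<le> sa_norm (Cc_alg GG) a * sa_dist (Cc_alg GG) b b' + sa_dist (Cc_alg GG) a a' * sa_norm (Cc_alg GG) b'"
    by (simp add: Cc_dist)
qed (auto simp: Cc_dist N_zero Cc_add Cc_scale Cc_conv Cc_star N_nonneg)

end

sublocale AH \<subseteq> cc: normed_star "Cc_alg (labelled_groupoid D)"
  by (rule Cc_normed_star)

subsection \<open>The level algebras as functions on the groupoid\<close>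

no_notation vec_nth (infixl "$" 90)

lemma A_alg_simps [simp]:
  "sa_carrier (A_alg D n) = A_carrier D n"
  "sa_add (A_alg D n) f g = fibrewise D n (\<lambda>i x. f i x + g i x)"
  "sa_mult (A_alg D n) f g = fibrewise D n (\<lambda>i x. f i x * g i x)"
  "sa_scale (A_alg D n) z f = fibrewise D n (\<lambda>i x. z \<cdot>\<^sub>m f i x)"
  "sa_star (A_alg D n) f = fibrewise D n (\<lambda>i x. mat_adjoint (f i x))"
  "sa_norm (A_alg D n) f = Sup {mat_opnorm (f i x) | i x. i < num D n \<and> x \<in> topspace (spc D n i)}"
  by (simp_all add: A_alg_def)

definition mbound :: "complex mat \<Rightarrow> real \<Rightarrow> bool" where
  "mbound M c \<longleftrightarrow> (\<forall>v\<in>carrier_vec (dim_col M).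
     L2_set (\<lambda>a. cmod ((M *\<^sub>v v) $ a)) {..<dim_row M} \<le> c * L2_set (\<lambda>a. cmod (v $ a)) {..<dim_col M})"

text \<open>As for the reduced norm, an a priori bound makes the set under the supremum bounded,
  after which normalising vectors shows the supremum to be the least bound.\<close>

lemma mat_opnorm_le_iff:
  assumes b: "mbound M c0"
  shows "0 \<le> mat_opnorm M" "0 \<le> c \<Longrightarrow> mat_opnorm M \<le> c \<longleftrightarrow> mbound M c"
proof -
  let ?L = "\<lambda>v. L2_set (\<lambda>a. cmod ((M *\<^sub>v v) $ a)) {..<dim_row M}"
  let ?V = "\<lambda>v. L2_set (\<lambda>a. cmod (v $ a)) {..<dim_col M}"
  let ?S = "{?L v | v. v \<in> carrier_vec (dim_col M) \<and> ?V v \<le> 1}"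
  \<comment> \<open>\<open>mbound\<close> puts no sign on its constant, hence the absolute
    value.\<close>
  have ub: "s \<le> \<bar>c\<bar>" if c: "mbound M c" and s: "s \<in> ?S" for s c
  proof -
    obtain v where v: "v \<in> carrier_vec (dim_col M)" "?V v \<le> 1" "s = ?L v" using s by blast
    have "s \<le> c * ?V v" using c v by (auto simp: mbound_def)
    also have "\<dots> \<le> \<bar>c\<bar> * 1" using v(2) by (intro mult_mono) auto
    finally show ?thesis by simp
  qed
  have bdd: "bdd_above ?S" using ub[OF b] by (rule bdd_aboveI)
  have ne: "?L (0\<^sub>v (dim_col M)) \<in> ?S" by (auto simp: L2_set_def intro!: exI[of _ "0\<^sub>v (dim_col M)"])
  show "0 \<le> mat_opnorm M"
    unfolding mat_opnorm_def by (rule order_trans[OF _ cSup_upper[OF ne bdd]]) simp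
  assume c: "0 \<le> c"
  show "mat_opnorm M \<le> c \<longleftrightarrow> mbound M c"
  proof
    assume m: "mbound M c"
    show "mat_opnorm M \<le> c" unfolding mat_opnorm_def using ne ub[OF m] c by (intro cSup_least) auto
  next
    assume le: "mat_opnorm M \<le> c"
    show "mbound M c"
      unfolding mbound_def
    proof
      fix v :: "complex Matrix.vec" assume v: "v \<in> carrier_vec (dim_col M)"
      show "?L v \<le> c * ?V v"
      proof (cases "?V v = 0")
        case True
        \<comment> \<open>A vector of norm zero cannot be normalised; the a priori bound shows that
          its image has norm zero too.\<close>
        have "?L v \<le> c0 * ?V v" using b v by (simp add: mbound_def)
        then show ?thesis using True by simp
      next
        case False
        then have V: "?V v > 0" using L2_set_nonneg[of "\<lambda>a. cmod (v $ a)" "{..<dim_col M}"] by linarith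
        let ?s = "complex_of_real (1 / ?V v)"
        let ?u = "?s \<cdot>\<^sub>v v"
        have u: "?u \<in> carrier_vec (dim_col M)" using v by simp
        have "?V ?u = L2_set (\<lambda>a. (1 / ?V v) * cmod (v $ a)) {..<dim_col M}"
          using v by (intro L2_set_cong refl) (auto simp: norm_mult norm_divide)
        also have "\<dots> = (1 / ?V v) * ?V v" using V by (intro L2_set_right_distrib[symmetric]) auto
        finally have u1: "?V ?u = 1" using V by simp
        have "M *\<^sub>v ?u = ?s \<cdot>\<^sub>v (M *\<^sub>v v)" using v by (intro mult_mat_vec) auto
        then have "?L ?u = L2_set (\<lambda>a. (1 / ?V v) * cmod ((M *\<^sub>v v) $ a)) {..<dim_row M}"
          by (intro L2_set_cong refl) (auto simp: norm_mult norm_divide)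
        also have "\<dots> = (1 / ?V v) * ?L v" using V by (intro L2_set_right_distrib[symmetric]) auto
        finally have "(1 / ?V v) * ?L v = ?L ?u" by simp
        also have "?L ?u \<le> mat_opnorm M"
          unfolding mat_opnorm_def by (rule cSup_upper[OF _ bdd]) (use u u1 in auto)
        finally have "?L v \<le> mat_opnorm M * ?V v" using V by (simp add: field_simps)
        also have "\<dots> \<le> c * ?V v" using le by (rule mult_right_mono) simp
        finally show ?thesis .
      qed
    qed
  qed
qed

section \<open>Operations in the level algebras and the functions \<open>Psi\<close>\<close>

context AH begin

lemma A_add_in: "f \<in> A_carrier D n \<Longrightarrow> g \<in> A_carrier D n \<Longrightarrow> fibrewise D n (\<lambda>i x. f i x + g i x) \<in> A_carrier D n"
proof (rule fibrewise_carrier)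
  assume f: "f \<in> A_carrier D n" and g: "g \<in> A_carrier D n"
  show "f i x + g i x \<in> carrier_mat (siz D n i) (siz D n i)" if "i < num D n" "x \<in> topspace (spc D n i)" for i x
    using A_carrierD(1)[OF f that] A_carrierD(1)[OF g that] by simp
  fix i a b assume i: "i < num D n" "a < siz D n i" "b < siz D n i"
  show "continuous_map (spc D n i) euclidean (\<lambda>x. (f i x + g i x) $$ (a, b))"
    by (rule continuous_map_eq[OF continuous_map_add[OF A_carrierD(2)[OF f i] A_carrierD(2)[OF g i]]])
       (use A_carrierD(1)[OF g i(1)] i in fastforce)
qed

lemma A_scale_in: "f \<in> A_carrier D n \<Longrightarrow> fibrewise D n (\<lambda>i x. z \<cdot>\<^sub>m f i x) \<in> A_carrier D n"
proof (rule fibrewise_carrier)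
  assume f: "f \<in> A_carrier D n"
  show "z \<cdot>\<^sub>m f i x \<in> carrier_mat (siz D n i) (siz D n i)" if "i < num D n" "x \<in> topspace (spc D n i)" for i x
    using A_carrierD(1)[OF f that] by simp
  fix i a b assume i: "i < num D n" "a < siz D n i" "b < siz D n i"
  show "continuous_map (spc D n i) euclidean (\<lambda>x. (z \<cdot>\<^sub>m f i x) $$ (a, b))"
    by (rule continuous_map_eq[OF continuous_map_mult_complex[OF continuous_map_canonical_const A_carrierD(2)[OF f i]]])
       (use A_carrierD(1)[OF f i(1)] i in fastforce)
qed

lemma adjoint_index: "M \<in> carrier_mat k k \<Longrightarrow> a < k \<Longrightarrow> b < k \<Longrightarrow> mat_adjoint (M :: complex mat) $$ (a, b) = cnj (M $$ (b, a))"
  by (auto simp: mat_adjoint_def mat_of_rows_index)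

lemma adjoint_carrier: "M \<in> carrier_mat k k \<Longrightarrow> mat_adjoint (M :: complex mat) \<in> carrier_mat k k"
  by (auto simp: mat_adjoint_def)

lemma A_star_in: "f \<in> A_carrier D n \<Longrightarrow> fibrewise D n (\<lambda>i x. mat_adjoint (f i x)) \<in> A_carrier D n"
proof (rule fibrewise_carrier)
  assume f: "f \<in> A_carrier D n"
  show "mat_adjoint (f i x) \<in> carrier_mat (siz D n i) (siz D n i)" if "i < num D n" "x \<in> topspace (spc D n i)" for i x
    using adjoint_carrier[OF A_carrierD(1)[OF f that]] .
  fix i a b assume i: "i < num D n" "a < siz D n i" "b < siz D n i"
  show "continuous_map (spc D n i) euclidean (\<lambda>x. mat_adjoint (f i x) $$ (a, b))"
    by (rule continuous_map_eq[OF continuous_map_cnj[OF A_carrierD(2)[OF f i(1,3,2)]]])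
       (use adjoint_index[OF A_carrierD(1)[OF f i(1)] i(2,3)] in auto)
qed

lemma mult_index: "A \<in> carrier_mat k k \<Longrightarrow> B \<in> carrier_mat k k \<Longrightarrow> a < k \<Longrightarrow> b < k \<Longrightarrow>
    (A * B) $$ (a, b) = (\<Sum>c<k. A $$ (a, c) * B $$ (c, b))"
  by (auto simp: scalar_prod_def lessThan_atLeast0 intro!: sum.cong)

lemma mult_vec_index: "M \<in> carrier_mat k l \<Longrightarrow> u \<in> carrier_vec l \<Longrightarrow> a < k \<Longrightarrow> (M *\<^sub>v u) $ a = (\<Sum>c<l. M $$ (a, c) * u $ c)"
  by (auto simp: scalar_prod_def lessThan_atLeast0 intro!: sum.cong)

lemma A_mult_in: "f \<in> A_carrier D n \<Longrightarrow> g \<in> A_carrier D n \<Longrightarrow> fibrewise D n (\<lambda>i x. f i x * g i x) \<in> A_carrier D n"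
proof (rule fibrewise_carrier)
  assume f: "f \<in> A_carrier D n" and g: "g \<in> A_carrier D n"
  show "f i x * g i x \<in> carrier_mat (siz D n i) (siz D n i)" if "i < num D n" "x \<in> topspace (spc D n i)" for i x
    using A_carrierD(1)[OF f that] A_carrierD(1)[OF g that] by simp
  fix i a b assume i: "i < num D n" "a < siz D n i" "b < siz D n i"
  have "continuous_map (spc D n i) euclidean (\<lambda>x. \<Sum>c<siz D n i. f i x $$ (a, c) * g i x $$ (c, b))"
    by (intro continuous_map_sum continuous_map_mult_complex A_carrierD(2)[OF f] A_carrierD(2)[OF g]) (use i in auto)
  then show "continuous_map (spc D n i) euclidean (\<lambda>x. (f i x * g i x) $$ (a, b))"
    by (rule continuous_map_eq) (use mult_index[OF A_carrierD(1)[OF f i(1)] A_carrierD(1)[OF g i(1)] i(2,3)] in auto)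
qed

text \<open>With \<open>pt\<close> and \<open>ix\<close> these are the coordinates of a path at
  level \<open>n\<close>: the summand, the point of its space and the matrix position.
  \<open>vtx\<close> and \<open>pt\<close> see the tail from level \<open>n\<close> on,
  \<open>ix\<close> the edges below \<open>n\<close>.\<close>

definition vtx :: "nat \<Rightarrow> (nat \<Rightarrow> 'e bedge \<times> 'a option) \<Rightarrow> nat" where
  "vtx n x = bsrc (fst (x n))"

definition pt :: "nat \<Rightarrow> (nat \<Rightarrow> 'e bedge \<times> 'a option) \<Rightarrow> 'a" where
  "pt n x = the (snd (x n))"

definition ix :: "nat \<Rightarrow> (nat \<Rightarrow> 'e bedge \<times> 'a option) \<Rightarrow> nat" where
  "ix n x = pos D (init_seg n (fst \<circ> x))"

lemma vtx_less: "n \<ge> 1 \<Longrightarrow> x \<in> P \<Longrightarrow> vtx n x < num D n"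
  unfolding vtx_def using bsrc_less pathD(1) by blast

lemma pt_in: "n \<ge> 1 \<Longrightarrow> x \<in> P \<Longrightarrow> pt n x \<in> topspace (spc D n (vtx n x))"
  and pt_Some: "n \<ge> 1 \<Longrightarrow> x \<in> P \<Longrightarrow> snd (x n) = Some (pt n x)"
  using pathD(3)[of x n] by (auto simp: vtx_def pt_def vs_topspace)

lemma ix_bij: "n \<ge> 1 \<Longrightarrow> x \<in> P \<Longrightarrow> bij_betw (ix n) (cls n x) {..<siz D n (vtx n x)}"
proof -
  assume n: "n \<ge> 1" and x: "x \<in> P"
  let ?i = "bsrc (fst (x n))"
  have "bij_betw (\<lambda>y. init_seg n (fst \<circ> y)) (cls n x) (paths_to n ?i)"
  proof (rule bij_betw_byWitness[where f' = "\<lambda>q. sw q x"])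
    show "\<forall>q\<in>paths_to n ?i. init_seg n (fst \<circ> sw q x) = q" using sw(2)[OF n _ x] by blast
    show "\<forall>y\<in>cls n x. sw (init_seg n (fst \<circ> y)) x = y" using sw_eq[OF n] by (auto simp: cls_def)
    show "(\<lambda>q. sw q x) ` paths_to n ?i \<subseteq> cls n x" using sw(1)[OF n _ x] by (auto simp: cls_def)
    show "(\<lambda>y. init_seg n (fst \<circ> y)) ` cls n x \<subseteq> paths_to n ?i"
      using init_paths_to[OF n] by (auto simp: cls_def R_iff)
  qed
  from bij_betw_trans[OF this pos_bij_betw[OF n]] vtx_less[OF n x]
  show ?thesis by (simp add: vtx_def ix_def[abs_def] comp_def)
qed

lemma ix_less: "n \<ge> 1 \<Longrightarrow> x \<in> P \<Longrightarrow> ix n x < siz D n (vtx n x)"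
  using bij_betwE[OF ix_bij] R_refl by (auto simp: cls_def)

lemma vtx_eq: "(x, y) \<in> R n \<Longrightarrow> vtx n x = vtx n y" and pt_eq: "(x, y) \<in> R n \<Longrightarrow> pt n x = pt n y"
  by (auto simp: R_iff vtx_def pt_def)

definition Psi :: "nat \<Rightarrow> 'a elt \<Rightarrow> (nat \<Rightarrow> 'e bedge \<times> 'a option) \<times> (nat \<Rightarrow> 'e bedge \<times> 'a option) \<Rightarrow> complex" where
  "Psi n f = (\<lambda>(x, y). if (x, y) \<in> R n then f (vtx n x) (pt n x) $$ (ix n x, ix n y) else 0)"

lemma Psi_R: "(x, y) \<in> R n \<Longrightarrow> Psi n f (x, y) = f (vtx n x) (pt n x) $$ (ix n x, ix n y)"
  and Psi_out: "(x, y) \<notin> R n \<Longrightarrow> Psi n f (x, y) = 0"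
  by (auto simp: Psi_def)

lemma Psi_supp: "suppR n (Psi n f)" by (auto simp: suppR_def Psi_def)

text \<open>On arrows whose second path has a fixed initial segment the column of the entry is
  constant; the row and the point depend only on the first path, to which
  \<open>continuous_level\<close> applies.\<close>

lemma Psi_CR:
  assumes n: "n \<ge> 1" and f: "f \<in> A_carrier D n"
  shows "Psi n f \<in> CR n"
proof -
  let ?T = "subtopology PP (R n)"
  \<comment> \<open>Meant for initial segments of length \<open>Suc n\<close>: the edge of index
    \<open>n\<close> carries the vertex and the label at level \<open>n\<close>, and the edges
    before it encode the row. The default 0 is for column numbers too large for the matrix at that
    vertex.\<close>
  define G where "G k p t = (if k < siz D n (bsrc (last p))
     then f (bsrc (last p)) (the t) $$ (pos D (butlast p), k) else 0)" for k p t
  have but: "butlast (init_seg (Suc n) x) = init_seg n x" for x :: "nat \<Rightarrow> 'e bedge" by (simp add: init_seg_Suc)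
  have H: "continuous_map X euclidean (\<lambda>x. G k (init_seg (Suc n) (fst \<circ> x)) (snd (x n)))" for k
  proof (rule continuous_level)
    fix p assume p: "p \<in> fin_paths D" "length p = Suc n"
    obtain q b where q: "p = q @ [b]" "q \<in> fin_paths D" "length q = n" "b \<in> bedges D n" "bsrc b = btgt (last q)"
    proof (rule fin_path_cases[OF p])
      show thesis if "n = 0" using that n by simp
    qed (rule that)
    have i: "bsrc b < num D n" "pos D q < siz D n (bsrc b)" using q pos_less[OF q(2)] bsrc_less[OF q(4) n] by auto
    have "continuous_map (vertex_space D n (bsrc b)) euclidean (\<lambda>t. f (bsrc b) (the t) $$ (pos D q, k))" if "k < siz D n (bsrc b)"
      using continuous_map_compose[OF vs_the[OF n] A_carrierD(2)[OF f i that]] by (simp add: comp_def)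
    then show "continuous_map (vertex_space D n (bsrc (last p))) euclidean (G k p)"
      by (cases "k < siz D n (bsrc b)") (auto simp: G_def[abs_def] q(1))
  qed
  have "continuous_map ?T euclidean (Psi n f)"
  proof (rule pasting_lemma[where I = "fpaths n" and T = "\<lambda>q. {z \<in> R n. init_seg n (fst \<circ> snd z) = q}" and
        f = "\<lambda>q z. G (pos D q) (init_seg (Suc n) (fst \<circ> fst z)) (snd (fst z n))"])
    fix q assume q: "q \<in> fpaths n"
    have o: "openin X (cylinder D q (topspace (vertex_space D (length q - 1) (bsrc (last q)))))"
      using q by (intro cylinder_open) (auto simp: fpaths_def)
    have "openin ?T {z \<in> topspace ?T. snd z \<in> cylinder D q (topspace (vertex_space D (length q - 1) (bsrc (last q))))}"
      by (rule openin_continuous_map_preimage[OF _ o]) (auto intro: continuous_map_from_subtopology continuous_map_snd)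
    moreover have "{z \<in> topspace ?T. snd z \<in> cylinder D q (topspace (vertex_space D (length q - 1) (bsrc (last q))))}
       = {z \<in> R n. init_seg n (fst \<circ> snd z) = q}"
    proof -
      have "snd (y (n - 1)) \<in> topspace (vertex_space D (n - 1) (bsrc (last q)))" if "y \<in> P" "init_seg n (fst \<circ> y) = q" for y
        using pathD(3)[OF that(1), of "n - 1"] last_init_seg[of "n - 1" "fst \<circ> y"] that(2) n by simp
      then show ?thesis using q unfolding R_top by (auto simp: cylinder_def fpaths_def R_iff)
    qed
    ultimately show "openin ?T {z \<in> R n. init_seg n (fst \<circ> snd z) = q}" by simp
    have "continuous_map ?T euclidean (\<lambda>z. G (pos D q) (init_seg (Suc n) (fst \<circ> fst z)) (snd (fst z n)))"
      using continuous_map_compose[OF _ H[of "pos D q"], of ?T fst]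
      by (simp add: comp_def continuous_map_from_subtopology continuous_map_fst)
    then show "continuous_map (subtopology ?T {z \<in> R n. init_seg n (fst \<circ> snd z) = q}) euclidean
       (\<lambda>z. G (pos D q) (init_seg (Suc n) (fst \<circ> fst z)) (snd (fst z n)))"
      by (rule continuous_map_from_subtopology)
  next
    fix z assume "z \<in> topspace ?T"
    then have z: "z \<in> R n" unfolding R_top .
    obtain x y where xy: "z = (x, y)" by (cases z)
    have P: "x \<in> P" "y \<in> P" using z xy by (auto simp: R_iff)
    have "ix n y < siz D n (vtx n x)" using ix_less[OF n P(2)] vtx_eq z xy by metis
    then have "Psi n f z = G (ix n y) (init_seg (Suc n) (fst \<circ> x)) (snd (x n))"
      using z xy by (simp add: Psi_R G_def but) (simp add: vtx_def pt_def ix_def)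
    then show "\<exists>q. q \<in> fpaths n \<and> z \<in> {z \<in> R n. init_seg n (fst \<circ> snd z) = q} \<and>
       Psi n f z = G (pos D q) (init_seg (Suc n) (fst \<circ> fst z)) (snd (fst z n))"
      using z xy init_in_fpaths[OF n P(2)] by (intro exI[of _ "init_seg n (fst \<circ> y)"]) (auto simp: ix_def)
  qed auto
  then show ?thesis using Psi_supp by (simp add: CR_def)
qed

lemma Psi_Cc: "n \<ge> 1 \<Longrightarrow> f \<in> A_carrier D n \<Longrightarrow> Psi n f \<in> Cc GG"
  using Psi_CR Cc_iff by blast

lemma Psi_entry:
  assumes n: "n \<ge> 1" and xy: "(x, y) \<in> R n"
  shows "vtx n x < num D n" "pt n x \<in> topspace (spc D n (vtx n x))" "ix n x < siz D n (vtx n x)" "ix n y < siz D n (vtx n x)"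
proof -
  have P: "x \<in> P" "y \<in> P" using xy by (auto simp: R_iff)
  show "vtx n x < num D n" "pt n x \<in> topspace (spc D n (vtx n x))" "ix n x < siz D n (vtx n x)"
    using vtx_less[OF n P(1)] pt_in[OF n P(1)] ix_less[OF n P(1)] by auto
  show "ix n y < siz D n (vtx n x)" using ix_less[OF n P(2)] vtx_eq[OF xy] by simp
qed

lemma Psi_add:
  assumes n: "n \<ge> 1" and f: "f \<in> A_carrier D n" and g: "g \<in> A_carrier D n"
  shows "Psi n (sa_add (A_alg D n) f g) = (\<lambda>z. Psi n f z + Psi n g z)"
proof (rule ext, clarify)
  fix x y show "Psi n (sa_add (A_alg D n) f g) (x, y) = Psi n f (x, y) + Psi n g (x, y)"
  proof (cases "(x, y) \<in> R n")
    case True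
    note e = Psi_entry[OF n True]
    show ?thesis using A_carrierD(1)[OF g e(1,2)] A_carrierD(1)[OF f e(1,2)] e by (simp add: Psi_R[OF True])
  qed (simp add: Psi_out)
qed

lemma Psi_scale:
  assumes n: "n \<ge> 1" and f: "f \<in> A_carrier D n"
  shows "Psi n (sa_scale (A_alg D n) c f) = (\<lambda>z. c * Psi n f z)"
proof (rule ext, clarify)
  fix x y show "Psi n (sa_scale (A_alg D n) c f) (x, y) = c * Psi n f (x, y)"
  proof (cases "(x, y) \<in> R n")
    case True
    note e = Psi_entry[OF n True]
    show ?thesis using A_carrierD(1)[OF f e(1,2)] e by (simp add: Psi_R[OF True])
  qed (simp add: Psi_out)
qed

lemma Psi_star:
  assumes n: "n \<ge> 1" and f: "f \<in> A_carrier D n"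
  shows "Psi n (sa_star (A_alg D n) f) = sa_star (Cc_alg GG) (Psi n f)"
proof (rule ext, clarify)
  fix x y show "Psi n (sa_star (A_alg D n) f) (x, y) = sa_star (Cc_alg GG) (Psi n f) (x, y)"
  proof (cases "(x, y) \<in> R n")
    case True
    note e = Psi_entry[OF n True]
    have "(x, y) \<in> topspace Gt" using True G_arrow by blast
    then show ?thesis
      using adjoint_index[OF A_carrierD(1)[OF f e(1,2)] e(3,4)] e vtx_eq[OF True] pt_eq[OF True]
      by (simp add: Psi_R[OF True] Psi_R[OF R_sym[OF True]] star_eq)
  next
    case False
    then have "(y, x) \<notin> R n" using R_sym by blast
    then show ?thesis using False by (simp add: Psi_out star_eq)
  qed
qed

text \<open>Within a class \<open>vtx\<close> and \<open>pt\<close> are constant and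
  \<open>ix n\<close> is a bijection onto the matrix positions, so summing over the middle path is
  matrix multiplication at one point.\<close>

lemma Psi_mult:
  assumes n: "n \<ge> 1" and f: "f \<in> A_carrier D n" and g: "g \<in> A_carrier D n"
  shows "Psi n (sa_mult (A_alg D n) f g) = convolve GG (Psi n f) (Psi n g)"
proof (rule ext, clarify)
  fix x z show "Psi n (sa_mult (A_alg D n) f g) (x, z) = convolve GG (Psi n f) (Psi n g) (x, z)"
  proof (cases "(x, z) \<in> R n")
    case True
    note e = Psi_entry[OF n True]
    let ?i = "vtx n x" and ?t = "pt n x"
    have arr: "(x, z) \<in> topspace Gt" and x: "x \<in> P" using True G_arrow by (blast, simp add: R_iff)
    have "convolve GG (Psi n f) (Psi n g) (x, z) = (\<Sum>y\<in>cls n x. Psi n f (x, y) * Psi n g (y, z))"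
      by (rule conv_cls[OF Psi_supp arr])
    also have "\<dots> = (\<Sum>y\<in>cls n x. f ?i ?t $$ (ix n x, ix n y) * g ?i ?t $$ (ix n y, ix n z))"
    proof (rule sum.cong[OF refl])
      fix y assume "y \<in> cls n x"
      then have xy: "(x, y) \<in> R n" by (simp add: cls_def)
      have yz: "(y, z) \<in> R n" using R_trans[OF R_sym[OF xy] True] .
      show "Psi n f (x, y) * Psi n g (y, z) = f ?i ?t $$ (ix n x, ix n y) * g ?i ?t $$ (ix n y, ix n z)"
        using vtx_eq[OF xy] pt_eq[OF xy] by (simp add: Psi_R[OF xy] Psi_R[OF yz])
    qed
    also have "\<dots> = (\<Sum>c<siz D n ?i. f ?i ?t $$ (ix n x, c) * g ?i ?t $$ (c, ix n z))"
      by (rule sum.reindex_bij_betw[OF ix_bij[OF n x]])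
    also have "\<dots> = (f ?i ?t * g ?i ?t) $$ (ix n x, ix n z)"
      by (rule mult_index[OF A_carrierD(1)[OF f e(1,2)] A_carrierD(1)[OF g e(1,2)] e(3,4), symmetric])
    finally show ?thesis using e by (simp add: Psi_R[OF True])
  next
    case False
    then show ?thesis using conv_supp[OF Psi_supp Psi_supp] suppRD Psi_out by metis
  qed
qed

lemma ix_Suc:
  assumes n: "n \<ge> 1" and x: "x \<in> P"
  obtains e where "fst (x n) = Edge (vtx n x) e (vtx (Suc n) x)" "vtx n x < num D n" "vtx (Suc n) x < num D (Suc n)"
    "e \<in> edg D n (vtx n x) (vtx (Suc n) x)" "ix (Suc n) x = block_offset D n (vtx (Suc n) x) (vtx n x, e) + ix n x"
    "egn D n (vtx n x) (vtx (Suc n) x) e (pt (Suc n) x) = pt n x"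
proof -
  obtain i e j where b: "fst (x n) = Edge i e j" "i < num D n" "j < num D (Suc n)" "e \<in> edg D n i j"
    using pathD(1)[OF x, of n] bedges_pos[OF n] by blast
  have v: "vtx n x = i" "vtx (Suc n) x = j" using b(1) pathD(2)[OF x, of n] by (auto simp: vtx_def)
  have "ix (Suc n) x = block_offset D n j (i, e) + ix n x"
    using b(1) by (simp add: ix_def init_seg_Suc pos_snoc)
  moreover have "egn D n i j e (pt (Suc n) x) = pt n x"
    using pathD(4)[OF x, of n] b(1) pt_Some[OF n x] pt_Some[of "Suc n" x] x by (simp add: edge_label_def)
  ultimately show thesis using that b v by simp
qed

text \<open>A pair in \<open>R (Suc n)\<close> belongs to \<open>R n\<close> exactly if both paths
  use the same edge of index \<open>n\<close>, that is, if row and column lie in the same diagonal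
  block. Off these blocks both sides vanish.\<close>

lemma Psi_conn:
  assumes n: "n \<ge> 1" and f: "f \<in> A_carrier D n"
  shows "Psi (Suc n) (conn D n f) = Psi n f"
proof (rule ext, clarify)
  fix x y show "Psi (Suc n) (conn D n f) (x, y) = Psi n f (x, y)"
  proof (cases "(x, y) \<in> R (Suc n)")
    case True
    then have P: "x \<in> P" "y \<in> P" by (auto simp: R_iff)
    have n1: "Suc n \<ge> 1" by simp
    let ?j = "vtx (Suc n) x"
    have j: "vtx (Suc n) y = ?j" and t: "pt (Suc n) y = pt (Suc n) x" using vtx_eq[OF True] pt_eq[OF True] by auto
    obtain e where e: "fst (x n) = Edge (vtx n x) e ?j" "vtx n x < num D n" "?j < num D (Suc n)"
      "e \<in> edg D n (vtx n x) ?j" "ix (Suc n) x = block_offset D n ?j (vtx n x, e) + ix n x"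
      "egn D n (vtx n x) ?j e (pt (Suc n) x) = pt n x" using ix_Suc[OF n P(1)] by blast
    obtain e' where e': "fst (y n) = Edge (vtx n y) e' ?j" "vtx n y < num D n"
      "e' \<in> edg D n (vtx n y) ?j" "ix (Suc n) y = block_offset D n ?j (vtx n y, e') + ix n y" using ix_Suc[OF n P(2)] j by metis
    have "Psi (Suc n) (conn D n f) (x, y) = conn D n f ?j (pt (Suc n) x) $$ (ix (Suc n) x, ix (Suc n) y)"
      by (rule Psi_R[OF True])
    also have "\<dots> = (if vtx n x = vtx n y \<and> e = e' then f (vtx n x) (pt n x) $$ (ix n x, ix n y) else 0)"
      unfolding e(5) e'(4)
      by (rule conn_entry[OF n f e(3) pt_in[OF n1 P(1)] e(2,4) e'(2,3) ix_less[OF n P(1)] ix_less[OF n P(2)], unfolded e(6)])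
    also have "\<dots> = Psi n f (x, y)"
    proof -
      have "(x, y) \<in> R n \<longleftrightarrow> fst (x n) = fst (y n)" using R_char[OF True, of n] by (auto simp: less_Suc_eq)
      then have "(x, y) \<in> R n \<longleftrightarrow> vtx n x = vtx n y \<and> e = e'" using e(1) e'(1) by auto
      then show ?thesis by (auto simp: Psi_def)
    qed
    finally show ?thesis .
  next
    case False
    then have "(x, y) \<notin> R n" using R_mono[of n "Suc n"] by auto
    then show ?thesis using False by (simp add: Psi_out)
  qed
qed

lemma point_path:
  assumes n: "n \<ge> 1" and i: "i < num D n" and t: "t \<in> topspace (spc D n i)" and a: "a < siz D n i"
  obtains x where "x \<in> P" "vtx n x = i" "pt n x = t" "ix n x = a"
proof -
  have "a \<in> pos D ` paths_to n i" using pos_bij_betw[OF n i] a by (auto simp: bij_betw_def)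
  then obtain p where p: "p \<in> paths_to n i" "pos D p = a" by blast
  obtain x where "x \<in> P" "init_seg n (fst \<circ> x) = p" "snd (x n) = Some t" "bsrc (fst (x n)) = i"
    using level_surj[OF n i t p(1)] by blast
  then show thesis using that[of x] p(2) by (simp add: vtx_def pt_def ix_def)
qed

text \<open>Every entry of every fibre is the value of \<open>Psi\<close> at some arrow, so nothing
  is lost in passing from elements to functions.\<close>

lemma point_pair:
  assumes n: "n \<ge> 1" and i: "i < num D n" and t: "t \<in> topspace (spc D n i)" and a: "a < siz D n i" and b: "b < siz D n i"
  obtains x y where "(x, y) \<in> R n" "vtx n x = i" "pt n x = t" "ix n x = a" "ix n y = b"
proof -
  obtain x where x: "x \<in> P" "vtx n x = i" "pt n x = t" "ix n x = a" using point_path[OF n i t a] by blast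
  have "b \<in> ix n ` cls n x" using ix_bij[OF n x(1)] b x(2) by (auto simp: bij_betw_def)
  then obtain y where "y \<in> cls n x" "ix n y = b" by blast
  then show thesis using that[of x y] x by (simp add: cls_def)
qed

lemma Psi_inj: "n \<ge> 1 \<Longrightarrow> f \<in> A_carrier D n \<Longrightarrow> g \<in> A_carrier D n \<Longrightarrow> Psi n f = Psi n g \<Longrightarrow> f = g"
proof (rule A_carrier_eqI)
  assume n: "n \<ge> 1" and eq: "Psi n f = Psi n g"
  fix i t a b assume a: "i < num D n" "t \<in> topspace (spc D n i)" "a < siz D n i" "b < siz D n i"
  obtain x y where "(x, y) \<in> R n" "vtx n x = i" "pt n x = t" "ix n x = a" "ix n y = b" using point_pair[OF n a] by blast
  then show "f i t $$ (a, b) = g i t $$ (a, b)" using Psi_R[of x y n f] Psi_R[of x y n g] eq by simp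
qed

text \<open>Through \<open>ix n\<close> the functions on one tail class become the coordinate
  vectors on which the fibre matrix \<open>M\<close> acts.\<close>

lemma block_L2:
  assumes n: "n \<ge> 1" and f: "f \<in> A_carrier D n" and w: "w \<in> P" and M: "M = f (vtx n w) (pt n w)"
    and u: "u \<in> carrier_vec (dim_col M)"
  shows "L2_set (\<lambda>x. cmod (\<Sum>z\<in>cls n w. Psi n f (x, z) * u $ ix n z)) (cls n w) = L2_set (\<lambda>a. cmod ((M *\<^sub>v u) $ a)) {..<dim_row M}"
    "L2_set (\<lambda>z. cmod (u $ ix n z)) (cls n w) = L2_set (\<lambda>a. cmod (u $ a)) {..<dim_col M}"
proof -
  let ?k = "siz D n (vtx n w)"
  have Mc: "M \<in> carrier_mat ?k ?k" unfolding M by (rule A_carrierD(1)[OF f vtx_less[OF n w] pt_in[OF n w]])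
  note bij = ix_bij[OF n w]
  have row: "(\<Sum>z\<in>cls n w. Psi n f (x, z) * u $ ix n z) = (M *\<^sub>v u) $ ix n x" if x: "x \<in> cls n w" for x
  proof -
    have wx: "(w, x) \<in> R n" using x by (simp add: cls_def)
    have "(\<Sum>z\<in>cls n w. Psi n f (x, z) * u $ ix n z) = (\<Sum>z\<in>cls n w. M $$ (ix n x, ix n z) * u $ ix n z)"
    proof (rule sum.cong[OF refl])
      fix z assume "z \<in> cls n w"
      then have "(x, z) \<in> R n" using R_trans[OF R_sym[OF wx]] by (simp add: cls_def)
      then show "Psi n f (x, z) * u $ ix n z = M $$ (ix n x, ix n z) * u $ ix n z"
        using vtx_eq[OF wx] pt_eq[OF wx] by (simp add: Psi_R M)
    qed
    also have "\<dots> = (\<Sum>c<?k. M $$ (ix n x, c) * u $ c)" by (rule sum.reindex_bij_betw[OF bij])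
    also have "\<dots> = (M *\<^sub>v u) $ ix n x"
      using bij_betwE[OF bij] x u Mc by (intro mult_vec_index[OF Mc, symmetric]) auto
    finally show ?thesis .
  qed
  have "(\<Sum>x\<in>cls n w. (cmod (\<Sum>z\<in>cls n w. Psi n f (x, z) * u $ ix n z))\<^sup>2) = (\<Sum>x\<in>cls n w. (cmod ((M *\<^sub>v u) $ ix n x))\<^sup>2)"
    by (intro sum.cong refl) (simp add: row)
  also have "\<dots> = (\<Sum>a<?k. (cmod ((M *\<^sub>v u) $ a))\<^sup>2)" by (rule sum.reindex_bij_betw[OF bij])
  finally show "L2_set (\<lambda>x. cmod (\<Sum>z\<in>cls n w. Psi n f (x, z) * u $ ix n z)) (cls n w) = L2_set (\<lambda>a. cmod ((M *\<^sub>v u) $ a)) {..<dim_row M}"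
    using Mc by (simp add: L2_set_def)
  have "(\<Sum>z\<in>cls n w. (cmod (u $ ix n z))\<^sup>2) = (\<Sum>a<?k. (cmod (u $ a))\<^sup>2)" by (rule sum.reindex_bij_betw[OF bij])
  then show "L2_set (\<lambda>z. cmod (u $ ix n z)) (cls n w) = L2_set (\<lambda>a. cmod (u $ a)) {..<dim_col M}"
    using Mc by (simp add: L2_set_def)
qed

lemma Psi_kbound_mbound:
  assumes n: "n \<ge> 1" and f: "f \<in> A_carrier D n" and k: "kbound P (Psi n f) c" and i: "i < num D n" "t \<in> topspace (spc D n i)"
  shows "mbound (f i t) c"
  unfolding mbound_def
proof
  fix v :: "complex Matrix.vec" assume v: "v \<in> carrier_vec (dim_col (f i t))"
  obtain w where w: "w \<in> P" "vtx n w = i" "pt n w = t"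
    by (rule point_path[OF n i, of 0]) (use siz_pos[OF n i(1)] in auto)
  have cl: "finite (cls n w)" "cls n w \<subseteq> P" using finite_cls by (auto simp: cls_def R_iff)
  have ft: "f i t = f (vtx n w) (pt n w)" using w by simp
  show "L2_set (\<lambda>a. cmod ((f i t *\<^sub>v v) $ a)) {..<dim_row (f i t)} \<le> c * L2_set (\<lambda>a. cmod (v $ a)) {..<dim_col (f i t)}"
    using kboundD[OF k cl, of "\<lambda>z. v $ ix n z"]
    by (simp only: block_L2[OF n f w(1) ft v])
qed

lemma mbound_Psi_kbound:
  assumes n: "n \<ge> 1" and f: "f \<in> A_carrier D n" and c: "0 \<le> c"
    and m: "\<And>i t. i < num D n \<Longrightarrow> t \<in> topspace (spc D n i) \<Longrightarrow> mbound (f i t) c"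
  shows "kbound P (Psi n f) c"
proof (rule kbound_blocks[OF c, where k = "tl_of n"])
  show "tl_of n x = tl_of n y" if "Psi n f (x, y) \<noteq> 0" for x y using Psi_supp that by (auto simp: suppR_def R_tl)
  fix F v
  assume F: "finite F" "F \<subseteq> P" "F \<noteq> {}" and tl: "\<And>x y. x \<in> F \<Longrightarrow> y \<in> F \<Longrightarrow> tl_of n x = tl_of n y"
  obtain w where w: "w \<in> F" using F by blast
  then have wP: "w \<in> P" using F by auto
  let ?i = "vtx n w" and ?t = "pt n w"
  have sub: "F \<subseteq> cls n w" using tl[OF w] F(2) wP unfolding cls_def R_tl by blast
  have Mc: "f ?i ?t \<in> carrier_mat (siz D n ?i) (siz D n ?i)" by (rule A_carrierD(1)[OF f vtx_less[OF n wP] pt_in[OF n wP]])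
  show "L2_set (\<lambda>x. cmod (\<Sum>z\<in>F. Psi n f (x, z) * v z)) F \<le> c * L2_set (\<lambda>z. cmod (v z)) F"
  \<comment> \<open>It suffices to treat the whole class, where the kernel is a full fibre
    matrix.\<close>
  proof (rule kbound_subset[OF finite_cls sub c])
    fix v :: "(nat \<Rightarrow> 'e bedge \<times> 'a option) \<Rightarrow> complex"
    \<comment> \<open>The function \<open>v\<close> on the class, rewritten in matrix
      positions.\<close>
    let ?u = "Matrix.vec (siz D n ?i) (\<lambda>k. v (the_inv_into (cls n w) (ix n) k))"
    have u: "?u \<in> carrier_vec (dim_col (f ?i ?t))" using Mc by auto
    have uv: "?u $ ix n z = v z" if "z \<in> cls n w" for z
    proof -
      have "ix n z < siz D n ?i" using bij_betwE[OF ix_bij[OF n wP]] that by auto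
      then show ?thesis using the_inv_into_f_f[OF bij_betw_imp_inj_on[OF ix_bij[OF n wP]] that] by simp
    qed
    have mw: "mbound (f ?i ?t) c" by (rule m[OF vtx_less[OF n wP] pt_in[OF n wP]])
    note b = block_L2[OF n f wP refl u]
    have "L2_set (\<lambda>x. cmod (\<Sum>z\<in>cls n w. Psi n f (x, z) * v z)) (cls n w) = L2_set (\<lambda>x. cmod (\<Sum>z\<in>cls n w. Psi n f (x, z) * ?u $ ix n z)) (cls n w)"
      by (intro L2_set_cong refl arg_cong[where f = cmod] sum.cong) (simp add: uv)
    also have "\<dots> = L2_set (\<lambda>a. cmod ((f ?i ?t *\<^sub>v ?u) $ a)) {..<dim_row (f ?i ?t)}" by (rule b(1))
    also have "\<dots> \<le> c * L2_set (\<lambda>a. cmod (?u $ a)) {..<dim_col (f ?i ?t)}"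
      by (rule bspec[OF mw[unfolded mbound_def] u])
    also have "L2_set (\<lambda>a. cmod (?u $ a)) {..<dim_col (f ?i ?t)} = L2_set (\<lambda>z. cmod (?u $ ix n z)) (cls n w)" by (rule b(2)[symmetric])
    also have "\<dots> = L2_set (\<lambda>z. cmod (v z)) (cls n w)" by (intro L2_set_cong refl) (simp add: uv)
    finally show "L2_set (\<lambda>x. cmod (\<Sum>z\<in>cls n w. Psi n f (x, z) * v z)) (cls n w) \<le> c * L2_set (\<lambda>z. cmod (v z)) (cls n w)" .
  qed
qed

lemma Psi_kbound_iff:
  assumes n: "n \<ge> 1" and f: "f \<in> A_carrier D n" and c: "0 \<le> c"
  shows "kbound P (Psi n f) c \<longleftrightarrow> (\<forall>i<num D n. \<forall>t\<in>topspace (spc D n i). mbound (f i t) c)"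
  using Psi_kbound_mbound[OF n f] mbound_Psi_kbound[OF n f c] by blast

text \<open>Both norms are least constants, and by \<open>Psi_kbound_iff\<close> a nonnegative
  constant bounds the kernel iff it bounds every fibre.\<close>

lemma Psi_norm:
  assumes n: "n \<ge> 1" and f: "f \<in> A_carrier D n"
  shows "sa_norm (A_alg D n) f = N (Psi n f)"
proof -
  have Cc: "Psi n f \<in> Cc GG" by (rule Psi_Cc[OF n f])
  have N: "0 \<le> N (Psi n f)" "kbound P (Psi n f) (N (Psi n f))" using N_nonneg[OF Cc] N_kbound[OF Cc] by auto
  let ?S = "{mat_opnorm (f i x) | i x. i < num D n \<and> x \<in> topspace (spc D n i)}"
  have mb: "mbound (f i t) (N (Psi n f))" if "i < num D n" "t \<in> topspace (spc D n i)" for i t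
    using Psi_kbound_iff[OF n f N(1)] N(2) that by blast
  have ub: "s \<le> N (Psi n f)" if "s \<in> ?S" for s using that mat_opnorm_le_iff(2)[OF mb N(1)] mb by auto
  obtain t where t: "t \<in> topspace (spc D n 0)" "0 < num D n" using space_ne[OF n, of 0] num_pos[OF n] by fastforce
  have ne: "mat_opnorm (f 0 t) \<in> ?S" using t by blast
  have bdd: "bdd_above ?S" using ub by (rule bdd_aboveI)
  have "Sup ?S \<le> N (Psi n f)" using ne ub by (intro cSup_least) auto
  moreover have S0: "0 \<le> Sup ?S" using cSup_upper[OF ne bdd] mat_opnorm_le_iff(1)[OF mb[OF t(2,1)]] by linarith
  moreover have "N (Psi n f) \<le> Sup ?S"
  proof (rule N_leI[OF Cc], subst Psi_kbound_iff[OF n f S0], intro allI impI ballI)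
    fix i t assume i: "i < num D n" "t \<in> topspace (spc D n i)"
    have "mat_opnorm (f i t) \<le> Sup ?S" by (rule cSup_upper[OF _ bdd]) (use i in blast)
    then show "mbound (f i t) (Sup ?S)" using mat_opnorm_le_iff(2)[OF mb[OF i] S0] by blast
  qed
  ultimately show ?thesis by simp
qed

end

lemma continuous_map_divide_complex:
  fixes f g :: "'x \<Rightarrow> complex"
  shows "continuous_map X euclidean f \<Longrightarrow> continuous_map X euclidean g \<Longrightarrow> (\<And>x. x \<in> topspace X \<Longrightarrow> g x \<noteq> 0) \<Longrightarrow>
    continuous_map X euclidean (\<lambda>x. f x / g x)"
  by (simp add: continuous_map_atin tendsto_divide)

lemma transit_self: "k \<le> n \<Longrightarrow> transit \<phi> n k a = a"
  by (simp add: transit_def)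

lemma transit_Suc: "n \<le> k \<Longrightarrow> transit \<phi> n (Suc k) a = \<phi> k (transit \<phi> n k a)"
  by (simp add: transit_def)

context AH begin

subsection \<open>The algebraic limit as a subalgebra of the convolution algebra\<close>

lemma transit_A:
  assumes "n \<ge> 1" "n \<le> k" "a \<in> A_carrier D n"
  shows "transit (conn D) n k a \<in> A_carrier D k \<and> Psi k (transit (conn D) n k a) = Psi n a"
  using assms(2)
proof (induction rule: dec_induct)
  case base
  then show ?case using assms(3) by (simp add: transit_self)
next
  case (step k)
  then show ?case using assms(1) conn_in[of k] Psi_conn[of k] by (simp add: transit_Suc)
qed

abbreviation "DL \<equiv> direct_limit (A_alg D) (conn D)"
abbreviation "dlc \<equiv> dl_class (A_alg D) (conn D)"

text \<open>\<open>Psi\<close> is unchanged by connecting maps and injective on each level, so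
  eventual equality in the direct limit means equality of functions on the groupoid: a class is a
  fibre of \<open>Psi\<close>.\<close>

lemma dlc_eq:
  assumes "n \<ge> 1" "a \<in> A_carrier D n"
  shows "dlc n a = {(m, b). m \<ge> 1 \<and> b \<in> A_carrier D m \<and> Psi m b = Psi n a}"
proof (intro equalityI subsetI; clarify)
  fix m b assume "(m, b) \<in> dlc n a"
  then obtain k where k: "m \<ge> 1" "b \<in> A_carrier D m" "k \<ge> n" "k \<ge> m" "transit (conn D) n k a = transit (conn D) m k b"
    by (auto simp: dl_class_def)
  then show "m \<ge> 1 \<and> b \<in> A_carrier D m \<and> Psi m b = Psi n a"
    using transit_A[OF k(1,4,2)] transit_A[OF assms(1) k(3) assms(2)] by auto
next
  fix m b assume m: "m \<ge> 1" "b \<in> A_carrier D m" "Psi m b = Psi n a"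
  let ?k = "max n m"
  have "transit (conn D) n ?k a = transit (conn D) m ?k b"
    by (rule Psi_inj[of ?k]) (use transit_A[OF m(1) _ m(2), of ?k] transit_A[OF assms(1) _ assms(2), of ?k] m assms in auto)
  then show "(m, b) \<in> dlc n a" using m by (auto simp: dl_class_def intro!: exI[of _ ?k])
qed

lemma dlc_eq_iff:
  assumes "n \<ge> 1" "a \<in> A_carrier D n" "m \<ge> 1" "b \<in> A_carrier D m"
  shows "dlc n a = dlc m b \<longleftrightarrow> Psi n a = Psi m b"
proof
  assume "dlc n a = dlc m b"
  then have "(n, a) \<in> dlc m b" using dlc_eq[OF assms(1,2)] assms by auto
  then show "Psi n a = Psi m b" using dlc_eq[OF assms(3,4)] by auto
next
  assume eq: "Psi n a = Psi m b"
  show "dlc n a = dlc m b" unfolding dlc_eq[OF assms(1,2)] dlc_eq[OF assms(3,4)] eq ..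
qed

text \<open>By \<open>dlc_eq\<close> all members of a class have the same function, so the arbitrary
  choice is harmless.\<close>

definition F :: "(nat \<times> 'a elt) set \<Rightarrow> (nat \<Rightarrow> 'e bedge \<times> 'a option) \<times> (nat \<Rightarrow> 'e bedge \<times> 'a option) \<Rightarrow> complex" where
  "F S = (let s = SOME s. s \<in> S in Psi (fst s) (snd s))"

lemma F_dlc:
  assumes "n \<ge> 1" "a \<in> A_carrier D n" shows "F (dlc n a) = Psi n a"
proof -
  have "(n, a) \<in> dlc n a" using dlc_eq assms by auto
  then have "(SOME s. s \<in> dlc n a) \<in> dlc n a" by (rule someI)
  then show ?thesis unfolding F_def Let_def using dlc_eq[OF assms] by auto
qed

lemma DL_carrier: "sa_carrier DL = {dlc n a | n a. n \<ge> 1 \<and> a \<in> A_carrier D n}"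
  by (simp add: direct_limit_def)

lemma DL_elem:
  assumes "S \<in> sa_carrier DL" obtains n a where "n \<ge> 1" "a \<in> A_carrier D n" "S = dlc n a"
  using assms by (auto simp: DL_carrier)

lemma dlc_in: "n \<ge> 1 \<Longrightarrow> a \<in> A_carrier D n \<Longrightarrow> dlc n a \<in> sa_carrier DL"
  by (auto simp: DL_carrier)

lemma dlc_up: "n \<ge> 1 \<Longrightarrow> n \<le> k \<Longrightarrow> a \<in> A_carrier D n \<Longrightarrow> dlc n a = dlc k (transit (conn D) n k a)"
  using transit_A[of n k a] by (subst dlc_eq_iff) auto

lemma DL_common:
  assumes "S \<in> sa_carrier DL" "T \<in> sa_carrier DL"
  obtains n a b where "n \<ge> 1" "a \<in> A_carrier D n" "b \<in> A_carrier D n" "S = dlc n a" "T = dlc n b"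
proof -
  obtain n a where n: "n \<ge> 1" "a \<in> A_carrier D n" "S = dlc n a" using DL_elem[OF assms(1)] by blast
  obtain m b where m: "m \<ge> 1" "b \<in> A_carrier D m" "T = dlc m b" using DL_elem[OF assms(2)] by blast
  let ?k = "max n m"
  have k: "n \<le> ?k" "m \<le> ?k" "?k \<ge> 1" using n by auto
  show thesis
    using that[OF k(3), of "transit (conn D) n ?k a" "transit (conn D) m ?k b"] transit_A[OF n(1) k(1) n(2)] transit_A[OF m(1) k(2) m(2)]
      dlc_up[OF n(1) k(1) n(2)] dlc_up[OF m(1) k(2) m(2)] n m by auto
qed

lemma Union_eq_const: "\<lbrakk>x \<in> \<S>; \<And>y. y \<in> \<S> \<Longrightarrow> y = c\<rbrakk> \<Longrightarrow> \<Union>\<S> = c"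
  by blast

text \<open>The union defining the sum ranges over copies of a single class, because
  \<open>Psi\<close> of a sum depends only on the functions of the summands. The other operations
  follow the same pattern.\<close>

lemma DL_add:
  assumes n: "n \<ge> 1" and a: "a \<in> A_carrier D n" and b: "b \<in> A_carrier D n"
  shows "sa_add DL (dlc n a) (dlc n b) = dlc n (sa_add (A_alg D n) a b)"
proof -
  let ?S = "{dlc m (sa_add (A_alg D m) a' b') | m a' b'. (m, a') \<in> dlc n a \<and> (m, b') \<in> dlc n b}"
  have "\<Union>?S = dlc n (sa_add (A_alg D n) a b)"
  proof (rule Union_eq_const)
    have "(n, a) \<in> dlc n a" "(n, b) \<in> dlc n b" using dlc_eq n a b by auto
    then show "dlc n (sa_add (A_alg D n) a b) \<in> ?S" by blast
    fix y assume "y \<in> ?S"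
    then obtain m a' b' where y: "y = dlc m (sa_add (A_alg D m) a' b')" "(m, a') \<in> dlc n a" "(m, b') \<in> dlc n b" by blast
    then have m: "m \<ge> 1" "a' \<in> A_carrier D m" "Psi m a' = Psi n a" "b' \<in> A_carrier D m" "Psi m b' = Psi n b"
      using dlc_eq n a b by auto
    show "y = dlc n (sa_add (A_alg D n) a b)"
      unfolding y(1) using m n a b Psi_add[OF m(1,2,4)] Psi_add[OF n a b]
      by (subst dlc_eq_iff) (auto simp: A_add_in)
  qed
  then show ?thesis by (simp add: direct_limit_def)
qed

lemma DL_mult:
  assumes n: "n \<ge> 1" and a: "a \<in> A_carrier D n" and b: "b \<in> A_carrier D n"
  shows "sa_mult DL (dlc n a) (dlc n b) = dlc n (sa_mult (A_alg D n) a b)"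
proof -
  let ?S = "{dlc m (sa_mult (A_alg D m) a' b') | m a' b'. (m, a') \<in> dlc n a \<and> (m, b') \<in> dlc n b}"
  have "\<Union>?S = dlc n (sa_mult (A_alg D n) a b)"
  proof (rule Union_eq_const)
    have "(n, a) \<in> dlc n a" "(n, b) \<in> dlc n b" using dlc_eq n a b by auto
    then show "dlc n (sa_mult (A_alg D n) a b) \<in> ?S" by blast
    fix y assume "y \<in> ?S"
    then obtain m a' b' where y: "y = dlc m (sa_mult (A_alg D m) a' b')" "(m, a') \<in> dlc n a" "(m, b') \<in> dlc n b" by blast
    then have m: "m \<ge> 1" "a' \<in> A_carrier D m" "Psi m a' = Psi n a" "b' \<in> A_carrier D m" "Psi m b' = Psi n b"
      using dlc_eq n a b by auto
    show "y = dlc n (sa_mult (A_alg D n) a b)"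
      unfolding y(1) using m n a b Psi_mult[OF m(1,2,4)] Psi_mult[OF n a b]
      by (subst dlc_eq_iff) (auto simp: A_mult_in)
  qed
  then show ?thesis by (simp add: direct_limit_def)
qed

lemma DL_scale:
  assumes n: "n \<ge> 1" and a: "a \<in> A_carrier D n"
  shows "sa_scale DL c (dlc n a) = dlc n (sa_scale (A_alg D n) c a)"
proof -
  let ?S = "{dlc m (sa_scale (A_alg D m) c a') | m a'. (m, a') \<in> dlc n a}"
  have "\<Union>?S = dlc n (sa_scale (A_alg D n) c a)"
  proof (rule Union_eq_const)
    have "(n, a) \<in> dlc n a" using dlc_eq n a by auto
    then show "dlc n (sa_scale (A_alg D n) c a) \<in> ?S" by blast
    fix y assume "y \<in> ?S"
    then obtain m a' where y: "y = dlc m (sa_scale (A_alg D m) c a')" "(m, a') \<in> dlc n a" by blast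
    then have m: "m \<ge> 1" "a' \<in> A_carrier D m" "Psi m a' = Psi n a" using dlc_eq n a by auto
    show "y = dlc n (sa_scale (A_alg D n) c a)"
      unfolding y(1) using m n a Psi_scale[OF m(1,2)] Psi_scale[OF n a]
      by (subst dlc_eq_iff) (auto simp: A_scale_in)
  qed
  then show ?thesis by (simp add: direct_limit_def)
qed

lemma DL_star:
  assumes n: "n \<ge> 1" and a: "a \<in> A_carrier D n"
  shows "sa_star DL (dlc n a) = dlc n (sa_star (A_alg D n) a)"
proof -
  let ?S = "{dlc m (sa_star (A_alg D m) a') | m a'. (m, a') \<in> dlc n a}"
  have "\<Union>?S = dlc n (sa_star (A_alg D n) a)"
  proof (rule Union_eq_const)
    have "(n, a) \<in> dlc n a" using dlc_eq n a by auto
    then show "dlc n (sa_star (A_alg D n) a) \<in> ?S" by blast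
    fix y assume "y \<in> ?S"
    then obtain m a' where y: "y = dlc m (sa_star (A_alg D m) a')" "(m, a') \<in> dlc n a" by blast
    then have m: "m \<ge> 1" "a' \<in> A_carrier D m" "Psi m a' = Psi n a" using dlc_eq n a by auto
    show "y = dlc n (sa_star (A_alg D n) a)"
      unfolding y(1) using m n a Psi_star[OF m(1,2)] Psi_star[OF n a]
      by (subst dlc_eq_iff) (auto simp: A_star_in)
  qed
  then show ?thesis by (simp add: direct_limit_def)
qed

text \<open>By \<open>Psi_norm\<close> the norms along the system are constant from the level of the
  representative on, so the limit in the definition is that constant.\<close>

lemma DL_norm:
  assumes n: "n \<ge> 1" and a: "a \<in> A_carrier D n"
  shows "sa_norm DL (dlc n a) = N (Psi n a)"
proof -
  have lim: "(\<lambda>k. sa_norm (A_alg D k) (transit (conn D) m k b)) \<longlonglongrightarrow> N (Psi n a)" if mb: "(m, b) \<in> dlc n a" for m b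
  proof -
    have m: "m \<ge> 1" "b \<in> A_carrier D m" "Psi m b = Psi n a" using mb dlc_eq[OF n a] by auto
    have "sa_norm (A_alg D k) (transit (conn D) m k b) = N (Psi n a)" if "k \<ge> m" for k
      using transit_A[OF m(1) that m(2)] Psi_norm[of k "transit (conn D) m k b"] m that by (simp del: A_alg_simps)
    then show ?thesis by (intro tendsto_eventually) (auto simp: eventually_sequentially)
  qed
  have self: "(n, a) \<in> dlc n a" using dlc_eq n a by auto
  have "sa_norm DL (dlc n a) = (THE r. \<forall>(m, b)\<in>dlc n a. (\<lambda>k. sa_norm (A_alg D k) (transit (conn D) m k b)) \<longlonglongrightarrow> r)"
    by (simp add: direct_limit_def)
  also have "\<dots> = N (Psi n a)"
  proof (rule the_equality)
    show "\<forall>(m, b)\<in>dlc n a. (\<lambda>k. sa_norm (A_alg D k) (transit (conn D) m k b)) \<longlonglongrightarrow> N (Psi n a)" using lim by blast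
    fix r assume "\<forall>(m, b)\<in>dlc n a. (\<lambda>k. sa_norm (A_alg D k) (transit (conn D) m k b)) \<longlonglongrightarrow> r"
    then show "r = N (Psi n a)" using LIMSEQ_unique lim[OF self] self by blast
  qed
  finally show ?thesis .
qed

lemma A_closed:
  assumes "f \<in> A_carrier D n" "g \<in> A_carrier D n"
  shows "sa_add (A_alg D n) f g \<in> A_carrier D n" "sa_mult (A_alg D n) f g \<in> A_carrier D n"
    "sa_scale (A_alg D n) c f \<in> A_carrier D n" "sa_star (A_alg D n) f \<in> A_carrier D n"
  using assms by (auto simp: A_add_in A_mult_in A_scale_in A_star_in)

sublocale em: star_embedding "Cc_alg GG" DL F
proof
  fix S assume "S \<in> sa_carrier DL"
  then obtain n a where n: "n \<ge> 1" "a \<in> A_carrier D n" "S = dlc n a" using DL_elem by blast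
  note c = A_closed[OF n(2) n(2)]
  show "sa_scale DL z S \<in> sa_carrier DL" for z unfolding n(3) DL_scale[OF n(1,2)] by (rule dlc_in[OF n(1) c(3)])
  show "sa_star DL S \<in> sa_carrier DL" unfolding n(3) DL_star[OF n(1,2)] by (rule dlc_in[OF n(1) c(4)])
  show "F S \<in> sa_carrier (Cc_alg GG)" unfolding n(3) F_dlc[OF n(1,2)] using Psi_Cc[OF n(1,2)] by simp
  show "F (sa_scale DL z S) = sa_scale (Cc_alg GG) z (F S)" for z
    unfolding n(3) DL_scale[OF n(1,2)] F_dlc[OF n(1,2)] F_dlc[OF n(1) c(3)] Psi_scale[OF n(1,2)] by simp
  show "F (sa_star DL S) = sa_star (Cc_alg GG) (F S)"
    unfolding n(3) DL_star[OF n(1,2)] F_dlc[OF n(1,2)] F_dlc[OF n(1) c(4)] Psi_star[OF n(1,2)] ..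
  show "sa_norm DL S = sa_norm (Cc_alg GG) (F S)"
    unfolding n(3) DL_norm[OF n(1,2)] F_dlc[OF n(1,2)] by simp
next
  fix S T assume "S \<in> sa_carrier DL" "T \<in> sa_carrier DL"
  then obtain n a b where n: "n \<ge> 1" "a \<in> A_carrier D n" "b \<in> A_carrier D n" "S = dlc n a" "T = dlc n b" using DL_common by blast
  note c = A_closed[OF n(2) n(3)]
  show "sa_add DL S T \<in> sa_carrier DL" unfolding n(4,5) DL_add[OF n(1-3)] by (rule dlc_in[OF n(1) c(1)])
  show "sa_mult DL S T \<in> sa_carrier DL" unfolding n(4,5) DL_mult[OF n(1-3)] by (rule dlc_in[OF n(1) c(2)])
  show "F (sa_add DL S T) = sa_add (Cc_alg GG) (F S) (F T)"
    unfolding n(4,5) DL_add[OF n(1-3)] F_dlc[OF n(1,2)] F_dlc[OF n(1,3)] F_dlc[OF n(1) c(1)] Psi_add[OF n(1-3)] by simp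
  show "F (sa_mult DL S T) = sa_mult (Cc_alg GG) (F S) (F T)"
    unfolding n(4,5) DL_mult[OF n(1-3)] F_dlc[OF n(1,2)] F_dlc[OF n(1,3)] F_dlc[OF n(1) c(2)] Psi_mult[OF n(1-3)] by simp
qed

subsection \<open>Density of the diagonal functions\<close>

definition diag_supp :: "((nat \<Rightarrow> 'e bedge \<times> 'a option) \<times> (nat \<Rightarrow> 'e bedge \<times> 'a option) \<Rightarrow> complex) \<Rightarrow> bool" where
  "diag_supp f \<longleftrightarrow> (\<forall>x y. x \<noteq> y \<longrightarrow> f (x, y) = 0)"

text \<open>\<open>ix n\<close> is injective on each class, so off-diagonal entries of the fibres
  correspond to arrows between distinct paths.\<close>

lemma C_level_iff:
  assumes n: "n \<ge> 1" and f: "f \<in> A_carrier D n"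
  shows "f \<in> C_level D n \<longleftrightarrow> diag_supp (Psi n f)"
proof
  assume C: "f \<in> C_level D n"
  show "diag_supp (Psi n f)"
    unfolding diag_supp_def
  proof (intro allI impI)
    fix x y :: "nat \<Rightarrow> 'e bedge \<times> 'a option" assume ne: "x \<noteq> y"
    show "Psi n f (x, y) = 0"
    proof (cases "(x, y) \<in> R n")
      case True
      note e = Psi_entry[OF n True]
      have P: "x \<in> P" using True by (simp add: R_iff)
      have "ix n x \<noteq> ix n y"
        using ne bij_betw_imp_inj_on[OF ix_bij[OF n P]] True R_refl[OF P, of n] by (auto simp: inj_on_def cls_def)
      moreover have "diagonal_mat (f (vtx n x) (pt n x))" using C e by (auto simp: C_level_def)
      ultimately show ?thesis
        using e A_carrierD(1)[OF f e(1,2)] by (auto simp: Psi_R[OF True] diagonal_mat_def)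
    qed (rule Psi_out)
  qed
next
  assume d: "diag_supp (Psi n f)"
  show "f \<in> C_level D n"
    unfolding C_level_def diagonal_mat_def
  proof (intro CollectI conjI f allI impI ballI)
    fix i t a b assume i: "i < num D n" "t \<in> topspace (spc D n i)"
      and ab: "a < dim_row (f i t)" "b < dim_col (f i t)" "a \<noteq> b"
    then have "a < siz D n i" "b < siz D n i" using A_carrierD(1)[OF f i] by auto
    then obtain x y where "(x, y) \<in> R n" "vtx n x = i" "pt n x = t" "ix n x = a" "ix n y = b" using point_pair[OF n i] by blast
    then show "f i t $$ (a, b) = 0" using d ab(3) Psi_R[of x y n f] unfolding diag_supp_def by metis
  qed
qed

lemma C_level_A: "f \<in> C_level D n \<Longrightarrow> f \<in> A_carrier D n"
  by (simp add: C_level_def)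

lemma C_level_up:
  assumes "n \<ge> 1" "n \<le> m" "f \<in> C_level D n"
  obtains g where "g \<in> C_level D m" "Psi m g = Psi n f"
proof -
  have f: "f \<in> A_carrier D n" using assms(3) by (rule C_level_A)
  note t = transit_A[OF assms(1,2) f]
  have m: "m \<ge> 1" using assms by simp
  have "transit (conn D) n m f \<in> C_level D m"
    using C_level_iff[OF m conjunct1[OF t]] C_level_iff[OF assms(1) f] assms(3) t by simp
  then show thesis using that t by blast
qed

definition dE :: "nat \<Rightarrow> (nat \<Rightarrow> nat \<Rightarrow> 'a \<Rightarrow> complex) \<Rightarrow> 'a elt" where
  "dE n g = fibrewise D n (\<lambda>i t. Matrix.mat (siz D n i) (siz D n i) (\<lambda>(a, b). if a = b then g i a t else 0))"

lemma dE_in: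
  assumes "\<And>i a. i < num D n \<Longrightarrow> a < siz D n i \<Longrightarrow> continuous_map (spc D n i) euclidean (g i a)"
  shows "dE n g \<in> C_level D n"
proof -
  have "dE n g \<in> A_carrier D n"
    unfolding dE_def
  proof (rule fibrewise_carrier)
    fix i a b assume i: "i < num D n" "a < siz D n i" "b < siz D n i"
    show "continuous_map (spc D n i) euclidean
      (\<lambda>x. Matrix.mat (siz D n i) (siz D n i) (\<lambda>(a, b). if a = b then g i a x else 0) $$ (a, b))"
      using assms i by (cases "a = b") auto
  qed auto
  then show ?thesis by (auto simp: C_level_def dE_def diagonal_mat_def)
qed

lemma dE_Psi: "n \<ge> 1 \<Longrightarrow> x \<in> P \<Longrightarrow> Psi n (dE n g) (x, x) = g (vtx n x) (ix n x) (pt n x)"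
  using vtx_less[of n x] pt_in[of n x] ix_less[of n x] by (simp add: Psi_R R_refl dE_def)

lemma init_eq_iff:
  assumes n: "n \<ge> 1" and "x \<in> P" "y \<in> P"
  shows "init_seg n (fst \<circ> y) = init_seg n (fst \<circ> x) \<longleftrightarrow> vtx n y = vtx n x \<and> ix n y = ix n x"
proof -
  have p: "init_seg n (fst \<circ> x) \<in> fin_paths D" "init_seg n (fst \<circ> y) \<in> fin_paths D"
    using init_in_fpaths[OF n] assms by (auto simp: fpaths_def)
  have v: "vtx n z = btgt (last (init_seg n (fst \<circ> z)))" if "z \<in> P" for z
    using init_paths_to[OF n that] by (simp add: paths_to_def vtx_def)
  show ?thesis using pos_inj[OF p(2,1)] v assms by (auto simp: ix_def)
qed

text \<open>A cylinder constrains the label at the source of its last edge, possibly at the root.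
  Pulling this condition back along the edge moves it to a space of level \<open>Suc m\<close>,
  where Urysohn functions are available.\<close>

lemma base_level:
  assumes "openin X W" "x \<in> W"
  shows "\<exists>n\<ge>1. \<exists>V. openin (spc D n (vtx n x)) V \<and> pt n x \<in> V \<and>
    (\<forall>y\<in>P. vtx n y = vtx n x \<and> ix n y = ix n x \<and> pt n y \<in> V \<longrightarrow> y \<in> W)"
proof -
  have x: "x \<in> P" using assms openin_subset X_topspace by fastforce
  obtain m U where U: "openin (vertex_space D m (bsrc (fst (x m)))) U" "snd (x m) \<in> U" "cylinder D (init_seg (Suc m) (fst \<circ> x)) U \<subseteq> W"
    using cylinder_base[OF assms] by blast
  let ?n = "Suc m" let ?i = "vtx ?n x"
  have bt: "btgt (fst (x m)) = ?i" using pathD(2)[OF x, of m] by (simp add: vtx_def)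
  let ?V = "{t \<in> topspace (spc D ?n ?i). edge_label D m (fst (x m)) (Some t) \<in> U}"
  have "continuous_map (spc D ?n ?i) (vertex_space D m (bsrc (fst (x m)))) (\<lambda>t. edge_label D m (fst (x m)) (Some t))"
    using continuous_map_compose[OF vs_Some edge_label_continuous[OF pathD(1)[OF x]], of m] bt by (simp add: comp_def)
  then have V: "openin (spc D ?n ?i) ?V" using openin_continuous_map_preimage U(1) by blast
  have ptS: "snd (z ?n) = Some (pt ?n z)" if "z \<in> P" for z using pt_Some[of ?n z] that by simp
  have "pt ?n x \<in> ?V" using pt_in[of ?n x] x U(2) pathD(4)[OF x, of m] ptS[OF x] by simp
  moreover have "y \<in> W" if y: "y \<in> P" "vtx ?n y = ?i" "ix ?n y = ix ?n x" "pt ?n y \<in> ?V" for y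
  proof -
    have "init_seg ?n (fst \<circ> y) = init_seg ?n (fst \<circ> x)" using init_eq_iff[of ?n x y] x y by simp
    moreover from this have "fst (y m) = fst (x m)" by (auto simp: init_seg_eq_iff)
    then have "snd (y m) \<in> U" using pathD(4)[OF y(1), of m] ptS[OF y(1)] y(4) by simp
    ultimately show ?thesis using y(1) U(3) by (auto simp: cylinder_def)
  qed
  ultimately show ?thesis using V by (intro exI[of _ ?n] conjI exI[of _ ?V]) auto
qed

lemma diag_continuous: "continuous_map X Gt (\<lambda>x. (x, x))"
proof -
  have "continuous_map X (subtopology PP (R 1)) (\<lambda>x. (x, x))"
    unfolding continuous_map_in_subtopology using R_refl by (auto simp: continuous_map_pairedI X_topspace)
  then have "continuous_map X (subtopology Gt (R 1)) (\<lambda>x. (x, x))" by (simp add: G_sub)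
  then show ?thesis by (simp add: continuous_map_in_subtopology)
qed

lemma Cc_diag_continuous: "f \<in> Cc GG \<Longrightarrow> continuous_map X euclidean (\<lambda>x. f (x, x))"
  using continuous_map_compose[OF diag_continuous, of euclidean f] by (simp add: Cc_def comp_def)

text \<open>A partition of unity by functions living on finite levels.\<close>

lemma level_dense:
  assumes phi: "continuous_map X euclidean (\<phi> :: _ \<Rightarrow> complex)" and e: "\<epsilon> > 0"
  shows "\<exists>n\<ge>1. \<exists>f\<in>C_level D n. \<forall>x\<in>P. cmod (Psi n f (x, x) - \<phi> x) < \<epsilon>"
proof -
  \<comment> \<open>A bump at \<open>x\<close> found at level \<open>n\<close>: it equals 1 at
    \<open>x\<close>, is nonnegative, and lives where \<open>\<phi>\<close> differs from
    \<open>\<phi> x\<close> by less than \<open>\<epsilon>\<close>.\<close>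
  define Q where "Q x n f \<longleftrightarrow> n \<ge> 1 \<and> f \<in> C_level D n \<and> Psi n f (x, x) = 1 \<and>
      (\<forall>y\<in>P. \<exists>r\<ge>0. Psi n f (y, y) = complex_of_real r \<and> (r \<noteq> 0 \<longrightarrow> cmod (\<phi> y - \<phi> x) < \<epsilon>))" for x n f
  have bump: "\<exists>n f. Q x n f" if x: "x \<in> P" for x
  proof -
    let ?W = "{y \<in> topspace X. \<phi> y \<in> ball (\<phi> x) \<epsilon>}"
    have W: "openin X ?W" using openin_continuous_map_preimage[OF phi, of "ball (\<phi> x) \<epsilon>"] by simp
    have xW: "x \<in> ?W" using x e by (simp add: X_topspace)
    obtain n V where n: "n \<ge> 1" and V: "openin (spc D n (vtx n x)) V" "pt n x \<in> V"
      and sub': "\<forall>y\<in>P. vtx n y = vtx n x \<and> ix n y = ix n x \<and> pt n y \<in> V \<longrightarrow> y \<in> ?W"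
      using base_level[OF W xW] by (elim exE conjE)
    have sub: "y \<in> ?W" if "y \<in> P" "vtx n y = vtx n x" "ix n y = ix n x" "pt n y \<in> V" for y
      using bspec[OF sub' that(1)] that by simp
    let ?i = "vtx n x" let ?Y = "spc D n ?i"
    have i: "?i < num D n" by (rule vtx_less[OF n x])
    have "normal_space ?Y"
      using compact_Hausdorff_or_regular_imp_normal_space space_Hausdorff[OF n i] space_compact[OF n i] by blast
    moreover have "closedin ?Y (topspace ?Y - V)" using V(1) by blast
    moreover have "closedin ?Y {pt n x}" using pt_in[OF n x] space_Hausdorff[OF n i] by (simp add: closedin_Hausdorff_singleton)
    moreover have "disjnt (topspace ?Y - V) {pt n x}" using V(2) by (auto simp: disjnt_iff)
    ultimately obtain g :: "'a \<Rightarrow> real" where g: "continuous_map ?Y (top_of_set {0..1}) g" "g ` (topspace ?Y - V) \<subseteq> {0}" "g ` {pt n x} \<subseteq> {1}"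
      using Urysohn_lemma[of ?Y "topspace ?Y - V" "{pt n x}" 0 1] by auto
    have gc: "continuous_map ?Y euclideanreal g" using g(1) by (simp add: continuous_map_in_subtopology)
    have g0: "0 \<le> g t" if "t \<in> topspace ?Y" for t using g(1) that by (auto simp: continuous_map_in_subtopology)
    define G where "G j a t = (if j = ?i \<and> a = ix n x then complex_of_real (g t) else 0)" for j a t
    have C: "dE n G \<in> C_level D n"
    proof (rule dE_in)
      fix j a
      have "continuous_map ?Y euclidean (\<lambda>t. complex_of_real (g t))"
        using continuous_map_compose[OF gc, of euclidean complex_of_real] by (simp add: comp_def continuous_intros)
      then show "continuous_map (spc D n j) euclidean (G j a)" by (cases "j = ?i \<and> a = ix n x") (auto simp: G_def[abs_def])
    qed
    have v: "Psi n (dE n G) (y, y) = (if vtx n y = ?i \<and> ix n y = ix n x then complex_of_real (g (pt n y)) else 0)" if "y \<in> P" for y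
      using dE_Psi[OF n that] by (simp add: G_def)
    have "\<exists>r\<ge>0. Psi n (dE n G) (y, y) = complex_of_real r \<and> (r \<noteq> 0 \<longrightarrow> cmod (\<phi> y - \<phi> x) < \<epsilon>)" if y: "y \<in> P" for y
    proof (cases "vtx n y = ?i \<and> ix n y = ix n x")
      case True
      have t: "pt n y \<in> topspace ?Y" using pt_in[OF n y] True by simp
      have "g (pt n y) \<noteq> 0 \<Longrightarrow> pt n y \<in> V" using g(2) t by blast
      then have "g (pt n y) \<noteq> 0 \<Longrightarrow> cmod (\<phi> y - \<phi> x) < \<epsilon>" using sub[OF y] True by (auto simp: dist_norm norm_minus_commute)
      then show ?thesis using v[OF y] True g0[OF t] by (intro exI[of _ "g (pt n y)"]) auto
    next
      case False
      then show ?thesis using v[OF y] by (intro exI[of _ 0]) auto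
    qed
    moreover have "Psi n (dE n G) (x, x) = 1" using v[OF x] g(3) by simp
    ultimately have "Q x n (dE n G)" unfolding Q_def using n C by blast
    then show ?thesis by blast
  qed
  then obtain nn ff where "\<And>x. x \<in> P \<Longrightarrow> Q x (nn x) (ff x)" by metis
  then have nf: "\<And>x. x \<in> P \<Longrightarrow> nn x \<ge> 1 \<and> ff x \<in> C_level D (nn x) \<and> Psi (nn x) (ff x) (x, x) = 1 \<and>
      (\<forall>y\<in>P. \<exists>r\<ge>0. Psi (nn x) (ff x) (y, y) = complex_of_real r \<and> (r \<noteq> 0 \<longrightarrow> cmod (\<phi> y - \<phi> x) < \<epsilon>))"
    unfolding Q_def .
  let ?O = "\<lambda>x. {y \<in> topspace X. Psi (nn x) (ff x) (y, y) \<in> - {0}}"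
  have opn: "openin X (?O x)" if "x \<in> P" for x
  proof (rule openin_continuous_map_preimage)
    show "continuous_map X euclidean (\<lambda>y. Psi (nn x) (ff x) (y, y))"
      using Cc_diag_continuous[OF Psi_Cc] nf[OF that] C_level_A by blast
  qed auto
  have cov: "P \<subseteq> \<Union>(?O ` P)" using nf by (auto simp: X_topspace)
  have "\<exists>\<F>. finite \<F> \<and> \<F> \<subseteq> ?O ` P \<and> P \<subseteq> \<Union>\<F>"
    by (rule X_compact[unfolded compact_space_def compactin_def X_topspace, THEN conjunct2, rule_format])
       (use opn cov in \<open>auto simp: X_topspace\<close>)
  then obtain \<F> where \<F>: "finite \<F>" "\<F> \<subseteq> ?O ` P" "P \<subseteq> \<Union>\<F>" by blast
  obtain I where "I \<subseteq> P" "finite I" "\<F> = ?O ` I" using finite_subset_image[OF \<F>(1,2)] by blast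
  with \<F>(3) have I: "finite I" "I \<subseteq> P" "P \<subseteq> \<Union>(?O ` I)" by auto
  have Ine: "I \<noteq> {}" using I(3) P_nonempty by auto
  \<comment> \<open>Finitely many bumps can be moved to one common level without changing their
    functions.\<close>
  let ?m = "Max (nn ` I)"
  have nm: "nn x \<le> ?m" if "x \<in> I" for x using I(1) that by simp
  obtain x1 where "x1 \<in> I" using Ine by blast
  then have m: "?m \<ge> 1" using nm[of x1] nf[of x1] I(2) by auto
  have "\<exists>g. g \<in> C_level D ?m \<and> Psi ?m g = Psi (nn x) (ff x)" if "x \<in> I" for x
  proof -
    have "x \<in> P" using I(2) that by blast
    then show ?thesis using C_level_up[OF _ nm[OF that], of "ff x"] nf[of x] by blast
  qed
  then have "\<forall>x\<in>I. \<exists>g. g \<in> C_level D ?m \<and> Psi ?m g = Psi (nn x) (ff x)" by blast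
  from bchoice[OF this] obtain gg where gg: "\<And>x. x \<in> I \<Longrightarrow> gg x \<in> C_level D ?m \<and> Psi ?m (gg x) = Psi (nn x) (ff x)" by blast
  define w where "w x y = Psi ?m (gg x) (y, y)" for x y
  have wr: "\<exists>r\<ge>0. w x y = complex_of_real r \<and> (r \<noteq> 0 \<longrightarrow> cmod (\<phi> y - \<phi> x) < \<epsilon>)" if "x \<in> I" "y \<in> P" for x y
    unfolding w_def using gg[OF that(1)] nf[of x] I(2) that by auto
  define r where "r x y = Re (w x y)" for x y
  have r: "0 \<le> r x y \<and> w x y = complex_of_real (r x y) \<and> (r x y \<noteq> 0 \<longrightarrow> cmod (\<phi> y - \<phi> x) < \<epsilon>)" if "x \<in> I" "y \<in> P" for x y
    using wr[OF that] unfolding r_def by auto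
  have S: "(\<Sum>x\<in>I. r x y) > 0" if y: "y \<in> P" for y
  proof -
    obtain x where x: "x \<in> I" "y \<in> ?O x" using I(3) y by blast
    then have "w x y \<noteq> 0" using gg[OF x(1)] by (simp add: w_def)
    then have "r x y > 0" using r[OF x(1) y] by auto
    then show ?thesis using r y I(1) x(1) by (intro sum_pos2[of I x]) auto
  qed
  define h where "h i a t = (\<Sum>x\<in>I. \<phi> x * gg x i t $$ (a, a)) / (\<Sum>x\<in>I. gg x i t $$ (a, a))" for i a t
  have gw: "gg x (vtx ?m y) (pt ?m y) $$ (ix ?m y, ix ?m y) = w x y" if "y \<in> P" for x y
    using Psi_R[OF R_refl[OF that]] by (simp add: w_def)
  have ggA: "gg x \<in> A_carrier D ?m" if "x \<in> I" for x using gg[OF that] C_level_A by blast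
  have "dE ?m h \<in> C_level D ?m"
  proof (rule dE_in)
    fix i a assume i: "i < num D ?m" "a < siz D ?m i"
    show "continuous_map (spc D ?m i) euclidean (h i a)"
      unfolding h_def[abs_def]
    proof (intro continuous_map_divide_complex continuous_map_sum continuous_map_mult_complex)
      fix t assume t: "t \<in> topspace (spc D ?m i)"
      obtain y where y: "y \<in> P" "vtx ?m y = i" "pt ?m y = t" "ix ?m y = a" using point_path[OF m i(1) t i(2)] by blast
      have "(\<Sum>x\<in>I. gg x i t $$ (a, a)) = (\<Sum>x\<in>I. complex_of_real (r x y))"
        using gw[OF y(1)] y r[OF _ y(1)] by (intro sum.cong) auto
      also have "\<dots> = complex_of_real (\<Sum>x\<in>I. r x y)" by simp
      also have "\<dots> \<noteq> 0" using S[OF y(1)] by (simp del: of_real_sum)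
      finally show "(\<Sum>x\<in>I. gg x i t $$ (a, a)) \<noteq> 0" .
    next
      fix x assume "x \<in> I"
      then show "continuous_map (spc D ?m i) euclidean (\<lambda>t. gg x i t $$ (a, a))"
        by (rule A_carrierD(2)[OF ggA i(1,2,2)])
      then show "continuous_map (spc D ?m i) euclidean (\<lambda>t. gg x i t $$ (a, a))" .
    qed (auto simp: I(1))
  qed
  moreover have "cmod (Psi ?m (dE ?m h) (y, y) - \<phi> y) < \<epsilon>" if y: "y \<in> P" for y
  proof -
    let ?S = "\<Sum>x\<in>I. r x y"
    have "Psi ?m (dE ?m h) (y, y) = (\<Sum>x\<in>I. \<phi> x * w x y) / (\<Sum>x\<in>I. w x y)"
      unfolding dE_Psi[OF m y] h_def gw[OF y] ..
    also have "\<dots> = (\<Sum>x\<in>I. \<phi> x * complex_of_real (r x y)) / complex_of_real ?S"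
    proof -
      have "(\<Sum>x\<in>I. \<phi> x * w x y) = (\<Sum>x\<in>I. \<phi> x * complex_of_real (r x y))" using r[OF _ y] by (intro sum.cong) auto
      moreover have "(\<Sum>x\<in>I. w x y) = (\<Sum>x\<in>I. complex_of_real (r x y))" using r[OF _ y] by (intro sum.cong) auto
      ultimately show ?thesis by simp
    qed
    finally have "Psi ?m (dE ?m h) (y, y) - \<phi> y = ((\<Sum>x\<in>I. \<phi> x * complex_of_real (r x y)) - \<phi> y * complex_of_real ?S) / complex_of_real ?S"
      using S[OF y] by (simp add: diff_divide_distrib del: of_real_sum)
    also have "(\<Sum>x\<in>I. \<phi> x * complex_of_real (r x y)) - \<phi> y * complex_of_real ?S = (\<Sum>x\<in>I. (\<phi> x - \<phi> y) * complex_of_real (r x y))"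
      by (simp add: sum_distrib_left left_diff_distrib sum_subtractf)
    finally have eq: "cmod (Psi ?m (dE ?m h) (y, y) - \<phi> y) = cmod (\<Sum>x\<in>I. (\<phi> x - \<phi> y) * complex_of_real (r x y)) / ?S"
      using S[OF y] by (simp add: norm_divide del: of_real_sum)
    \<comment> \<open>Terms of weight zero give only equality; one positive weight makes the
      weighted estimate strict.\<close>
    obtain x0 where x0: "x0 \<in> I" "r x0 y > 0"
      using S[OF y] sum_nonpos[of I "\<lambda>x. r x y"] by (meson not_less)
    have "cmod (\<Sum>x\<in>I. (\<phi> x - \<phi> y) * complex_of_real (r x y)) \<le> (\<Sum>x\<in>I. cmod (\<phi> x - \<phi> y) * r x y)"
      by (rule order_trans[OF norm_sum]) (use r[OF _ y] in \<open>auto simp: norm_mult intro!: sum_mono\<close>)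
    also have "\<dots> < (\<Sum>x\<in>I. \<epsilon> * r x y)"
    proof (rule sum_strict_mono_ex1[OF I(1)])
      show "\<forall>x\<in>I. cmod (\<phi> x - \<phi> y) * r x y \<le> \<epsilon> * r x y"
      proof
        fix x assume x: "x \<in> I"
        show "cmod (\<phi> x - \<phi> y) * r x y \<le> \<epsilon> * r x y"
          using r[OF x y] by (cases "r x y = 0") (auto intro!: mult_right_mono simp: norm_minus_commute less_imp_le)
      qed
      show "\<exists>x\<in>I. cmod (\<phi> x - \<phi> y) * r x y < \<epsilon> * r x y"
        using x0 r[OF x0(1) y] by (intro bexI[of _ x0]) (auto simp: norm_minus_commute)
    qed
    also have "\<dots> = \<epsilon> * ?S" by (simp add: sum_distrib_left)
    finally show ?thesis unfolding eq using S[OF y] by (simp add: field_simps)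
  qed
  ultimately show ?thesis using m by blast
qed

lemma init_open: "openin X {x \<in> P. init_seg n (fst \<circ> x) \<in> Q}"
proof (subst openin_subopen, intro ballI)
  fix x assume x: "x \<in> {x \<in> P. init_seg n (fst \<circ> x) \<in> Q}"
  let ?U = "topspace (vertex_space D n (bsrc (fst (x n))))"
  have "openin X (cylinder D (init_seg (Suc n) (fst \<circ> x)) ?U)" using x by (intro cylinder_open') auto
  moreover have "x \<in> cylinder D (init_seg (Suc n) (fst \<circ> x)) ?U" using x pathD(3)[of x n] by (auto simp: cylinder_def)
  moreover have "cylinder D (init_seg (Suc n) (fst \<circ> x)) ?U \<subseteq> {x \<in> P. init_seg n (fst \<circ> x) \<in> Q}"
    using x by (auto simp: cylinder_def init_seg_Suc)
  ultimately show "\<exists>T. openin X T \<and> x \<in> T \<and> T \<subseteq> {x \<in> P. init_seg n (fst \<circ> x) \<in> Q}" by blast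
qed

section \<open>Matrix units as functions on the groupoid, and density of the algebraic limit\<close>

lemma path_pairsD:
  assumes "(p, q) \<in> path_pairs D"
  shows "length p \<ge> 1" "length q = length p" "p \<in> fin_paths D" "q \<in> fin_paths D"
    "p \<in> paths_to (length p) (btgt (last p))" "q \<in> paths_to (length p) (btgt (last p))" "btgt (last p) < num D (length p)"
  using assms fin_path_target[of p] by (auto simp: path_pairs_def paths_to_def)

lemma vtx_init: "n \<ge> 1 \<Longrightarrow> x \<in> P \<Longrightarrow> vtx n x = btgt (last (init_seg n (fst \<circ> x)))"
  using init_paths_to[of n x] by (simp add: paths_to_def vtx_def)

lemma init_path_iff:
  assumes p: "p \<in> fin_paths D" and x: "x \<in> P"
  shows "init_seg (length p) (fst \<circ> x) = p \<longleftrightarrow> vtx (length p) x = btgt (last p) \<and> ix (length p) x = pos D p"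
proof -
  have n: "length p \<ge> 1" using fin_path_target(1)[OF p] .
  have q: "init_seg (length p) (fst \<circ> x) \<in> fin_paths D" using init_in_fpaths[OF n x] by (simp add: fpaths_def)
  show ?thesis using pos_inj[OF q p] vtx_init[OF n x] by (auto simp: ix_def)
qed

lemma mat_unit_in:
  assumes "(p, q) \<in> path_pairs D" shows "mat_unit D p q \<in> A_carrier D (length p)"
  unfolding mat_unit_def
proof (rule fibrewise_carrier)
  fix i a b assume "a < siz D (length p) i" "b < siz D (length p) i"
  then show "continuous_map (spc D (length p) i) euclidean (\<lambda>x. Matrix.mat (siz D (length p) i) (siz D (length p) i)
      (\<lambda>(a, b). if i = btgt (last p) \<and> a = pos D p \<and> b = pos D q then 1 else 0) $$ (a, b))" by simp
qed auto

text \<open>Matrix units become indicators of graphs, namely of the partial bijection that exchanges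
  the initial segments \<open>p\<close> and \<open>q\<close>.\<close>

lemma Psi_unit:
  assumes pq: "(p, q) \<in> path_pairs D"
  shows "Psi (length p) (mat_unit D p q) (x, y) =
    (if (x, y) \<in> R (length p) \<and> init_seg (length p) (fst \<circ> x) = p \<and> init_seg (length p) (fst \<circ> y) = q then 1 else 0)"
proof (cases "(x, y) \<in> R (length p)")
  case True
  note d = path_pairsD[OF pq]
  note e = Psi_entry[OF d(1) True]
  have P: "x \<in> P" "y \<in> P" using True by (auto simp: R_iff)
  have t: "btgt (last q) = btgt (last p)" using pq by (simp add: path_pairs_def)
  have "init_seg (length p) (fst \<circ> x) = p \<longleftrightarrow> vtx (length p) x = btgt (last p) \<and> ix (length p) x = pos D p"
    by (rule init_path_iff[OF d(3) P(1)])
  moreover have "init_seg (length p) (fst \<circ> y) = q \<longleftrightarrow> vtx (length p) x = btgt (last p) \<and> ix (length p) y = pos D q"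
    using init_path_iff[OF d(4) P(2)] d(2) t vtx_eq[OF True] by simp
  ultimately show ?thesis using True e by (auto simp: Psi_R[OF True] mat_unit_def)
qed (simp add: Psi_out)

lemma conv_diag_left:
  assumes d: "diag_supp f" and arr: "(x, y) \<in> topspace Gt"
  shows "convolve GG f g (x, y) = f (x, x) * g (x, y)"
proof -
  have "convolve GG f g (x, y) = (\<Sum>z\<in>{x}. f (x, z) * g (z, y))"
    by (rule conv_eq[OF arr]) (use d arr in \<open>auto simp: diag_supp_def\<close>)
  then show ?thesis by simp
qed

lemma F_image_add:
  assumes "f \<in> F ` sa_carrier DL" "g \<in> F ` sa_carrier DL" shows "(\<lambda>z. f z + g z) \<in> F ` sa_carrier DL"
proof -
  obtain S T where "S \<in> sa_carrier DL" "T \<in> sa_carrier DL" "f = F S" "g = F T" using assms by blast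
  then show ?thesis using em.F_add[of S T] em.S_add[of S T] by (auto intro!: image_eqI[of _ F "sa_add DL S T"])
qed

lemma F_image_conv:
  assumes "f \<in> F ` sa_carrier DL" "g \<in> F ` sa_carrier DL" shows "convolve GG f g \<in> F ` sa_carrier DL"
proof -
  obtain S T where "S \<in> sa_carrier DL" "T \<in> sa_carrier DL" "f = F S" "g = F T" using assms by blast
  then show ?thesis using em.F_mult[of S T] em.S_mult[of S T] by (auto intro!: image_eqI[of _ F "sa_mult DL S T"])
qed

lemma Psi_F_image: "n \<ge> 1 \<Longrightarrow> f \<in> A_carrier D n \<Longrightarrow> Psi n f \<in> F ` sa_carrier DL"
  using F_dlc dlc_in by (metis image_eqI)

lemma F_image_zero: "(\<lambda>_. 0) \<in> F ` sa_carrier DL"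
proof -
  have "Psi 1 (sa_scale (A_alg D 1) 0 (A_one D 1)) = (\<lambda>_. 0)" using Psi_scale[of 1 "A_one D 1" 0] A_one_in by simp
  moreover have "sa_scale (A_alg D 1) 0 (A_one D 1) \<in> A_carrier D 1" using A_closed(3)[OF A_one_in A_one_in] .
  ultimately show ?thesis using Psi_F_image[of 1] by (metis order_refl)
qed

lemma F_image_sum:
  assumes "finite I" "\<And>i. i \<in> I \<Longrightarrow> f i \<in> F ` sa_carrier DL"
  shows "(\<lambda>z. \<Sum>i\<in>I. f i z) \<in> F ` sa_carrier DL"
  using assms by (induction I rule: finite_induct) (auto simp: F_image_zero intro: F_image_add simp del: image_iff)

text \<open>\<open>sw q\<close> is known to be continuous where the vertex at level \<open>n\<close>
  fits \<open>q\<close>. Paths beginning with \<open>p\<close> satisfy this and form an open and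
  closed set, outside of which the function is set to zero.\<close>

lemma entry_continuous:
  assumes n: "n \<ge> 1" and t: "t \<in> CR n" and p: "p \<in> paths_to n i" and q: "q \<in> paths_to n i"
  shows "continuous_map X euclidean (\<lambda>x. if init_seg n (fst \<circ> x) = p then t (x, sw q x) else 0)"
proof (rule pasting_lemma[where I = "UNIV :: bool set" and T = "\<lambda>b. {x \<in> P. init_seg n (fst \<circ> x) \<in> (if b then {p} else - {p})}"
    and f = "\<lambda>b x. if b then t (x, sw q x) else 0"])
  fix b :: bool
  show "openin X {x \<in> P. init_seg n (fst \<circ> x) \<in> (if b then {p} else - {p})}" by (rule init_open)
  let ?S = "subtopology X {x \<in> P. init_seg n (fst \<circ> x) \<in> {p}}"
  have vt: "bsrc (fst (x n)) = i" if "x \<in> P" "init_seg n (fst \<circ> x) = p" for x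
    using init_paths_to[OF n that(1)] that(2) p by (simp add: paths_to_def)
  have S: "x \<in> topspace ?S \<longleftrightarrow> x \<in> P \<and> init_seg n (fst \<circ> x) = p" for x by (auto simp: X_topspace)
  have c1: "continuous_map ?S X (sw q)"
    by (rule continuous_map_from_subtopology_mono[OF sw_continuous[OF n q]]) (use vt in auto)
  have c2: "continuous_map ?S X (\<lambda>x. x)" by (rule continuous_map_from_subtopology) simp
  have sR: "(x, sw q x) \<in> R n" if "x \<in> topspace ?S" for x
    using that q sw(1)[OF n, of q x] vt[of x] by (simp only: S)
  have "continuous_map ?S (subtopology PP (R n)) (\<lambda>x. (x, sw q x))"
    unfolding continuous_map_in_subtopology using c1 c2 sR by (auto simp: continuous_map_pairedI simp del: topspace_subtopology)
  then have "continuous_map ?S (subtopology Gt (R n)) (\<lambda>x. (x, sw q x))" by (simp add: G_sub)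
  then have "continuous_map ?S Gt (\<lambda>x. (x, sw q x))" by (simp add: continuous_map_in_subtopology)
  then have "continuous_map ?S euclidean (\<lambda>x. t (x, sw q x))"
    using continuous_map_compose[OF _ CR_continuous[OF t]] by (force simp: comp_def)
  then show "continuous_map (subtopology X {x \<in> P. init_seg n (fst \<circ> x) \<in> (if b then {p} else - {p})}) euclidean
      (\<lambda>x. if b then t (x, sw q x) else 0)" by (cases b) auto
next
  fix x assume "x \<in> topspace X"
  then show "\<exists>j. j \<in> UNIV \<and> x \<in> {x \<in> P. init_seg n (fst \<circ> x) \<in> (if j then {p} else - {p})} \<and>
     (if init_seg n (fst \<circ> x) = p then t (x, sw q x) else 0) = (if j then t (x, sw q x) else 0)"
    by (intro exI[of _ "init_seg n (fst \<circ> x) = p"]) (auto simp: X_topspace)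
qed (auto split: if_splits)

text \<open>On each of the finitely many graphs \<open>x \<mapsto> sw q x\<close>, a function supported on \<open>R n\<close> is a
  diagonal function times a matrix unit.\<close>

lemma F_dense:
  assumes "t \<in> Cc GG" "\<epsilon> > 0" shows "\<exists>S\<in>sa_carrier DL. sa_dist (Cc_alg GG) (F S) t < \<epsilon>"
proof -
  obtain n where n: "n \<ge> 1" and t: "t \<in> CR n" using assms(1) Cc_iff by blast
  let ?I = "{pq \<in> path_pairs D. length (fst pq) = n}"
  have I: "?I \<subseteq> fpaths n \<times> fpaths n" by (auto simp: path_pairs_def fpaths_def)
  then have fI: "finite ?I" using finite_fpaths finite_subset by blast
  let ?k = "real (card (fpaths n \<times> fpaths n))"
  \<comment> \<open>\<open>kbound_of_bounded\<close> costs the factor \<open>?k\<close>, the number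
    of pairs of segments; the added 1 makes the final estimate strict.\<close>
  define \<delta> where "\<delta> = \<epsilon> / (?k + 1)"
  have d: "\<delta> > 0" using assms(2) by (simp add: \<delta>_def add_nonneg_pos)
  let ?a = "\<lambda>pq x. if init_seg n (fst \<circ> x) = fst pq then t (x, sw (snd pq) x) else 0"
  have "\<exists>f. f \<in> F ` sa_carrier DL \<and> diag_supp f \<and> (\<forall>x\<in>P. cmod (f (x, x) - ?a pq x) < \<delta>)" if "pq \<in> ?I" for pq
  proof -
    obtain p q where pq: "pq = (p, q)" by (cases pq)
    have "continuous_map X euclidean (?a pq)"
      unfolding pq fst_conv snd_conv
      by (rule entry_continuous[OF n t]) (use that pq path_pairsD(5,6)[of p q] in auto)
    then obtain m f where f: "m \<ge> 1" "f \<in> C_level D m" "\<forall>x\<in>P. cmod (Psi m f (x, x) - ?a pq x) < \<delta>"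
      using level_dense[OF _ d] by blast
    then show ?thesis using Psi_F_image[OF f(1)] C_level_iff[OF f(1)] C_level_A by blast
  qed
  then have "\<forall>pq\<in>?I. \<exists>f. f \<in> F ` sa_carrier DL \<and> diag_supp f \<and> (\<forall>x\<in>P. cmod (f (x, x) - ?a pq x) < \<delta>)" by blast
  from bchoice[OF this] obtain f where f0: "\<forall>pq\<in>?I. f pq \<in> F ` sa_carrier DL \<and> diag_supp (f pq) \<and> (\<forall>x\<in>P. cmod (f pq (x, x) - ?a pq x) < \<delta>)"
    by blast
  have f: "f pq \<in> F ` sa_carrier DL" "diag_supp (f pq)" "\<And>x. x \<in> P \<Longrightarrow> cmod (f pq (x, x) - ?a pq x) < \<delta>" if "pq \<in> ?I" for pq
    using bspec[OF f0 that] by auto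
  let ?e = "\<lambda>pq. Psi n (mat_unit D (fst pq) (snd pq))"
  define s where "s z = (\<Sum>pq\<in>?I. convolve GG (f pq) (?e pq) z)" for z
  have e: "?e pq \<in> F ` sa_carrier DL" if "pq \<in> ?I" for pq
    by (rule Psi_F_image[OF n]) (use that mat_unit_in[of "fst pq" "snd pq"] in auto)
  have sF: "s \<in> F ` sa_carrier DL"
    unfolding s_def[abs_def] by (intro F_image_sum fI F_image_conv f e)
  have ev: "?e pq (x, y) = (if (x, y) \<in> R n \<and> init_seg n (fst \<circ> x) = fst pq \<and> init_seg n (fst \<circ> y) = snd pq then 1 else 0)"
    if "pq \<in> ?I" for pq x y
    using Psi_unit[of "fst pq" "snd pq" x y] that by auto
  have sR: "s (x, y) = f (init_seg n (fst \<circ> x), init_seg n (fst \<circ> y)) (x, x)" "(init_seg n (fst \<circ> x), init_seg n (fst \<circ> y)) \<in> ?I" if xy: "(x, y) \<in> R n" for x y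
  proof -
    let ?pq = "(init_seg n (fst \<circ> x), init_seg n (fst \<circ> y))"
    have arr: "(x, y) \<in> topspace Gt" using xy G_arrow by blast
    have P: "x \<in> P" "y \<in> P" using xy by (auto simp: R_iff)
    show pq: "?pq \<in> ?I"
      using init_in_fpaths[OF n P(1)] init_in_fpaths[OF n P(2)] vtx_init[OF n P(1)] vtx_init[OF n P(2)] vtx_eq[OF xy]
      by (auto simp: fpaths_def path_pairs_def)
    \<comment> \<open>The graphs are disjoint, so only the pair of initial segments of the two ends
      contributes.\<close>
    have "s (x, y) = (\<Sum>pq\<in>{?pq}. convolve GG (f pq) (?e pq) (x, y))"
      unfolding s_def
    proof (rule sum.mono_neutral_right[OF fI])
      show "{?pq} \<subseteq> ?I" using pq by blast
      show "\<forall>pq\<in>?I - {?pq}. convolve GG (f pq) (?e pq) (x, y) = 0"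
      proof
        fix pq assume "pq \<in> ?I - {?pq}"
        then have "pq \<in> ?I" "pq \<noteq> ?pq" by auto
        then have "?e pq (x, y) = 0" using ev[of pq x y] by (cases pq) auto
        then show "convolve GG (f pq) (?e pq) (x, y) = 0" using conv_diag_left[OF f(2)[OF \<open>pq \<in> ?I\<close>] arr] by simp
      qed
    qed
    also have "\<dots> = f ?pq (x, x)" using conv_diag_left[OF f(2)[OF pq] arr, of "?e ?pq"] ev[OF pq, of x y] xy by simp
    finally show "s (x, y) = f ?pq (x, x)" .
  qed
  have s0: "s (x, y) = 0" if "(x, y) \<notin> R n" for x y
    unfolding s_def
  proof (rule sum.neutral, rule ballI)
    fix pq assume pq: "pq \<in> ?I"
    have e0: "?e pq (x, y) = 0" using ev[OF pq] that by simp
    show "convolve GG (f pq) (?e pq) (x, y) = 0"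
      using conv_diag_left[OF f(2)[OF pq], of x y "?e pq"] conv_outside[of "(x, y)"] e0 by (cases "(x, y) \<in> topspace Gt") auto
  qed
  have supp: "suppR n (\<lambda>z. s z - t z)" using s0 suppRD[OF CR_supp[OF t]] by (auto simp: suppR_def) fastforce
  have bd: "cmod (s z - t z) \<le> \<delta>" for z
  proof -
    obtain x y where z: "z = (x, y)" by (cases z)
    show ?thesis
    proof (cases "(x, y) \<in> R n")
      case True
      then have "x \<in> P" by (simp add: R_iff)
      then show ?thesis using f(3)[OF sR(2)[OF True], of x] sR(1)[OF True] sw_eq[OF n True] z by simp
    next
      case False
      then show ?thesis using s0 suppRD[OF CR_supp[OF t]] d z by simp
    qed
  qed
  obtain S where S: "S \<in> sa_carrier DL" "s = F S" using sF by blast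
  have sC: "s \<in> Cc GG" using em.F_in[OF S(1)] S(2) by simp
  have "N (\<lambda>z. s z - t z) \<le> ?k * \<delta>"
    by (rule N_leI[OF Cc_diff[OF sC assms(1)] kbound_of_bounded[OF supp n less_imp_le[OF d] bd]])
  also have "\<dots> = \<epsilon> * (?k / (?k + 1))" by (simp add: \<delta>_def)
  also have "\<dots> < \<epsilon> * 1" using assms(2) by (intro mult_strict_left_mono) (auto simp: divide_simps add_nonneg_pos simp del: of_nat_mult card_cartesian_product)
  finally show ?thesis using S by (intro bexI[of _ S]) (auto simp: Cc_dist)
qed

lemma AH_limit_isomorphic: "star_isomorphic (AH_limit D) (reduced_cstar GG)"
  unfolding AH_limit_def cstar_limit_def reduced_cstar_def
  by (rule em.completion_iso) (use F_dense in auto)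

section \<open>The limit algebra and its evaluations at units\<close>

abbreviation "L \<equiv> AH_limit D"
abbreviation "ccl \<equiv> cauchy_class DL"

lemma L_eq: "L = completion DL"
  by (simp add: AH_limit_def cstar_limit_def)

lemma emb_eq: "emb D n a = ccl (\<lambda>_. dlc n a)"
  by (simp add: to_limit_def)

lemma DL_dist: "S \<in> sa_carrier DL \<Longrightarrow> T \<in> sa_carrier DL \<Longrightarrow> sa_dist DL S T = N (\<lambda>z. F S z - F T z)"
  by (simp add: em.F_dist Cc_dist)

lemma F_Cc: "S \<in> sa_carrier DL \<Longrightarrow> F S \<in> Cc GG"
  using em.F_in by simp

lemma DL_entry:
  assumes "S \<in> sa_carrier DL" "T \<in> sa_carrier DL" "x \<in> P"
  shows "cmod (F S (x, x) - F T (x, x)) \<le> sa_dist DL S T"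
  unfolding DL_dist[OF assms(1,2)] using N_entry[OF Cc_diff[OF F_Cc F_Cc] assms(3,3), OF assms(1,2)] by simp

text \<open>A diagonal kernel is a multiplication operator, bounded by the supremum of its values.
  With \<open>N_entry\<close> this makes the norm of a diagonal function its supremum norm.\<close>

lemma N_diag:
  assumes "f \<in> Cc GG" "diag_supp f" "0 \<le> s" "\<And>x. x \<in> P \<Longrightarrow> cmod (f (x, x)) \<le> s"
  shows "N f \<le> s"
proof (rule N_leI[OF assms(1) kbound_partial_bij[OF assms(3)]])
  fix x y assume "x \<in> P" "y \<in> P"
  then show "cmod (f (x, y)) \<le> s" using assms by (cases "x = y") (auto simp: diag_supp_def)
next
  have d: "f (x, y) \<noteq> 0 \<Longrightarrow> x = y" for x y using assms(2) by (auto simp: diag_supp_def)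
  show "y = y'" if "f (x, y) \<noteq> 0" "f (x, y') \<noteq> 0" for x y y' using d[OF that(1)] d[OF that(2)] by simp
  show "x = x'" if "f (x, y) \<noteq> 0" "f (x', y) \<noteq> 0" for x x' y using d[OF that(1)] d[OF that(2)] by simp
qed

text \<open>Entries are controlled by the norm, so the diagonal value at the unit of
  \<open>x\<close> extends from functions to Cauchy classes. \<open>ev_lim\<close> shows that the
  chosen representative does not matter.\<close>

definition ev :: "(nat \<Rightarrow> 'e bedge \<times> 'a option) \<Rightarrow> (nat \<Rightarrow> (nat \<times> 'a elt) set) set \<Rightarrow> complex" where
  "ev x c = lim (\<lambda>n. F ((SOME u. u \<in> c) n) (x, x))"

lemma ev_lim:
  assumes u: "u \<in> cauchy_seqs DL" and x: "x \<in> P"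
  shows "(\<lambda>n. F (u n) (x, x)) \<longlonglongrightarrow> ev x (ccl u)"
proof -
  define v where "v = (SOME v. v \<in> ccl u)"
  have "v \<in> ccl u" unfolding v_def
    by (rule someI[where P = "\<lambda>v. v \<in> ccl u", OF em.dom.class_self[OF u]])
  then have v: "v \<in> cauchy_seqs DL" "(\<lambda>n. sa_dist DL (u n) (v n)) \<longlonglongrightarrow> 0" by (auto simp: em.dom.in_class_iff)
  note vc = em.dom.cauchy_carrier[OF v(1)] and uc = em.dom.cauchy_carrier[OF u]
  have "Cauchy (\<lambda>n. F (v n) (x, x))"
  proof (rule metric_CauchyI)
    fix e :: real assume "e > 0"
    then obtain M where M: "\<forall>m\<ge>M. \<forall>n\<ge>M. sa_dist DL (v m) (v n) < e" using em.dom.cauchyD[OF v(1)] by blast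
    have "dist (F (v m) (x, x)) (F (v n) (x, x)) < e" if "m \<ge> M" "n \<ge> M" for m n
      using DL_entry[OF vc[of m] vc[of n] x] M that unfolding dist_norm by (meson le_less_trans)
    then show "\<exists>M. \<forall>m\<ge>M. \<forall>n\<ge>M. dist (F (v m) (x, x)) (F (v n) (x, x)) < e" by blast
  qed
  then have lv: "(\<lambda>n. F (v n) (x, x)) \<longlonglongrightarrow> ev x (ccl u)"
    unfolding ev_def v_def[symmetric] by (simp add: Cauchy_convergent_iff convergent_LIMSEQ_iff)
  have "(\<lambda>n. F (u n) (x, x) - F (v n) (x, x)) \<longlonglongrightarrow> 0"
    by (rule Lim_null_comparison[OF _ v(2)]) (use DL_entry[OF uc vc x] in auto)
  from tendsto_add[OF this lv] show ?thesis by simp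
qed

lemma ev_eqI: "u \<in> cauchy_seqs DL \<Longrightarrow> x \<in> P \<Longrightarrow> (\<lambda>n. F (u n) (x, x)) \<longlonglongrightarrow> l \<Longrightarrow> ev x (ccl u) = l"
  using LIMSEQ_unique ev_lim by blast

text \<open>\<open>DL_entry\<close> bounds all points at once, so one index \<open>M\<close> serves
  the whole path space; continuity and injectivity of evaluation rest on this.\<close>

lemma ev_uniform:
  assumes u: "u \<in> cauchy_seqs DL" and e: "\<epsilon> > 0"
  shows "\<exists>M. \<forall>n\<ge>M. \<forall>x\<in>P. cmod (F (u n) (x, x) - ev x (ccl u)) \<le> \<epsilon>"
proof -
  obtain M where M: "\<forall>m\<ge>M. \<forall>n\<ge>M. sa_dist DL (u m) (u n) < \<epsilon>" using em.dom.cauchyD[OF u e] by blast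
  note uc = em.dom.cauchy_carrier[OF u]
  have "cmod (F (u n) (x, x) - ev x (ccl u)) \<le> \<epsilon>" if n: "n \<ge> M" and x: "x \<in> P" for n x
  proof (rule LIMSEQ_le_const2)
    show "(\<lambda>m. cmod (F (u n) (x, x) - F (u m) (x, x))) \<longlonglongrightarrow> cmod (F (u n) (x, x) - ev x (ccl u))"
      by (intro tendsto_intros ev_lim[OF u x])
    show "\<exists>K. \<forall>m\<ge>K. cmod (F (u n) (x, x) - F (u m) (x, x)) \<le> \<epsilon>"
      using M n DL_entry[OF uc uc x] by (meson less_imp_le order_trans)
  qed
  then show ?thesis by blast
qed

lemma emb_cauchy: "n \<ge> 1 \<Longrightarrow> a \<in> A_carrier D n \<Longrightarrow> (\<lambda>_. dlc n a) \<in> cauchy_seqs DL"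
  by (intro em.dom.const_cauchy dlc_in)

lemma ev_emb: "n \<ge> 1 \<Longrightarrow> a \<in> A_carrier D n \<Longrightarrow> x \<in> P \<Longrightarrow> ev x (emb D n a) = Psi n a (x, x)"
  unfolding emb_eq by (rule ev_eqI[OF emb_cauchy]) (auto simp: F_dlc)

subsection \<open>Limits of subalgebras\<close>

definition lev :: "(nat \<Rightarrow> 'a elt set) \<Rightarrow> (nat \<times> 'a elt) set set" where
  "lev S = {dlc n a | n a. n \<ge> 1 \<and> a \<in> S n}"

text \<open>An instance of \<open>closure_seq\<close> for the algebraic union of the subalgebras:
  limit elements are represented by sequences with terms in that union.\<close>

lemma limit_subalg_iff:
  assumes S: "\<And>n. S n \<subseteq> A_carrier D n"
  shows "c \<in> limit_subalg (A_alg D) (conn D) S \<longleftrightarrow> (\<exists>u\<in>cauchy_seqs DL. range u \<subseteq> lev S \<and> c = ccl u)"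
proof -
  have sub: "lev S \<subseteq> sa_carrier DL" using S dlc_in by (auto simp: lev_def)
  have L: "cstar_limit (A_alg D) (conn D) = completion DL" by (simp add: cstar_limit_def)
  have "c \<in> limit_subalg (A_alg D) (conn D) S \<longleftrightarrow> c \<in> sa_carrier (completion DL) \<and>
     (\<forall>\<epsilon>>0. \<exists>s\<in>lev S. sa_dist (completion DL) c (ccl (\<lambda>_. s)) < \<epsilon>)"
    unfolding limit_subalg_def L to_limit_def lev_def by blast
  then show ?thesis using em.dom.closure_seq[OF sub, of c] em.dom.compl_carrier by blast
qed

text \<open>Operations of the completion act termwise on representing sequences, so it is enough
  that the algebraic union is closed.\<close>

lemma limit_subalg_closed:
  assumes S: "\<And>n. S n \<subseteq> A_carrier D n"
    and add: "\<And>s t. s \<in> lev S \<Longrightarrow> t \<in> lev S \<Longrightarrow> sa_add DL s t \<in> lev S"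
    and mult: "\<And>s t. s \<in> lev S \<Longrightarrow> t \<in> lev S \<Longrightarrow> sa_mult DL s t \<in> lev S"
    and scale: "\<And>s z. s \<in> lev S \<Longrightarrow> sa_scale DL z s \<in> lev S"
    and c: "c \<in> limit_subalg (A_alg D) (conn D) S" and d: "d \<in> limit_subalg (A_alg D) (conn D) S"
  shows "sa_add L c d \<in> limit_subalg (A_alg D) (conn D) S" "sa_mult L c d \<in> limit_subalg (A_alg D) (conn D) S"
    "sa_scale L z c \<in> limit_subalg (A_alg D) (conn D) S"
proof -
  obtain u where u: "u \<in> cauchy_seqs DL" "range u \<subseteq> lev S" "c = ccl u" using c limit_subalg_iff[OF S] by blast
  obtain v where v: "v \<in> cauchy_seqs DL" "range v \<subseteq> lev S" "d = ccl v" using d limit_subalg_iff[OF S] by blast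
  have "range (\<lambda>n. sa_add DL (u n) (v n)) \<subseteq> lev S" using u(2) v(2) add by blast
  then show "sa_add L c d \<in> limit_subalg (A_alg D) (conn D) S"
    unfolding L_eq u(3) v(3) em.dom.compl_add[OF u(1) v(1)] limit_subalg_iff[OF S] using em.dom.cauchy_add[OF u(1) v(1)] by blast
  have "range (\<lambda>n. sa_mult DL (u n) (v n)) \<subseteq> lev S" using u(2) v(2) mult by blast
  then show "sa_mult L c d \<in> limit_subalg (A_alg D) (conn D) S"
    unfolding L_eq u(3) v(3) em.dom.compl_mult[OF u(1) v(1)] limit_subalg_iff[OF S] using em.dom.cauchy_mult[OF u(1) v(1)] by blast
  have "range (\<lambda>n. sa_scale DL z (u n)) \<subseteq> lev S" using u(2) scale by blast
  then show "sa_scale L z c \<in> limit_subalg (A_alg D) (conn D) S"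
    unfolding L_eq u(3) em.dom.compl_scale[OF u(1)] limit_subalg_iff[OF S] using em.dom.cauchy_scale[OF u(1)] by blast
qed

lemma emb_in_limit:
  assumes S: "\<And>n. S n \<subseteq> A_carrier D n" and n: "n \<ge> 1" and a: "a \<in> S n"
  shows "emb D n a \<in> limit_subalg (A_alg D) (conn D) S"
  unfolding limit_subalg_iff[OF S] emb_eq
  by (rule bexI[of _ "\<lambda>_. dlc n a"]) (use n a S emb_cauchy in \<open>auto simp: lev_def\<close>)

lemma C_sub: "C_level D n \<subseteq> A_carrier D n" and B_sub: "B_level D n \<subseteq> A_carrier D n"
  by (auto simp: C_level_def B_level_def)

lemma lev_C: "s \<in> lev (C_level D) \<longleftrightarrow> s \<in> sa_carrier DL \<and> diag_supp (F s)"
proof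
  assume "s \<in> lev (C_level D)"
  then obtain n a where n: "n \<ge> 1" "a \<in> C_level D n" "s = dlc n a" by (auto simp: lev_def)
  then show "s \<in> sa_carrier DL \<and> diag_supp (F s)"
    using dlc_in[OF n(1) C_level_A[OF n(2)]] C_level_iff[OF n(1) C_level_A[OF n(2)]] F_dlc[OF n(1) C_level_A[OF n(2)]] by simp
next
  assume s: "s \<in> sa_carrier DL \<and> diag_supp (F s)"
  then obtain n a where n: "n \<ge> 1" "a \<in> A_carrier D n" "s = dlc n a" using DL_elem by blast
  then have "a \<in> C_level D n" using C_level_iff[OF n(1,2)] F_dlc[OF n(1,2)] s by simp
  then show "s \<in> lev (C_level D)" using n by (auto simp: lev_def)
qed

lemma diag_conv: "diag_supp f \<Longrightarrow> diag_supp g \<Longrightarrow> diag_supp (convolve GG f g)"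
  unfolding diag_supp_def
proof (intro allI impI)
  fix x y :: "nat \<Rightarrow> 'e bedge \<times> 'a option"
  assume f: "\<forall>x y. x \<noteq> y \<longrightarrow> f (x, y) = 0" and g: "\<forall>x y. x \<noteq> y \<longrightarrow> g (x, y) = 0" and ne: "x \<noteq> y"
  show "convolve GG f g (x, y) = 0"
  proof (cases "(x, y) \<in> topspace Gt")
    case True
    have "diag_supp f" using f by (simp add: diag_supp_def)
    from conv_diag_left[OF this True] show ?thesis using g ne by simp
  qed (rule conv_outside)
qed

lemma lev_C_closed:
  assumes "s \<in> lev (C_level D)" "t \<in> lev (C_level D)"
  shows "sa_add DL s t \<in> lev (C_level D)" "sa_mult DL s t \<in> lev (C_level D)" "sa_scale DL z s \<in> lev (C_level D)"
  using assms em.S_add em.S_mult em.S_scale diag_conv[of "F s" "F t"]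
  unfolding lev_C by (auto simp: em.F_add em.F_mult em.F_scale diag_supp_def)

lemma B_levelI:
  assumes "f \<in> A_carrier D n" "\<And>i t. i < num D n \<Longrightarrow> t \<in> topspace (spc D n i) \<Longrightarrow> f i t = M i"
  shows "f \<in> B_level D n"
  using assms by (auto simp: B_level_def)

lemma B_levelE:
  assumes "f \<in> B_level D n"
  obtains M where "\<And>i t. i < num D n \<Longrightarrow> t \<in> topspace (spc D n i) \<Longrightarrow> f i t = M i"
proof -
  have "\<forall>i. \<exists>M. i < num D n \<longrightarrow> (\<forall>t\<in>topspace (spc D n i). f i t = M)" using assms by (auto simp: B_level_def)
  from choice[OF this] show thesis using that by blast
qed

lemma B_level_conn:
  assumes n: "n \<ge> 1" and f: "f \<in> B_level D n" shows "conn D n f \<in> B_level D (Suc n)"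
proof -
  obtain M where M: "\<And>i t. i < num D n \<Longrightarrow> t \<in> topspace (spc D n i) \<Longrightarrow> f i t = M i" using B_levelE[OF f] by blast
  show ?thesis
  proof (rule B_levelI[OF conn_in[OF n]])
    show "f \<in> A_carrier D n" using f B_sub by blast
    fix j t assume j: "j < num D (Suc n)" "t \<in> topspace (spc D (Suc n) j)"
    show "conn D n f j t = diag_block_mat (map (\<lambda>(i, e). M i) (ord D n j))"
      unfolding conn_apply[OF j]
    proof (intro arg_cong[where f = diag_block_mat] map_cong refl, clarify)
      fix i e assume "(i, e) \<in> set (ord D n j)"
      then have "i < num D n" "e \<in> edg D n i j" using ord_set[OF n j(1)] by auto
      then show "f i (egn D n i j e t) = M i" using M egn_in[OF n _ j(1) _ j(2)] by blast
    qed
  qed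
qed

lemma B_level_transit:
  assumes "n \<ge> 1" "n \<le> k" "f \<in> B_level D n" shows "transit (conn D) n k f \<in> B_level D k"
  using assms(2)
proof (induction rule: dec_induct)
  case base
  then show ?case using assms(3) by (simp add: transit_self)
next
  case (step k)
  then show ?case using assms(1) B_level_conn[of k] by (simp add: transit_Suc)
qed

lemma B_level_ops:
  assumes f: "f \<in> B_level D n" and g: "g \<in> B_level D n"
  shows "sa_add (A_alg D n) f g \<in> B_level D n" "sa_mult (A_alg D n) f g \<in> B_level D n" "sa_scale (A_alg D n) z f \<in> B_level D n"
proof -
  obtain M where M: "\<And>i t. i < num D n \<Longrightarrow> t \<in> topspace (spc D n i) \<Longrightarrow> f i t = M i" using B_levelE[OF f] by blast
  obtain M' where M': "\<And>i t. i < num D n \<Longrightarrow> t \<in> topspace (spc D n i) \<Longrightarrow> g i t = M' i" using B_levelE[OF g] by blast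
  have A: "f \<in> A_carrier D n" "g \<in> A_carrier D n" using f g B_sub by auto
  show "sa_add (A_alg D n) f g \<in> B_level D n" by (rule B_levelI[OF A_closed(1)[OF A], of "\<lambda>i. M i + M' i"]) (simp add: M M')
  show "sa_mult (A_alg D n) f g \<in> B_level D n" by (rule B_levelI[OF A_closed(2)[OF A], of "\<lambda>i. M i * M' i"]) (simp add: M M')
  show "sa_scale (A_alg D n) z f \<in> B_level D n" by (rule B_levelI[OF A_closed(3)[OF A], where M = "\<lambda>i. z \<cdot>\<^sub>m M i"]) (simp add: M)
qed

text \<open>For \<open>C_level\<close> membership is read off from the support of the function on
  the groupoid. Here both elements are moved to a common level instead, where the constant matrix
  functions are closed under the operations.\<close>

lemma lev_B_closed:
  assumes "s \<in> lev (B_level D)" "t \<in> lev (B_level D)"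
  shows "sa_add DL s t \<in> lev (B_level D)" "sa_mult DL s t \<in> lev (B_level D)" "sa_scale DL z s \<in> lev (B_level D)"
proof -
  obtain n a where n: "n \<ge> 1" "a \<in> B_level D n" "s = dlc n a" using assms(1) by (auto simp: lev_def)
  obtain m b where m: "m \<ge> 1" "b \<in> B_level D m" "t = dlc m b" using assms(2) by (auto simp: lev_def)
  let ?k = "max n m"
  let ?a = "transit (conn D) n ?k a" and ?b = "transit (conn D) m ?k b"
  have k: "?k \<ge> 1" "n \<le> ?k" "m \<le> ?k" using n(1) by auto
  have B: "?a \<in> B_level D ?k" "?b \<in> B_level D ?k" using B_level_transit n m k by auto
  have A: "?a \<in> A_carrier D ?k" "?b \<in> A_carrier D ?k" using B B_sub by auto
  have eq: "s = dlc ?k ?a" "t = dlc ?k ?b" using dlc_up n m k B_sub by blast+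
  note o = B_level_ops[OF B]
  show "sa_add DL s t \<in> lev (B_level D)" unfolding eq DL_add[OF k(1) A] lev_def using o(1) k(1) by blast
  show "sa_mult DL s t \<in> lev (B_level D)" unfolding eq DL_mult[OF k(1) A] lev_def using o(2) k(1) by blast
  show "sa_scale DL z s \<in> lev (B_level D)" unfolding eq DL_scale[OF k(1) A(1)] lev_def using o(3) k(1) by blast
qed

abbreviation "CC \<equiv> limit_subalg (A_alg D) (conn D) (C_level D)"
abbreviation "BB \<equiv> limit_subalg (A_alg D) (conn D) (B_level D)"

lemma CC_iff: "c \<in> CC \<longleftrightarrow> (\<exists>u\<in>cauchy_seqs DL. (\<forall>n. diag_supp (F (u n))) \<and> c = ccl u)"
  unfolding limit_subalg_iff[OF C_sub]
  using em.dom.cauchy_carrier by (auto simp: lev_C image_subset_iff)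

lemma CC_closed:
  assumes "c \<in> CC" "d \<in> CC"
  shows "sa_add L c d \<in> CC" "sa_mult L c d \<in> CC" "sa_scale L z c \<in> CC"
  by (rule limit_subalg_closed[OF C_sub _ _ _ assms]; rule lev_C_closed; assumption)+

lemma BB_closed:
  assumes "c \<in> BB" "d \<in> BB"
  shows "sa_add L c d \<in> BB" "sa_mult L c d \<in> BB" "sa_scale L z c \<in> BB"
  by (rule limit_subalg_closed[OF B_sub _ _ _ assms]; rule lev_B_closed; assumption)+

lemma ev_add:
  assumes "c \<in> CC" "d \<in> CC" "x \<in> P" shows "ev x (sa_add L c d) = ev x c + ev x d"
proof -
  obtain u where u: "u \<in> cauchy_seqs DL" "c = ccl u" using assms(1) CC_iff by blast
  obtain v where v: "v \<in> cauchy_seqs DL" "d = ccl v" using assms(2) CC_iff by blast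
  show ?thesis
    unfolding u(2) v(2) L_eq em.dom.compl_add[OF u(1) v(1)]
    by (rule ev_eqI[OF em.dom.cauchy_add[OF u(1) v(1)] assms(3)])
       (simp add: em.F_add em.dom.cauchy_carrier u v tendsto_add ev_lim assms(3))
qed

lemma ev_scale:
  assumes "c \<in> CC" "x \<in> P" shows "ev x (sa_scale L z c) = z * ev x c"
proof -
  obtain u where u: "u \<in> cauchy_seqs DL" "c = ccl u" using assms(1) CC_iff by blast
  show ?thesis
    unfolding u(2) L_eq em.dom.compl_scale[OF u(1)]
    by (rule ev_eqI[OF em.dom.cauchy_scale[OF u(1)] assms(2)])
       (simp add: em.F_scale em.dom.cauchy_carrier u tendsto_mult_left ev_lim assms(2))
qed

text \<open>A diagonally supported first factor turns convolution into multiplication of values;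
  hence \<open>c\<close> is represented by a sequence of diagonal functions.\<close>

lemma ev_mult:
  assumes "c \<in> CC" "d \<in> CC" "x \<in> P" shows "ev x (sa_mult L c d) = ev x c * ev x d"
proof -
  obtain u where u: "u \<in> cauchy_seqs DL" "\<And>n. diag_supp (F (u n))" "c = ccl u" using assms(1) CC_iff by blast
  obtain v where v: "v \<in> cauchy_seqs DL" "d = ccl v" using assms(2) CC_iff by blast
  have "F (sa_mult DL (u n) (v n)) (x, x) = F (u n) (x, x) * F (v n) (x, x)" for n
    using em.F_mult[of "u n" "v n"] conv_diag_left[OF u(2) G_refl[OF assms(3)]] em.dom.cauchy_carrier u(1) v(1) by simp
  then show ?thesis
    unfolding u(3) v(2) L_eq em.dom.compl_mult[OF u(1) v(1)]
    by (intro ev_eqI[OF em.dom.cauchy_mult[OF u(1) v(1)] assms(3)])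
       (simp add: tendsto_mult ev_lim u v assms(3))
qed

text \<open>A uniform limit of continuous functions: the neighbourhood is taken from a single term
  of a representing sequence that is within \<open>r / 3\<close> of the limit everywhere.\<close>

lemma ev_continuous:
  assumes "c \<in> CC" shows "continuous_map X euclidean (\<lambda>x. ev x c)"
  unfolding continuous_map_def
proof (intro conjI allI impI)
  obtain u where u: "u \<in> cauchy_seqs DL" "c = ccl u" using assms CC_iff by blast
  fix V :: "complex set" assume V: "openin euclidean V"
  show "openin X {x \<in> topspace X. ev x c \<in> V}"
  proof (subst openin_subopen, intro ballI)
    fix x assume "x \<in> {x \<in> topspace X. ev x c \<in> V}"
    then have x: "x \<in> P" "ev x c \<in> V" by (auto simp: X_topspace)
    obtain r where r: "r > 0" "ball (ev x c) r \<subseteq> V" 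
      by (rule openE[of V "ev x c"]) (use V x(2) in auto)
    obtain n where n: "\<forall>y\<in>P. cmod (F (u n) (y, y) - ev y c) \<le> r / 3" using ev_uniform[OF u(1), of "r / 3"] r(1) u(2) by auto
    let ?f = "\<lambda>y. F (u n) (y, y)"
    let ?W = "{y \<in> topspace X. ?f y \<in> ball (?f x) (r / 3)}"
    have "continuous_map X euclidean ?f" by (rule Cc_diag_continuous[OF F_Cc[OF em.dom.cauchy_carrier[OF u(1)]]])
    then have "openin X ?W" by (rule openin_continuous_map_preimage) simp
    moreover have "x \<in> ?W" using x r(1) by (simp add: X_topspace)
    moreover have "?W \<subseteq> {x \<in> topspace X. ev x c \<in> V}"
    proof
      fix y assume y: "y \<in> ?W"
      then have yP: "y \<in> P" by (simp add: X_topspace)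
      have "dist (ev x c) (ev y c) \<le> dist (ev x c) (?f x) + dist (?f x) (?f y) + dist (?f y) (ev y c)"
        using dist_triangle[of "ev x c" "ev y c" "?f x"] dist_triangle[of "?f x" "ev y c" "?f y"] by linarith
      also have "\<dots> < r" using bspec[OF n x(1)] bspec[OF n yP] y r(1) by (simp add: dist_norm norm_minus_commute)
      finally show "y \<in> {x \<in> topspace X. ev x c \<in> V}" using r(2) y by auto
    qed
    ultimately show "\<exists>T. openin X T \<and> x \<in> T \<and> T \<subseteq> {x \<in> topspace X. ev x c \<in> V}" by blast
  qed
qed auto

text \<open>For diagonal functions the norm is controlled by a supremum over the path space, so
  uniform convergence to the same values makes two representing sequences equivalent.\<close>

lemma ev_inj:
  assumes "c \<in> CC" "d \<in> CC" "\<And>x. x \<in> P \<Longrightarrow> ev x c = ev x d" shows "c = d"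
proof -
  obtain u where u: "u \<in> cauchy_seqs DL" "\<And>n. diag_supp (F (u n))" "c = ccl u" using assms(1) CC_iff by blast
  obtain v where v: "v \<in> cauchy_seqs DL" "\<And>n. diag_supp (F (v n))" "d = ccl v" using assms(2) CC_iff by blast
  note uc = em.dom.cauchy_carrier[OF u(1)] and vc = em.dom.cauchy_carrier[OF v(1)]
  have "(\<lambda>n. sa_dist DL (u n) (v n)) \<longlonglongrightarrow> 0"
  proof (rule LIMSEQ_I)
    fix r :: real assume r: "r > 0"
    obtain M1 where M1: "\<forall>n\<ge>M1. \<forall>x\<in>P. cmod (F (u n) (x, x) - ev x c) \<le> r / 3" using ev_uniform[OF u(1), of "r / 3"] r u(3) by auto
    obtain M2 where M2: "\<forall>n\<ge>M2. \<forall>x\<in>P. cmod (F (v n) (x, x) - ev x d) \<le> r / 3" using ev_uniform[OF v(1), of "r / 3"] r v(3) by auto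
    have "sa_dist DL (u n) (v n) \<le> 2 * r / 3" if n: "n \<ge> max M1 M2" for n
      unfolding DL_dist[OF uc vc]
    proof (rule N_diag[OF Cc_diff[OF F_Cc[OF uc] F_Cc[OF vc]]])
      show "diag_supp (\<lambda>z. F (u n) z - F (v n) z)" using u(2)[of n] v(2)[of n] by (simp add: diag_supp_def)
      fix x assume x: "x \<in> P"
      have "cmod (F (u n) (x, x) - ev x c) \<le> r / 3" "cmod (F (v n) (x, x) - ev x d) \<le> r / 3" using M1 M2 n x by auto
      moreover have "F (u n) (x, x) - F (v n) (x, x) = (F (u n) (x, x) - ev x c) - (F (v n) (x, x) - ev x d)" using assms(3)[OF x] by simp
      ultimately show "cmod (F (u n) (x, x) - F (v n) (x, x)) \<le> 2 * r / 3"
        using norm_triangle_ineq4[of "F (u n) (x, x) - ev x c" "F (v n) (x, x) - ev x d"] by simp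
    qed (use r in simp)
    then have "norm (sa_dist DL (u n) (v n) - 0) < r" if "n \<ge> max M1 M2" for n
      using em.dom.dist_nonneg[OF uc[of n] vc[of n]] r that by fastforce
    then show "\<exists>no. \<forall>n\<ge>no. norm (sa_dist DL (u n) (v n) - 0) < r" by blast
  qed
  then show ?thesis using em.dom.class_eq_iff[OF u(1) v(1)] u(3) v(3) by simp
qed

text \<open>The approximants supplied by \<open>level_dense\<close> are diagonal, so uniform
  closeness makes them a Cauchy sequence. Together with \<open>ev_inj\<close> and
  \<open>ev_continuous\<close> this identifies \<open>CC\<close> with the continuous functions on
  the compact path space.\<close>

lemma ev_surj:
  assumes phi: "continuous_map X euclidean (\<phi> :: _ \<Rightarrow> complex)"
  shows "\<exists>c\<in>CC. \<forall>x\<in>P. ev x c = \<phi> x"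
proof -
  have "\<exists>s. s \<in> lev (C_level D) \<and> (\<forall>x\<in>P. cmod (F s (x, x) - \<phi> x) < inverse (real (Suc k)))" for k
  proof -
    obtain n f where f: "n \<ge> 1" "f \<in> C_level D n" "\<forall>x\<in>P. cmod (Psi n f (x, x) - \<phi> x) < inverse (real (Suc k))"
      using level_dense[OF phi, of "inverse (real (Suc k))"] by auto
    have "F (dlc n f) = Psi n f" using F_dlc[OF f(1) C_level_A[OF f(2)]] .
    then show ?thesis using f by (intro exI[of _ "dlc n f"]) (auto simp: lev_def)
  qed
  then obtain u where u: "\<And>k. u k \<in> lev (C_level D)" "\<And>k. \<forall>x\<in>P. cmod (F (u k) (x, x) - \<phi> x) < inverse (real (Suc k))" by metis
  have uc: "u k \<in> sa_carrier DL" "diag_supp (F (u k))" for k using u(1)[of k] by (auto simp: lev_C)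
  have ucs: "u \<in> cauchy_seqs DL"
  proof (rule em.dom.cauchy_seqsI[OF uc(1)])
    fix \<epsilon> :: real assume e: "\<epsilon> > 0"
    obtain M where M: "inverse (real (Suc M)) < \<epsilon> / 3" using reals_Archimedean[of "\<epsilon> / 3"] e by auto
    have "sa_dist DL (u m) (u n) < \<epsilon>" if mn: "m \<ge> M" "n \<ge> M" for m n
    proof -
      have "sa_dist DL (u m) (u n) \<le> 2 * \<epsilon> / 3"
        unfolding DL_dist[OF uc(1) uc(1)]
      proof (rule N_diag[OF Cc_diff[OF F_Cc[OF uc(1)] F_Cc[OF uc(1)]]])
        show "diag_supp (\<lambda>z. F (u m) z - F (u n) z)" using uc(2)[of m] uc(2)[of n] by (simp add: diag_supp_def)
        fix x assume x: "x \<in> P"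
        have "inverse (real (Suc k)) \<le> inverse (real (Suc M))" if "k \<ge> M" for k using that by (intro le_imp_inverse_le) auto
        then have "cmod (F (u k) (x, x) - \<phi> x) \<le> \<epsilon> / 3" if "k \<ge> M" for k
          using that bspec[OF u(2)[of k] x] M by (meson less_imp_le order_trans)
        from this[OF mn(1)] this[OF mn(2)] show "cmod (F (u m) (x, x) - F (u n) (x, x)) \<le> 2 * \<epsilon> / 3"
          using norm_triangle_ineq4[of "F (u m) (x, x) - \<phi> x" "F (u n) (x, x) - \<phi> x"] by simp
      qed (use e in simp)
      then show ?thesis using e by simp
    qed
    then show "\<exists>M. \<forall>m\<ge>M. \<forall>n\<ge>M. sa_dist DL (u m) (u n) < \<epsilon>" by blast
  qed
  have "ccl u \<in> CC" using CC_iff ucs uc(2) by blast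
  moreover have "ev x (ccl u) = \<phi> x" if x: "x \<in> P" for x
  proof (rule ev_eqI[OF ucs x])
    have "(\<lambda>k. F (u k) (x, x) - \<phi> x) \<longlonglongrightarrow> 0"
      by (rule Lim_null_comparison[OF _ LIMSEQ_inverse_real_of_nat]) (use u(2) x in \<open>auto intro!: always_eventually less_imp_le\<close>)
    then show "(\<lambda>k. F (u k) (x, x)) \<longlonglongrightarrow> \<phi> x" by (simp add: LIM_zero_iff)
  qed
  ultimately show ?thesis by blast
qed

subsection \<open>The spectrum of the diagonal subalgebra\<close>

lemma C_alg_simps [simp]:
  "sa_carrier (C_alg D) = CC" "sa_add (C_alg D) = sa_add L" "sa_mult (C_alg D) = sa_mult L"
  "sa_scale (C_alg D) = sa_scale L"
  by (simp_all add: C_alg_def)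

definition one :: "(nat \<Rightarrow> (nat \<times> 'a elt) set) set" where
  "one = emb D 1 (A_one D 1)"

lemma A_one_C: "A_one D n \<in> C_level D n" and A_one_B: "A_one D n \<in> B_level D n"
  using A_one_in[of n] by (auto simp: C_level_def B_level_def A_one_def diagonal_mat_def)

lemma one_CC: "one \<in> CC" and one_BB: "one \<in> BB"
  unfolding one_def by (auto intro!: emb_in_limit C_sub B_sub A_one_C A_one_B)

lemma ev_one:
  assumes x: "x \<in> P" shows "ev x one = 1"
proof -
  have "A_one D (Suc 0) \<in> A_carrier D (Suc 0)" using A_one_in[of 1] by simp
  then have "ev x one = Psi (Suc 0) (A_one D (Suc 0)) (x, x)" unfolding one_def by (simp add: ev_emb x)
  then show ?thesis using Psi_entry[OF _ R_refl, of 1 x] x by (simp add: Psi_R R_refl A_one_def)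
qed

lemma mult_one: "c \<in> CC \<Longrightarrow> sa_mult L c one = c"
  by (rule ev_inj) (auto simp: CC_closed one_CC ev_mult ev_one)

definition chi :: "(nat \<Rightarrow> 'e bedge \<times> 'a option) \<Rightarrow> (nat \<Rightarrow> (nat \<times> 'a elt) set) set \<Rightarrow> complex" where
  "chi x = restrict (ev x) CC"

lemma chi_apply: "c \<in> CC \<Longrightarrow> chi x c = ev x c"
  by (simp add: chi_def)

lemma chi_character: "x \<in> P \<Longrightarrow> chi x \<in> characters (C_alg D)"
  unfolding characters_def
  by (auto simp: chi_def CC_closed ev_add ev_mult ev_scale intro!: bexI[of _ one] one_CC simp: ev_one)

text \<open>If no point evaluation annihilates the kernel of a character, compactness yields an
  element of the kernel that vanishes nowhere on the path space and hence is invertible.\<close>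

lemma character_eq_chi:
  assumes w: "\<omega> \<in> characters (C_alg D)"
  shows "\<exists>x\<in>P. \<omega> = chi x"
proof -
  have wadd: "\<omega> (sa_add L a b) = \<omega> a + \<omega> b" and wmult: "\<omega> (sa_mult L a b) = \<omega> a * \<omega> b" if "a \<in> CC" "b \<in> CC" for a b
    using w that by (auto simp: characters_def)
  have wscale: "\<omega> (sa_scale L z a) = z * \<omega> a" if "a \<in> CC" for a z using w that by (auto simp: characters_def)
  have wext: "\<omega> \<in> extensional CC" using w by (simp add: characters_def)
  obtain a0 where a0: "a0 \<in> CC" "\<omega> a0 \<noteq> 0" using w by (auto simp: characters_def)
  have w1: "\<omega> one = 1" using wmult[OF a0(1) one_CC] mult_one[OF a0(1)] a0(2) by simp
  have "\<exists>x\<in>P. \<forall>c\<in>CC. \<omega> c = 0 \<longrightarrow> ev x c = 0"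
  proof (rule ccontr)
    assume "\<not> ?thesis"
    then have "\<forall>x\<in>P. \<exists>c. c \<in> CC \<and> \<omega> c = 0 \<and> ev x c \<noteq> 0" by blast
    from bchoice[OF this] obtain k where k: "\<forall>x\<in>P. k x \<in> CC \<and> \<omega> (k x) = 0 \<and> ev x (k x) \<noteq> 0" by blast
    let ?O = "\<lambda>x. {y \<in> topspace X. ev y (k x) \<in> - {0}}"
    have opn: "openin X (?O x)" if "x \<in> P" for x
      by (rule openin_continuous_map_preimage[OF ev_continuous]) (use k that in auto)
    have cov: "P \<subseteq> \<Union>(?O ` P)" using k by (auto simp: X_topspace)
    have "\<exists>\<F>. finite \<F> \<and> \<F> \<subseteq> ?O ` P \<and> P \<subseteq> \<Union>\<F>"
      by (rule X_compact[unfolded compact_space_def compactin_def X_topspace, THEN conjunct2, rule_format])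
         (use opn cov in \<open>auto simp: X_topspace\<close>)
    then obtain \<F> where \<F>: "finite \<F>" "\<F> \<subseteq> ?O ` P" "P \<subseteq> \<Union>\<F>" by blast
    obtain I where "I \<subseteq> P" "finite I" "\<F> = ?O ` I" using finite_subset_image[OF \<F>(1,2)] by blast
    with \<F>(3) have I: "finite I" "I \<subseteq> P" "P \<subseteq> \<Union>(?O ` I)" by auto
    have "\<exists>s\<in>CC. \<omega> s = 0 \<and> (\<forall>y\<in>P. ev y s = complex_of_real (\<Sum>x\<in>I. (cmod (ev y (k x)))\<^sup>2))"
      using I(1,2)
    proof (induction I rule: finite_induct)
      case empty
      show ?case
        using wscale[OF one_CC, of 0] by (intro bexI[of _ "sa_scale L 0 one"]) (auto simp: ev_scale one_CC CC_closed(3)[OF one_CC one_CC])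
    next
      case (insert x I)
      then obtain s where s: "s \<in> CC" "\<omega> s = 0" "\<forall>y\<in>P. ev y s = complex_of_real (\<Sum>x\<in>I. (cmod (ev y (k x)))\<^sup>2)" by auto
      have kx: "k x \<in> CC" "\<omega> (k x) = 0" using k insert.prems by auto
      \<comment> \<open>The complex conjugate is taken from \<open>ev_surj\<close>; multiplying by
        it stays in the kernel of \<open>\<omega>\<close> and makes the values nonnegative.\<close>
      obtain d where d: "d \<in> CC" "\<forall>y\<in>P. ev y d = cnj (ev y (k x))" using ev_surj[OF continuous_map_cnj[OF ev_continuous[OF kx(1)]]] by blast
      let ?m = "sa_mult L (k x) d"
      have m: "?m \<in> CC" "\<omega> ?m = 0" using CC_closed(2)[OF kx(1) d(1)] wmult[OF kx(1) d(1)] kx(2) by auto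
      have "ev y (sa_add L ?m s) = complex_of_real (\<Sum>x\<in>insert x I. (cmod (ev y (k x)))\<^sup>2)" if y: "y \<in> P" for y
      proof -
        have "ev y (sa_add L ?m s) = ev y (k x) * cnj (ev y (k x)) + ev y s"
          using ev_add[OF m(1) s(1) y] ev_mult[OF kx(1) d(1) y] d(2) y by simp
        also have "ev y (k x) * cnj (ev y (k x)) = complex_of_real ((cmod (ev y (k x)))\<^sup>2)" by (rule complex_norm_square[symmetric])
        finally show ?thesis using s(3) y insert.hyps by simp
      qed
      then show ?case using CC_closed(1)[OF m(1) s(1)] wadd[OF m(1) s(1)] m(2) s(2)
        by (intro bexI[of _ "sa_add L ?m s"]) auto
    qed
    then obtain s where s: "s \<in> CC" "\<omega> s = 0" "\<forall>y\<in>P. ev y s = complex_of_real (\<Sum>x\<in>I. (cmod (ev y (k x)))\<^sup>2)" by blast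
    have nz: "ev y s \<noteq> 0" if y: "y \<in> P" for y
    proof -
      obtain x where x: "x \<in> I" "ev y (k x) \<noteq> 0" using I(3) y by blast
      have "(\<Sum>x\<in>I. (cmod (ev y (k x)))\<^sup>2) > 0" using x I(1) by (intro sum_pos2[of I x]) auto
      moreover have "ev y s = complex_of_real (\<Sum>x\<in>I. (cmod (ev y (k x)))\<^sup>2)" using s(3) y by blast
      ultimately show ?thesis by (metis less_irrefl of_real_eq_0_iff)
    qed
    have "continuous_map X euclidean (\<lambda>y. 1 / ev y s)"
      by (rule continuous_map_divide_complex[OF _ ev_continuous[OF s(1)]]) (use nz in \<open>auto simp: X_topspace\<close>)
    then obtain c where c: "c \<in> CC" "\<forall>y\<in>P. ev y c = 1 / ev y s" using ev_surj by blast
    have "sa_mult L s c = one"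
      by (rule ev_inj) (use s c nz in \<open>auto simp: CC_closed one_CC ev_mult ev_one\<close>)
    then show False using wmult[OF s(1) c(1)] s(2) w1 by simp
  qed
  then obtain x where x: "x \<in> P" "\<forall>c\<in>CC. \<omega> c = 0 \<longrightarrow> ev x c = 0" by blast
  have "\<omega> c = chi x c" if c: "c \<in> CC" for c
  proof -
    \<comment> \<open>\<open>c\<close> minus \<open>\<omega> c\<close> times the unit lies in the
      kernel of \<open>\<omega>\<close>, so it vanishes at \<open>x\<close>, which says that
      \<open>\<omega> c\<close> is the value of \<open>c\<close> at \<open>x\<close>.\<close>
    let ?d = "sa_add L c (sa_scale L (- \<omega> c) one)"
    have o: "sa_scale L (- \<omega> c) one \<in> CC" by (rule CC_closed(3)[OF one_CC one_CC])
    have "?d \<in> CC" "\<omega> ?d = 0" using CC_closed(1)[OF c o] wadd[OF c o] wscale[OF one_CC] w1 by auto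
    then have "ev x ?d = 0" using x(2) by blast
    then show ?thesis using ev_add[OF c o x(1)] ev_scale[OF one_CC x(1)] ev_one[OF x(1)] chi_apply[OF c] by simp
  qed
  then have "\<omega> = chi x" by (intro extensionalityI[OF wext]) (auto simp: chi_def)
  then show ?thesis using x(1) by blast
qed

lemma characters_eq: "characters (C_alg D) = chi ` P"
  using chi_character character_eq_chi by blast

lemma C_hat_topspace: "topspace (C_hat D) = chi ` P"
proof -
  have "characters (C_alg D) \<subseteq> extensional CC" by (auto simp: characters_def)
  then show ?thesis unfolding gelfand_spectrum_def topspace_subtopology characters_eq by (auto simp: PiE_def)
qed

lemma chi_continuous: "continuous_map X (C_hat D) chi"
  unfolding gelfand_spectrum_def continuous_map_in_subtopology
proof
  show "continuous_map X (product_topology (\<lambda>_. euclidean) (sa_carrier (C_alg D))) chi"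
    unfolding continuous_map_componentwise C_alg_simps
  proof (intro conjI ballI)
    show "chi ` topspace X \<subseteq> extensional CC" by (auto simp: chi_def)
    fix c assume "c \<in> CC"
    then show "continuous_map X euclidean (\<lambda>x. chi x c)" using ev_continuous by (simp add: chi_apply)
  qed
qed (use chi_character in \<open>auto simp: X_topspace\<close>)

text \<open>Indicators of a summand and a position are constant on each space, hence continuous, and
  separate vertices and positions; Urysohn functions separate the points.\<close>

lemma level_separates:
  assumes n: "n \<ge> 1" and x: "x \<in> P" and y: "y \<in> P"
    and eq: "\<And>f. f \<in> C_level D n \<Longrightarrow> Psi n f (x, x) = Psi n f (y, y)"
  shows "vtx n y = vtx n x" "ix n y = ix n x" "pt n y = pt n x"
proof -
  have ev: "g (vtx n x) (ix n x) (pt n x) = g (vtx n y) (ix n y) (pt n y)"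
    if "\<And>i a. i < num D n \<Longrightarrow> a < siz D n i \<Longrightarrow> continuous_map (spc D n i) euclidean (g i a)" for g :: "nat \<Rightarrow> nat \<Rightarrow> 'a \<Rightarrow> complex"
    using eq[OF dE_in[OF that]] dE_Psi[OF n x, of g] dE_Psi[OF n y, of g] by simp
  let ?i = "vtx n x" let ?Y = "spc D n ?i"
  have "(if vtx n x = ?i \<and> ix n x = ix n x then 1 else 0 :: complex) = (if vtx n y = ?i \<and> ix n y = ix n x then 1 else 0)"
    by (rule ev[of "\<lambda>i a t. if i = ?i \<and> a = ix n x then 1 else 0"]) simp
  then show v: "vtx n y = ?i" "ix n y = ix n x" by (auto split: if_splits)
  show "pt n y = pt n x"
  proof (rule ccontr)
    assume ne: "pt n y \<noteq> pt n x"
    have i: "?i < num D n" by (rule vtx_less[OF n x])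
    have p: "pt n x \<in> topspace ?Y" "pt n y \<in> topspace ?Y" using pt_in[OF n x] pt_in[OF n y] v(1) by auto
    have "normal_space ?Y" "closedin ?Y {pt n x}" "closedin ?Y {pt n y}" "disjnt {pt n x} {pt n y}"
      using compact_Hausdorff_or_regular_imp_normal_space space_Hausdorff[OF n i] space_compact[OF n i] p ne
      by (auto simp: closedin_Hausdorff_singleton)
    then obtain g :: "'a \<Rightarrow> real" where g: "continuous_map ?Y euclideanreal g" "g ` {pt n x} \<subseteq> {0}" "g ` {pt n y} \<subseteq> {1}"
      using Urysohn_lemma_alt by metis
    have gc: "continuous_map ?Y euclidean (\<lambda>t. complex_of_real (g t))"
      using continuous_map_compose[OF g(1), of euclidean complex_of_real] by (simp add: comp_def continuous_intros)
    have "(if vtx n x = ?i then complex_of_real (g (pt n x)) else 0) = (if vtx n y = ?i then complex_of_real (g (pt n y)) else 0)"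
    proof (rule ev[of "\<lambda>i a t. if i = ?i then complex_of_real (g t) else 0"])
      fix i a show "continuous_map (spc D n i) euclidean (\<lambda>t. if i = ?i then complex_of_real (g t) else 0)"
        using gc by (cases "i = ?i") auto
    qed
    then show False using v(1) g(2,3) by simp
  qed
qed

lemma chi_emb: "n \<ge> 1 \<Longrightarrow> f \<in> C_level D n \<Longrightarrow> x \<in> P \<Longrightarrow> chi x (emb D n f) = Psi n f (x, x)"
  using chi_apply[OF emb_in_limit[OF C_sub]] ev_emb C_level_A by metis

text \<open>The definite description is unique: a competing pair \<open>(p, t)\<close> is realised
  by some path \<open>y\<close>, and the diagonal elements of level \<open>n\<close> tell
  \<open>x\<close> from \<open>y\<close> unless their coordinates coincide.\<close>

lemma coord_chi:
  assumes n: "n \<ge> 1" and x: "x \<in> P"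
  shows "coord D (chi x) n = (init_seg n (fst \<circ> x), pt n x)"
  unfolding coord_def
proof (rule the_equality)
  have "chi x (emb D n f) = f (btgt (last (init_seg n (fst \<circ> x)))) (pt n x) $$ (pos D (init_seg n (fst \<circ> x)), pos D (init_seg n (fst \<circ> x)))"
    if "f \<in> C_level D n" for f
    using chi_emb[OF n that x] Psi_R[OF R_refl[OF x]] vtx_init[OF n x] by (simp add: ix_def)
  then show "case (init_seg n (fst \<circ> x), pt n x) of (p, t) \<Rightarrow> p \<in> fin_paths D \<and> length p = n \<and> t \<in> topspace (spc D n (btgt (last p))) \<and>
      (\<forall>f\<in>C_level D n. chi x (emb D n f) = f (btgt (last p)) t $$ (pos D p, pos D p))"
    using init_in_fpaths[OF n x] pt_in[OF n x] vtx_init[OF n x] by (auto simp: fpaths_def)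
  fix pt' assume a: "case pt' of (p, t) \<Rightarrow> p \<in> fin_paths D \<and> length p = n \<and> t \<in> topspace (spc D n (btgt (last p))) \<and>
      (\<forall>f\<in>C_level D n. chi x (emb D n f) = f (btgt (last p)) t $$ (pos D p, pos D p))"
  obtain p t where pt': "pt' = (p, t)" by (cases pt')
  have p: "p \<in> fin_paths D" "length p = n" "t \<in> topspace (spc D n (btgt (last p)))"
    and f: "\<And>f. f \<in> C_level D n \<Longrightarrow> chi x (emb D n f) = f (btgt (last p)) t $$ (pos D p, pos D p)" using a pt' by auto
  have "p \<in> paths_to n (btgt (last p))" "btgt (last p) < num D n" using p fin_path_target[OF p(1)] by (auto simp: paths_to_def)
  then obtain y where y: "y \<in> P" "init_seg n (fst \<circ> y) = p" "snd (y n) = Some t" "bsrc (fst (y n)) = btgt (last p)"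
    using level_surj[OF n _ p(3)] by blast
  have yy: "vtx n y = btgt (last p)" "pt n y = t" "ix n y = pos D p" using y by (auto simp: vtx_def pt_def ix_def)
  have eq: "Psi n f (x, x) = Psi n f (y, y)" if "f \<in> C_level D n" for f
    using f[OF that] chi_emb[OF n that x] Psi_R[OF R_refl[OF y(1)], of n f] yy by simp
  note s = level_separates[OF n x y(1) eq]
  show "pt' = (init_seg n (fst \<circ> x), pt n x)"
    using s init_eq_iff[OF n x y(1)] y(2) yy(2) pt' by simp
qed

lemma h_chi: "x \<in> P \<Longrightarrow> h_map D (chi x) = x"
proof
  fix m assume x: "x \<in> P"
  have "snd (x m) = (if m = 0 then None else Some (pt m x))"
    using pathD(3)[OF x, of 0] pt_Some[of m x] x by (auto simp: vs_topspace)
  then show "h_map D (chi x) m = x m"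
    using coord_chi[of "Suc m" x] coord_chi[of m x] x by (cases "x m") (auto simp: h_map_def)
qed

lemma chi_inj: "inj_on chi P"
  by (rule inj_on_inverseI[where g = "h_map D"]) (rule h_chi)

lemma inv_h: "y \<in> P \<Longrightarrow> inv_into (characters (C_alg D)) (h_map D) y = chi y"
  by (rule inv_into_f_eq) (auto simp: characters_eq h_chi inj_on_def)

text \<open>A continuous bijection from a compact space onto a Hausdorff space; the spectrum is
  Hausdorff because it carries the topology of pointwise convergence.\<close>

lemma chi_homeomorphic: "homeomorphic_map X (C_hat D) chi"
proof (rule continuous_imp_homeomorphic_map[OF chi_continuous X_compact])
  show "Hausdorff_space (C_hat D)"
    unfolding gelfand_spectrum_def
    by (intro Hausdorff_space_subtopology) (simp add: Hausdorff_space_product_topology)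
  show "chi ` topspace X = topspace (C_hat D)" by (simp add: X_topspace C_hat_topspace)
  show "inj_on chi (topspace X)" by (simp add: X_topspace chi_inj)
qed

subsection \<open>The anchor map and the action\<close>

lemma unit_level:
  assumes p: "p \<in> fin_paths D"
  shows "mat_unit D p p \<in> C_level D (length p)" "mat_unit D p p \<in> B_level D (length p)"
proof -
  have pp: "(p, p) \<in> path_pairs D" using p by (simp add: path_pairs_def)
  show "mat_unit D p p \<in> C_level D (length p)" "mat_unit D p p \<in> B_level D (length p)"
    using mat_unit_in[OF pp] by (auto simp: C_level_def B_level_def mat_unit_def diagonal_mat_def)
qed

lemma ev_unit:
  assumes p: "p \<in> fin_paths D" and y: "y \<in> P"
  shows "ev y (unit_in_A D p p) = (if fst \<circ> y \<in> Zset D p then 1 else 0)"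
proof -
  have pp: "(p, p) \<in> path_pairs D" using p by (simp add: path_pairs_def)
  have "ev y (unit_in_A D p p) = Psi (length p) (mat_unit D p p) (y, y)"
    by (rule ev_emb[OF path_pairsD(1)[OF pp] mat_unit_in[OF pp] y])
  then show ?thesis using Psi_unit[OF pp, of y y] R_refl[OF y] pathD(5)[OF y] by (simp add: Zset_def)
qed

abbreviation "CB \<equiv> sa_carrier (CB_alg D)"

lemma CB_eq: "CB = CC \<inter> BB"
  by (simp add: CB_alg_def B_alg_def)

lemma CB_simps: "sa_add (CB_alg D) = sa_add L" "sa_mult (CB_alg D) = sa_mult L" "sa_scale (CB_alg D) = sa_scale L"
  by (simp_all add: CB_alg_def)

lemma unit_CB: "p \<in> fin_paths D \<Longrightarrow> unit_in_A D p p \<in> CB"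
  unfolding CB_eq using emb_in_limit[OF C_sub] emb_in_limit[OF B_sub] unit_level fin_path_target(1) by blast

lemma restrict_chi: "restrict (chi y) CB = restrict (ev y) CB"
  by (auto simp: restrict_def chi_def CB_eq)

lemma ev_CB_character: "y \<in> P \<Longrightarrow> restrict (ev y) CB \<in> characters (CB_alg D)"
  unfolding characters_def CB_simps
  by (auto simp: CB_eq CC_closed BB_closed ev_add ev_mult ev_scale intro!: bexI[of _ one] one_CC one_BB simp: ev_one)

text \<open>The matrix units along the initial segments of \<open>y\<close> have value 1, which
  forces every edge of a competing path.\<close>

lemma anchor_chi:
  assumes y: "y \<in> P" shows "anchor_map D (chi y) = fst \<circ> y"
  unfolding anchor_map_def restrict_chi
proof (rule the_equality)
  show "fst \<circ> y \<in> inf_paths D \<and> evaluation_at D (fst \<circ> y) (restrict (ev y) CB)"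
    unfolding evaluation_at_def using pathD(5)[OF y] ev_CB_character[OF y] unit_CB ev_unit[OF _ y] by simp
  fix z assume z: "z \<in> inf_paths D \<and> evaluation_at D z (restrict (ev y) CB)"
  have "z m = (fst \<circ> y) m" for m
  proof -
    let ?p = "init_seg (Suc m) (fst \<circ> y)"
    have p: "?p \<in> fin_paths D" by (rule init_seg_fin_path[OF pathD(5)[OF y]])
    have "restrict (ev y) CB (unit_in_A D ?p ?p) = 1"
      using ev_unit[OF p y] unit_CB[OF p] pathD(5)[OF y] by (simp add: Zset_def)
    then have "z \<in> Zset D ?p" using z p unfolding evaluation_at_def by (metis zero_neq_one)
    then show ?thesis by (simp add: Zset_def init_seg_eq_iff)
  qed
  then show "z = fst \<circ> y" by blast
qed

text \<open>\<open>e\<close> is the indicator of the graph exchanging \<open>p\<close> and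
  \<open>q\<close>, so conjugation by it transports a diagonal function along that partial
  bijection: the value at \<open>y\<close> is the old value at its partner \<open>x\<close>.\<close>

lemma conj_unit:
  assumes pq: "(p, q) \<in> path_pairs D" and f: "diag_supp f"
  defines "e \<equiv> Psi (length p) (mat_unit D p q)"
  shows "diag_supp (convolve GG (sa_star (Cc_alg GG) e) (convolve GG f e))"
    "(x, y) \<in> R (length p) \<Longrightarrow> init_seg (length p) (fst \<circ> x) = p \<Longrightarrow> init_seg (length p) (fst \<circ> y) = q \<Longrightarrow>
      convolve GG (sa_star (Cc_alg GG) e) (convolve GG f e) (y, y) = f (x, x)"
proof -
  let ?n = "length p"
  let ?s = "sa_star (Cc_alg GG) e"
  have n: "?n \<ge> 1" using path_pairsD(1)[OF pq] .
  have ev: "e (a, b) = (if (a, b) \<in> R ?n \<and> init_seg ?n (fst \<circ> a) = p \<and> init_seg ?n (fst \<circ> b) = q then 1 else 0)" for a b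
    unfolding e_def by (rule Psi_unit[OF pq])
  have sv: "?s (b, a) = (if (a, b) \<in> R ?n \<and> init_seg ?n (fst \<circ> a) = p \<and> init_seg ?n (fst \<circ> b) = q then 1 else 0)" for a b
    using R_sym[of a b ?n] G_arrow[of b a] by (auto simp: star_eq ev)
  have fe: "convolve GG f e (a, z) = f (a, a) * e (a, z)" if "(a, z) \<in> topspace Gt" for a z
    by (rule conv_diag_left[OF f that])
  \<comment> \<open>If \<open>b\<close> has a partner \<open>a\<close>, then it is unique, and the
    outer sum has only the term at \<open>a\<close>.\<close>
  have main: "convolve GG ?s (convolve GG f e) (b, z) = f (a, a) * e (a, z)"
    if ab: "(a, b) \<in> R ?n" "init_seg ?n (fst \<circ> a) = p" "init_seg ?n (fst \<circ> b) = q" and bz: "(b, z) \<in> topspace Gt" for a b z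
  proof -
    have az: "(a, z) \<in> topspace Gt" using G_trans[OF _ bz] ab(1) G_arrow by blast
    have "convolve GG ?s (convolve GG f e) (b, z) = (\<Sum>c\<in>{a}. ?s (b, c) * convolve GG f e (c, z))"
    proof (rule conv_eq[OF bz])
      fix c assume "(c, z) \<in> topspace Gt" "c \<notin> {a}"
      have "\<not> ((c, b) \<in> R ?n \<and> init_seg ?n (fst \<circ> c) = p)"
        using R_eqI[of c a ?n] R_trans[OF _ R_sym[OF ab(1)]] ab(2) \<open>c \<notin> {a}\<close> by auto
      then show "?s (b, c) * convolve GG f e (c, z) = 0" using sv[of b c] by auto
    qed (use az in auto)
    then show ?thesis using sv[of b a] ab fe[OF az] by simp
  qed
  show "diag_supp (convolve GG ?s (convolve GG f e))"
    unfolding diag_supp_def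
  proof (intro allI impI)
    fix b z :: "nat \<Rightarrow> 'e bedge \<times> 'a option" assume ne: "b \<noteq> z"
    show "convolve GG ?s (convolve GG f e) (b, z) = 0"
    proof (cases "(b, z) \<in> topspace Gt")
      case bz: True
      show ?thesis
      proof (cases "\<exists>a. (a, b) \<in> R ?n \<and> init_seg ?n (fst \<circ> a) = p \<and> init_seg ?n (fst \<circ> b) = q")
        case True
        then obtain a where ab: "(a, b) \<in> R ?n" "init_seg ?n (fst \<circ> a) = p" "init_seg ?n (fst \<circ> b) = q" by blast
        have "e (a, z) = 0"
        proof (rule ccontr)
          assume "e (a, z) \<noteq> 0"
          then have "(a, z) \<in> R ?n" "init_seg ?n (fst \<circ> z) = q" using ev[of a z] by (auto split: if_splits)
          then have "b = z" using R_eqI[of b z ?n] R_trans[OF R_sym[OF ab(1)]] ab(3) by auto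
          then show False using ne by simp
        qed
        then show ?thesis using main[OF ab bz] by simp
      next
        case False
        \<comment> \<open>Without a partner for \<open>b\<close> the row of the adjoint vanishes, so
          the sum runs over the empty set.\<close>
        have "convolve GG ?s (convolve GG f e) (b, z) = (\<Sum>c\<in>{}. ?s (b, c) * convolve GG f e (c, z))"
          by (rule conv_eq[OF bz]) (use False sv[of b] in auto)
        then show ?thesis by simp
      qed
    qed (rule conv_outside)
  qed
  assume xy: "(x, y) \<in> R ?n" "init_seg ?n (fst \<circ> x) = p" "init_seg ?n (fst \<circ> y) = q"
  have "y \<in> P" using xy(1) by (simp add: R_iff)
  then show "convolve GG ?s (convolve GG f e) (y, y) = f (x, x)"
    using main[OF xy G_refl] ev[of x y] xy by simp
qed

text \<open>\<open>conj_unit\<close> is applied to each term of a diagonal representing sequence;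
  the operations of the completion act termwise, and evaluation passes to the limit.\<close>

lemma conj_unit_CC:
  assumes pq: "(p, q) \<in> path_pairs D" and c: "c \<in> CC"
  defines "E \<equiv> unit_in_A D p q"
  shows "sa_mult L (sa_star L E) (sa_mult L c E) \<in> CC"
    "(x, y) \<in> R (length p) \<Longrightarrow> init_seg (length p) (fst \<circ> x) = p \<Longrightarrow> init_seg (length p) (fst \<circ> y) = q \<Longrightarrow>
      ev y (sa_mult L (sa_star L E) (sa_mult L c E)) = ev x c"
proof -
  obtain u where u: "u \<in> cauchy_seqs DL" "\<And>n. diag_supp (F (u n))" "c = ccl u" using c CC_iff by blast
  let ?e = "dlc (length p) (mat_unit D p q)"
  have e: "?e \<in> sa_carrier DL" using dlc_in[OF path_pairsD(1)[OF pq] mat_unit_in[OF pq]] .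
  have ec: "(\<lambda>_. ?e) \<in> cauchy_seqs DL" by (rule em.dom.const_cauchy[OF e])
  have Fe: "F ?e = Psi (length p) (mat_unit D p q)" using F_dlc[OF path_pairsD(1)[OF pq] mat_unit_in[OF pq]] .
  let ?w = "\<lambda>n. sa_mult DL (sa_star DL ?e) (sa_mult DL (u n) ?e)"
  note uc = em.dom.cauchy_carrier[OF u(1)]
  have w: "?w \<in> cauchy_seqs DL" by (intro em.dom.cauchy_mult em.dom.cauchy_star[OF ec] u(1) ec)
  have eq: "sa_mult L (sa_star L E) (sa_mult L c E) = ccl ?w"
    unfolding E_def emb_eq u(3) L_eq em.dom.compl_star[OF ec] em.dom.compl_mult[OF u(1) ec]
    by (rule em.dom.compl_mult[OF em.dom.cauchy_star[OF ec] em.dom.cauchy_mult[OF u(1) ec]])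
  have Fw: "F (?w n) = convolve GG (sa_star (Cc_alg GG) (F ?e)) (convolve GG (F (u n)) (F ?e))" for n
    using e uc[of n] by (simp add: em.F_mult em.F_star em.S_star em.S_mult)
  show "sa_mult L (sa_star L E) (sa_mult L c E) \<in> CC"
    unfolding eq CC_iff
  proof (intro exI[of _ ?w] bexI[OF _ w] conjI allI w refl)
    show "diag_supp (F (?w n))" for n unfolding Fw Fe by (rule conj_unit(1)[OF pq u(2)])
  qed
  assume xy: "(x, y) \<in> R (length p)" "init_seg (length p) (fst \<circ> x) = p" "init_seg (length p) (fst \<circ> y) = q"
  have P: "x \<in> P" "y \<in> P" using xy by (auto simp: R_iff)
  have "F (?w n) (y, y) = F (u n) (x, x)" for n
    unfolding Fw Fe by (rule conj_unit(2)[OF pq u(2) xy])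
  then show "ev y (sa_mult L (sa_star L E) (sa_mult L c E)) = ev x c"
    unfolding eq by (intro ev_eqI[OF w P(2)]) (simp add: u(3) ev_lim[OF u(1) P(1)])
qed

lemma Zset2_iff:
  assumes "x \<in> P" "y \<in> P"
  shows "(fst \<circ> x, fst \<circ> y) \<in> Zset2 D p q \<longleftrightarrow> init_seg (length p) (fst \<circ> x) = p \<and> init_seg (length q) (fst \<circ> y) = q \<and>
    (\<forall>m\<ge>length p. fst (x m) = fst (y m))"
  using pathD(5)[OF assms(1)] pathD(5)[OF assms(2)] by (auto simp: Zset2_def Zset_def)

text \<open>A tail-equivalent pair shares its labels far out, and equal edges propagate them down to
  level \<open>n\<close>. \<open>Zset2\<close> records edges only, so this recovers the labels from
  it.\<close>

lemma R_of_edges: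
  assumes "(x, y) \<in> topspace Gt" "\<forall>m\<ge>n. fst (x m) = fst (y m)" shows "(x, y) \<in> R n"
proof -
  obtain m where "m \<ge> n" "(x, y) \<in> R m" using G_pos_level[OF assms(1)] by blast
  then show ?thesis using R_char[of x y m n] assms(2) by auto
qed

lemma init_pair:
  assumes n: "n \<ge> 1" and xy: "(x, y) \<in> R n"
  shows "(init_seg n (fst \<circ> x), init_seg n (fst \<circ> y)) \<in> path_pairs D"
    "(fst \<circ> x, fst \<circ> y) \<in> Zset2 D (init_seg n (fst \<circ> x)) (init_seg n (fst \<circ> y))"
proof -
  have P: "x \<in> P" "y \<in> P" using xy by (auto simp: R_iff)
  show "(init_seg n (fst \<circ> x), init_seg n (fst \<circ> y)) \<in> path_pairs D"
    using init_in_fpaths[OF n P(1)] init_in_fpaths[OF n P(2)] vtx_init[OF n P(1)] vtx_init[OF n P(2)] vtx_eq[OF xy]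
    by (auto simp: fpaths_def path_pairs_def)
  show "(fst \<circ> x, fst \<circ> y) \<in> Zset2 D (init_seg n (fst \<circ> x)) (init_seg n (fst \<circ> y))"
    unfolding Zset2_iff[OF P] using xy by (simp add: R_iff)
qed

text \<open>Every admissible pair of segments yields evaluation at \<open>x\<close>, and at least
  one such pair exists: this gives existence and uniqueness for the definite description.\<close>

lemma action_chi:
  assumes xy: "(x, y) \<in> topspace Gt"
  shows "path_action D (fst \<circ> x, fst \<circ> y) (chi y) = chi x"
  unfolding path_action_def
proof (rule the_equality)
  have P: "x \<in> P" "y \<in> P" using G_arrow_P[OF xy] by auto
  have eq: "chi y (sa_mult L (sa_star L (unit_in_A D p q)) (sa_mult L c (unit_in_A D p q))) = chi x c"
    if pq: "(p, q) \<in> path_pairs D" "(fst \<circ> x, fst \<circ> y) \<in> Zset2 D p q" and c: "c \<in> CC" for p q c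
  proof -
    have z: "init_seg (length p) (fst \<circ> x) = p" "init_seg (length p) (fst \<circ> y) = q" "\<forall>m\<ge>length p. fst (x m) = fst (y m)"
      using pq(2) path_pairsD(2)[OF pq(1)] unfolding Zset2_iff[OF P] by auto
    show ?thesis
      using conj_unit_CC(2)[OF pq(1) c R_of_edges[OF xy z(3)] z(1,2)] chi_apply[OF conj_unit_CC(1)[OF pq(1) c]] chi_apply[OF c] by simp
  qed
  show "chi x \<in> characters (C_alg D) \<and> (\<forall>(p, q)\<in>path_pairs D. (fst \<circ> x, fst \<circ> y) \<in> Zset2 D p q \<longrightarrow>
      (\<forall>c\<in>sa_carrier (C_alg D). chi x c = chi y (sa_mult L (sa_star L (unit_in_A D p q)) (sa_mult L c (unit_in_A D p q)))))"
    using chi_character[OF P(1)] eq by auto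
  fix \<omega>' assume w: "\<omega>' \<in> characters (C_alg D) \<and> (\<forall>(p, q)\<in>path_pairs D. (fst \<circ> x, fst \<circ> y) \<in> Zset2 D p q \<longrightarrow>
      (\<forall>c\<in>sa_carrier (C_alg D). \<omega>' c = chi y (sa_mult L (sa_star L (unit_in_A D p q)) (sa_mult L c (unit_in_A D p q)))))"
  obtain n where n: "n \<ge> 1" "(x, y) \<in> R n" using G_pos_level[OF xy] by blast
  note pq = init_pair[OF n]
  have "\<omega>' c = chi x c" if c: "c \<in> CC" for c
  proof -
    have "\<omega>' c = chi y (sa_mult L (sa_star L (unit_in_A D (init_seg n (fst \<circ> x)) (init_seg n (fst \<circ> y))))
       (sa_mult L c (unit_in_A D (init_seg n (fst \<circ> x)) (init_seg n (fst \<circ> y)))))"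
      using conjunct2[OF w] pq c by fastforce
    then show ?thesis using eq[OF pq c] by simp
  qed
  moreover have "\<omega>' \<in> extensional CC" using w by (simp add: characters_def)
  ultimately show "\<omega>' = chi x" by (intro extensionalityI[of _ CC]) (auto simp: chi_def)
qed

end

subsection \<open>The isomorphism of topological groupoids\<close>

lemma composable_transport:
  assumes \<Phi>: "inj_on \<Phi> (gp_arrows G)" "\<Phi> ` gp_arrows G = gp_arrows H"
    and G: "topological_groupoid G"
    and src: "\<And>g. g \<in> gp_arrows G \<Longrightarrow> gp_src H (\<Phi> g) = \<Phi> (gp_src G g)"
    and rng: "\<And>g. g \<in> gp_arrows G \<Longrightarrow> gp_rng H (\<Phi> g) = \<Phi> (gp_rng G g)"
    and g: "g \<in> gp_arrows G" and h: "h \<in> gp_arrows G"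
  shows "(\<Phi> g, \<Phi> h) \<in> gp_composable H \<longleftrightarrow> (g, h) \<in> gp_composable G"
proof -
  have "gp_src G g \<in> gp_arrows G" "gp_rng G h \<in> gp_arrows G"
    using G g h unfolding topological_groupoid_def by auto
  then show ?thesis using g h \<Phi> src[OF g] rng[OF h] by (auto simp: gp_composable_def inj_on_eq_iff)
qed

text \<open>A bijection compatible with source, range, inverse and composition carries the algebraic
  axioms across; the operations of the target are continuous because they factor through the inverse
  homeomorphism and those of the origin.\<close>

lemma topological_groupoid_transport:
  assumes G: "topological_groupoid G"
    and hom: "homeomorphic_map (gp_top G) (gp_top H) \<Phi>"
    and src: "\<And>g. g \<in> gp_arrows G \<Longrightarrow> gp_src H (\<Phi> g) = \<Phi> (gp_src G g)"
    and rng: "\<And>g. g \<in> gp_arrows G \<Longrightarrow> gp_rng H (\<Phi> g) = \<Phi> (gp_rng G g)"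
    and inv: "\<And>g. g \<in> gp_arrows G \<Longrightarrow> gp_inv H (\<Phi> g) = \<Phi> (gp_inv G g)"
    and comp: "\<And>g h. (g, h) \<in> gp_composable G \<Longrightarrow> gp_comp H (\<Phi> g) (\<Phi> h) = \<Phi> (gp_comp G g h)"
  shows "topological_groupoid H"
proof -
  obtain \<Psi> where maps: "homeomorphic_maps (gp_top G) (gp_top H) \<Phi> \<Psi>"
    using hom homeomorphic_map_maps by blast
  have cont: "continuous_map (gp_top G) (gp_top H) \<Phi>" "continuous_map (gp_top H) (gp_top G) \<Psi>"
    and iv: "\<And>h. h \<in> gp_arrows H \<Longrightarrow> \<Phi> (\<Psi> h) = h"
    using maps by (auto simp: homeomorphic_maps_def)
  have inj: "inj_on \<Phi> (gp_arrows G)" and surj: "\<Phi> ` gp_arrows G = gp_arrows H"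
    using hom by (auto simp: homeomorphic_map_def homeomorphic_imp_injective_map[OF hom]
        homeomorphic_imp_surjective_map[OF hom])
  have arr: "\<Phi> g \<in> gp_arrows H" if "g \<in> gp_arrows G" for g using surj that by blast
  have psi: "\<Psi> h \<in> gp_arrows G" if "h \<in> gp_arrows H" for h
    using cont(2) that by (auto simp: continuous_map_def)
  have composable: "(\<Phi> g, \<Phi> h) \<in> gp_composable H \<longleftrightarrow> (g, h) \<in> gp_composable G"
    if "g \<in> gp_arrows G" "h \<in> gp_arrows G" for g h
    by (rule composable_transport[OF inj surj G src rng that])
  have units: "gp_src G g \<in> gp_arrows G" "gp_rng G g \<in> gp_arrows G" "gp_inv G g \<in> gp_arrows G"
      "gp_src G (gp_src G g) = gp_src G g" "gp_rng G (gp_src G g) = gp_src G g"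
      "gp_src G (gp_rng G g) = gp_rng G g" "gp_rng G (gp_rng G g) = gp_rng G g"
      "gp_src G (gp_inv G g) = gp_rng G g" "gp_rng G (gp_inv G g) = gp_src G g"
      "gp_comp G (gp_rng G g) g = g" "gp_comp G g (gp_src G g) = g"
      "gp_comp G g (gp_inv G g) = gp_rng G g" "gp_comp G (gp_inv G g) g = gp_src G g"
    if "g \<in> gp_arrows G" for g
    using that G unfolding topological_groupoid_def by auto
  have compD: "gp_comp G g h \<in> gp_arrows G" "gp_src G (gp_comp G g h) = gp_src G h"
      "gp_rng G (gp_comp G g h) = gp_rng G g" if "(g, h) \<in> gp_composable G" for g h
    using that G unfolding topological_groupoid_def by auto
  have assoc: "gp_comp G (gp_comp G g h) k = gp_comp G g (gp_comp G h k)"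
    if "(g, h) \<in> gp_composable G" "(h, k) \<in> gp_composable G" for g h k
    using that G unfolding topological_groupoid_def by blast
  have cc: "continuous_map (subtopology (prod_topology (gp_top G) (gp_top G)) (gp_composable G)) (gp_top G)
       (\<lambda>(g, h). gp_comp G g h)" and ci: "continuous_map (gp_top G) (gp_top G) (gp_inv G)"
    using G unfolding topological_groupoid_def by auto
  have pull: "\<exists>a b. g = \<Phi> a \<and> h = \<Phi> b \<and> (a, b) \<in> gp_composable G" if gh: "(g, h) \<in> gp_composable H" for g h
  proof -
    have "g \<in> gp_arrows H" "h \<in> gp_arrows H" using gh by (auto simp: gp_composable_def)
    then obtain a b where ab: "g = \<Phi> a" "h = \<Phi> b" "a \<in> gp_arrows G" "b \<in> gp_arrows G"
      unfolding surj[symmetric] by blast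
    then show ?thesis using composable[OF ab(3,4)] gh by blast
  qed
  have unit_comp: "(gp_rng G g, g) \<in> gp_composable G" "(g, gp_src G g) \<in> gp_composable G"
      "(g, gp_inv G g) \<in> gp_composable G" "(gp_inv G g, g) \<in> gp_composable G" if "g \<in> gp_arrows G" for g
    using that units[OF that] by (auto simp: gp_composable_def)
  show ?thesis
    unfolding topological_groupoid_def
  proof (intro conjI)
    show "\<forall>g\<in>gp_arrows H.
        gp_src H g \<in> gp_arrows H \<and> gp_rng H g \<in> gp_arrows H \<and> gp_inv H g \<in> gp_arrows H \<and>
        gp_src H (gp_src H g) = gp_src H g \<and> gp_rng H (gp_src H g) = gp_src H g \<and>
        gp_src H (gp_rng H g) = gp_rng H g \<and> gp_rng H (gp_rng H g) = gp_rng H g \<and>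
        gp_src H (gp_inv H g) = gp_rng H g \<and> gp_rng H (gp_inv H g) = gp_src H g \<and>
        gp_comp H (gp_rng H g) g = g \<and> gp_comp H g (gp_src H g) = g \<and>
        gp_comp H g (gp_inv H g) = gp_rng H g \<and> gp_comp H (gp_inv H g) g = gp_src H g"
    proof
      fix h assume "h \<in> gp_arrows H"
      then obtain g where g: "h = \<Phi> g" "g \<in> gp_arrows G" unfolding surj[symmetric] by blast
      show "gp_src H h \<in> gp_arrows H \<and> gp_rng H h \<in> gp_arrows H \<and> gp_inv H h \<in> gp_arrows H \<and>
        gp_src H (gp_src H h) = gp_src H h \<and> gp_rng H (gp_src H h) = gp_src H h \<and>
        gp_src H (gp_rng H h) = gp_rng H h \<and> gp_rng H (gp_rng H h) = gp_rng H h \<and>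
        gp_src H (gp_inv H h) = gp_rng H h \<and> gp_rng H (gp_inv H h) = gp_src H h \<and>
        gp_comp H (gp_rng H h) h = h \<and> gp_comp H h (gp_src H h) = h \<and>
        gp_comp H h (gp_inv H h) = gp_rng H h \<and> gp_comp H (gp_inv H h) h = gp_src H h"
        using g(2) by (simp add: g(1) src rng inv units unit_comp comp arr)
    qed
    show "\<forall>(g, h)\<in>gp_composable H. gp_comp H g h \<in> gp_arrows H \<and>
        gp_src H (gp_comp H g h) = gp_src H h \<and> gp_rng H (gp_comp H g h) = gp_rng H g"
    proof (clarify)
      fix g h assume "(g, h) \<in> gp_composable H"
      then obtain a b where ab: "g = \<Phi> a" "h = \<Phi> b" "(a, b) \<in> gp_composable G" using pull by blast
      have "a \<in> gp_arrows G" "b \<in> gp_arrows G" using ab(3) by (auto simp: gp_composable_def)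
      then show "gp_comp H g h \<in> gp_arrows H \<and>
        gp_src H (gp_comp H g h) = gp_src H h \<and> gp_rng H (gp_comp H g h) = gp_rng H g"
        unfolding ab(1,2) comp[OF ab(3)] by (simp add: compD[OF ab(3)] src rng arr)
    qed
    show "\<forall>g h k. (g, h) \<in> gp_composable H \<and> (h, k) \<in> gp_composable H \<longrightarrow>
        gp_comp H (gp_comp H g h) k = gp_comp H g (gp_comp H h k)"
    proof (intro allI impI, elim conjE)
      fix g h k assume gh: "(g, h) \<in> gp_composable H" and hk: "(h, k) \<in> gp_composable H"
      obtain a b where ab: "g = \<Phi> a" "h = \<Phi> b" "(a, b) \<in> gp_composable G" using pull[OF gh] by blast
      have "k \<in> gp_arrows H" using hk by (simp add: gp_composable_def)
      then obtain c where c: "k = \<Phi> c" "c \<in> gp_arrows G" unfolding surj[symmetric] by blast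
      have bc: "(b, c) \<in> gp_composable G"
        using composable[of b c] ab c hk by (simp add: gp_composable_def[of G])
      have "(gp_comp G a b, c) \<in> gp_composable G" "(a, gp_comp G b c) \<in> gp_composable G"
        using compD[OF ab(3)] compD[OF bc] ab(3) bc by (auto simp: gp_composable_def)
      then show "gp_comp H (gp_comp H g h) k = gp_comp H g (gp_comp H h k)"
        unfolding ab(1,2) c(1) comp[OF ab(3)] comp[OF bc] by (simp add: comp assoc[OF ab(3) bc])
    qed
    let ?CH = "subtopology (prod_topology (gp_top H) (gp_top H)) (gp_composable H)"
    let ?CG = "subtopology (prod_topology (gp_top G) (gp_top G)) (gp_composable G)"
    have "continuous_map ?CH ?CG (\<lambda>z. (\<Psi> (fst z), \<Psi> (snd z)))"
      unfolding continuous_map_in_subtopology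
    proof
      show "continuous_map ?CH (prod_topology (gp_top G) (gp_top G)) (\<lambda>z. (\<Psi> (fst z), \<Psi> (snd z)))"
        by (intro continuous_map_pairedI continuous_map_compose[OF _ cont(2), unfolded comp_def]
            continuous_map_from_subtopology continuous_map_fst continuous_map_snd)
      show "(\<lambda>z. (\<Psi> (fst z), \<Psi> (snd z))) \<in> topspace ?CH \<rightarrow> gp_composable G"
      proof
        fix z assume "z \<in> topspace ?CH"
        then have z: "fst z \<in> gp_arrows H" "snd z \<in> gp_arrows H" "(fst z, snd z) \<in> gp_composable H"
          by auto
        then show "(\<Psi> (fst z), \<Psi> (snd z)) \<in> gp_composable G"
          using composable[OF psi psi, OF z(1,2)] by (simp add: iv)
      qed
    qed
    from continuous_map_compose[OF continuous_map_compose[OF this cc] cont(1)]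
    show "continuous_map ?CH (gp_top H) (\<lambda>(g, h). gp_comp H g h)"
    proof (rule continuous_map_eq)
      fix z assume "z \<in> topspace ?CH"
      then have z: "fst z \<in> gp_arrows H" "snd z \<in> gp_arrows H" "(fst z, snd z) \<in> gp_composable H"
        by auto
      then have "(\<Psi> (fst z), \<Psi> (snd z)) \<in> gp_composable G"
        using composable[OF psi psi, OF z(1,2)] by (simp add: iv)
      from comp[OF this] show "(\<Phi> \<circ> ((\<lambda>(g, h). gp_comp G g h) \<circ> (\<lambda>z. (\<Psi> (fst z), \<Psi> (snd z))))) z = (\<lambda>(g, h). gp_comp H g h) z"
        by (simp add: iv z case_prod_unfold)
    qed
    from continuous_map_compose[OF continuous_map_compose[OF cont(2) ci] cont(1)]
    show "continuous_map (gp_top H) (gp_top H) (gp_inv H)"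
    proof (rule continuous_map_eq)
      fix h assume h: "h \<in> gp_arrows H"
      show "(\<Phi> \<circ> (gp_inv G \<circ> \<Psi>)) h = gp_inv H h" using inv[OF psi[OF h]] iv[OF h] by simp
    qed
  qed
qed

section \<open>Bijectivity, continuity and openness of \<open>Phi\<close>\<close>

context AH begin

lemma Phi_eq: "(x, y) \<in> topspace Gt \<Longrightarrow> Phi D (x, y) = ((fst \<circ> x, fst \<circ> y), chi y)"
  using G_arrow_P inv_h by (simp add: Phi_def)

abbreviation "Qt \<equiv> topology_generated_by {Zset2 D p q | p q. (p, q) \<in> path_pairs D}"
abbreviation "HH \<equiv> action_groupoid D"

lemma action_groupoid_simps:
  "gp_top HH = subtopology (prod_topology Qt (C_hat D))
     {(g, \<omega>). (snd g, snd g) = (anchor_map D \<omega>, anchor_map D \<omega>)}"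
  "gp_comp HH ((a, b), \<omega>') ((b', c), \<omega>) = ((a, c), \<omega>)"
  "gp_inv HH ((a, b), \<omega>) = ((b, a), path_action D (a, b) \<omega>)"
  "gp_rng HH ((a, b), \<omega>) = ((a, a), path_action D (a, b) \<omega>)"
  "gp_src HH ((a, b), \<omega>) = ((b, b), \<omega>)"
  by (auto simp: action_groupoid_def transformation_groupoid_def path_groupoid_def relation_groupoid_def
      case_prod_unfold)

lemma action_arrows_iff:
  "((a, b), \<omega>) \<in> gp_arrows HH \<longleftrightarrow>
     (\<exists>(p, q)\<in>path_pairs D. (a, b) \<in> Zset2 D p q) \<and> \<omega> \<in> chi ` P \<and> b = anchor_map D \<omega>"
  unfolding action_groupoid_simps(1) topspace_subtopology topspace_prod_topology topology_generated_by_topspace C_hat_topspace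
  by auto

lemma Phi_arrow:
  assumes "(x, y) \<in> topspace Gt" shows "Phi D (x, y) \<in> gp_arrows HH"
proof -
  obtain n where "n \<ge> 1" "(x, y) \<in> R n" using G_pos_level[OF assms] by blast
  note p = init_pair[OF this]
  have P: "x \<in> P" "y \<in> P" using G_arrow_P[OF assms] by auto
  show ?thesis
    unfolding Phi_eq[OF assms] action_arrows_iff anchor_chi[OF P(2)]
    by (intro conjI bexI[OF _ p(1)] imageI P(2) refl) (simp add: p(2))
qed

text \<open>\<open>chi y\<close> determines \<open>y\<close>. The first components are
  tail-equivalent through \<open>y\<close> and have the same edges at all levels, so they agree from
  level 0 on.\<close>

lemma Phi_inj: "inj_on (Phi D) (topspace Gt)"
proof (rule inj_onI, clarify)
  fix x y x' y' assume xy: "(x, y) \<in> topspace Gt" "(x', y') \<in> topspace Gt" "Phi D (x, y) = Phi D (x', y')"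
  have e: "fst \<circ> x = fst \<circ> x'" "chi y = chi y'" using xy(3) Phi_eq[OF xy(1)] Phi_eq[OF xy(2)] by auto
  have y: "y = y'" using e(2) chi_inj G_arrow_P[OF xy(1)] G_arrow_P[OF xy(2)] by (auto dest: inj_onD)
  have "(x, x') \<in> topspace Gt" using G_trans[OF xy(1)] G_sym[OF xy(2)] y by simp
  then have "(x, x') \<in> R 0" using e(1) by (intro R_of_edges) (auto dest: fun_cong)
  then show "x = x' \<and> y = y'" using y by (auto simp: R_iff)
qed

text \<open>Grafting the edges of \<open>a\<close> onto the labelled tail of \<open>y\<close> gives
  the missing first path.\<close>

lemma Phi_surj: "Phi D ` topspace Gt = gp_arrows HH"
proof
  show "Phi D ` topspace Gt \<subseteq> gp_arrows HH" using Phi_arrow by auto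
  show "gp_arrows HH \<subseteq> Phi D ` topspace Gt"
  proof
    fix z assume z: "z \<in> gp_arrows HH"
    obtain a b \<omega> where zz: "z = ((a, b), \<omega>)" by (metis prod.collapse)
    obtain p q y where pq: "(p, q) \<in> path_pairs D" "(a, b) \<in> Zset2 D p q" and y: "y \<in> P" "\<omega> = chi y" "b = fst \<circ> y"
      using z anchor_chi unfolding zz action_arrows_iff by auto
    have "a \<in> inf_paths D" "\<And>m. m \<ge> length p \<Longrightarrow> a m = fst (y m)"
      using pq(2) by (auto simp: Zset2_def Zset_def y(3))
    from change_prefix[OF y(1) this] obtain x where x: "x \<in> P" "fst \<circ> x = a" "\<forall>m\<ge>length p. x m = y m" by blast
    then have xy: "(x, y) \<in> topspace Gt" using y(1) by (auto simp: G_arrow R_iff)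
    then have "Phi D (x, y) = z" using Phi_eq[OF xy] zz x(2) y by simp
    then show "z \<in> Phi D ` topspace Gt" using xy by blast
  qed
qed

text \<open>Inside \<open>R (length p)\<close> membership in \<open>Zset2 D p q\<close> depends only
  on the two initial segments, which are locally constant.\<close>

lemma edge_pair_continuous: "continuous_map Gt Qt (\<lambda>(x, y). (fst \<circ> x, fst \<circ> y))"
proof (rule continuous_on_generated_topo)
  fix U assume "U \<in> {Zset2 D p q | p q. (p, q) \<in> path_pairs D}"
  then obtain p q where pq: "U = Zset2 D p q" "(p, q) \<in> path_pairs D" by blast
  have l: "length q = length p" using pq(2) by (simp add: path_pairs_def)
  let ?V = "\<lambda>p. {x \<in> P. init_seg (length p) (fst \<circ> x) \<in> {p}}"
  show "openin Gt ((\<lambda>(x, y). (fst \<circ> x, fst \<circ> y)) -` U \<inter> topspace Gt)"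
  proof (rule G_openI)
    fix x y assume "(x, y) \<in> (\<lambda>(x, y). (fst \<circ> x, fst \<circ> y)) -` U \<inter> topspace Gt"
    then have xy: "(x, y) \<in> topspace Gt" "(fst \<circ> x, fst \<circ> y) \<in> Zset2 D p q" by (auto simp: pq(1))
    have P: "x \<in> P" "y \<in> P" using G_arrow_P[OF xy(1)] by auto
    have z: "init_seg (length p) (fst \<circ> x) = p" "init_seg (length q) (fst \<circ> y) = q" "\<forall>m\<ge>length p. fst (x m) = fst (y m)"
      using xy(2) unfolding Zset2_iff[OF P] by auto
    have "(x, y) \<in> R (length p)" by (rule R_of_edges[OF xy(1) z(3)])
    moreover have "(?V p \<times> ?V q) \<inter> R (length p) \<subseteq> (\<lambda>(x, y). (fst \<circ> x, fst \<circ> y)) -` U \<inter> topspace Gt"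
    proof clarify
      fix x' y' assume "(x', y') \<in> R (length p)" "x' \<in> P" "y' \<in> P" "init_seg (length p) (fst \<circ> x') = p" "init_seg (length q) (fst \<circ> y') = q"
      then show "(x', y') \<in> (\<lambda>(x, y). (fst \<circ> x, fst \<circ> y)) -` U \<inter> topspace Gt"
        using Zset2_iff[of x' y' p q] by (auto simp: pq(1) G_arrow R_iff)
    qed
    ultimately show "\<exists>n U' V. openin X U' \<and> openin X V \<and> x \<in> U' \<and> y \<in> V \<and> (x, y) \<in> R n \<and>
        (U' \<times> V) \<inter> R n \<subseteq> (\<lambda>(x, y). (fst \<circ> x, fst \<circ> y)) -` U \<inter> topspace Gt"
      using init_open[of "length p" "{p}"] init_open[of "length q" "{q}"] P z(1,2)
      by (intro exI[of _ "length p"] exI[of _ "?V p"] exI[of _ "?V q"]) simp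
  qed
next
  show "(\<lambda>(x, y). (fst \<circ> x, fst \<circ> y)) ` topspace Gt \<subseteq> \<Union>{Zset2 D p q | p q. (p, q) \<in> path_pairs D}"
  proof clarify
    fix x y assume "(x, y) \<in> topspace Gt"
    then obtain n where "n \<ge> 1" "(x, y) \<in> R n" using G_pos_level by blast
    then show "(fst \<circ> x, fst \<circ> y) \<in> \<Union>{Zset2 D p q | p q. (p, q) \<in> path_pairs D}" using init_pair[of n x y] by blast
  qed
qed

lemma Phi_continuous: "continuous_map Gt (gp_top HH) (Phi D)"
proof (rule continuous_map_eq)
  show "continuous_map Gt (gp_top HH) (\<lambda>z. ((\<lambda>(x, y). (fst \<circ> x, fst \<circ> y)) z, chi (snd z)))"
    unfolding action_groupoid_simps(1) continuous_map_in_subtopology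
  proof
    show "continuous_map Gt (prod_topology Qt (C_hat D)) (\<lambda>z. ((\<lambda>(x, y). (fst \<circ> x, fst \<circ> y)) z, chi (snd z)))"
      by (intro continuous_map_pairedI edge_pair_continuous continuous_map_compose[OF G_snd chi_continuous, unfolded comp_def])
    show "(\<lambda>z. ((\<lambda>(x, y). (fst \<circ> x, fst \<circ> y)) z, chi (snd z))) \<in> topspace Gt \<rightarrow> {(g, \<omega>). (snd g, snd g) = (anchor_map D \<omega>, anchor_map D \<omega>)}"
      using G_arrow_P anchor_chi by auto
  qed
  show "((\<lambda>(x, y). (fst \<circ> x, fst \<circ> y)) z, chi (snd z)) = Phi D z" if "z \<in> topspace Gt" for z
    using that Phi_eq by (cases z) auto
qed

text \<open>Near \<open>Phi (x, y)\<close> the path pair fixes the edges of the first component, and beyond level \<open>n\<close>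
  its labels are those of the second; so a neighbourhood of \<open>y\<close> controls both components once the
  neighbourhood of \<open>x\<close> is a cylinder set over a vertex beyond level \<open>n\<close>.\<close>

lemma Phi_open: "open_map Gt (gp_top HH) (Phi D)"
  unfolding open_map_def
proof (intro allI impI)
  fix W assume W: "openin Gt W"
  show "openin (gp_top HH) (Phi D ` W)"
  proof (subst openin_subopen, intro ballI)
    fix z assume "z \<in> Phi D ` W"
    then obtain x y where xy: "(x, y) \<in> W" "z = Phi D (x, y)" by auto
    have a: "(x, y) \<in> topspace Gt" using openin_subset[OF W] xy(1) by blast
    have P: "x \<in> P" "y \<in> P" using G_arrow_P[OF a] by auto
    obtain n where n: "n \<ge> 1" "(x, y) \<in> R n" using G_pos_level[OF a] by blast
    obtain U V where UV: "openin X U" "openin X V" "x \<in> U" "y \<in> V" "(U \<times> V) \<inter> R n \<subseteq> W"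
      using G_nbhd[OF W xy(1) n(2)] by blast
    obtain M where M: "\<forall>m\<ge>M. \<exists>U'. openin (vertex_space D m (bsrc (fst (x m)))) U' \<and> snd (x m) \<in> U' \<and>
       cylinder D (init_seg (Suc m) (fst \<circ> x)) U' \<subseteq> U" using cylinder_base[OF UV(1,3)] by blast
    define m where "m = max n M"
    have m: "m \<ge> n" "m \<ge> M" by (auto simp: m_def)
    obtain U' where U': "openin (vertex_space D m (bsrc (fst (x m)))) U'" "snd (x m) \<in> U'"
      "cylinder D (init_seg (Suc m) (fst \<circ> x)) U' \<subseteq> U" using M m(2) by blast
    have tl: "x k = y k" if "k \<ge> n" for k using n(2) that by (auto simp: R_iff)
    \<comment> \<open>\<open>V'\<close> keeps \<open>y'\<close> in \<open>V\<close> and, through the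
      label at a level \<open>m \<ge> n\<close> that \<open>x'\<close> shares with
      \<open>y'\<close>, brings \<open>x'\<close> into \<open>U\<close> once its first
      \<open>n\<close> edges are fixed.\<close>
    define V' where "V' = V \<inter> cylinder D (init_seg (Suc m) (fst \<circ> y)) U'"
    have oV: "openin X V'" unfolding V'_def
      using U'(1) tl[OF m(1)] by (intro openin_Int UV(2) cylinder_open'[OF P(2)]) simp
    have yV: "y \<in> V'" using UV(4) U'(2) tl[OF m(1)] P(2) by (auto simp: V'_def cylinder_def)
    let ?p = "init_seg n (fst \<circ> x)" and ?q = "init_seg n (fst \<circ> y)"
    let ?S = "(Zset2 D ?p ?q \<times> chi ` V') \<inter> gp_arrows HH"
    have "openin Qt (Zset2 D ?p ?q)" using init_pair(1)[OF n] by (intro topology_generated_by_Basis) blast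
    moreover have "openin (C_hat D) (chi ` V')"
      using chi_homeomorphic oV homeomorphic_imp_open_map open_map_def by blast
    ultimately have "openin (prod_topology Qt (C_hat D)) (Zset2 D ?p ?q \<times> chi ` V')"
      by (simp add: openin_prod_Times_iff)
    then have "openin (gp_top HH) ?S"
      unfolding action_groupoid_simps(1) openin_subtopology topspace_subtopology
      using openin_subset by (intro exI[of _ "Zset2 D ?p ?q \<times> chi ` V'"]) blast
    moreover have "z \<in> ?S"
      using init_pair(2)[OF n] yV Phi_arrow[OF a] unfolding xy(2) Phi_eq[OF a] by blast
    moreover have "?S \<subseteq> Phi D ` W"
    proof
      fix w assume w: "w \<in> ?S"
      then obtain x' y' where w': "w = Phi D (x', y')" "(x', y') \<in> topspace Gt"
        unfolding Phi_surj[symmetric] by auto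
      have P': "x' \<in> P" "y' \<in> P" using G_arrow_P[OF w'(2)] by auto
      have z2: "(fst \<circ> x', fst \<circ> y') \<in> Zset2 D ?p ?q" and "chi y' \<in> chi ` V'"
        using w unfolding w'(1) Phi_eq[OF w'(2)] by auto
      then have y': "y' \<in> V'" using chi_inj P'(2) openin_subset[OF oV] X_topspace by (metis inj_on_image_mem_iff)
      have s: "init_seg n (fst \<circ> x') = ?p" "\<forall>k\<ge>n. fst (x' k) = fst (y' k)"
        using z2 unfolding Zset2_iff[OF P'] by auto
      have r: "(x', y') \<in> R n" by (rule R_of_edges[OF w'(2) s(2)])
      then have tl': "x' k = y' k" if "k \<ge> n" for k using that by (auto simp: R_iff)
      have cy: "init_seg (Suc m) (fst \<circ> y') = init_seg (Suc m) (fst \<circ> y)" "snd (y' m) \<in> U'"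
        using y' by (auto simp: V'_def cylinder_def)
      have "fst (x' k) = fst (x k)" if "k < Suc m" for k
      proof (cases "k < n")
        case True
        then show ?thesis using s(1) by (auto simp: init_seg_eq_iff)
      next
        case False
        then show ?thesis using cy(1) that tl[of k] tl'[of k] by (auto simp: init_seg_eq_iff)
      qed
      then have "x' \<in> cylinder D (init_seg (Suc m) (fst \<circ> x)) U'"
        using cy(2) tl'[OF m(1)] P'(1) by (auto simp: cylinder_def init_seg_eq_iff)
      then have "(x', y') \<in> W" using U'(3) UV(5) y' r by (auto simp: V'_def)
      then show "w \<in> Phi D ` W" using w'(1) by blast
    qed
    ultimately show "\<exists>T. openin (gp_top HH) T \<and> z \<in> T \<and> T \<subseteq> Phi D ` W" by blast
  qed
qed

lemma Phi_homeomorphic: "homeomorphic_map Gt (gp_top HH) (Phi D)"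
  by (rule bijective_open_imp_homeomorphic_map[OF Phi_continuous Phi_open Phi_surj Phi_inj])

lemma Phi_src: "(x, y) \<in> topspace Gt \<Longrightarrow> gp_src HH (Phi D (x, y)) = Phi D (y, y)"
  using G_refl G_arrow_P by (simp add: Phi_eq action_groupoid_simps)

lemma Phi_rng: "(x, y) \<in> topspace Gt \<Longrightarrow> gp_rng HH (Phi D (x, y)) = Phi D (x, x)"
  using G_refl G_arrow_P by (simp add: Phi_eq action_groupoid_simps action_chi)

lemma Phi_inv: "(x, y) \<in> topspace Gt \<Longrightarrow> gp_inv HH (Phi D (x, y)) = Phi D (y, x)"
  using G_sym by (simp add: Phi_eq action_groupoid_simps action_chi)

lemma Phi_comp:
  "(x, y) \<in> topspace Gt \<Longrightarrow> (y, z) \<in> topspace Gt \<Longrightarrow> gp_comp HH (Phi D (x, y)) (Phi D (y, z)) = Phi D (x, z)"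
  using G_trans by (simp add: Phi_eq action_groupoid_simps)

theorem Phi_isomorphism: "topological_groupoid_iso (labelled_groupoid D) (action_groupoid D) (Phi D)"
proof -
  let ?G = "labelled_groupoid D"
  have src: "gp_src HH (Phi D g) = Phi D (gp_src ?G g)" and rng: "gp_rng HH (Phi D g) = Phi D (gp_rng ?G g)"
    and inv: "gp_inv HH (Phi D g) = Phi D (gp_inv ?G g)" if "g \<in> gp_arrows ?G" for g
    using that Phi_src Phi_rng Phi_inv by (cases g; simp)+
  have comp: "gp_comp HH (Phi D g) (Phi D h) = Phi D (gp_comp ?G g h)" if "(g, h) \<in> gp_composable ?G" for g h
    using that Phi_comp by (cases g; cases h) (simp add: composable_iff)
  have hom: "homeomorphic_map (gp_top ?G) (gp_top HH) (Phi D)" using Phi_homeomorphic by simp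
  have "(Phi D g, Phi D h) \<in> gp_composable HH" if gh: "(g, h) \<in> gp_composable ?G" for g h
  proof -
    have "g \<in> gp_arrows ?G" "h \<in> gp_arrows ?G" using gh by (auto simp: gp_composable_def)
    then show ?thesis
      using composable_transport[of "Phi D" ?G HH g h] Phi_inj Phi_surj labelled_topological_groupoid src rng gh by simp
  qed
  then show ?thesis
    unfolding topological_groupoid_iso_def
    using labelled_topological_groupoid topological_groupoid_transport[OF labelled_topological_groupoid hom src rng inv comp] hom comp
    by auto
qed

end

theorem theorem4p9:
  fixes D :: "('a, 'e) ah_data"
  assumes "diagonal_AH_system D"
  shows "topological_groupoid_iso (labelled_groupoid D) (action_groupoid D) (Phi D)
    \<and> star_isomorphic (AH_limit D) (reduced_cstar (labelled_groupoid D))"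
proof -
  interpret AH D by unfold_locales (rule assms)
  show ?thesis using Phi_isomorphism AH_limit_isomorphic by simp
qed

end
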